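(* Let $d\ge2$ and $m>d/2$ be integers and let $j,k\in\{0,\dots,m-1\}$. The operator $$v_{k,j}:g\mapsto\int_{\mathbb R^{d-1}}g(y)\,\lambda_{k,x}\lambda_{j,y}\phi(x-y)\,\mathrm dy,\qquad x\in\mathbb R^{d-1},$$ acting on functions $g$ on $\mathbb R^{d-1}$ that are $j$-admissible, is a Fourier multiplier operator with symbol $$\sigma(v_{k,j})(\xi')=(-1)^{(j+k-2m)/2}\,\mathsf M_{k,j}\,|\xi'|^{j+k+1-2m},$$ where $$\mathsf M_{k,j}=\begin{cases}2^{1+j+k-2m}\,\mathsf b_{m-(j+k)/2-1},&j,k\text{ both even},\\-2^{j+k-2m}\,\mathsf c_{m-(j+k)/2-1},&j,k\text{ both odd},\\0,&j+k\text{ odd},\end{cases}\qquad \mathsf b_n=\binom{2n}{n},\quad \mathsf c_n=\binom{2n}{n}-\binom{2n}{n+1}.$$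
   Context: $\phi$ is the fundamental solution of $\Delta^m$ on $\mathbb R^d$: $\phi(x)=C_{m,d}|x|^{2m-d}\log|x|$ for $d$ even, $\phi(x)=C_{m,d}|x|^{2m-d}$ for $d$ odd, with $C_{m,d}$ such that $\Delta^m\phi=\delta$. $\lambda_k u(x')=(\Delta^{k/2}u)(x',0)$ for $k$ even and $\lambda_k u(x')=-\bigl(\frac{\partial}{\partial x_d}\Delta^{(k-1)/2}u\bigr)(x',0)$ for $k$ odd; subscripts $x,y$ indicate the variable on which the operator acts, and $\mathbb R^{d-1}$ is identified with $\mathbb R^{d-1}\times\{0\}$. Thus $\lambda_{k,x}\lambda_{j,y}\phi(x-y)$ is the kernel obtained by applying $\lambda_j$ in $y$ and $\lambda_k$ in $x$ to $(x,y)\mapsto\phi(x-y)$. A function $g$ on $\mathbb R^{d-1}$ is called $j$-admissible here if: (Decay) $g$ is continuous and there are $C>0$, $\delta>2$ with $|g(y)|\le C(1+|y|)^{1+j-2m}(\log(e+|y|))^{-\delta}$; (Vanishing moments) if $j\le\min(m-1,2m-d)$, there are $C>0$, $\tau>1$ with $|\widehat g(\xi')|\le C|\xi'|^{2m-j-d}\bigl|\log|\xi'|\bigr|^{-\tau}$ in a neighborhood of the origin; (Smoothness) $\int_{\mathbb R^{d-1}}|\widehat g(\xi')|(1+|\xi'|)^{j-m}\,\mathrm d\xi'<\infty$. Fourier transform: $\widehat g(\xi')=\int g(x)e^{-i\langle x,\xi'\rangle}\mathrm dx$ (extended to tempered distributions). An operator $v$ is a multiplier operator on $\mathbb R^{d-1}$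 with symbol $\sigma(v)=\mu$ if $vg(x)=(2\pi)^{-(d-1)}\int_{\mathbb R^{d-1}}\mu(\xi')\widehat g(\xi')e^{i\langle x,\xi'\rangle}\mathrm d\xi'$. When $j+k$ is odd the symbol is $0$. *)

theory Defs
  imports "HOL-Analysis.Analysis"
begin

text \<open>
  \<open>\<real>\<^sup>d\<^sup>-\<^sup>1\<close> is a Euclidean space \<open>'a\<close> with \<open>DIM('a) = d - 1\<close>, and \<open>\<real>\<^sup>d\<close> is \<open>'a \<times> real\<close>, the second
  component being the coordinate \<open>x\<^sub>d\<close>; \<open>\<real>\<^sup>d\<^sup>-\<^sup>1\<close> is identified with the points \<open>(x', 0)\<close>.
\<close>

subsection \<open>Partial derivatives, smooth functions and the Laplacian\<close>

definition partial_deriv ::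
    "'a::euclidean_space \<Rightarrow> ('a \<Rightarrow> 'b::real_normed_vector) \<Rightarrow> 'a \<Rightarrow> 'b" where
  "partial_deriv b f x = vector_derivative (\<lambda>t. f (x + t *\<^sub>R b)) (at 0)"

definition laplacian :: "('a::euclidean_space \<Rightarrow> 'b::real_normed_vector) \<Rightarrow> 'a \<Rightarrow> 'b" where
  "laplacian f x = (\<Sum>b\<in>Basis. partial_deriv b (partial_deriv b f) x)"

definition smooth :: "('a::euclidean_space \<Rightarrow> 'b::real_normed_vector) \<Rightarrow> bool" where
  "smooth f \<longleftrightarrow>
    (\<forall>bs. set bs \<subseteq> Basis \<longrightarrow> foldr partial_deriv bs f differentiable_on UNIV)"

definition test_function :: "('a::euclidean_space \<Rightarrow> real) \<Rightarrow> bool" where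
  "test_function \<psi> \<longleftrightarrow> smooth \<psi> \<and> compact (closure {x. \<psi> x \<noteq> 0})"

definition schwartz :: "('a::euclidean_space \<Rightarrow> complex) \<Rightarrow> bool" where
  "schwartz \<psi> \<longleftrightarrow> smooth \<psi> \<and>
    (\<forall>bs n. set bs \<subseteq> Basis \<longrightarrow>
      (\<exists>B. \<forall>x. (1 + norm x) ^ n * norm (foldr partial_deriv bs \<psi> x) \<le> B))"

subsection \<open>The fundamental solution\<close>

text \<open>\<open>\<Delta>\<^sup>m u = \<delta>\<close> in the sense of distributions; \<open>\<Delta>\<^sup>m\<close> is its own formal transpose.\<close>

definition fundamental_solution :: "nat \<Rightarrow> ('a::euclidean_space \<Rightarrow> real) \<Rightarrow> bool" where
  "fundamental_solution m u \<longleftrightarrow>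
    (\<forall>K. compact K \<longrightarrow> set_integrable lborel K u) \<and>
    (\<forall>\<psi>. test_function \<psi> \<longrightarrow> (LINT x|lborel. u x * (laplacian ^^ m) \<psi> x) = \<psi> 0)"

definition phi :: "real \<Rightarrow> nat \<Rightarrow> nat \<Rightarrow> 'a::euclidean_space \<Rightarrow> real" where
  "phi C m d x =
    (if even d then C * norm x powi (2 * int m - int d) * ln (norm x)
     else C * norm x powi (2 * int m - int d))"

subsection \<open>Boundary operators and the kernel\<close>

definition lambda_op ::
    "nat \<Rightarrow> ('a::euclidean_space \<times> real \<Rightarrow> real) \<Rightarrow> 'a \<Rightarrow> real" where
  "lambda_op k u x' =
    (if even k then (laplacian ^^ (k div 2)) u (x', 0)
     else - partial_deriv (0, 1) ((laplacian ^^ ((k - 1) div 2)) u) (x', 0))"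

text \<open>
  First \<open>\<lambda>\<^sub>j\<close> is applied in \<open>y \<in> \<real>\<^sup>d\<close>, with \<open>x \<in> \<real>\<^sup>d\<close> fixed, and then \<open>\<lambda>\<^sub>k\<close> in \<open>x\<close>. For \<open>x' = y'\<close> the
  derivatives need not exist and the value is then unspecified; this concerns a single point \<open>y'\<close>
  for each \<open>x'\<close>.
\<close>

definition bdry_kernel ::
    "nat \<Rightarrow> nat \<Rightarrow> ('a::euclidean_space \<times> real \<Rightarrow> real) \<Rightarrow> 'a \<Rightarrow> 'a \<Rightarrow> real" where
  "bdry_kernel k j f x' y' = lambda_op k (\<lambda>x. lambda_op j (\<lambda>y. f (x - y)) y') x'"

definition v_op ::
    "nat \<Rightarrow> nat \<Rightarrow> ('a::euclidean_space \<times> real \<Rightarrow> real) \<Rightarrow> ('a \<Rightarrow> complex) \<Rightarrow> 'a \<Rightarrow> complex" where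
  "v_op k j f g x = (LINT y|lborel. g y * of_real (bdry_kernel k j f x y))"

subsection \<open>Fourier transform\<close>

definition fourier_integral ::
    "('a::euclidean_space \<Rightarrow> complex) \<Rightarrow> 'a \<Rightarrow> complex" where
  "fourier_integral \<psi> \<xi> = (LINT x|lborel. \<psi> x * cis (- (x \<bullet> \<xi>)))"

text \<open>
  The functions \<open>g\<close> of interest need not be integrable, so their Fourier transform is that of
  tempered distributions: \<open>\<langle>\<hat>g, \<psi>\<rangle> = \<langle>g, \<hat>\<psi>\<rangle>\<close> for all Schwartz functions \<open>\<psi>\<close>. The predicate
  says that \<open>g\<close> has a Fourier transform that is given by the function \<open>h\<close>, which is unique up to
  null sets; \<open>fourier g\<close> is a chosen representative.
\<close>

definition is_fourier :: "('a::euclidean_space \<Rightarrow> complex) \<Rightarrow> ('a \<Rightarrow> complex) \<Rightarrow> bool" where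
  "is_fourier g h \<longleftrightarrow>
    g \<in> borel_measurable lborel \<and> h \<in> borel_measurable lborel \<and>
    (\<forall>\<psi>. schwartz \<psi> \<longrightarrow>
      integrable lborel (\<lambda>x. g x * \<psi> x) \<and>
      integrable lborel (\<lambda>\<xi>. h \<xi> * \<psi> \<xi>) \<and>
      (LINT \<xi>|lborel. h \<xi> * \<psi> \<xi>) = (LINT x|lborel. g x * fourier_integral \<psi> x))"

definition fourier :: "('a::euclidean_space \<Rightarrow> complex) \<Rightarrow> 'a \<Rightarrow> complex" where
  "fourier g = (SOME h. is_fourier g h)"

subsection \<open>Admissible functions and multiplier operators\<close>

text \<open>
  As \<open>fourier g\<close> is only determined almost everywhere, so is the bound near the origin.
\<close>

definition admissible ::
    "nat \<Rightarrow> nat \<Rightarrow> nat \<Rightarrow> ('a::euclidean_space \<Rightarrow> complex) \<Rightarrow> bool" where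
  "admissible m d j g \<longleftrightarrow>
    is_fourier g (fourier g) \<and>
    continuous_on UNIV g \<and>
    (\<exists>C>0. \<exists>\<delta>>2. \<forall>y. norm (g y) \<le>
        C * (1 + norm y) powi (1 + int j - 2 * int m) * ln (exp 1 + norm y) powr (- \<delta>)) \<and>
    (int j \<le> min (int m - 1) (2 * int m - int d) \<longrightarrow>
      (\<exists>C>0. \<exists>\<tau>>1. \<exists>r>0. AE \<xi> in lborel. norm \<xi> < r \<longrightarrow>
        norm (fourier g \<xi>) \<le>
          C * norm \<xi> powi (2 * int m - int j - int d) * \<bar>ln (norm \<xi>)\<bar> powr (- \<tau>))) \<and>
    integrable lborel (\<lambda>\<xi>. norm (fourier g \<xi>) * (1 + norm \<xi>) powi (int j - int m))"

definition is_multiplier_on ::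
    "('a::euclidean_space \<Rightarrow> complex) set \<Rightarrow> (('a \<Rightarrow> complex) \<Rightarrow> 'a \<Rightarrow> complex) \<Rightarrow>
      ('a \<Rightarrow> complex) \<Rightarrow> bool" where
  "is_multiplier_on D v \<mu> \<longleftrightarrow>
    (\<forall>g\<in>D. is_fourier g (fourier g) \<and>
      (\<forall>x. integrable lborel (\<lambda>\<xi>. \<mu> \<xi> * fourier g \<xi> * cis (x \<bullet> \<xi>)) \<and>
        v g x = (LINT \<xi>|lborel. \<mu> \<xi> * fourier g \<xi> * cis (x \<bullet> \<xi>)) / (2 * pi) ^ DIM('a)))"

subsection \<open>The symbol\<close>

definition b_coeff :: "nat \<Rightarrow> real" where
  "b_coeff n = real ((2 * n) choose n)"

definition c_coeff :: "nat \<Rightarrow> real" where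
  "c_coeff n = real ((2 * n) choose n) - real ((2 * n) choose (n + 1))"

definition M_coeff :: "nat \<Rightarrow> nat \<Rightarrow> nat \<Rightarrow> real" where
  "M_coeff m k j =
    (if even j \<and> even k then
       2 powi (1 + int j + int k - 2 * int m) * b_coeff (m - (j + k) div 2 - 1)
     else if odd j \<and> odd k then
       - (2 powi (int j + int k - 2 * int m)) * c_coeff (m - (j + k) div 2 - 1)
     else 0)"

text \<open>For odd \<open>j + k\<close> the rounding in the exponent of \<open>-1\<close> is harmless since \<open>M_coeff m k j = 0\<close>.\<close>

definition v_symbol :: "nat \<Rightarrow> nat \<Rightarrow> nat \<Rightarrow> 'a::euclidean_space \<Rightarrow> complex" where
  "v_symbol m k j \<xi> =
    of_real ((-1) powi ((int j + int k - 2 * int m) div 2) * M_coeff m k j *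
      norm \<xi> powi (int j + int k + 1 - 2 * int m))"

end

theory Submission
  imports Defs "HOL-Probability.Probability" "HOL-Real_Asymp.Real_Asymp"
begin

text \<open>
  The operator is convolution with the kernel of \<open>\<lambda>\<^sub>k\<lambda>\<^sub>j\<phi>\<close> on the hyperplane. For odd \<open>j + k\<close> this kernel is an odd
  function of the normal variable, hence zero there. For even \<open>j + k\<close> put \<open>N = m - (j + k) / 2\<close>. Laplacians turn a
  fundamental solution of \<open>\<Delta>\<^sup>m\<close> into one of lower order, and two normal derivatives of a radial function, taken at
  \<open>x\<^sub>d = 0\<close>, give its radial derivative divided by the radius, which for these functions lowers the order
  by one more (\<open>bdry_kernel_powlog\<close>). So the kernel is a constant times a fundamental solution of \<open>\<Delta>\<^sup>N\<close>
  on \<open>\<real>\<^sup>d\<close> restricted to \<open>\<real>\<^sup>d\<^sup>-\<^sup>1\<close>. The symbol of that convolution is, up to sign, the integral of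
  \<open>(\<bar>\<xi>\<bar>\<^sup>2 + s\<^sup>2)\<close> to the power \<open>- N\<close> over the normal frequency \<open>s\<close>, divided by \<open>2 \<pi>\<close>: a multiple
  of \<open>\<bar>\<xi>\<bar>\<close> to the power \<open>1 - 2 N\<close>, and \<open>\<Gamma>(N - 1/2)\<close> produces the central binomial coefficient.
  
  The rigorous argument uses Gaussians only. On the side of the kernel, \<open>\<bar>z\<bar>\<close> to the power \<open>2 N - d\<close> is an integral of
  \<open>exp (- \<bar>z\<bar>\<^sup>2 / (4 t))\<close> against a power of \<open>t\<close>; on the Fourier side \<open>\<bar>\<xi>\<bar>\<close> to the power \<open>1 - 2 N\<close> is an
  integral of \<open>exp (- t \<bar>\<xi>\<bar>\<^sup>2)\<close> (\<open>riesz_potential_heat\<close>). For fixed \<open>t\<close> these Gaussians are Fourier transforms of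
  each other and Schwartz functions, so the definition of the transform of \<open>g\<close> links them (\<open>heat_identity\<close>), and Fubini's
  theorem gives the multiplier identity.
  
  Two points need work. First, for \<open>2 N \<ge> d\<close> the integral over \<open>t\<close> on the kernel side diverges at infinity.
  It converges once the Taylor polynomial in \<open>\<bar>z\<bar>\<^sup>2 / (4 t)\<close> is subtracted from the exponential; for even \<open>d\<close>
  its last term is subtracted for \<open>t > 1\<close> only, and this cutoff creates the logarithm. The subtraction costs nothing
  (\<open>powlog_integral_heat\<close>), because the moments of \<open>g\<close> vanish: the bound on the transform near the origin makes the
  heat integrals of \<open>g\<close> decay, and their expansion in powers of \<open>1 / t\<close> has the moments as coefficients
  (\<open>moments_vanish\<close>). Second, the transform divided by a power of \<open>\<bar>\<xi>\<bar>\<close> has to be integrable near the origin. If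
  \<open>j > 2 m - d\<close> nothing is assumed about the transform there, and integrability has to come from the decay of \<open>g\<close>,
  by a dyadic decomposition and a Plancherel inequality (\<open>near_zero_of_L2\<close>).
  
  The constant \<open>C\<close> is identified by testing \<open>\<phi>\<close> against a single radial cutoff function
  (\<open>fundamental_solution_riesz_coeffs\<close>).
\<close>

section \<open>Gaussian and radial integrals\<close>

lemma has_bochner_integral_gauss_cis_real:
  fixes t s :: real
  assumes t: "t > 0"
  shows "has_bochner_integral lborel (\<lambda>x. of_real (exp (-t * x\<^sup>2)) * cis (x * s))
           (of_real (sqrt (pi / t) * exp (- s\<^sup>2 / (4 * t))))"
proof -
  have A: "has_bochner_integral lborel (\<lambda>x. std_normal_density x *\<^sub>R cis (u * x))
      (of_real (exp (- u\<^sup>2 / 2)))" for u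
  proof -
    have i: "integrable lborel std_normal_density"
      using integrable_std_normal_moment[of 0] by simp
    have "integrable lborel (\<lambda>x. std_normal_density x *\<^sub>R cis (u * x))"
      by (rule Bochner_Integration.integrable_bound[OF i]) (auto simp: cis_conv_exp)
    moreover have "char std_normal_distribution u = (LINT x|lborel. std_normal_density x *\<^sub>R cis (u * x))"
      unfolding char_def
      by (subst integral_density) (auto simp: cis_conv_exp)
    ultimately show ?thesis
      by (simp add: has_bochner_integral_iff char_std_normal_distribution)
  qed
  define c where "c = sqrt (2 * t)"
  have c: "c > 0" "c\<^sup>2 = 2 * t" using t by (auto simp: c_def)
  have "has_bochner_integral lborel (\<lambda>x. std_normal_density (0 + c * x) *\<^sub>R cis ((s/c) * (0 + c * x)))
      (of_real (exp (- (s/c)\<^sup>2 / 2)) /\<^sub>R \<bar>c\<bar>)"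
    using A[of "s/c"] c by (subst lborel_has_bochner_integral_real_affine_iff[symmetric]) auto
  hence "has_bochner_integral lborel (\<lambda>x. sqrt (2 * pi) *\<^sub>R (std_normal_density (0 + c * x) *\<^sub>R cis ((s/c) * (0 + c * x))))
      (sqrt (2 * pi) *\<^sub>R (of_real (exp (- (s/c)\<^sup>2 / 2)) /\<^sub>R \<bar>c\<bar>))"
    by (rule has_bochner_integral_scaleR_right[rotated])
  moreover have "sqrt (2 * pi) *\<^sub>R (std_normal_density (0 + c * x) *\<^sub>R cis ((s/c) * (0 + c * x)))
      = of_real (exp (-t * x\<^sup>2)) * cis (x * s)" for x
    using c by (simp add: std_normal_density_def scaleR_conv_of_real power_mult_distrib mult.commute)
  moreover have "sqrt (2 * pi) *\<^sub>R (complex_of_real (exp (- (s/c)\<^sup>2 / 2)) /\<^sub>R \<bar>c\<bar>) =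
      of_real (sqrt (pi / t) * exp (- s\<^sup>2 / (4 * t)))"
  proof -
    have "sqrt (2*pi) / c = sqrt (pi / t)"
      unfolding c_def using t by (simp add: real_sqrt_divide real_sqrt_mult)
    thus ?thesis using c
      by (simp add: power_divide scaleR_conv_of_real field_simps flip: of_real_mult of_real_inverse of_real_divide)
  qed
  ultimately show ?thesis by simp
qed

text \<open>
  The integrand is a product over the coordinates, so the one-dimensional case suffices.
\<close>

lemma has_bochner_integral_gauss_cis:
  fixes y :: "'a::euclidean_space" and t :: real
  assumes t: "t > 0"
  shows "has_bochner_integral lborel (\<lambda>x::'a. of_real (exp (-t * (norm x)\<^sup>2)) * cis (x \<bullet> y))
           (of_real ((pi / t) powr (real DIM('a) / 2) * exp (- (norm y)\<^sup>2 / (4 * t))))"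
proof -
  interpret P: product_sigma_finite "\<lambda>_::'a. lborel :: real measure" by standard
  let ?g = "\<lambda>b x. complex_of_real (exp (-t * x\<^sup>2)) * cis (x * (y \<bullet> b))"
  let ?f = "\<lambda>x::'a. complex_of_real (exp (-t * (norm x)\<^sup>2)) * cis (x \<bullet> y)"
  let ?S = "\<lambda>f::'a\<Rightarrow>real. \<Sum>b\<in>Basis. f b *\<^sub>R b"
  have cisum: "cis (\<Sum>b\<in>A. h b) = (\<Prod>b\<in>A. cis (h b))" if "finite A" for h and A :: "'a set"
    using that by induction (auto simp: cis_mult[symmetric])
  have eq: "?f (?S f) = (\<Prod>b\<in>Basis. ?g b (f b))" for f
  proof -
    have 1: "(norm (?S f))\<^sup>2 = (\<Sum>b\<in>Basis. (f b)\<^sup>2)"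
      unfolding power2_norm_eq_inner
      by (subst euclidean_inner) (simp add: power2_eq_square inner_sum_left inner_Basis if_distrib cong: if_cong)
    have 2: "?S f \<bullet> y = (\<Sum>b\<in>Basis. f b * (y \<bullet> b))"
      by (simp add: inner_sum_left inner_commute[of y])
    have "exp (-t * (\<Sum>b\<in>Basis. (f b)\<^sup>2)) = (\<Prod>b\<in>Basis. exp (-t * (f b)\<^sup>2))"
      by (simp add: sum_distrib_left exp_sum flip: sum_negf)
    thus ?thesis
      unfolding 1 2 by (simp add: prod.distrib cisum)
  qed
  have int: "integrable lborel (?g b)" "integral\<^sup>L lborel (?g b) = of_real (sqrt (pi / t) * exp (- (y \<bullet> b)\<^sup>2 / (4 * t)))" for b
    using has_bochner_integral_gauss_cis_real[OF t, of "y \<bullet> b"] by (auto simp: has_bochner_integral_iff)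
  have m[measurable]: "?f \<in> borel_measurable borel"
    by (auto intro!: borel_measurable_continuous_onI continuous_intros simp: cis_conv_exp)
  have "integrable (Pi\<^sub>M Basis (\<lambda>_. lborel)) (\<lambda>f. \<Prod>b\<in>Basis. ?g b (f b))"
    by (intro P.product_integrable_prod int) simp
  hence i: "integrable lborel ?f"
    by (subst lborel_eq, subst integrable_distr_eq[OF _ m]) (simp_all only: eq, measurable)
  have "integral\<^sup>L lborel ?f = integral\<^sup>L (Pi\<^sub>M Basis (\<lambda>_. lborel)) (\<lambda>f. \<Prod>b\<in>Basis. ?g b (f b))"
    by (subst lborel_eq, subst integral_distr[OF _ m]) (simp_all only: eq, measurable)
  also have "\<dots> = (\<Prod>b\<in>Basis. of_real (sqrt (pi / t) * exp (- (y \<bullet> b)\<^sup>2 / (4 * t))))"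
    by (subst P.product_integral_prod) (use int in auto)
  also have "\<dots> = of_real ((sqrt (pi / t)) ^ DIM('a) * exp (- (\<Sum>b\<in>Basis. (y \<bullet> b)\<^sup>2) / (4 * t)))"
    by (simp only: of_real_prod[symmetric] prod.distrib prod_constant exp_sum[symmetric] finite_Basis sum_divide_distrib[symmetric] sum_negf)
  also have "(sqrt (pi / t)) ^ DIM('a) = (pi / t) powr (real DIM('a) / 2)"
    using t by (simp add: powr_half_sqrt[symmetric] powr_powr flip: powr_realpow)
  also have "(\<Sum>b\<in>Basis. (y \<bullet> b)\<^sup>2) = (norm y)\<^sup>2"
    unfolding power2_norm_eq_inner by (subst (2) euclidean_inner) (simp add: power2_eq_square)
  finally show ?thesis using i by (simp add: has_bochner_integral_iff)
qed

text \<open>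
  Both measures agree on the intervals \<open>{..r}\<close>, whose preimages under the norm are balls with known volume.
\<close>

lemma distr_norm_lborel:
  "distr (lborel :: 'a::euclidean_space measure) borel norm =
   density lborel (\<lambda>r. ennreal (if 0 \<le> r then unit_ball_vol (DIM('a)) * real DIM('a) * r ^ (DIM('a) - 1) else 0))"
   (is "?M = ?N")
proof (rule measure_eqI_generator_eq[where E = "range atMost" and \<Omega> = UNIV and A = "\<lambda>i. {..real i}"])
  let ?V = "unit_ball_vol (DIM('a))"
  have eM: "emeasure ?M {..u} = ennreal (if 0 \<le> u then ?V * u ^ DIM('a) else 0)" for u
  proof -
    have "norm -` {..u} = (cball 0 u :: 'a set)" by (auto simp: dist_norm)
    thus ?thesis
      by (subst emeasure_distr) (auto simp: emeasure_cball)
  qed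
  have eN: "emeasure ?N {..u} = ennreal (if 0 \<le> u then ?V * u ^ DIM('a) else 0)" for u
  proof -
    have "emeasure ?N {..u} = (\<integral>\<^sup>+r. ennreal (if 0 \<le> r then ?V * real DIM('a) * r ^ (DIM('a) - 1) else 0) * indicator {..u} r \<partial>lborel)"
      by (subst emeasure_density) auto
    also have "\<dots> = (\<integral>\<^sup>+r. ennreal (?V * real DIM('a) * r ^ (DIM('a) - 1)) * indicator {0..u} r \<partial>lborel)"
      by (intro nn_integral_cong) (auto simp: indicator_def)
    also have "\<dots> = ennreal (if 0 \<le> u then ?V * u ^ DIM('a) else 0)"
    proof (cases "0 \<le> u")
      case True
      have "(\<integral>\<^sup>+r. ennreal (?V * real DIM('a) * r ^ (DIM('a) - 1)) * indicator {0..u} r \<partial>lborel)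
        = ennreal (?V * u ^ DIM('a) - ?V * 0 ^ DIM('a))"
        by (rule nn_integral_FTC_Icc[where F = "\<lambda>r. ?V * r ^ DIM('a)"])
           (auto intro!: derivative_eq_intros simp: True)
      thus ?thesis using True by (simp add: power_0_left)
    qed (auto simp: indicator_def)
    finally show ?thesis .
  qed
  show "emeasure ?M X = emeasure ?N X" if "X \<in> range atMost" for X
    using that eM eN by auto
  show "emeasure ?M {..real i} \<noteq> \<infinity>" for i by (simp add: eM)
  show "(\<Union>i. {..real i}) = UNIV" using real_arch_simple by auto
  show "Int_stable (range (atMost :: real \<Rightarrow> _))" by (auto simp: Int_stable_def)
  show "sets ?M = sigma_sets UNIV (range atMost)" "sets ?N = sigma_sets UNIV (range atMost)"
    by (simp_all add: borel_eq_atMost)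
qed auto

lemma nn_integral_radial:
  assumes [measurable]: "f \<in> borel_measurable borel"
  shows "(\<integral>\<^sup>+x. f (norm x) \<partial>(lborel :: 'a::euclidean_space measure)) =
    (\<integral>\<^sup>+r. ennreal (if 0 \<le> r then unit_ball_vol (DIM('a)) * real DIM('a) * r ^ (DIM('a) - 1) else 0) * f r \<partial>lborel)"
proof -
  have "(\<integral>\<^sup>+x. f (norm x) \<partial>(lborel :: 'a measure)) = integral\<^sup>N (distr lborel borel (norm :: 'a \<Rightarrow> real)) f"
    by (subst nn_integral_distr) auto
  also note distr_norm_lborel
  finally show ?thesis by (subst (asm) nn_integral_density) auto
qed

lemma integral_radial:
  fixes f :: "real \<Rightarrow> real"
  assumes [measurable]: "f \<in> borel_measurable borel"
  shows "(LINT x|(lborel :: 'a::euclidean_space measure). f (norm x)) =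
    (LINT r|lborel. (if 0 \<le> r then unit_ball_vol (DIM('a)) * real DIM('a) * r ^ (DIM('a) - 1) else 0) * f r)"
proof -
  have "(LINT x|(lborel :: 'a measure). f (norm x)) = integral\<^sup>L (distr lborel borel (norm :: 'a \<Rightarrow> real)) f"
    by (subst integral_distr) auto
  also note distr_norm_lborel
  finally show ?thesis by (subst (asm) integral_density) auto
qed

section \<open>Smoothness from closure under differentiation\<close>

lemma partial_deriv_eq:
  fixes f :: "'a::euclidean_space \<Rightarrow> 'b::real_normed_vector"
  assumes "(f has_derivative f') (at x)"
  shows "partial_deriv b f x = f' b"
proof -
  have "((\<lambda>t. x + t *\<^sub>R b) has_derivative (\<lambda>t. t *\<^sub>R b)) (at 0)"
    by (auto intro!: derivative_eq_intros)
  moreover have "(f has_derivative f') (at (x + 0 *\<^sub>R b))" using assms by simp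
  ultimately have "((\<lambda>t. f (x + t *\<^sub>R b)) has_derivative (\<lambda>t. f' (t *\<^sub>R b))) (at 0)"
    by (rule has_derivative_compose)
  moreover have "f' (t *\<^sub>R b) = t *\<^sub>R f' b" for t
    using assms by (simp add: has_derivative_def bounded_linear.linear linear_cmul)
  ultimately have "((\<lambda>t. f (x + t *\<^sub>R b)) has_vector_derivative f' b) (at 0)"
    by (simp add: has_vector_derivative_def)
  thus ?thesis unfolding partial_deriv_def by (rule vector_derivative_at)
qed

text \<open>
  Smoothness and Schwartz bounds of a concrete function are inherited by all its derivatives at once if the function lies
  in a space that is closed under differentiation. The space generated here is the span of the seeds over polynomials in the
  coordinates; it is closed under derivatives as soon as the derivatives of the seeds lie in it.
\<close>

inductive_set poly_span :: "('a::euclidean_space \<Rightarrow> 'b::real_normed_field) set \<Rightarrow> ('a \<Rightarrow> 'b) set"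
  for S where
  seed: "g \<in> S \<Longrightarrow> g \<in> poly_span S"
| add: "f \<in> poly_span S \<Longrightarrow> g \<in> poly_span S \<Longrightarrow> (\<lambda>x. f x + g x) \<in> poly_span S"
| scale: "f \<in> poly_span S \<Longrightarrow> (\<lambda>x. c * f x) \<in> poly_span S"
| coord: "f \<in> poly_span S \<Longrightarrow> (\<lambda>x. (x \<bullet> b) *\<^sub>R f x) \<in> poly_span S"

lemma poly_span_deriv:
  assumes S: "\<And>g. g \<in> S \<Longrightarrow> \<exists>g'. (\<forall>x. (g has_derivative g' x) (at x)) \<and> (\<forall>b. (\<lambda>x. g' x b) \<in> poly_span S)"
    and "f \<in> poly_span S"
  shows "\<exists>f'. (\<forall>x. (f has_derivative f' x) (at x)) \<and> (\<forall>b. (\<lambda>x. f' x b) \<in> poly_span S)"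
  using assms(2)
proof induction
  case (add f g)
  then obtain f' g' where "\<And>x. (f has_derivative f' x) (at x)" "\<And>b. (\<lambda>x. f' x b) \<in> poly_span S"
    "\<And>x. (g has_derivative g' x) (at x)" "\<And>b. (\<lambda>x. g' x b) \<in> poly_span S" by metis
  thus ?case
    by (intro exI[of _ "\<lambda>x b. f' x b + g' x b"] conjI allI)
       (auto intro: has_derivative_add poly_span.add)
next
  case (scale f c)
  then obtain f' where f': "\<And>x. (f has_derivative f' x) (at x)" "\<And>b. (\<lambda>x. f' x b) \<in> poly_span S" by metis
  show ?case
    by (intro exI[of _ "\<lambda>x b. c * f' x b"] conjI allI)
       (auto intro: has_derivative_mult_right poly_span.scale f')
next
  case (coord f c)
  then obtain f' where f': "\<And>x. (f has_derivative f' x) (at x)" "\<And>b. (\<lambda>x. f' x b) \<in> poly_span S" by metis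
  show ?case
  proof (intro exI[of _ "\<lambda>x b. (x \<bullet> c) *\<^sub>R f' x b + of_real (b \<bullet> c) * f x"] conjI allI)
    show "((\<lambda>x. (x \<bullet> c) *\<^sub>R f x) has_derivative (\<lambda>b. (x \<bullet> c) *\<^sub>R f' x b + of_real (b \<bullet> c) * f x)) (at x)" for x
      by (auto intro!: derivative_eq_intros f' simp: scaleR_conv_of_real)
    show "(\<lambda>x. (x \<bullet> c) *\<^sub>R f' x b + of_real (b \<bullet> c) * f x) \<in> poly_span S" for b
      by (intro poly_span.add poly_span.coord poly_span.scale f' coord)
  qed
qed (use S in blast)

lemma smooth_poly_span:
  assumes S: "\<And>g. g \<in> S \<Longrightarrow> \<exists>g'. (\<forall>x. (g has_derivative g' x) (at x)) \<and> (\<forall>b. (\<lambda>x. g' x b) \<in> poly_span S)"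
    and f: "f \<in> poly_span S"
  shows "foldr partial_deriv bs f \<in> poly_span S" and "smooth f"
proof -
  have *: "foldr partial_deriv bs f \<in> poly_span S" for bs
  proof (induction bs)
    case (Cons b bs)
    obtain f' where f': "\<And>x. (foldr partial_deriv bs f has_derivative f' x) (at x)" "\<And>b. (\<lambda>x. f' x b) \<in> poly_span S"
      using poly_span_deriv[OF S Cons] by metis
    have "partial_deriv b (foldr partial_deriv bs f) = (\<lambda>x. f' x b)"
      using f' by (auto intro!: partial_deriv_eq)
    thus ?case using f' by simp
  qed (use f in auto)
  show "foldr partial_deriv bs f \<in> poly_span S" by (rule *)
  show "smooth f" unfolding smooth_def
    using poly_span_deriv[OF S *] unfolding differentiable_on_def differentiable_def
    by (meson has_derivative_at_withinI)
qed

lemma power_gauss_bounded: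
  fixes t :: real assumes "t > 0"
  obtains B where "\<And>r. r \<ge> 0 \<Longrightarrow> (1 + r) ^ n * exp (-t * r\<^sup>2) \<le> B"
proof -
  have "((\<lambda>r. (1 + r) ^ n * exp (-t * r\<^sup>2)) \<longlongrightarrow> 0) at_top"
    using assms by real_asymp
  hence "eventually (\<lambda>r. (1 + r) ^ n * exp (-t * r\<^sup>2) < 1) at_top"
    by (rule order_tendstoD) simp
  then obtain R where R: "\<And>r. r \<ge> R \<Longrightarrow> (1 + r) ^ n * exp (-t * r\<^sup>2) < 1"
    by (auto simp: eventually_at_top_linorder)
  show thesis
  proof (rule that)
    fix r :: real assume r: "r \<ge> 0"
    show "(1 + r) ^ n * exp (-t * r\<^sup>2) \<le> max 1 ((1 + \<bar>R\<bar>) ^ n)"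
    proof (cases "r \<ge> R")
      case False
      have "(1 + r) ^ n * exp (-t * r\<^sup>2) \<le> (1 + \<bar>R\<bar>) ^ n * 1"
        using r False assms by (intro mult_mono power_mono) auto
      thus ?thesis by simp
    qed (use R[of r] in \<open>intro max.coboundedI1, simp\<close>)
  qed
qed

text \<open>
  The center \<open>\<eta>\<close> is needed for mollification in frequency, the phase \<open>x\<close> for evaluating convolutions at \<open>x\<close>.
\<close>

definition gauss_wave :: "real \<Rightarrow> 'a::euclidean_space \<Rightarrow> 'a \<Rightarrow> 'a \<Rightarrow> complex" where
  "gauss_wave t \<eta> x \<xi> = of_real (exp (- t * (norm (\<xi> - \<eta>))\<^sup>2)) * cis (x \<bullet> \<xi>)"

lemma gauss_wave_deriv:
  "(gauss_wave t \<eta> x has_derivative (\<lambda>b. (of_real (- 2 * t * ((\<xi> - \<eta>) \<bullet> b)) + \<i> * of_real (x \<bullet> b)) * gauss_wave t \<eta> x \<xi>)) (at \<xi>)"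
proof -
  have eq: "gauss_wave t \<eta> x = (\<lambda>\<xi>. exp (of_real (- t * ((\<xi> - \<eta>) \<bullet> (\<xi> - \<eta>))) + \<i> * of_real (x \<bullet> \<xi>)))"
    by (simp add: fun_eq_iff gauss_wave_def cis_conv_exp power2_norm_eq_inner exp_add del: of_real_mult of_real_minus flip: exp_of_real)
  have "((\<lambda>\<xi>. complex_of_real (- t * ((\<xi> - \<eta>) \<bullet> (\<xi> - \<eta>))) + \<i> * complex_of_real (x \<bullet> \<xi>)) has_derivative
      (\<lambda>b. of_real (- 2 * t * ((\<xi> - \<eta>) \<bullet> b)) + \<i> * of_real (x \<bullet> b))) (at \<xi>)"
    by (rule derivative_eq_intros refl)+ (auto simp: inner_commute algebra_simps)
  from has_derivative_compose[OF this DERIV_exp[unfolded has_field_derivative_def]]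
  show ?thesis unfolding eq by (simp add: mult.commute)
qed

text \<open>
  The polynomial multiples of \<open>gauss_wave t \<eta> x\<close> form a space closed under differentiation, and the Gaussian factor
  beats every polynomial.
\<close>

lemma schwartz_gauss_wave:
  fixes \<eta> x :: "'a::euclidean_space"
  assumes t: "t > 0"
  shows "schwartz (gauss_wave t \<eta> x)"
proof -
  let ?S = "{gauss_wave t \<eta> x}"
  have S: "\<exists>g'. (\<forall>x. (g has_derivative g' x) (at x)) \<and> (\<forall>b. (\<lambda>x. g' x b) \<in> poly_span ?S)" if "g \<in> ?S" for g
  proof -
    have "(\<lambda>\<xi>. (of_real (- 2 * t * ((\<xi> - \<eta>) \<bullet> b)) + \<i> * of_real (x \<bullet> b)) * gauss_wave t \<eta> x \<xi>) \<in> poly_span ?S" for b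
    proof -
      have "(\<lambda>\<xi>. of_real (- 2 * t) * ((\<xi> \<bullet> b) *\<^sub>R gauss_wave t \<eta> x \<xi>) + (of_real (2 * t * (\<eta> \<bullet> b)) + \<i> * of_real (x \<bullet> b)) * gauss_wave t \<eta> x \<xi>) \<in> poly_span ?S"
        by (intro poly_span.intros) auto
      thus ?thesis
        by (simp add: algebra_simps inner_diff_left scaleR_conv_of_real)
    qed
    thus ?thesis using that gauss_wave_deriv[of t \<eta> x]
      by (intro exI[of _ "\<lambda>\<xi> b. (of_real (- 2 * t * ((\<xi> - \<eta>) \<bullet> b)) + \<i> * of_real (x \<bullet> b)) * gauss_wave t \<eta> x \<xi>"]) simp
  qed
  have decay: "\<exists>B. \<forall>\<xi>. (1 + norm \<xi>) ^ n * norm (f \<xi>) \<le> B" if "f \<in> poly_span ?S" for f n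
    using that
  proof (induction arbitrary: n)
    case (seed g)
    obtain B where B: "\<And>r. r \<ge> 0 \<Longrightarrow> (1 + r) ^ n * exp (-t * r\<^sup>2) \<le> B"
      using power_gauss_bounded[OF t] by blast
    have "(1 + norm \<xi>) ^ n * norm (g \<xi>) \<le> (1 + norm \<eta>) ^ n * B" for \<xi>
    proof -
      have "1 + norm \<xi> \<le> 1 + (norm \<eta> + norm (\<xi> - \<eta>))" by (simp add: norm_triangle_sub)
      also have "\<dots> \<le> (1 + norm \<eta>) * (1 + norm (\<xi> - \<eta>))" by (simp add: algebra_simps)
      finally have "(1 + norm \<xi>) ^ n \<le> ((1 + norm \<eta>) * (1 + norm (\<xi> - \<eta>))) ^ n"
        by (intro power_mono) auto
      hence "(1 + norm \<xi>) ^ n * norm (g \<xi>) \<le> ((1 + norm \<eta>) * (1 + norm (\<xi> - \<eta>))) ^ n * exp (-t * (norm (\<xi> - \<eta>))\<^sup>2)"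
        using seed by (auto simp: gauss_wave_def norm_mult intro!: mult_mono)
      also have "\<dots> = (1 + norm \<eta>) ^ n * ((1 + norm (\<xi> - \<eta>)) ^ n * exp (-t * (norm (\<xi> - \<eta>))\<^sup>2))"
        by (simp add: power_mult_distrib)
      also have "\<dots> \<le> (1 + norm \<eta>) ^ n * B"
        by (intro mult_left_mono B) auto
      finally show ?thesis .
    qed
    thus ?case by blast
  next
    case (add f g)
    obtain A B where "\<And>\<xi>. (1 + norm \<xi>) ^ n * norm (f \<xi>) \<le> A" "\<And>\<xi>. (1 + norm \<xi>) ^ n * norm (g \<xi>) \<le> B"
      using add.IH by metis
    hence "(1 + norm \<xi>) ^ n * (norm (f \<xi>) + norm (g \<xi>)) \<le> A + B" for \<xi>
      by (simp add: distrib_left add_mono)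
    moreover have "(1 + norm \<xi>) ^ n * norm (f \<xi> + g \<xi>) \<le> (1 + norm \<xi>) ^ n * (norm (f \<xi>) + norm (g \<xi>))" for \<xi>
      by (intro mult_left_mono norm_triangle_ineq) auto
    ultimately show ?case by (meson order_trans)
  next
    case (scale f c)
    obtain A where "\<And>\<xi>. (1 + norm \<xi>) ^ n * norm (f \<xi>) \<le> A"
      using scale.IH by metis
    hence "norm c * ((1 + norm \<xi>) ^ n * norm (f \<xi>)) \<le> norm c * A" for \<xi>
      by (intro mult_left_mono) auto
    thus ?case by (auto simp: norm_mult mult_ac)
  next
    case (coord f b)
    obtain A where A: "\<And>\<xi>. (1 + norm \<xi>) ^ Suc n * norm (f \<xi>) \<le> A"
      using coord.IH by metis
    have "(1 + norm \<xi>) ^ n * norm ((\<xi> \<bullet> b) *\<^sub>R f \<xi>) \<le> norm b * A" for \<xi>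
    proof -
      have "\<bar>\<xi> \<bullet> b\<bar> \<le> norm b * (1 + norm \<xi>)"
        using Cauchy_Schwarz_ineq2[of \<xi> b] norm_ge_zero[of b] by (simp add: algebra_simps del: norm_ge_zero)
      hence "(1 + norm \<xi>) ^ n * norm ((\<xi> \<bullet> b) *\<^sub>R f \<xi>) \<le> (1 + norm \<xi>) ^ n * ((norm b * (1 + norm \<xi>)) * norm (f \<xi>))"
        by (auto intro!: mult_left_mono mult_right_mono)
      also have "\<dots> = norm b * ((1 + norm \<xi>) ^ Suc n * norm (f \<xi>))" by (simp add: mult_ac)
      also have "\<dots> \<le> norm b * A" by (intro mult_left_mono A) auto
      finally show ?thesis .
    qed
    thus ?case by blast
  qed
  have "gauss_wave t \<eta> x \<in> poly_span ?S" by (rule poly_span.seed) simp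
  thus ?thesis unfolding schwartz_def
    using smooth_poly_span[OF S, of "gauss_wave t \<eta> x"] decay by blast
qed

section \<open>A smooth radial cutoff\<close>

text \<open>
  The powers of \<open>1 / x\<close> make the family closed under differentiation.
\<close>

definition exp_recip :: "nat \<Rightarrow> real \<Rightarrow> real" where
  "exp_recip k x = (if x > 0 then exp (- (1 / x)) / x ^ k else 0)"

lemma exp_recip_deriv:
  "(exp_recip k has_real_derivative (exp_recip (k + 2) x - real k * exp_recip (k + 1) x)) (at x)"
proof -
  consider "x > 0" | "x < 0" | "x = 0" by linarith
  thus ?thesis
  proof cases
    case 1
    have "((\<lambda>x. inverse x ^ k) has_real_derivative - (real k * inverse x ^ (k + 1))) (at x)"
      using DERIV_power[OF DERIV_inverse[of x UNIV], of k] 1 by (cases k) (auto simp: algebra_simps power_inverse)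
    moreover have "((\<lambda>x. exp (- inverse x)) has_real_derivative exp (- inverse x) * inverse x ^ 2) (at x)"
      using 1 by (auto intro!: derivative_eq_intros simp: power2_eq_square)
    ultimately have "((\<lambda>x. exp (- inverse x) * inverse x ^ k) has_real_derivative
        exp (- inverse x) * inverse x ^ 2 * inverse x ^ k + - (real k * inverse x ^ (k + 1)) * exp (- inverse x)) (at x)"
      by (rule DERIV_mult[rotated])
    hence "((\<lambda>x. exp (- inverse x) * inverse x ^ k) has_real_derivative (exp_recip (k + 2) x - real k * exp_recip (k + 1) x)) (at x)"
      using 1 by (simp add: exp_recip_def divide_inverse power_inverse power2_eq_square algebra_simps)
    moreover have "eventually (\<lambda>x. exp (- inverse x) * inverse x ^ k = exp_recip k x) (nhds x)"
      using eventually_nhds_in_open[of "{0<..}" x] 1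
      by (auto elim!: eventually_mono simp: exp_recip_def divide_inverse power_inverse)
    ultimately show ?thesis by (subst (asm) DERIV_cong_ev[OF refl _ refl]) auto
  next
    case 2
    have "eventually (\<lambda>x. 0 = exp_recip k x) (nhds x)"
      using eventually_nhds_in_open[of "{..<0}" x] 2 by (auto elim!: eventually_mono simp: exp_recip_def)
    moreover have "((\<lambda>x. 0) has_real_derivative (exp_recip (k + 2) x - real k * exp_recip (k + 1) x)) (at x)"
      using 2 by (auto simp: exp_recip_def)
    ultimately show ?thesis by (subst (asm) DERIV_cong_ev[OF refl _ refl]) auto
  next
    case 3
    have "((\<lambda>y::real. y ^ (k + 1) / exp y) \<longlongrightarrow> 0) at_top" by (rule tendsto_power_div_exp_0)
    hence "((\<lambda>h::real. (inverse h) ^ (k + 1) / exp (inverse h)) \<longlongrightarrow> 0) (at_right 0)"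
      by (rule filterlim_compose) (rule filterlim_inverse_at_top_right)
    moreover have "eventually (\<lambda>h. (inverse h) ^ (k + 1) / exp (inverse h) = (exp_recip k (0 + h) - exp_recip k 0) / h) (at_right (0::real))"
      by (auto simp: eventually_at_right_less exp_recip_def field_simps exp_minus intro!: eventually_at_rightI[of 0 1])
    ultimately have R: "((\<lambda>h. (exp_recip k (0 + h) - exp_recip k 0) / h) \<longlongrightarrow> 0) (at_right 0)"
      by (rule Lim_transform_eventually)
    have L: "((\<lambda>h. (exp_recip k (0 + h) - exp_recip k 0) / h) \<longlongrightarrow> 0) (at_left 0)"
      by (rule tendsto_eventually) (auto simp: exp_recip_def intro!: eventually_at_leftI[of "-1"])
    show ?thesis using 3 filterlim_split_at[OF L R]
      by (simp add: DERIV_def exp_recip_def)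
  qed
qed

definition bump_seeds :: "(real \<Rightarrow> real) set" where
  "bump_seeds = {\<lambda>u. exp_recip k (u - 1) * exp_recip l (2 - u) | k l. True}"

lemma bump_seed_deriv:
  assumes "g \<in> bump_seeds"
  shows "\<exists>g'. (\<forall>x. (g has_derivative g' x) (at x)) \<and> (\<forall>b. (\<lambda>x. g' x b) \<in> poly_span bump_seeds)"
proof -
  obtain k l where g: "g = (\<lambda>u. exp_recip k (u - 1) * exp_recip l (2 - u))"
    using assms by (auto simp: bump_seeds_def)
  let ?r = "\<lambda>k l u. exp_recip k (u - 1) * exp_recip l (2 - u)"
  let ?d = "\<lambda>u. ?r (k+2) l u + (- real k) * ?r (k+1) l u + ((-1) * ?r k (l+2) u + real l * ?r k (l+1) u)"
  have "(g has_real_derivative ?d u) (at u)" for u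
    unfolding g
    by (auto intro!: derivative_eq_intros DERIV_chain2[OF exp_recip_deriv] simp: algebra_simps)
  moreover have s: "?r k l \<in> poly_span bump_seeds" for k l
    by (rule poly_span.seed) (auto simp: bump_seeds_def)
  have "?d \<in> poly_span bump_seeds"
    by (intro poly_span.add poly_span.scale s)
  hence "(\<lambda>u. b * ?d u) \<in> poly_span bump_seeds" for b by (rule poly_span.scale)
  ultimately show ?thesis
    by (intro exI[of _ "\<lambda>u b. b * ?d u"]) (auto simp: has_field_derivative_def mult_commute_abs)
qed

lemma bump_span_deriv:
  assumes "F \<in> poly_span bump_seeds"
  obtains F' where "\<And>u. (F has_real_derivative F' u) (at u)" "F' \<in> poly_span bump_seeds"
proof -
  obtain f' where f': "\<And>x. (F has_derivative f' x) (at x)" "\<And>b. (\<lambda>x. f' x b) \<in> poly_span bump_seeds"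
    using poly_span_deriv[OF bump_seed_deriv assms] by metis
  have "f' x = (\<lambda>h. h * f' x 1)" for x
  proof
    fix h show "f' x h = h * f' x 1"
      using linear_cmul[of "f' x" h 1] f'(1)[of x] by (simp add: has_derivative_def bounded_linear.linear)
  qed
  hence "(F has_real_derivative f' x 1) (at x)" for x
    using f'(1)[of x] by (metis (no_types, lifting) ext has_field_derivative_def mult.commute)
  with f' show thesis by (intro that[of "\<lambda>x. f' x 1"])
qed

lemma bump_span_zero: "F \<in> poly_span bump_seeds \<Longrightarrow> u \<le> 1 \<or> u \<ge> 2 \<Longrightarrow> F u = 0"
  by (induction rule: poly_span.induct) (auto simp: bump_seeds_def exp_recip_def)

text \<open>
  A normalized primitive of a bump on \<open>[1, 2]\<close>. Membership of the derivative in the span of the seeds records at once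
  that all derivatives exist and that they vanish outside \<open>[1, 2]\<close>.
\<close>

lemma exists_cutoff:
  obtains f f' where "\<And>u. u \<le> 1 \<Longrightarrow> f u = (1::real)" "\<And>u. u \<ge> 2 \<Longrightarrow> f u = 0"
    "\<And>u. (f has_real_derivative f' u) (at u)" "f' \<in> poly_span bump_seeds"
proof -
  define \<rho> where "\<rho> = (\<lambda>u. exp_recip 0 (u - 1) * exp_recip 0 (2 - u))"
  have \<rho>: "\<rho> \<in> poly_span bump_seeds"
    by (rule poly_span.seed) (auto simp: bump_seeds_def \<rho>_def)
  have cont: "continuous_on A \<rho>" for A
    using bump_span_deriv[OF \<rho>] by (meson DERIV_isCont continuous_at_imp_continuous_on)
  have \<rho>0: "\<rho> u = 0" if "u \<le> 1 \<or> u \<ge> 2" for u using bump_span_zero[OF \<rho> that] .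
  have \<rho>pos: "\<rho> u > 0" if "1 < u" "u < 2" for u using that by (simp add: \<rho>_def exp_recip_def)
  have \<rho>nn: "\<rho> u \<ge> 0" for u using \<rho>0[of u] \<rho>pos[of u] by (cases "u \<le> 1 \<or> u \<ge> 2") auto
  define I where "I = (\<lambda>u. integral {0..u} \<rho>)"
  have I0: "I u = 0" if "u \<le> 1" for u
    unfolding I_def by (subst Henstock_Kurzweil_Integration.integral_cong[of _ _ "\<lambda>_. 0"]) (use that \<rho>0 in auto)
  have int: "\<rho> integrable_on {a..b}" for a b by (rule integrable_continuous_interval) (rule cont)
  have I2: "I u = I 2" if "u \<ge> 2" for u
  proof -
    have "I u = integral {0..2} \<rho> + integral {2..u} \<rho>"
      unfolding I_def by (rule Henstock_Kurzweil_Integration.integral_combine[symmetric]) (use that int in auto)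
    also have "integral {2..u} \<rho> = 0" by (subst Henstock_Kurzweil_Integration.integral_cong[of _ _ "\<lambda>_. 0"]) (use \<rho>0 in auto)
    finally show ?thesis by (simp add: I_def)
  qed
  have dI: "(I has_real_derivative \<rho> u) (at u)" for u
  proof (cases "u > 0")
    case True
    have "(I has_real_derivative \<rho> u) (at u within {0..u+1})"
      unfolding I_def by (rule integral_has_real_derivative) (use cont True in auto)
    thus ?thesis using True at_within_Icc_at[of 0 u "u+1"] by simp
  next
    case False
    have "eventually (\<lambda>x. 0 = I x) (nhds u)"
      using eventually_nhds_in_open[of "{..<1}" u] False by (auto elim!: eventually_mono simp: I0)
    moreover have "((\<lambda>x. 0) has_real_derivative \<rho> u) (at u)" using False \<rho>0 by auto
    ultimately show ?thesis by (subst (asm) DERIV_cong_ev[OF refl _ refl]) auto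
  qed
  have "I 2 > I 1"
  proof (rule DERIV_pos_imp_increasing_open[of 1 2 I])
    show "continuous_on {1..2} I" using dI by (meson DERIV_isCont continuous_at_imp_continuous_on)
  qed (use dI \<rho>pos in auto)
  hence Z: "I 2 > 0" using I0[of 1] by simp
  show thesis
  proof (rule that[of "\<lambda>u. 1 - I u / I 2" "\<lambda>u. (- 1 / I 2) * \<rho> u"])
    show "((\<lambda>u. 1 - I u / I 2) has_real_derivative - 1 / I 2 * \<rho> u) (at u)" for u
      using Z by (auto intro!: derivative_eq_intros dI)
    show "(\<lambda>u. - 1 / I 2 * \<rho> u) \<in> poly_span bump_seeds" by (intro poly_span.scale \<rho>)
    show "1 - I u / I 2 = 0" if "u \<ge> 2" for u using I2[OF that] Z by simp
  qed (use I0 in auto)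
qed

section \<open>Laplacians of radial functions\<close>

lemma radial_has_derivative:
  fixes c v z :: "'a::euclidean_space"
  assumes "(G has_real_derivative G1) (at ((norm (z - c))\<^sup>2))"
  shows "((\<lambda>z. G ((norm (z - c))\<^sup>2)) has_derivative (\<lambda>b. 2 * ((z - c) \<bullet> b) * G1)) (at z)"
proof -
  have "((\<lambda>z. (norm (z - c))\<^sup>2) has_derivative (\<lambda>b. 2 * ((z - c) \<bullet> b))) (at z)"
    unfolding power2_norm_eq_inner by (auto intro!: derivative_eq_intros simp: inner_commute)
  from has_derivative_compose[OF this assms[unfolded has_field_derivative_def]]
  show ?thesis by (simp add: mult.commute)
qed

text \<open>
  The affine factor covers both a radial function and a directional derivative of one, which is what remains after one normal
  derivative has been taken.
\<close>

lemma laplacian_affine_radial: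
  fixes c v :: "'a::euclidean_space"
  assumes S: "open S" and z: "z \<in> S"
    and f: "\<And>z. z \<in> S \<Longrightarrow> f z = (\<alpha> + (z - c) \<bullet> v) * G ((norm (z - c))\<^sup>2)"
    and G1: "\<And>z. z \<in> S \<Longrightarrow> (G has_real_derivative G1 ((norm (z - c))\<^sup>2)) (at ((norm (z - c))\<^sup>2))"
    and G2: "\<And>z. z \<in> S \<Longrightarrow> (G1 has_real_derivative G2 ((norm (z - c))\<^sup>2)) (at ((norm (z - c))\<^sup>2))"
  shows "laplacian f z = (\<alpha> + (z - c) \<bullet> v) * (4 * (norm (z - c))\<^sup>2 * G2 ((norm (z - c))\<^sup>2) + 2 * real DIM('a) * G1 ((norm (z - c))\<^sup>2))
       + 4 * ((z - c) \<bullet> v) * G1 ((norm (z - c))\<^sup>2)"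
proof -
  let ?u = "\<lambda>z. (norm (z - c))\<^sup>2"
  let ?p = "\<lambda>z. \<alpha> + (z - c) \<bullet> v"
  let ?D = "\<lambda>b z. (b \<bullet> v) * G (?u z) + 2 * ?p z * ((z - c) \<bullet> b) * G1 (?u z)"
  have d1: "partial_deriv b f z = ?D b z" if "z \<in> S" for z b
  proof (rule partial_deriv_eq)
    have "((\<lambda>z. ?p z * G (?u z)) has_derivative (\<lambda>b. ?D b z)) (at z)"
      using G1[OF that]
      by (auto intro!: derivative_eq_intros radial_has_derivative simp: algebra_simps)
    thus "(f has_derivative (\<lambda>b. ?D b z)) (at z)"
      by (rule has_derivative_transform_within_open[OF _ S that]) (use f in simp)
  qed
  let ?E = "\<lambda>b. 4 * (b \<bullet> v) * ((z - c) \<bullet> b) * G1 (?u z) + 2 * ?p z * (b \<bullet> b) * G1 (?u z)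
     + 4 * ?p z * (((z - c) \<bullet> b) * ((z - c) \<bullet> b)) * G2 (?u z)"
  have d2: "partial_deriv b (partial_deriv b f) z = ?E b" for b
  proof -
    have "(?D b has_derivative (\<lambda>h. (b \<bullet> v) * (2 * ((z - c) \<bullet> h) * G1 (?u z))
        + (2 * ?p z * ((z - c) \<bullet> b) * (2 * ((z - c) \<bullet> h) * G2 (?u z))
        + (2 * ?p z * (h \<bullet> b) + 2 * (h \<bullet> v) * ((z - c) \<bullet> b)) * G1 (?u z)))) (at z)"
      using G1[OF z] G2[OF z]
      by (auto intro!: derivative_eq_intros radial_has_derivative simp: algebra_simps)
    hence "(partial_deriv b f has_derivative (\<lambda>h. (b \<bullet> v) * (2 * ((z - c) \<bullet> h) * G1 (?u z))
        + (2 * ?p z * ((z - c) \<bullet> b) * (2 * ((z - c) \<bullet> h) * G2 (?u z))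
        + (2 * ?p z * (h \<bullet> b) + 2 * (h \<bullet> v) * ((z - c) \<bullet> b)) * G1 (?u z)))) (at z)"
      by (rule has_derivative_transform_within_open[OF _ S z]) (use d1 in simp)
    from partial_deriv_eq[OF this, of b] show ?thesis
      by (simp add: algebra_simps)
  qed
  have s1: "(\<Sum>b\<in>Basis. (b \<bullet> v) * ((z - c) \<bullet> b)) = (z - c) \<bullet> v"
    by (subst (3) euclidean_inner) (simp add: mult.commute inner_commute)
  have s2: "(\<Sum>b\<in>Basis. (((z - c) \<bullet> b) * ((z - c) \<bullet> b))) = ?u z"
    unfolding power2_norm_eq_inner by (subst (3) euclidean_inner) simp
  have "laplacian f z = (\<Sum>b\<in>Basis. ?E b)"
    unfolding laplacian_def d2 ..
  also have "\<dots> = 4 * (\<Sum>b\<in>Basis. (b \<bullet> v) * ((z - c) \<bullet> b)) * G1 (?u z) + 2 * ?p z * (\<Sum>b\<in>(Basis::'a set). b \<bullet> b) * G1 (?u z)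
     + 4 * ?p z * (\<Sum>b\<in>Basis. (((z - c) \<bullet> b) * ((z - c) \<bullet> b))) * G2 (?u z)"
    by (simp only: sum.distrib sum_distrib_left sum_distrib_right mult.assoc)
  also have "(\<Sum>b\<in>(Basis::'a set). b \<bullet> b) = DIM('a)" by simp
  finally show ?thesis unfolding s1 s2 by (simp add: algebra_simps)
qed

lemma laplacian_radial:
  fixes c :: "'a::euclidean_space"
  assumes "open S" "z \<in> S"
    and "\<And>z. z \<in> S \<Longrightarrow> f z = G ((norm (z - c))\<^sup>2)"
    and "\<And>z. z \<in> S \<Longrightarrow> (G has_real_derivative G1 ((norm (z - c))\<^sup>2)) (at ((norm (z - c))\<^sup>2))"
    and "\<And>z. z \<in> S \<Longrightarrow> (G1 has_real_derivative G2 ((norm (z - c))\<^sup>2)) (at ((norm (z - c))\<^sup>2))"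
  shows "laplacian f z = 4 * (norm (z - c))\<^sup>2 * G2 ((norm (z - c))\<^sup>2) + 2 * real DIM('a) * G1 ((norm (z - c))\<^sup>2)"
  using laplacian_affine_radial[of S z f 1 c 0 G G1 G2] assms by simp

text \<open>
  Radial functions are written as functions of \<open>u = \<bar>x\<bar>\<^sup>2\<close>; then the fundamental solution of \<open>\<Delta>\<^sup>m\<close> and
  everything obtained from it by the operators at hand is of this form, with or without logarithm.
\<close>

definition powlog :: "real \<Rightarrow> real \<Rightarrow> real \<Rightarrow> real \<Rightarrow> real" where
  "powlog b A B u = u powr b * (A + B * ln u)"

lemma powlog_deriv:
  assumes "u > 0"
  shows "(powlog b A B has_real_derivative powlog (b - 1) (b * A + B) (b * B) u) (at u)"
  unfolding powlog_def using assms
  by (auto intro!: derivative_eq_intros simp: powr_diff field_simps)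

lemma powlog_laplace:
  assumes "u > 0"
  shows "4 * u * powlog (b - 1 - 1) ((b - 1) * (b * A + B) + b * B) ((b - 1) * (b * B)) u + 2 * D * powlog (b - 1) (b * A + B) (b * B) u
    = powlog (b - 1) (4 * (b - 1 + D / 2) * (b * A + B) + 4 * b * B) (4 * (b - 1 + D / 2) * b * B) u"
proof -
  have "u * u powr (b - 1 - 1) = u powr (b - 1)"
    using assms by (simp add: powr_diff power2_eq_square)
  hence *: "4 * u * powlog (b - 1 - 1) X Y u = powlog (b - 1) (4 * X) (4 * Y) u" for X Y
  proof -
    have "4 * u * powlog (b - 1 - 1) X Y u = (u * u powr (b - 1 - 1)) * (4 * X + 4 * Y * ln u)"
      by (simp add: powlog_def algebra_simps)
    thus ?thesis unfolding \<open>u * u powr (b - 1 - 1) = _\<close> by (simp add: powlog_def algebra_simps)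
  qed
  show ?thesis unfolding * by (simp add: powlog_def algebra_simps)
qed

text \<open>
  The coefficients for which \<open>powlog (N - d/2) A B (\<bar>x\<bar>\<^sup>2)\<close> is a fundamental solution of \<open>\<Delta>\<^sup>N\<close> on
  \<open>\<real>\<^sup>d\<close>. In the logarithmic case \<open>A\<close> is left free: it multiplies a polynomial of degree \<open>2 N - d\<close>, which
  \<open>\<Delta>\<^sup>N\<close> annihilates and which vanishing moments do not see.
\<close>

definition riesz_coeffs :: "nat \<Rightarrow> nat \<Rightarrow> real \<Rightarrow> real \<Rightarrow> bool" where
  "riesz_coeffs d N A B \<longleftrightarrow>
    (if even d \<and> d \<le> 2 * N then
       B = - ((-1) ^ N * (-1) ^ (N - d div 2)) / (fact (N - d div 2) * 4 ^ N * pi powr (d / 2) * fact (N - 1))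
     else B = 0 \<and> A = (-1) ^ N * Gamma (d / 2 - N) / (4 ^ N * pi powr (d / 2) * fact (N - 1)))"

text \<open>
  Differentiation in \<open>u = \<bar>x\<bar>\<^sup>2\<close> lowers the order: \<open>4 N\<close> times the derivative of the profile of order
  \<open>N + 1\<close> is a profile of order \<open>N\<close>. This is where a pair of normal derivatives gets its constant.
\<close>

lemma riesz_coeffs_deriv:
  assumes R: "riesz_coeffs d (Suc N) A B" and N: "N \<ge> 1"
  shows "riesz_coeffs d N (4 * real N * ((real (Suc N) - d / 2) * A + B)) (4 * real N * ((real (Suc N) - d / 2) * B))"
proof -
  obtain M where M: "N = Suc M" using N by (cases N) auto
  consider (a) "even d" "d \<le> 2 * N" | (b) "d = 2 * Suc N" | (c) "\<not> (even d \<and> d \<le> 2 * Suc N)"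
    by (cases "even d"; cases "d \<le> 2 * N"; cases "d = 2 * Suc N") (auto elim!: evenE)
  thus ?thesis
  proof cases
    case a
    define e where "e = d div 2"
    have d: "d = 2 * e" "e \<le> N" using a by (auto simp: e_def)
    have f: "Suc N - e = Suc (N - e)" using d by simp
    have B: "B = - ((-1) ^ Suc N * (-1) ^ (Suc N - e)) / (fact (Suc N - e) * 4 ^ Suc N * pi powr (real e) * fact N)"
      using R d unfolding riesz_coeffs_def by simp
    have "real (Suc N) - real e = real (Suc (N - e))" using d by simp
    hence "4 * real N * ((real (Suc N) - d / 2) * B) = 4 * real N * (real (Suc (N - e)) * B)" using d by simp
    also have "\<dots> = - ((-1) ^ N * (-1) ^ (N - e)) / (fact (N - e) * 4 ^ N * pi powr (real e) * fact (N - 1))"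
      unfolding B f by (simp add: M field_simps del: of_nat_Suc)
    finally show ?thesis using d unfolding riesz_coeffs_def by simp
  next
    case b
    have B: "B = - ((-1) ^ Suc N * (-1) ^ (Suc N - Suc N)) / (fact (Suc N - Suc N) * 4 ^ Suc N * pi powr (d / 2) * fact N)"
      using R b unfolding riesz_coeffs_def by simp
    have "4 * real N * B = (-1) ^ N / (4 ^ N * pi powr (d / 2) * fact (N - 1))"
      unfolding B by (simp add: M field_simps del: of_nat_Suc)
    hence B: "4 * real N * B = (-1) ^ N * Gamma (1 + real N - N) / (4 ^ N * pi powr (d / 2) * fact (N - 1))" by simp
    have hd: "real d / 2 = 1 + real N" and nd: "\<not> (even d \<and> d \<le> 2 * N)" using b by auto
    have hd': "real (Suc N) - real d / 2 = 0" unfolding hd by simp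
    show ?thesis unfolding riesz_coeffs_def hd' if_not_P[OF nd]
      using B unfolding hd by simp
  next
    case c
    let ?z = "d / 2 - real (Suc N)"
    have z: "?z \<notin> \<int>\<^sub>\<le>\<^sub>0"
    proof
      assume "?z \<in> \<int>\<^sub>\<le>\<^sub>0"
      then obtain i :: int where i: "?z = of_int i" "i \<le> 0" by (auto elim!: nonpos_Ints_cases)
      hence "real d = of_int (2 * (i + int (Suc N)))" by (simp add: field_simps)
      hence "int d = 2 * (i + int (Suc N))" by linarith
      hence "even d" "d \<le> 2 * Suc N" using i by presburger+
      thus False using c by blast
    qed
    have A: "B = 0" "A = (-1) ^ Suc N * Gamma ?z / (4 ^ Suc N * pi powr (d / 2) * fact N)"
      using R c unfolding riesz_coeffs_def by auto
    have G: "Gamma (d / 2 - real N) = ?z * Gamma ?z"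
      using Gamma_plus1[OF z] by (simp add: algebra_simps)
    have "4 * real N * ((real (Suc N) - d / 2) * A) = (-1) ^ N * (?z * Gamma ?z) / (4 ^ N * pi powr (d / 2) * fact (N - 1))"
      unfolding A by (simp add: M field_simps del: of_nat_Suc)
    moreover have "\<not> (even d \<and> d \<le> 2 * N)" using c by auto
    ultimately show ?thesis using A(1) unfolding riesz_coeffs_def G by simp
  qed
qed

text \<open>
  With a logarithm on both sides only \<open>B\<close> has to be checked, without one it is the recurrence of the Gamma function; for
  \<open>d = 2 N + 2\<close> the logarithm disappears in this step and \<open>B\<close> determines the new \<open>A\<close>.
\<close>

lemma riesz_coeffs_laplace:
  assumes R: "riesz_coeffs d (Suc N) A B" and N: "N \<ge> 1"
  defines "b \<equiv> real (Suc N) - d / 2"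
  shows "riesz_coeffs d N (4 * real N * (b * A + B) + 4 * b * B) (4 * real N * b * B)"
proof -
  have *: "riesz_coeffs d N (4 * real N * (b * A + B)) (4 * real N * (b * B))"
    using riesz_coeffs_deriv[OF R N] unfolding b_def .
  show ?thesis
  proof (cases "even d \<and> d \<le> 2 * N")
    case True
    thus ?thesis using * unfolding riesz_coeffs_def by (simp add: mult.assoc)
  next
    case False
    have "b * B = 0"
    proof (cases "even d \<and> d \<le> 2 * Suc N")
      case True
      hence "d = 2 * Suc N" using False by (auto elim!: evenE)
      thus ?thesis by (simp add: b_def)
    next
      case False
      thus ?thesis using R unfolding riesz_coeffs_def by simp
    qed
    hence "4 * b * B = 0" "4 * real N * b * B = 4 * real N * (b * B)" by auto
    thus ?thesis using * by (simp only: add_0_right)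
  qed
qed

lemma laplacian_powlog:
  assumes R: "riesz_coeffs DIM('b::euclidean_space) (Suc N) A B" and N: "N \<ge> 1"
  obtains A' B' where "riesz_coeffs DIM('b) N A' B'"
    "\<And>c f z. (\<And>z. z \<noteq> c \<Longrightarrow> f z = powlog (real (Suc N) - DIM('b) / 2) A B ((norm (z - c))\<^sup>2)) \<Longrightarrow>
       z \<noteq> c \<Longrightarrow> laplacian f z = powlog (real N - DIM('b) / 2) A' B' ((norm (z - c :: 'b))\<^sup>2)"
proof -
  define b where "b = real (Suc N) - DIM('b) / 2"
  have bN: "b - 1 + DIM('b) / 2 = real N" "b - 1 = real N - DIM('b) / 2" by (auto simp: b_def)
  have "laplacian f z = powlog (real N - DIM('b) / 2) (4 * real N * (b * A + B) + 4 * b * B) (4 * real N * b * B) ((norm (z - c))\<^sup>2)"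
    if f: "\<And>z. z \<noteq> c \<Longrightarrow> f z = powlog (real (Suc N) - DIM('b) / 2) A B ((norm (z - c))\<^sup>2)"
      and z: "z \<noteq> c" for z c :: 'b and f
  proof -
    have "laplacian f z = 4 * (norm (z - c))\<^sup>2 * powlog (b - 1 - 1) ((b - 1) * (b * A + B) + b * B) ((b - 1) * (b * B)) ((norm (z - c))\<^sup>2) + 2 * real DIM('b) * powlog (b - 1) (b * A + B) (b * B) ((norm (z - c))\<^sup>2)"
    proof (rule laplacian_radial[of "- {c}"])
      show "f z = powlog b A B ((norm (z - c))\<^sup>2)" if "z \<in> - {c}" for z
        using f that by (simp add: b_def)
    qed (insert z, (rule powlog_deriv | simp add: open_Compl)+)
    also have "\<dots> = powlog (b - 1) (4 * (b - 1 + DIM('b) / 2) * (b * A + B) + 4 * b * B) (4 * (b - 1 + DIM('b) / 2) * b * B) ((norm (z - c))\<^sup>2)"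
      by (rule powlog_laplace) (use z in simp)
    finally show ?thesis unfolding bN(1) unfolding bN(2) .
  qed
  with riesz_coeffs_laplace[OF R N, folded b_def] show ?thesis
    by (rule that)
qed

text \<open>
  The function is half the derivative in direction \<open>v\<close> of the radial one in \<open>laplacian_powlog\<close>, and this derivative
  commutes with the Laplacian.
\<close>

lemma laplacian_inner_powlog:
  assumes R: "riesz_coeffs DIM('b::euclidean_space) (Suc N) A B" and N: "N \<ge> 1"
  obtains A' B' where "riesz_coeffs DIM('b) N A' B'"
    "\<And>c v f z. (\<And>z. z \<noteq> c \<Longrightarrow> f z = ((z - c) \<bullet> v) * powlog (real N - DIM('b) / 2)
      ((real (Suc N) - DIM('b) / 2) * A + B) ((real (Suc N) - DIM('b) / 2) * B) ((norm (z - c))\<^sup>2)) \<Longrightarrow>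
      z \<noteq> c \<Longrightarrow> laplacian f z = ((z - c :: 'b) \<bullet> v) * powlog (real N - 1 - DIM('b) / 2)
        ((real N - DIM('b) / 2) * A' + B') ((real N - DIM('b) / 2) * B') ((norm (z - c))\<^sup>2)"
proof -
  define b where "b = real N - DIM('b) / 2"
  define A1 where "A1 = (b + 1) * A + B"
  define B1 where "B1 = (b + 1) * B"
  have b1: "real (Suc N) - DIM('b) / 2 = b + 1" "real N = b + DIM('b) / 2" "real N - 1 - DIM('b) / 2 = b - 1"
    by (auto simp: b_def)
  have "laplacian f z = ((z - c) \<bullet> v) * powlog (b - 1) (b * (4 * real N * A1 + 4 * (b + 1) * B) + 4 * real N * (b + 1) * B) (b * (4 * real N * (b + 1) * B)) ((norm (z - c))\<^sup>2)"
    if f: "\<And>z. z \<noteq> c \<Longrightarrow> f z = ((z - c) \<bullet> v) * powlog (real N - DIM('b) / 2)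
      ((real (Suc N) - DIM('b) / 2) * A + B) ((real (Suc N) - DIM('b) / 2) * B) ((norm (z - c))\<^sup>2)"
      and z: "z \<noteq> c" for z c v :: 'b and f
  proof -
    let ?u = "(norm (z - c))\<^sup>2"
    have u: "?u > 0" using z by simp
    let ?G1 = "powlog (b - 1) (b * A1 + B1) (b * B1)"
    let ?G2 = "powlog (b - 1 - 1) ((b - 1) * (b * A1 + B1) + b * B1) ((b - 1) * (b * B1))"
    have "laplacian f z = (0 + (z - c) \<bullet> v) * (4 * ?u * ?G2 ?u + 2 * real DIM('b) * ?G1 ?u) + 4 * ((z - c) \<bullet> v) * ?G1 ?u"
    proof (rule laplacian_affine_radial[of "- {c}"])
      show "f z = (0 + (z - c) \<bullet> v) * powlog b A1 B1 ((norm (z - c))\<^sup>2)" if "z \<in> - {c}" for z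
        using f[of z, unfolded b1(1), folded b_def] that by (simp add: A1_def B1_def)
    qed (insert z, (rule powlog_deriv | simp add: open_Compl)+)
    also have "\<dots> = ((z - c) \<bullet> v) * (4 * ?u * ?G2 ?u + 2 * (real DIM('b) + 2) * ?G1 ?u)"
      by (simp add: algebra_simps)
    also have "4 * ?u * ?G2 ?u + 2 * (real DIM('b) + 2) * ?G1 ?u = powlog (b - 1) (4 * (b - 1 + (real DIM('b) + 2) / 2) * (b * A1 + B1) + 4 * b * B1) (4 * (b - 1 + (real DIM('b) + 2) / 2) * b * B1) ?u"
      using powlog_laplace[OF u, of b A1 B1 "real DIM('b) + 2"] by simp
    also have "\<dots> = powlog (b - 1) (b * (4 * real N * A1 + 4 * (b + 1) * B) + 4 * real N * (b + 1) * B) (b * (4 * real N * (b + 1) * B)) ?u"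
      unfolding b1(2) by (simp add: A1_def B1_def powlog_def field_simps)
    finally show ?thesis .
  qed
  note this[folded b1(3), unfolded A1_def b_def[symmetric] b1(1)]
  with riesz_coeffs_laplace[OF R N, unfolded b1(1)] show ?thesis
    unfolding b_def[symmetric] by (rule that[unfolded b1(1), folded b_def])
qed

text \<open>
  The coefficients are chosen before the function and its center, since the outer operator in the kernel is applied
  for every position of the pole.
\<close>

lemma funpow_laplacian_powlog:
  assumes R: "riesz_coeffs DIM('b::euclidean_space) N A B" and N: "s < N"
  shows "\<exists>A' B'. riesz_coeffs DIM('b) (N - s) A' B' \<and>
     (\<forall>f c. (\<forall>z. z \<noteq> c \<longrightarrow> f z = powlog (real N - DIM('b) / 2) A B ((norm (z - c))\<^sup>2)) \<longrightarrow>
       (\<forall>z. z \<noteq> c \<longrightarrow> (laplacian ^^ s) f z = powlog (real (N - s) - DIM('b) / 2) A' B' ((norm (z - c :: 'b))\<^sup>2)))"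
  using N
proof (induction s)
  case (Suc s)
  then obtain A' B' where 1: "riesz_coeffs DIM('b) (N - s) A' B'"
    "\<And>f c z. (\<forall>z. z \<noteq> c \<longrightarrow> f z = powlog (real N - DIM('b) / 2) A B ((norm (z - c))\<^sup>2)) \<Longrightarrow>
      z \<noteq> c \<Longrightarrow> (laplacian ^^ s) f z = powlog (real (N - s) - DIM('b) / 2) A' B' ((norm (z - c :: 'b))\<^sup>2)"
    by auto
  have e: "N - s = Suc (N - Suc s)" "N - Suc s \<ge> 1" using Suc.prems by auto
  obtain A'' B'' where 2: "riesz_coeffs DIM('b) (N - Suc s) A'' B''"
    "\<And>c f z. (\<And>z. z \<noteq> c \<Longrightarrow> f z = powlog (real (Suc (N - Suc s)) - DIM('b) / 2) A' B' ((norm (z - c))\<^sup>2)) \<Longrightarrow>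
       z \<noteq> c \<Longrightarrow> laplacian f z = powlog (real (N - Suc s) - DIM('b) / 2) A'' B'' ((norm (z - c :: 'b))\<^sup>2)"
    using laplacian_powlog[OF 1(1)[unfolded e(1)] e(2)] by blast
  show ?case
  proof (intro exI conjI allI impI)
    fix f c z
    assume f: "\<forall>z. z \<noteq> c \<longrightarrow> f z = powlog (real N - DIM('b) / 2) A B ((norm (z - c))\<^sup>2)" and z: "z \<noteq> (c :: 'b)"
    have "laplacian ((laplacian ^^ s) f) z = powlog (real (N - Suc s) - DIM('b) / 2) A'' B'' ((norm (z - c))\<^sup>2)"
      by (rule 2(2)[OF _ z]) (use 1(2)[OF f] e(1) in simp)
    thus "(laplacian ^^ Suc s) f z = powlog (real (N - Suc s) - DIM('b) / 2) A'' B'' ((norm (z - c))\<^sup>2)" by simp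
  qed (rule 2)
qed (use R in auto)

lemma funpow_laplacian_inner_powlog:
  assumes R: "riesz_coeffs DIM('b::euclidean_space) N A B" and N: "s < N"
  shows "\<exists>A' B'. riesz_coeffs DIM('b) (N - s) A' B' \<and>
     (\<forall>f c v. (\<forall>z. z \<noteq> c \<longrightarrow> f z = ((z - c) \<bullet> v) * powlog (real N - 1 - DIM('b) / 2)
      ((real N - DIM('b) / 2) * A + B) ((real N - DIM('b) / 2) * B) ((norm (z - c))\<^sup>2)) \<longrightarrow>
     (\<forall>z. z \<noteq> c \<longrightarrow> (laplacian ^^ s) f z = ((z - c :: 'b) \<bullet> v) * powlog (real (N - s) - 1 - DIM('b) / 2)
      ((real (N - s) - DIM('b) / 2) * A' + B') ((real (N - s) - DIM('b) / 2) * B') ((norm (z - c))\<^sup>2)))"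
  using N
proof (induction s)
  case (Suc s)
  then obtain A' B' where 1: "riesz_coeffs DIM('b) (N - s) A' B'"
    "\<And>f c v z. (\<forall>z. z \<noteq> c \<longrightarrow> f z = ((z - c) \<bullet> v) * powlog (real N - 1 - DIM('b) / 2)
      ((real N - DIM('b) / 2) * A + B) ((real N - DIM('b) / 2) * B) ((norm (z - c))\<^sup>2)) \<Longrightarrow>
      z \<noteq> c \<Longrightarrow> (laplacian ^^ s) f z = ((z - c :: 'b) \<bullet> v) * powlog (real (N - s) - 1 - DIM('b) / 2)
      ((real (N - s) - DIM('b) / 2) * A' + B') ((real (N - s) - DIM('b) / 2) * B') ((norm (z - c))\<^sup>2)"
    by auto
  have e: "N - s = Suc (N - Suc s)" "N - Suc s \<ge> 1" using Suc.prems by auto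
  have e2: "real (Suc (N - Suc s)) - 1 = real (N - Suc s)" by simp
  obtain A'' B'' where 2: "riesz_coeffs DIM('b) (N - Suc s) A'' B''"
    "\<And>c v f z. (\<And>z. z \<noteq> c \<Longrightarrow> f z = ((z - c) \<bullet> v) * powlog (real (N - Suc s) - DIM('b) / 2)
      ((real (Suc (N - Suc s)) - DIM('b) / 2) * A' + B') ((real (Suc (N - Suc s)) - DIM('b) / 2) * B') ((norm (z - c))\<^sup>2)) \<Longrightarrow>
      z \<noteq> c \<Longrightarrow> laplacian f z = ((z - c :: 'b) \<bullet> v) * powlog (real (N - Suc s) - 1 - DIM('b) / 2)
        ((real (N - Suc s) - DIM('b) / 2) * A'' + B'') ((real (N - Suc s) - DIM('b) / 2) * B'') ((norm (z - c))\<^sup>2)"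
    using laplacian_inner_powlog[OF 1(1)[unfolded e(1)] e(2)] by blast
  show ?case
  proof (intro exI conjI allI impI)
    fix f c v z
    assume f: "\<forall>z. z \<noteq> c \<longrightarrow> f z = ((z - c) \<bullet> v) * powlog (real N - 1 - DIM('b) / 2)
      ((real N - DIM('b) / 2) * A + B) ((real N - DIM('b) / 2) * B) ((norm (z - c))\<^sup>2)" and z: "z \<noteq> (c :: 'b)"
    have "laplacian ((laplacian ^^ s) f) z = ((z - c :: 'b) \<bullet> v) * powlog (real (N - Suc s) - 1 - DIM('b) / 2)
        ((real (N - Suc s) - DIM('b) / 2) * A'' + B'') ((real (N - Suc s) - DIM('b) / 2) * B'') ((norm (z - c))\<^sup>2)"
      by (rule 2(2)[OF _ z]) (use 1(2)[OF f, unfolded e(1) e2] in simp)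
    thus "(laplacian ^^ Suc s) f z = ((z - c :: 'b) \<bullet> v) * powlog (real (N - Suc s) - 1 - DIM('b) / 2)
        ((real (N - Suc s) - DIM('b) / 2) * A'' + B'') ((real (N - Suc s) - DIM('b) / 2) * B'') ((norm (z - c))\<^sup>2)" by simp
  qed (rule 2)
qed (use R in auto)

section \<open>The boundary kernel\<close>

text \<open>
  One normal derivative contributes a factor \<open>z\<^sub>d\<close> and two of them, at \<open>z\<^sub>d = 0\<close>, leave the product rule term in which
  that factor is differentiated. Hence mixed parities give zero, and two odd indices give \<open>-2\<close> times the derivative in
  \<open>u\<close> of the profile of order \<open>N + 1\<close>, that is \<open>- 1 / (2 N)\<close> times one of order \<open>N\<close>.
\<close>

lemma bdry_kernel_powlog:
  fixes \<phi> :: "'a::euclidean_space \<times> real \<Rightarrow> real"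
  assumes D: "DIM('a) = d - 1" "d \<ge> 2"
    and \<phi>: "\<And>z. z \<noteq> 0 \<Longrightarrow> \<phi> z = powlog (real m - d / 2) A B ((norm z)\<^sup>2)"
    and R: "riesz_coeffs d m A B" and jk: "j < m" "k < m"
  shows "even (j + k) \<Longrightarrow> \<exists>A' B'. riesz_coeffs d (m - (j + k) div 2) A' B' \<and>
    (\<forall>x y. x \<noteq> y \<longrightarrow> bdry_kernel k j \<phi> x y =
      (if even j then 1 else - (1 / (2 * real (m - (j + k) div 2)))) * powlog (real (m - (j + k) div 2) - d / 2) A' B' ((norm (x - y))\<^sup>2))"
    and "\<And>x y. odd (j + k) \<Longrightarrow> x \<noteq> y \<Longrightarrow> bdry_kernel k j \<phi> x y = 0"
proof -
  let ?v = "(0, 1) :: 'a \<times> real"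
  have DIM: "DIM('a \<times> real) = d" using D by simp
  have ji: "(i - 1) div 2 = i div 2" if "odd i" for i :: nat using that by (auto elim: oddE)
  define M1 where "M1 = m - j div 2"
  define M2 where "M2 = M1 - k div 2"
  have M1: "j div 2 < m" "k div 2 < M1" using jk by (auto simp: M1_def)
  obtain A1 B1 where 1: "riesz_coeffs d M1 A1 B1"
    and 2: "\<And>f c z. (\<And>z. z \<noteq> c \<Longrightarrow> f z = powlog (real m - d / 2) A B ((norm (z - c))\<^sup>2)) \<Longrightarrow> z \<noteq> c \<Longrightarrow>
       (laplacian ^^ (j div 2)) f z = powlog (real M1 - d / 2) A1 B1 ((norm (z - c :: 'a \<times> real))\<^sup>2)"
    using funpow_laplacian_powlog[where 'b = "'a \<times> real", unfolded DIM, OF R M1(1)] unfolding M1_def by blast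
  have lap\<phi>: "(laplacian ^^ (j div 2)) (\<lambda>y. \<phi> (x - y)) z = powlog (real M1 - d / 2) A1 B1 ((norm (z - x))\<^sup>2)" if "z \<noteq> x" for x z
    by (rule 2[OF _ that]) (use \<phi> in \<open>auto simp: norm_minus_commute\<close>)
  have der: "partial_deriv ?v f z = 2 * ((z - c) \<bullet> ?v) * powlog (b - 1) (b * A + B) (b * B) ((norm (z - c))\<^sup>2)"
    if "\<And>z. z \<noteq> c \<Longrightarrow> f z = powlog b A B ((norm (z - c))\<^sup>2)" "z \<noteq> c" for f b A B and c z :: "'a \<times> real"
  proof (rule partial_deriv_eq)
    have "((\<lambda>z. powlog b A B ((norm (z - c))\<^sup>2)) has_derivative (\<lambda>h. 2 * ((z - c) \<bullet> h) * powlog (b - 1) (b * A + B) (b * B) ((norm (z - c))\<^sup>2))) (at z)"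
      by (rule radial_has_derivative) (rule powlog_deriv, use that in simp)
    thus "(f has_derivative (\<lambda>h. 2 * ((z - c) \<bullet> h) * powlog (b - 1) (b * A + B) (b * B) ((norm (z - c))\<^sup>2))) (at z)"
      by (rule has_derivative_transform_within_open[of _ _ _ _ "- {c}"]) (use that in auto)
  qed
  \<comment> \<open>The inner operator acts in \<open>y\<close>; its value is recorded for every \<open>x \<in> \<real>\<^sup>d\<close>, since the outer one differentiates in all directions.\<close>
  have even_j: "lambda_op j (\<lambda>y. \<phi> (x - y)) y' = powlog (real M1 - d / 2) A1 B1 ((norm (x - (y', 0)))\<^sup>2)"
    if "even j" "x \<noteq> (y', 0)" for x y'
    using lap\<phi>[of "(y', 0)" x] that by (simp add: lambda_op_def norm_minus_commute)
  let ?b1 = "real M1 - d / 2"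
  have odd_j: "lambda_op j (\<lambda>y. \<phi> (x - y)) y' = ((x - (y', 0)) \<bullet> (2 *\<^sub>R ?v)) * powlog (real M1 - 1 - d / 2) (?b1 * A1 + B1) (?b1 * B1) ((norm (x - (y', 0)))\<^sup>2)"
    if "odd j" "x \<noteq> (y', 0)" for x y'
  proof -
    have b1: "?b1 - 1 = real M1 - 1 - d / 2" by simp
    have neg: "((y', 0) - x) \<bullet> ?v = - ((x - (y', 0)) \<bullet> ?v)" by (simp add: inner_diff_left)
    have "lambda_op j (\<lambda>y. \<phi> (x - y)) y' = - partial_deriv ?v ((laplacian ^^ (j div 2)) (\<lambda>y. \<phi> (x - y))) (y', 0)"
      using that ji by (simp add: lambda_op_def)
    also have "\<dots> = - (2 * (((y', 0) - x) \<bullet> ?v) * powlog (?b1 - 1) (?b1 * A1 + B1) (?b1 * B1) ((norm ((y', 0) - x))\<^sup>2))"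
      by (subst der[OF lap\<phi>]) (use that in auto)
    also have "\<dots> = ((x - (y', 0)) \<bullet> (2 *\<^sub>R ?v)) * powlog (real M1 - 1 - d / 2) (?b1 * A1 + B1) (?b1 * B1) ((norm (x - (y', 0)))\<^sup>2)"
      unfolding b1 neg inner_scaleR_right norm_minus_commute[of "(y', 0)" x] by simp
    finally show ?thesis .
  qed
  obtain A2 B2 where 3: "riesz_coeffs d M2 A2 B2"
    and 4: "\<And>f c z. (\<And>z. z \<noteq> c \<Longrightarrow> f z = powlog (real M1 - d / 2) A1 B1 ((norm (z - c))\<^sup>2)) \<Longrightarrow> z \<noteq> c \<Longrightarrow>
       (laplacian ^^ (k div 2)) f z = powlog (real M2 - d / 2) A2 B2 ((norm (z - c :: 'a \<times> real))\<^sup>2)"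
    using funpow_laplacian_powlog[where 'b = "'a \<times> real", unfolded DIM, OF 1 M1(2)] unfolding M2_def by blast
  let ?b2 = "\<lambda>M. real M - d / 2"
  obtain A3 B3 where 5: "riesz_coeffs d M2 A3 B3"
    and 6: "\<And>f c v z. (\<And>z. z \<noteq> c \<Longrightarrow> f z = ((z - c) \<bullet> v) * powlog (real M1 - 1 - d / 2) (?b1 * A1 + B1) (?b1 * B1) ((norm (z - c))\<^sup>2)) \<Longrightarrow> z \<noteq> c \<Longrightarrow>
       (laplacian ^^ (k div 2)) f z = ((z - c) \<bullet> v) * powlog (real M2 - 1 - d / 2) ((real M2 - d / 2) * A3 + B3) ((real M2 - d / 2) * B3) ((norm (z - c :: 'a \<times> real))\<^sup>2)"
    using funpow_laplacian_inner_powlog[where 'b = "'a \<times> real", unfolded DIM, OF 1 M1(2)] unfolding M2_def by blast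
  have pair: "(x, 0) - (y, 0) = (x - y, 0 :: real)" for x y :: 'a by simp
  have nrm: "norm (x - y, 0 :: real) = norm (x - y)" for x y :: 'a by (simp add: norm_Pair)
  have ee: "bdry_kernel k j \<phi> x y = powlog (real M2 - d / 2) A2 B2 ((norm (x - y))\<^sup>2)" if "even j" "even k" "x \<noteq> y" for x y
  proof -
    have "(laplacian ^^ (k div 2)) (\<lambda>x. lambda_op j (\<lambda>y. \<phi> (x - y)) y) (x, 0) = powlog (real M2 - d / 2) A2 B2 ((norm ((x, 0) - (y, 0 :: real)))\<^sup>2)"
      by (rule 4) (use even_j that in auto)
    thus ?thesis using that unfolding bdry_kernel_def lambda_op_def[of k] pair nrm by simp
  qed
  have eo: "bdry_kernel k j \<phi> x y = 0" if "even j" "odd k" "x \<noteq> y" for x y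
  proof -
    have "(laplacian ^^ (k div 2)) (\<lambda>x. lambda_op j (\<lambda>y. \<phi> (x - y)) y) z = powlog (real M2 - d / 2) A2 B2 ((norm (z - (y, 0 :: real)))\<^sup>2)"
      if "z \<noteq> (y, 0)" for z
      by (rule 4) (use even_j that \<open>even j\<close> in auto)
    from der[OF this, of "(x, 0)"] show ?thesis
      using that unfolding bdry_kernel_def lambda_op_def[of k] by (simp add: ji[unfolded One_nat_def])
  qed
  have lo: "(laplacian ^^ (k div 2)) (\<lambda>x. lambda_op j (\<lambda>y. \<phi> (x - y)) y) z =
      ((z - (y, 0)) \<bullet> (2 *\<^sub>R ?v)) * powlog (real M2 - 1 - d / 2) ((real M2 - d / 2) * A3 + B3) ((real M2 - d / 2) * B3) ((norm (z - (y, 0)))\<^sup>2)"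
    if "odd j" "z \<noteq> (y, 0)" for z y
    by (rule 6) (use odd_j that in auto)
  have oe: "bdry_kernel k j \<phi> x y = 0" if "odd j" "even k" "x \<noteq> y" for x y
    using lo[of "(x, 0)" y] that unfolding bdry_kernel_def lambda_op_def[of k] by simp
  have oo: "bdry_kernel k j \<phi> x y = - 2 * powlog (real M2 - 1 - d / 2) ((real M2 - d / 2) * A3 + B3) ((real M2 - d / 2) * B3) ((norm (x - y))\<^sup>2)"
    if "odd j" "odd k" "x \<noteq> y" for x y
  proof -
    let ?G = "powlog (real M2 - 1 - d / 2) ((real M2 - d / 2) * A3 + B3) ((real M2 - d / 2) * B3)"
    let ?c = "(y, 0) :: 'a \<times> real" and ?z = "(x, 0) :: 'a \<times> real"
    have zc: "?z \<noteq> ?c" using that by simp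
    hence pos: "(norm (?z - ?c))\<^sup>2 > 0" by simp
    have "((\<lambda>z. ((z - ?c) \<bullet> (2 *\<^sub>R ?v)) * ?G ((norm (z - ?c))\<^sup>2)) has_derivative
       (\<lambda>h. (h \<bullet> (2 *\<^sub>R ?v)) * ?G ((norm (?z - ?c))\<^sup>2))) (at ?z)"
      by (rule derivative_eq_intros radial_has_derivative powlog_deriv[OF pos] refl)+ simp
    hence "((laplacian ^^ (k div 2)) (\<lambda>x. lambda_op j (\<lambda>y. \<phi> (x - y)) y) has_derivative
       (\<lambda>h. (h \<bullet> (2 *\<^sub>R ?v)) * ?G ((norm (?z - ?c))\<^sup>2))) (at ?z)"
      by (rule has_derivative_transform_within_open[of _ _ _ _ "- {?c}"]) (use lo that zc in auto)
    from partial_deriv_eq[OF this, of ?v] show ?thesis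
      using that unfolding bdry_kernel_def lambda_op_def[of k] pair nrm by (simp add: ji[unfolded One_nat_def])
  qed
  show "bdry_kernel k j \<phi> x y = 0" if "odd (j + k)" "x \<noteq> y" for x y
    using that eo oe by auto
  show "\<exists>A' B'. riesz_coeffs d (m - (j + k) div 2) A' B' \<and>
    (\<forall>x y. x \<noteq> y \<longrightarrow> bdry_kernel k j \<phi> x y =
      (if even j then 1 else - (1 / (2 * real (m - (j + k) div 2)))) * powlog (real (m - (j + k) div 2) - d / 2) A' B' ((norm (x - y))\<^sup>2))"
    if ev: "even (j + k)"
  proof (cases "even j")
    case True
    hence k: "even k" using ev by simp
    have "M2 = m - (j + k) div 2" using True k by (auto simp: M2_def M1_def elim!: evenE)
    with 3 ee True k show ?thesis by auto
  next
    case False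
    hence k: "odd k" using ev by simp
    define N where "N = m - (j + k) div 2"
    have N: "M2 = Suc N" "N \<ge> 1" using False k jk by (auto simp: M2_def M1_def N_def elim!: oddE)
    let ?A = "4 * real N * ((real (Suc N) - d / 2) * A3 + B3)" and ?B = "4 * real N * ((real (Suc N) - d / 2) * B3)"
    have "riesz_coeffs d N ?A ?B"
      using riesz_coeffs_deriv[OF 5[unfolded N(1)] N(2)] .
    moreover have "bdry_kernel k j \<phi> x y = - (1 / (2 * real N)) * powlog (real N - d / 2) ?A ?B ((norm (x - y))\<^sup>2)" if "x \<noteq> y" for x y
    proof -
      have e: "real (Suc N) - 1 = real N" by simp
      show ?thesis unfolding oo[OF False k that] N(1) e using N(2)
        by (simp add: powlog_def field_simps)
    qed
    ultimately show ?thesis using False unfolding N_def[symmetric] by auto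
  qed
qed

section \<open>The constant of the fundamental solution\<close>

lemma power2_powr: "r > 0 \<Longrightarrow> (r\<^sup>2) powr b = (r :: real) powr (2 * b)"
  using powr_powr[of r 2 b] by simp

text \<open>
  The Laplacian in dimension \<open>D\<close> of \<open>F (\<bar>x\<bar>\<^sup>2)\<close>, as an operator on the profile \<open>F\<close>.
\<close>

definition radial_laplace :: "real \<Rightarrow> (real \<Rightarrow> real) \<Rightarrow> real \<Rightarrow> real" where
  "radial_laplace D F u = 4 * u * deriv (deriv F) u + 2 * D * deriv F u"

lemma bump_span_deriv_closed:
  assumes "F \<in> poly_span bump_seeds"
  shows "(F has_real_derivative deriv F u) (at u)" "deriv F \<in> poly_span bump_seeds"
proof -
  obtain F' where F': "\<And>u. (F has_real_derivative F' u) (at u)" "F' \<in> poly_span bump_seeds"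
    using bump_span_deriv[OF assms] by blast
  have "deriv F = F'" using F'(1) by (auto intro: DERIV_imp_deriv)
  thus "(F has_real_derivative deriv F u) (at u)" "deriv F \<in> poly_span bump_seeds" using F' by auto
qed

lemma radial_laplace_closed:
  assumes "F' \<in> poly_span bump_seeds" "deriv F = F'"
  shows "radial_laplace D F \<in> poly_span bump_seeds"
proof -
  have "(\<lambda>u. 4 * ((u \<bullet> 1) *\<^sub>R deriv F' u) + (2 * D) * F' u) \<in> poly_span bump_seeds"
    using assms bump_span_deriv_closed(2) by (intro poly_span.add poly_span.scale poly_span.coord)
  moreover have "radial_laplace D F = (\<lambda>u. 4 * ((u \<bullet> 1) *\<^sub>R deriv F' u) + (2 * D) * F' u)"
    unfolding radial_laplace_def[abs_def] assms(2) by (simp add: mult.assoc)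
  ultimately show ?thesis by simp
qed

lemma laplacian_radial_fun:
  assumes "\<And>u. (F has_real_derivative deriv F u) (at u)" "\<And>u. (deriv F has_real_derivative deriv (deriv F) u) (at u)"
  shows "laplacian (\<lambda>x::'b::euclidean_space. F ((norm x)\<^sup>2)) = (\<lambda>x. radial_laplace DIM('b) F ((norm x)\<^sup>2))"
proof
  fix x :: 'b
  show "laplacian (\<lambda>x::'b. F ((norm x)\<^sup>2)) x = radial_laplace DIM('b) F ((norm x)\<^sup>2)"
    using laplacian_radial[of UNIV x "\<lambda>x. F ((norm x)\<^sup>2)" F 0 "deriv F" "deriv (deriv F)"] assms
    by (simp add: radial_laplace_def)
qed

text \<open>
  A cutoff function as delivered by \<open>exists_cutoff\<close>; its radial Laplacians are supported in \<open>1 \<le> u \<le> 2\<close>, away from the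
  pole of the fundamental solution.
\<close>

locale cutoff =
  fixes f :: "real \<Rightarrow> real"
  assumes f1: "u \<le> 1 \<Longrightarrow> f u = 1" and f0: "u \<ge> 2 \<Longrightarrow> f u = 0"
    and fd: "(f has_real_derivative deriv f u) (at u)" and fs: "deriv f \<in> poly_span bump_seeds"
begin

lemma iterate_in_span: "s > 0 \<Longrightarrow> (radial_laplace D ^^ s) f \<in> poly_span bump_seeds"
proof (induction s)
  case (Suc s)
  show ?case
  proof (cases "s = 0")
    case True
    thus ?thesis using radial_laplace_closed[OF fs refl] by simp
  next
    case False
    thus ?thesis using Suc radial_laplace_closed[OF bump_span_deriv_closed(2) refl] by simp
  qed
qed simp

lemma funpow_laplacian_cutoff:
  "(laplacian ^^ s) (\<lambda>x::'b::euclidean_space. f ((norm x)\<^sup>2)) = (\<lambda>x. (radial_laplace DIM('b) ^^ s) f ((norm x)\<^sup>2))"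
proof (induction s)
  case (Suc s)
  show ?case
  proof (cases "s = 0")
    case True
    show ?thesis unfolding True
      using laplacian_radial_fun[where 'b = 'b, OF fd bump_span_deriv_closed(1)[OF fs]] by simp
  next
    case False
    hence m: "(radial_laplace DIM('b) ^^ s) f \<in> poly_span bump_seeds" by (intro iterate_in_span) simp
    show ?thesis
      using laplacian_radial_fun[where 'b = 'b, OF bump_span_deriv_closed(1)[OF m] bump_span_deriv_closed(1)[OF bump_span_deriv_closed(2)[OF m]]] Suc
      by simp
  qed
qed simp

lemma test_function_cutoff: "test_function (\<lambda>x::'b::euclidean_space. f ((norm x)\<^sup>2))"
proof -
  let ?S = "insert (\<lambda>x::'b. f ((norm x)\<^sup>2)) {\<lambda>x. F ((norm x)\<^sup>2) | F. F \<in> poly_span bump_seeds}"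
  have *: "\<exists>g'. (\<forall>x. ((\<lambda>x::'b. F ((norm x)\<^sup>2)) has_derivative g' x) (at x)) \<and> (\<forall>b. (\<lambda>x. g' x b) \<in> poly_span ?S)"
    if F: "\<And>u. (F has_real_derivative F' u) (at u)" "F' \<in> poly_span bump_seeds" for F F'
  proof (intro exI conjI allI)
    show "((\<lambda>x::'b. F ((norm x)\<^sup>2)) has_derivative (\<lambda>b. 2 * (x \<bullet> b) * F' ((norm x)\<^sup>2))) (at x)" for x
      using radial_has_derivative[of F "F' ((norm x)\<^sup>2)" x 0] F by simp
    have "(\<lambda>x. 2 * ((x \<bullet> b) *\<^sub>R F' ((norm x)\<^sup>2))) \<in> poly_span ?S" for b
      by (intro poly_span.scale poly_span.coord poly_span.seed) (use F in auto)
    thus "(\<lambda>x. 2 * (x \<bullet> b) * F' ((norm x)\<^sup>2)) \<in> poly_span ?S" for b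
      by (simp add: mult.assoc)
  qed
  have S: "\<exists>g'. (\<forall>x. (g has_derivative g' x) (at x)) \<and> (\<forall>b. (\<lambda>x. g' x b) \<in> poly_span ?S)" if "g \<in> ?S" for g
    using that *[OF fd fs] *[OF bump_span_deriv_closed] by blast
  have sm: "smooth (\<lambda>x::'b. f ((norm x)\<^sup>2))"
    by (rule smooth_poly_span(2)[OF S]) (auto intro: poly_span.seed)
  have "{x::'b. f ((norm x)\<^sup>2) \<noteq> 0} \<subseteq> cball 0 2"
  proof
    fix x :: 'b assume "x \<in> {x::'b. f ((norm x)\<^sup>2) \<noteq> 0}"
    hence "(norm x)\<^sup>2 < 2" using f0[of "(norm x)\<^sup>2"] by force
    also have "\<dots> \<le> 2\<^sup>2" by simp
    finally have "norm x < 2" by (rule power_less_imp_less_base) simp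
    thus "x \<in> cball 0 2" by simp
  qed
  hence "bounded {x::'b. f ((norm x)\<^sup>2) \<noteq> 0}" using bounded_cball bounded_subset by blast
  thus ?thesis using sm unfolding test_function_def by (simp add: compact_closure)
qed

end

text \<open>
  Green's formula in the radial variable. There are no boundary terms, since \<open>F\<close> and its derivative vanish at both ends.
\<close>

lemma powlog_laplace_green:
  assumes D: "D \<ge> 1"
    and R: "riesz_coeffs D (Suc N) A B" and N: "N \<ge> 1"
  shows "\<exists>A' B'. riesz_coeffs D N A' B' \<and> (\<forall>F \<in> poly_span bump_seeds.
      integral {1..2} (\<lambda>r. r ^ (D - 1) * powlog (real (Suc N) - D / 2) A B (r\<^sup>2) * radial_laplace D F (r\<^sup>2)) =
      integral {1..2} (\<lambda>r. r ^ (D - 1) * powlog (real N - D / 2) A' B' (r\<^sup>2) * F (r\<^sup>2)))"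
proof -
  define b where "b = real (Suc N) - D / 2"
  let ?A1 = "b * A + B" and ?B1 = "b * B"
  let ?A2 = "(b - 1) * ?A1 + ?B1" and ?B2 = "(b - 1) * ?B1"
  let ?P = "powlog b A B" and ?P1 = "powlog (b - 1) ?A1 ?B1" and ?P2 = "powlog (b - 1 - 1) ?A2 ?B2"
  let ?A' = "4 * real N * (b * A + B) + 4 * b * B" and ?B' = "4 * real N * b * B"
  have "integral {1..2} (\<lambda>r. r ^ (D - 1) * ?P (r\<^sup>2) * radial_laplace D F (r\<^sup>2)) =
      integral {1..2} (\<lambda>r. r ^ (D - 1) * powlog (real N - D / 2) ?A' ?B' (r\<^sup>2) * F (r\<^sup>2))"
    if F: "F \<in> poly_span bump_seeds" for F
  proof -
    note d1 = bump_span_deriv_closed(1)[OF F] and d2 = bump_span_deriv_closed(1)[OF bump_span_deriv_closed(2)[OF F]]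
    \<comment> \<open>The Wronskian of the two profiles; its derivative is the difference of the integrands.\<close>
    let ?W = "\<lambda>r::real. 2 * r ^ D * (?P (r\<^sup>2) * deriv F (r\<^sup>2) - ?P1 (r\<^sup>2) * F (r\<^sup>2))"
    have "((\<lambda>r. r ^ (D - 1) * ?P (r\<^sup>2) * radial_laplace D F (r\<^sup>2) - r ^ (D - 1) * powlog (real N - D / 2) ?A' ?B' (r\<^sup>2) * F (r\<^sup>2)) has_integral ?W 2 - ?W 1) {1..2}"
    proof (rule fundamental_theorem_of_calculus)
      fix r :: real assume r: "r \<in> {1..2}"
      hence pos: "r\<^sup>2 > 0" "r > 0" by auto
      have L: "4 * r\<^sup>2 * ?P2 (r\<^sup>2) + 2 * real D * ?P1 (r\<^sup>2) = powlog (real N - D / 2) ?A' ?B' (r\<^sup>2)"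
      proof -
        have "b - 1 + real D / 2 = real N" "b - 1 = real N - D / 2" by (auto simp: b_def)
        thus ?thesis using powlog_laplace[OF pos(1), of b A B D] by simp
      qed
      obtain E where E: "D = Suc E" using D by (cases D) auto
      have sq: "((\<lambda>r. r\<^sup>2) has_real_derivative 2 * r) (at r)" by (auto intro!: derivative_eq_intros)
      have "(?W has_real_derivative 2 * r ^ D * ((?P1 (r\<^sup>2) * (2 * r) * deriv F (r\<^sup>2) + deriv (deriv F) (r\<^sup>2) * (2 * r) * ?P (r\<^sup>2))
          - (?P2 (r\<^sup>2) * (2 * r) * F (r\<^sup>2) + deriv F (r\<^sup>2) * (2 * r) * ?P1 (r\<^sup>2)))
          + 2 * real D * r ^ (D - 1) * (?P (r\<^sup>2) * deriv F (r\<^sup>2) - ?P1 (r\<^sup>2) * F (r\<^sup>2))) (at r)"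
        by (auto intro!: derivative_eq_intros DERIV_chain2[OF powlog_deriv[OF pos(1)] sq] DERIV_chain2[OF d1 sq] DERIV_chain2[OF d2 sq])
      also have "2 * r ^ D * ((?P1 (r\<^sup>2) * (2 * r) * deriv F (r\<^sup>2) + deriv (deriv F) (r\<^sup>2) * (2 * r) * ?P (r\<^sup>2))
          - (?P2 (r\<^sup>2) * (2 * r) * F (r\<^sup>2) + deriv F (r\<^sup>2) * (2 * r) * ?P1 (r\<^sup>2)))
          + 2 * real D * r ^ (D - 1) * (?P (r\<^sup>2) * deriv F (r\<^sup>2) - ?P1 (r\<^sup>2) * F (r\<^sup>2))
         = r ^ (D - 1) * ?P (r\<^sup>2) * radial_laplace D F (r\<^sup>2) - r ^ (D - 1) * (4 * r\<^sup>2 * ?P2 (r\<^sup>2) + 2 * real D * ?P1 (r\<^sup>2)) * F (r\<^sup>2)"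
        by (simp add: E radial_laplace_def algebra_simps power2_eq_square)
      finally show "(?W has_vector_derivative r ^ (D - 1) * ?P (r\<^sup>2) * radial_laplace D F (r\<^sup>2) - r ^ (D - 1) * powlog (real N - D / 2) ?A' ?B' (r\<^sup>2) * F (r\<^sup>2)) (at r within {1..2})"
        unfolding L has_real_derivative_iff_has_vector_derivative[symmetric]
        by (rule DERIV_subset) auto
    qed simp
    moreover have "?W 2 = 0" "?W 1 = 0"
      using bump_span_zero[OF F] bump_span_zero[OF bump_span_deriv_closed(2)[OF F]] by auto
    ultimately have I: "((\<lambda>r. r ^ (D - 1) * ?P (r\<^sup>2) * radial_laplace D F (r\<^sup>2) - r ^ (D - 1) * powlog (real N - D / 2) ?A' ?B' (r\<^sup>2) * F (r\<^sup>2)) has_integral 0) {1..2}"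
      by simp
    have cF: "continuous_on UNIV F"
      by (intro continuous_at_imp_continuous_on ballI DERIV_isCont[OF d1])
    have "continuous_on {1..2} (\<lambda>r. r ^ (D - 1) * powlog (real N - D / 2) ?A' ?B' (r\<^sup>2) * F (r\<^sup>2))"
      unfolding powlog_def by (intro continuous_intros continuous_on_compose2[OF cF]) auto
    hence "(\<lambda>r. r ^ (D - 1) * powlog (real N - D / 2) ?A' ?B' (r\<^sup>2) * F (r\<^sup>2)) integrable_on {1..2}"
      by (rule integrable_continuous_interval)
    from has_integral_add[OF I integrable_integral[OF this]] show ?thesis by (simp add: integral_unique)
  qed
  with riesz_coeffs_laplace[OF R N] show ?thesis unfolding b_def by blast
qed


lemma riesz_coeffs_1:
  assumes R: "riesz_coeffs d 1 A B" and d: "d \<ge> 2"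
  shows "(1 - d / 2) * B = 0" "(1 - d / 2) * A + B = Gamma (d / 2) / (4 * pi powr (d / 2))"
proof -
  have "(1 - d / 2) * B = 0 \<and> (1 - d / 2) * A + B = Gamma (d / 2) / (4 * pi powr (d / 2))"
  proof (cases "d = 2")
    case True
    thus ?thesis using R by (simp add: riesz_coeffs_def)
  next
    case False
    hence nd: "\<not> (even d \<and> d \<le> 2 * 1)" using d by auto
    have AB: "B = 0" "A = - Gamma (d / 2 - 1) / (4 * pi powr (d / 2))"
      using R nd unfolding riesz_coeffs_def if_not_P[OF nd] by auto
    have "d / 2 - 1 > 0" using False d by simp
    hence G: "Gamma (d / 2) = (d / 2 - 1) * Gamma (d / 2 - 1)"
      using Gamma_plus1[of "d / 2 - 1"] nonpos_Ints_nonpos[of "d / 2 - 1"] by force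
    show ?thesis unfolding AB G by (simp add: algebra_simps diff_divide_distrib)
  qed
  thus "(1 - d / 2) * B = 0" "(1 - d / 2) * A + B = Gamma (d / 2) / (4 * pi powr (d / 2))" by auto
qed

context cutoff begin

text \<open>
  Green's formula again, but the cutoff equals \<open>1\<close> at the inner end; the one boundary term that survives is the
  flux of the gradient of the fundamental solution through the unit sphere.
\<close>

lemma radial_pairing_base:
  assumes R: "riesz_coeffs D 1 A B" and D: "D \<ge> 2"
  shows "integral {1..2} (\<lambda>r. r ^ (D - 1) * powlog (1 - D / 2) A B (r\<^sup>2) * radial_laplace D f (r\<^sup>2)) =
     Gamma (D / 2) / (2 * pi powr (D / 2))"
proof -
  define b where "b = 1 - real D / 2"
  define c where "c = Gamma (D / 2) / (4 * pi powr (D / 2))"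
  have c: "b * A + B = c" "b * B = 0" using riesz_coeffs_1[OF R D] by (auto simp: b_def c_def)
  let ?P = "powlog b A B" and ?P1 = "powlog (b - 1) (b * A + B) (b * B)"
  \<comment> \<open>The Wronskian once more, simplified by \<open>r\<^sup>D P\<^sub>1(r\<^sup>2) = c\<close>.\<close>
  let ?W = "\<lambda>r::real. 2 * r ^ D * ?P (r\<^sup>2) * deriv f (r\<^sup>2) - 2 * c * f (r\<^sup>2)"
  have "((\<lambda>r. r ^ (D - 1) * ?P (r\<^sup>2) * radial_laplace D f (r\<^sup>2)) has_integral ?W 2 - ?W 1) {1..2}"
  proof (rule fundamental_theorem_of_calculus)
    fix r :: real assume r: "r \<in> {1..2}"
    hence pos: "r\<^sup>2 > 0" "r > 0" by auto
    obtain E where E: "D = Suc E" using D by (cases D) auto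
    have sq: "((\<lambda>r. r\<^sup>2) has_real_derivative 2 * r) (at r)" by (auto intro!: derivative_eq_intros)
    have P1: "r ^ D * ?P1 (r\<^sup>2) = c"
    proof -
      have "(r\<^sup>2) powr (b - 1) = r powr (- real D)"
        using pos by (simp add: b_def power2_powr)
      thus ?thesis unfolding powlog_def c using pos by (simp add: powr_minus powr_realpow)
    qed
    have "(?W has_real_derivative 2 * r ^ D * ?P (r\<^sup>2) * (deriv (deriv f) (r\<^sup>2) * (2 * r)) +
       (2 * r ^ D * (?P1 (r\<^sup>2) * (2 * r)) + 2 * real D * r ^ (D - 1) * ?P (r\<^sup>2)) * deriv f (r\<^sup>2)
       - 2 * c * (deriv f (r\<^sup>2) * (2 * r))) (at r)"
      by (auto intro!: derivative_eq_intros DERIV_chain2[OF powlog_deriv[OF pos(1)] sq] DERIV_chain2[OF fd sq]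
        DERIV_chain2[OF bump_span_deriv_closed(1)[OF fs] sq])
    also have "2 * r ^ D * ?P (r\<^sup>2) * (deriv (deriv f) (r\<^sup>2) * (2 * r)) +
       (2 * r ^ D * (?P1 (r\<^sup>2) * (2 * r)) + 2 * real D * r ^ (D - 1) * ?P (r\<^sup>2)) * deriv f (r\<^sup>2)
       - 2 * c * (deriv f (r\<^sup>2) * (2 * r)) =
       2 * r ^ D * ?P (r\<^sup>2) * (deriv (deriv f) (r\<^sup>2) * (2 * r)) + 2 * real D * r ^ (D - 1) * ?P (r\<^sup>2) * deriv f (r\<^sup>2)
         + (r ^ D * ?P1 (r\<^sup>2) - c) * (4 * r * deriv f (r\<^sup>2))"
      by (simp add: algebra_simps)
    also have "\<dots> = r ^ (D - 1) * ?P (r\<^sup>2) * radial_laplace D f (r\<^sup>2)"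
      unfolding P1 by (simp add: E radial_laplace_def algebra_simps power2_eq_square)
    finally show "(?W has_vector_derivative r ^ (D - 1) * ?P (r\<^sup>2) * radial_laplace D f (r\<^sup>2)) (at r within {1..2})"
      unfolding has_real_derivative_iff_has_vector_derivative[symmetric] by (rule DERIV_subset) auto
  qed simp
  moreover have "?W 2 - ?W 1 = 2 * c"
    using f1[of 1] f0[of 4] bump_span_zero[OF fs, of 4] bump_span_zero[OF fs, of 1] by simp
  ultimately show ?thesis unfolding b_def c_def by (simp add: integral_unique)
qed

text \<open>
  All but one of the Laplacians are moved to the fundamental solution by Green's formula.
\<close>

lemma radial_pairing:
  assumes R: "riesz_coeffs D m A B" and D: "D \<ge> 2" and m: "m \<ge> 1"
  shows "integral {1..2} (\<lambda>r. r ^ (D - 1) * powlog (real m - D / 2) A B (r\<^sup>2) * (radial_laplace D ^^ m) f (r\<^sup>2)) =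
     Gamma (D / 2) / (2 * pi powr (D / 2))"
  using m R
proof (induction m arbitrary: A B rule: nat_induct_at_least)
  case base
  thus ?case using radial_pairing_base[OF _ D] by simp
next
  case (Suc n)
  obtain A' B' where 1: "riesz_coeffs D n A' B'" "\<forall>F \<in> poly_span bump_seeds.
      integral {1..2} (\<lambda>r. r ^ (D - 1) * powlog (real (Suc n) - D / 2) A B (r\<^sup>2) * radial_laplace D F (r\<^sup>2)) =
      integral {1..2} (\<lambda>r. r ^ (D - 1) * powlog (real n - D / 2) A' B' (r\<^sup>2) * F (r\<^sup>2))"
    using powlog_laplace_green[OF _ Suc.prems Suc.hyps] D by auto
  have "(radial_laplace D ^^ n) f \<in> poly_span bump_seeds"
    by (rule iterate_in_span) (use Suc.hyps in simp)
  with 1 Suc.IH[OF 1(1)] show ?case by simp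
qed

text \<open>
  Polar coordinates; the volume of the unit ball cancels the constant of \<open>radial_pairing\<close>.
\<close>

lemma powlog_pairing:
  assumes R: "riesz_coeffs DIM('b::euclidean_space) m A B" and D: "DIM('b) \<ge> 2" and m: "m \<ge> 1"
  shows "(LINT x|lborel. powlog (real m - DIM('b) / 2) A B ((norm x)\<^sup>2) * (laplacian ^^ m) (\<lambda>x::'b. f ((norm x)\<^sup>2)) x) = 1"
proof -
  let ?D = "DIM('b)"
  define F where "F = (radial_laplace ?D ^^ m) f"
  have F: "F \<in> poly_span bump_seeds" unfolding F_def by (rule iterate_in_span) (use m in simp)
  have cF: "continuous_on S F" for S
    by (intro continuous_at_imp_continuous_on ballI DERIV_isCont[OF bump_span_deriv_closed(1)[OF F]])
  let ?P = "powlog (real m - ?D / 2) A B"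
  let ?V = "unit_ball_vol (real ?D)"
  have [measurable]: "F \<in> borel_measurable borel" using cF by (intro borel_measurable_continuous_onI)
  have [measurable]: "?P \<in> borel_measurable borel" unfolding powlog_def by measurable
  have cI: "continuous_on {1..2} (\<lambda>r. r ^ (?D - 1) * ?P (r\<^sup>2) * F (r\<^sup>2))"
    unfolding powlog_def
    by (intro continuous_intros continuous_on_compose2[OF cF[of UNIV]]) auto
  have "(LINT x|lborel. ?P ((norm x)\<^sup>2) * (laplacian ^^ m) (\<lambda>x::'b. f ((norm x)\<^sup>2)) x) =
     (LINT x|(lborel :: 'b measure). (\<lambda>r. ?P (r\<^sup>2) * F (r\<^sup>2)) (norm x))"
    unfolding funpow_laplacian_cutoff F_def ..
  also have "\<dots> = (LINT r|lborel. (if 0 \<le> r then ?V * real ?D * r ^ (?D - 1) else 0) * (?P (r\<^sup>2) * F (r\<^sup>2)))"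
    by (rule integral_radial) measurable
  also have "\<dots> = (LINT r|lborel. (?V * real ?D) * (indicator {1..2} r *\<^sub>R (r ^ (?D - 1) * ?P (r\<^sup>2) * F (r\<^sup>2))))"
  proof (intro Bochner_Integration.integral_cong refl)
    fix r :: real
    have "F (r\<^sup>2) = 0" if "0 \<le> r" "r \<notin> {1..2}"
    proof (rule bump_span_zero[OF F])
      show "r\<^sup>2 \<le> 1 \<or> 2 \<le> r\<^sup>2"
      proof (cases "r < 1")
        case True
        thus ?thesis using that by (simp add: power_le_one)
      next
        case False
        hence "2\<^sup>2 \<le> r\<^sup>2" using that by (intro power_mono) auto
        thus ?thesis by simp
      qed
    qed
    thus "(if 0 \<le> r then ?V * real ?D * r ^ (?D - 1) else 0) * (?P (r\<^sup>2) * F (r\<^sup>2)) =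
      (?V * real ?D) * (indicator {1..2} r *\<^sub>R (r ^ (?D - 1) * ?P (r\<^sup>2) * F (r\<^sup>2)))"
      by (cases "r \<in> {1..2}") auto
  qed
  also have "\<dots> = ?V * real ?D * integral {1..2} (\<lambda>r. r ^ (?D - 1) * ?P (r\<^sup>2) * F (r\<^sup>2))"
    using set_borel_integral_eq_integral(2)[of "{1..2}" "\<lambda>r. r ^ (?D - 1) * ?P (r\<^sup>2) * F (r\<^sup>2)"]
      borel_integrable_compact[OF _ cI]
    by (simp add: set_lebesgue_integral_def set_integrable_def)
  also have "\<dots> = ?V * real ?D * (Gamma (?D / 2) / (2 * pi powr (?D / 2)))"
    unfolding F_def radial_pairing[OF R D m] ..
  also have "\<dots> = 1"
  proof -
    have "real ?D / 2 > 0" using D by simp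
    hence "Gamma (real ?D / 2 + 1) = (real ?D / 2) * Gamma (real ?D / 2)"
      using Gamma_plus1[of "real ?D / 2"] nonpos_Ints_nonpos[of "real ?D / 2"] by force
    moreover have "Gamma (real ?D / 2) \<noteq> 0"
      using Gamma_real_pos[OF \<open>real ?D / 2 > 0\<close>] by (metis less_irrefl)
    ultimately show ?thesis unfolding unit_ball_vol_def using D by simp
  qed
  finally show ?thesis .
qed

end

lemma phi_eq_powlog:
  assumes "x \<noteq> (0 :: 'b::euclidean_space)"
  shows "phi C m d x = powlog (real m - d / 2) (if even d then 0 else C) (if even d then C / 2 else 0) ((norm x)\<^sup>2)"
proof -
  have n: "norm x > 0" using assms by simp
  have "((norm x)\<^sup>2) powr (real m - d / 2) = norm x powr (2 * real m - d)"
    using n by (simp add: power2_powr)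
  also have "\<dots> = norm x powr (of_int (2 * int m - int d))" by simp
  also have "\<dots> = norm x powi (2 * int m - int d)" using n by (subst powr_real_of_int') auto
  finally show ?thesis using n by (simp add: phi_def powlog_def ln_realpow)
qed

text \<open>
  A single test function determines the scalar \<open>C\<close>, because the pairing is linear in \<open>C\<close> and is known to be
  \<open>1\<close> for the coefficients of \<open>riesz_coeffs\<close>.
\<close>

lemma fundamental_solution_riesz_coeffs:
  assumes fsol: "fundamental_solution m (phi C m d :: 'b::euclidean_space \<Rightarrow> real)"
    and d: "DIM('b) = d" "d \<ge> 2" "2 * m > d"
  shows "riesz_coeffs d m (if even d then 0 else C) (if even d then C / 2 else 0)"
proof -
  obtain f f' where f: "\<And>u. u \<le> 1 \<Longrightarrow> f u = (1::real)" "\<And>u. u \<ge> 2 \<Longrightarrow> f u = 0"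
    "\<And>u. (f has_real_derivative f' u) (at u)" "f' \<in> poly_span bump_seeds"
    using exists_cutoff by metis
  have "deriv f = f'" using f(3) by (auto intro: DERIV_imp_deriv)
  then interpret cutoff f by unfold_locales (use f in auto)
  let ?\<psi> = "\<lambda>x::'b. f ((norm x)\<^sup>2)"
  let ?A = "\<lambda>C::real. if even d then 0 else C" and ?B = "\<lambda>C. if even d then C / 2 else 0"
  have phi: "phi C m d = (\<lambda>x::'b. powlog (real m - d / 2) (?A C) (?B C) ((norm x)\<^sup>2))" for C
  proof
    fix x :: 'b
    have "2 * int m - int d \<noteq> 0" "real m - d / 2 \<noteq> 0" using d by linarith+
    thus "phi C m d x = powlog (real m - d / 2) (?A C) (?B C) ((norm x)\<^sup>2)"
      by (cases "x = 0") (auto simp: phi_eq_powlog, auto simp: phi_def powlog_def power_int_0_left)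
  qed
  define I where "I = (LINT x|lborel. powlog (real m - d / 2) (?A 1) (?B 1) ((norm x)\<^sup>2) * (laplacian ^^ m) ?\<psi> x)"
  have lin: "(LINT x|lborel. powlog (real m - d / 2) (?A c) (?B c) ((norm x)\<^sup>2) * (laplacian ^^ m) ?\<psi> x) = c * I" for c
  proof -
    have "powlog (real m - d / 2) (?A c) (?B c) u = c * powlog (real m - d / 2) (?A 1) (?B 1) u" for u
      by (simp add: powlog_def)
    thus ?thesis unfolding I_def by (simp add: mult.assoc)
  qed
  have "(LINT x|lborel. phi C m d x * (laplacian ^^ m) ?\<psi> x) = ?\<psi> 0"
    using fsol test_function_cutoff unfolding fundamental_solution_def by blast
  hence 1: "C * I = 1" unfolding phi lin using f(1)[of 0] by simp
  obtain c where c: "riesz_coeffs d m (?A c) (?B c)"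
  proof (cases "even d")
    case True
    let ?c = "- ((-1) ^ m * (-1) ^ (m - d div 2)) / (fact (m - d div 2) * 4 ^ m * pi powr (d / 2) * fact (m - 1)) :: real"
    have "riesz_coeffs d m (?A (2 * ?c)) (?B (2 * ?c))"
      unfolding riesz_coeffs_def using True d by simp
    thus thesis by (rule that)
  next
    case False
    thus thesis
      by (intro that[of "(-1) ^ m * Gamma (d / 2 - m) / (4 ^ m * pi powr (d / 2) * fact (m - 1))"]) (simp add: riesz_coeffs_def)
  qed
  have "c * I = 1"
    using powlog_pairing[where 'b = 'b, unfolded d(1), OF c] d unfolding lin[symmetric] by simp
  with 1 have "C = c" by (metis mult_cancel_right mult_zero_right zero_neq_one)
  with c show ?thesis by (simp only:)
qed

section \<open>Mellin transforms of exponential Taylor remainders\<close>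

text \<open>
  The remainder of \<open>exp (- s)\<close> after \<open>r\<close> Taylor terms. For \<open>r > 0\<close> it is of order \<open>r\<close> at the origin and
  \<open>r - 1\<close> at infinity, so its Mellin integral converges in a strip of width one.
\<close>

definition exp_rem :: "nat \<Rightarrow> real \<Rightarrow> real" where
  "exp_rem r s = exp (- s) - (\<Sum>i<r. (- s) ^ i / fact i)"

lemma exp_rem_0 [simp]: "exp_rem 0 s = exp (- s)" by (simp add: exp_rem_def)

lemma exp_rem_Suc: "exp_rem (Suc r) s = exp_rem r s - (- s) ^ r / fact r"
  by (simp add: exp_rem_def)

lemma exp_rem_Suc_0 [simp]: "exp_rem (Suc r) 0 = 0"
  by (induction r) (auto simp: exp_rem_Suc)

lemma power_over_fact_deriv:
  "((\<lambda>s::real. s ^ Suc r / fact (Suc r)) has_real_derivative s ^ r / fact r) (at s)"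
  by (rule DERIV_cong[OF DERIV_cdivide[OF DERIV_pow]]) (simp add: field_simps del: of_nat_Suc)

lemma exp_rem_deriv: "(exp_rem (Suc r) has_real_derivative - exp_rem r s) (at s)"
proof (induction r)
  case 0
  show ?case unfolding exp_rem_Suc by (auto intro!: derivative_eq_intros)
next
  case (Suc r)
  have "((\<lambda>s. (- s) ^ Suc r / fact (Suc r)) has_real_derivative (- s) ^ r / fact r * (- 1)) (at s)"
    by (rule DERIV_chain2[OF power_over_fact_deriv DERIV_minus[OF DERIV_ident]])
  from DERIV_diff[OF Suc this]
  show ?case by (simp add: exp_rem_Suc[of "Suc r", abs_def] exp_rem_Suc[of r])
qed

lemma continuous_exp_rem [continuous_intros]: "continuous_on A (exp_rem r)"
  unfolding exp_rem_def by (intro continuous_intros) auto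

lemma borel_measurable_exp_rem [measurable]: "exp_rem r \<in> borel_measurable borel"
  by (intro borel_measurable_continuous_onI continuous_exp_rem)

text \<open>
  The remainder of an alternating series. Each derivative is minus the preceding remainder, and all of them with
  \<open>r > 0\<close> vanish at \<open>0\<close>, so both bounds follow by induction from monotonicity.
\<close>

lemma exp_rem_bounds:
  assumes "s \<ge> 0"
  shows "0 \<le> (-1) ^ r * exp_rem r s" "(-1) ^ r * exp_rem r s \<le> s ^ r / fact r"
proof -
  have "\<forall>s\<ge>0. 0 \<le> (-1) ^ r * exp_rem r s \<and> (-1) ^ r * exp_rem r s \<le> s ^ r / fact r"
  proof (induction r)
    case (Suc r)
    have d: "((\<lambda>s. (-1) ^ Suc r * exp_rem (Suc r) s) has_real_derivative (-1) ^ r * exp_rem r s) (at s)" for s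
      by (rule derivative_eq_intros exp_rem_deriv refl)+ simp
    have d2: "((\<lambda>s. s ^ Suc r / fact (Suc r) - (-1) ^ Suc r * exp_rem (Suc r) s) has_real_derivative s ^ r / fact r - (-1) ^ r * exp_rem r s) (at s)" for s
      by (rule DERIV_diff[OF power_over_fact_deriv d])
    show ?case
    proof (intro allI impI conjI)
      fix s :: real assume s: "s \<ge> 0"
      have "(-1) ^ Suc r * exp_rem (Suc r) 0 \<le> (-1) ^ Suc r * exp_rem (Suc r) s"
        by (rule DERIV_nonneg_imp_nondecreasing[OF s]) (use d Suc in blast)
      thus "0 \<le> (-1) ^ Suc r * exp_rem (Suc r) s" by simp
      have "0 ^ Suc r / fact (Suc r) - (-1) ^ Suc r * exp_rem (Suc r) 0 \<le> s ^ Suc r / fact (Suc r) - (-1) ^ Suc r * exp_rem (Suc r) s"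
        by (rule DERIV_nonneg_imp_nondecreasing[OF s]) (use d2 Suc in \<open>meson diff_ge_0_iff_ge\<close>)
      thus "(-1) ^ Suc r * exp_rem (Suc r) s \<le> s ^ Suc r / fact (Suc r)" by simp
    qed
  qed simp
  thus "0 \<le> (-1) ^ r * exp_rem r s" "(-1) ^ r * exp_rem r s \<le> s ^ r / fact r" using assms by auto
qed

lemma abs_exp_rem_le:
  assumes "s \<ge> 0" shows "\<bar>exp_rem r s\<bar> \<le> s ^ r / fact r"
proof -
  have "\<bar>exp_rem r s\<bar> = \<bar>(-1) ^ r * exp_rem r s\<bar>" by (simp add: abs_mult)
  thus ?thesis using exp_rem_bounds[OF assms, of r] by simp
qed

lemma abs_exp_rem_Suc_le:
  assumes "s \<ge> 0" shows "\<bar>exp_rem (Suc r) s\<bar> \<le> 2 * s ^ r"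
proof -
  have "\<bar>exp_rem (Suc r) s\<bar> \<le> \<bar>exp_rem r s\<bar> + s ^ r / fact r"
    unfolding exp_rem_Suc by (rule order_trans[OF abs_triangle_ineq4]) (use assms in \<open>simp add: power_abs\<close>)
  also have "\<dots> \<le> 2 * (s ^ r / fact r)" using abs_exp_rem_le[OF assms, of r] by simp
  also have "s ^ r / fact r \<le> s ^ r / 1" by (rule divide_left_mono) (use assms in auto)
  finally show ?thesis by simp
qed

lemma abs_exp_rem_le_powr:
  assumes "s > 0" shows "\<bar>exp_rem r s\<bar> \<le> s powr real r"
proof -
  have "\<bar>exp_rem r s\<bar> \<le> s ^ r / fact r" using abs_exp_rem_le[of s r] assms by simp
  also have "\<dots> \<le> s ^ r / 1" by (rule divide_left_mono) (use assms in auto)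
  finally show ?thesis using assms by (simp add: powr_realpow)
qed

lemma abs_exp_rem_Suc_le_powr:
  assumes "s > 0" shows "\<bar>exp_rem (Suc r) s\<bar> \<le> 2 * s powr real r"
  using abs_exp_rem_Suc_le[of s r] assms by (simp add: powr_realpow)

lemma exp_rem_tendsto: "((\<lambda>s. exp_rem r s / s ^ r) \<longlongrightarrow> (-1) ^ r / fact r) (at_right 0)"
proof -
  have ev: "eventually (\<lambda>s. exp_rem (Suc r) s / s ^ r = exp_rem r s / s ^ r - (-1) ^ r / fact r) (at_right (0::real))"
  proof (intro eventually_at_rightI[of 0 1])
    fix s :: real assume s: "s \<in> {0<..<1}"
    have "(- s) ^ r = (-1) ^ r * s ^ r" by (rule power_minus)
    thus "exp_rem (Suc r) s / s ^ r = exp_rem r s / s ^ r - (-1) ^ r / fact r"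
      unfolding exp_rem_Suc using s by (simp add: diff_divide_distrib)
  qed simp
  have "((\<lambda>s. exp_rem (Suc r) s / s ^ r) \<longlongrightarrow> 0) (at_right 0)"
  proof (rule Lim_null_comparison)
    show "eventually (\<lambda>s. norm (exp_rem (Suc r) s / s ^ r) \<le> s) (at_right (0::real))"
    proof (intro eventually_at_rightI[of 0 1])
      fix s :: real assume s: "s \<in> {0<..<1}"
      have "\<bar>exp_rem (Suc r) s\<bar> \<le> s ^ Suc r / fact (Suc r)" by (rule abs_exp_rem_le) (use s in simp)
      also have "\<dots> \<le> s ^ Suc r / 1" by (rule divide_left_mono) (use s in \<open>auto simp del: fact_Suc\<close>)
      finally show "norm (exp_rem (Suc r) s / s ^ r) \<le> s" using s by (simp add: field_simps)
    qed simp
  qed (rule tendsto_ident_at)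
  hence "((\<lambda>s. exp_rem r s / s ^ r - (-1) ^ r / fact r) \<longlongrightarrow> 0) (at_right 0)"
    by (rule Lim_transform_eventually) (rule ev)
  thus ?thesis by (simp add: LIM_zero_iff)
qed

lemma set_integrable_powr_0_1:
  assumes "a > -1" shows "set_integrable lborel {0<..<1} (\<lambda>s::real. s powr a)"
proof -
  have "set_integrable lborel (einterval 0 1) (\<lambda>s::real. s powr a)"
  proof (rule interval_integral_FTC_nonneg(1)[where F = "\<lambda>s. s powr (a + 1) / (a + 1)"])
    show "(((\<lambda>s. s powr (a + 1) / (a + 1)) \<circ> real_of_ereal) \<longlongrightarrow> 0) (at_right 0)"
      unfolding zero_ereal_def ereal_tendsto_simps using assms by real_asymp
    show "(((\<lambda>s. s powr (a + 1) / (a + 1)) \<circ> real_of_ereal) \<longlongrightarrow> 1 / (a + 1)) (at_left 1)"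
      unfolding one_ereal_def ereal_tendsto_simps using assms by (auto intro!: tendsto_eq_intros)
  qed (use assms in \<open>auto intro!: derivative_eq_intros continuous_intros simp: zero_ereal_def\<close>)
  moreover have "einterval 0 1 = {0<..<1}" by (auto simp: einterval_def)
  ultimately show ?thesis by simp
qed

lemma set_integrable_powr_1_inf:
  assumes "a < -1" shows "set_integrable lborel {1<..} (\<lambda>s::real. s powr a)"
proof -
  have "set_integrable lborel (einterval 1 \<infinity>) (\<lambda>s::real. s powr a)"
  proof (rule interval_integral_FTC_nonneg(1)[where F = "\<lambda>s. s powr (a + 1) / (a + 1)"])
    show "(((\<lambda>s. s powr (a + 1) / (a + 1)) \<circ> real_of_ereal) \<longlongrightarrow> 1 / (a + 1)) (at_right 1)"
      unfolding one_ereal_def ereal_tendsto_simps using assms by (auto intro!: tendsto_eq_intros)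
    show "(((\<lambda>s. s powr (a + 1) / (a + 1)) \<circ> real_of_ereal) \<longlongrightarrow> 0) (at_left \<infinity>)"
      unfolding ereal_tendsto_simps using assms by real_asymp
  qed (use assms in \<open>auto intro!: derivative_eq_intros continuous_intros simp: one_ereal_def\<close>)
  moreover have "einterval 1 \<infinity> = {1<..}" by (auto simp: einterval_def)
  ultimately show ?thesis by simp
qed

lemma set_integrable_exp_rem:
  assumes z: "- real r < z" "r > 0 \<Longrightarrow> z < 1 - real r"
  shows "set_integrable lborel {0<..} (\<lambda>s. s powr (z - 1) * exp_rem r s)"
proof (cases r)
  case 0
  have "(\<integral>\<^sup>+s. ennreal (indicator {0..} s * s powr (z - 1) / exp s) \<partial>lborel) = ennreal (Gamma z)"
    using Gamma_conv_nn_integral_real[of z] z 0 by simp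
  hence "integrable lborel (\<lambda>s. indicator {0..} s * s powr (z - 1) / exp s)"
    by (intro integrableI_nonneg) (auto simp: divide_nonneg_pos)
  moreover have "indicator {0..} s * s powr (z - 1) / exp s = indicator {0<..} s *\<^sub>R (s powr (z - 1) * exp_rem r s)" for s :: real
    unfolding 0 by (cases "s = 0") (auto simp: indicator_def exp_minus field_simps)
  ultimately show ?thesis unfolding set_integrable_def by simp
next
  case (Suc q)
  let ?f = "\<lambda>s. s powr (z - 1) * exp_rem r s"
  have 1: "set_integrable lborel {0<..<1} ?f"
  proof (rule set_integrable_bound)
    show "set_integrable lborel {0<..<1} (\<lambda>s. s powr (z - 1 + r))"
      by (rule set_integrable_powr_0_1) (use z in simp)
    show "AE s in lborel. s \<in> {0<..<1} \<longrightarrow> norm (?f s) \<le> norm (s powr (z - 1 + r))"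
    proof (intro AE_I2 impI)
      fix s :: real assume s: "s \<in> {0<..<1}"
      have "\<bar>exp_rem r s\<bar> \<le> s ^ r / fact r" using abs_exp_rem_le s by simp
      also have "\<dots> \<le> s ^ r / 1" by (rule divide_left_mono) (use s in auto)
      finally have "s powr (z - 1) * \<bar>exp_rem r s\<bar> \<le> s powr (z - 1) * s powr r"
        using s by (intro mult_left_mono) (auto simp: powr_realpow)
      thus "norm (?f s) \<le> norm (s powr (z - 1 + r))" by (simp add: abs_mult powr_add)
    qed
  qed (auto simp: set_borel_measurable_def)
  have 2: "set_integrable lborel {1<..} ?f"
  proof (rule set_integrable_bound)
    show "set_integrable lborel {1<..} (\<lambda>s. 2 * s powr (z - 1 + q))"
      by (intro set_integrable_mult_right set_integrable_powr_1_inf) (use z Suc in simp)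
    show "AE s in lborel. s \<in> {1<..} \<longrightarrow> norm (?f s) \<le> norm (2 * s powr (z - 1 + q))"
    proof (intro AE_I2 impI)
      fix s :: real assume s: "s \<in> {1<..}"
      have "\<bar>exp_rem r s\<bar> \<le> 2 * s ^ q" using abs_exp_rem_Suc_le[of s q] s Suc by simp
      hence "s powr (z - 1) * \<bar>exp_rem r s\<bar> \<le> s powr (z - 1) * (2 * s powr q)"
        using s by (intro mult_left_mono) (auto simp: powr_realpow)
      thus "norm (?f s) \<le> norm (2 * s powr (z - 1 + q))" by (simp add: abs_mult powr_add mult_ac)
    qed
  qed (auto simp: set_borel_measurable_def)
  have "set_integrable lborel {1::real} ?f"
    unfolding set_integrable_def by (rule integrable_cong_AE_imp[of _ "\<lambda>_. 0"]) (auto simp: AE_lborel_singleton intro: AE_mp[OF AE_lborel_singleton[of 1]])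
  hence "set_integrable lborel ({0<..<1} \<union> {1<..} \<union> {1}) ?f"
    by (intro set_integrable_Un 1 2) auto
  also have "{0<..<1} \<union> {1<..} \<union> {1} = {0::real<..}" by auto
  finally show ?thesis .
qed

text \<open>
  The Cauchy-Saalschuetz continuation of Euler's integral: partial integration lowers \<open>r\<close> and raises \<open>z\<close> by one,
  in accordance with \<open>z \<Gamma>(z) = \<Gamma>(z + 1)\<close>.
\<close>

lemma integral_exp_rem:
  assumes "- real r < z" "r > 0 \<Longrightarrow> z < 1 - real r"
  shows "(LINT s:{0<..}|lborel. s powr (z - 1) * exp_rem r s) = Gamma z"
  using assms
proof (induction r arbitrary: z)
  case 0
  have "Gamma z > 0" using 0 by (simp add: Gamma_real_pos)
  moreover have "(\<integral>\<^sup>+s. ennreal (indicator {0..} s * s powr (z - 1) / exp s) \<partial>lborel) = ennreal (Gamma z)"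
    using Gamma_conv_nn_integral_real[of z] 0 by simp
  ultimately have "(LINT s|lborel. indicator {0..} s * s powr (z - 1) / exp s) = Gamma z"
    by (subst integral_eq_nn_integral) (auto simp: divide_nonneg_pos)
  moreover have "indicator {0..} s * s powr (z - 1) / exp s = indicator {0<..} s *\<^sub>R (s powr (z - 1) * exp_rem 0 s)" for s :: real
    by (cases "s = 0") (auto simp: indicator_def exp_minus field_simps)
  ultimately show ?case unfolding set_lebesgue_integral_def by simp
next
  case (Suc r)
  have z: "z < 0" "- real r < z + 1" "r > 0 \<Longrightarrow> z + 1 < 1 - real r" using Suc.prems by auto
  have IH: "(LINT s:{0<..}|lborel. s powr z * exp_rem r s) = Gamma (z + 1)"
    using Suc.IH[of "z + 1"] z by simp
  have i1: "set_integrable lborel {0<..} (\<lambda>s. s powr (z - 1) * exp_rem (Suc r) s)"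
    by (rule set_integrable_exp_rem) (use Suc.prems in auto)
  have i2: "set_integrable lborel {0<..} (\<lambda>s. s powr z * exp_rem r s)"
    using set_integrable_exp_rem[of r "z + 1"] z by simp
  have i3: "set_integrable lborel {0<..} (\<lambda>s. z * (s powr (z - 1) * exp_rem (Suc r) s) - s powr z * exp_rem r s)"
    by (intro set_integral_diff set_integrable_mult_right i1 i2)
  have ei: "einterval 0 \<infinity> = {0::real<..}" by (auto simp: einterval_def)
  have "(LBINT s=0..\<infinity>. z * (s powr (z - 1) * exp_rem (Suc r) s) - s powr z * exp_rem r s) = 0 - 0"
  proof (rule interval_integral_FTC_integrable[where F = "\<lambda>s. s powr z * exp_rem (Suc r) s"])
    show "((\<lambda>s. s powr z * exp_rem (Suc r) s) has_vector_derivative z * (s powr (z - 1) * exp_rem (Suc r) s) - s powr z * exp_rem r s) (at s)"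
      if "0 < ereal s" for s
      unfolding has_real_derivative_iff_has_vector_derivative[symmetric]
      using that by (auto intro!: derivative_eq_intros exp_rem_deriv)
    show "isCont (\<lambda>s. z * (s powr (z - 1) * exp_rem (Suc r) s) - s powr z * exp_rem r s) s" if "0 < ereal s" for s
    proof -
      have c: "isCont (exp_rem q) s" for q
        using continuous_exp_rem[of UNIV q] by (simp add: continuous_on_eq_continuous_at)
      have powr_cont: "isCont (\<lambda>s. s powr w) s" for w
        using that by (auto intro!: DERIV_isCont[OF has_real_derivative_powr])
      show ?thesis
        by (intro isCont_diff isCont_mult powr_cont c continuous_const)
    qed
    show "set_integrable lborel (einterval 0 \<infinity>) (\<lambda>s. z * (s powr (z - 1) * exp_rem (Suc r) s) - s powr z * exp_rem r s)"
      unfolding ei by (rule i3)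
    show "(((\<lambda>s. s powr z * exp_rem (Suc r) s) \<circ> real_of_ereal) \<longlongrightarrow> 0) (at_right 0)"
      unfolding zero_ereal_def ereal_tendsto_simps
    proof (rule Lim_null_comparison)
      show "eventually (\<lambda>s. norm (s powr z * exp_rem (Suc r) s) \<le> s powr (z + Suc r)) (at_right (0::real))"
      proof (intro eventually_at_rightI[of 0 1])
        fix s :: real assume s: "s \<in> {0<..<1}"
        have "s powr z * \<bar>exp_rem (Suc r) s\<bar> \<le> s powr z * s powr real (Suc r)"
          by (rule mult_left_mono[OF abs_exp_rem_le_powr]) (use s in auto)
        thus "norm (s powr z * exp_rem (Suc r) s) \<le> s powr (z + Suc r)"
          by (simp only: powr_add real_norm_def abs_mult abs_of_nonneg[OF powr_ge_zero])
      qed simp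
      show "((\<lambda>s. s powr (z + Suc r)) \<longlongrightarrow> 0) (at_right (0::real))"
      proof -
        define c where "c = z + Suc r"
        have "c > 0" using Suc.prems by (simp add: c_def)
        hence "((\<lambda>s. s powr c) \<longlongrightarrow> 0) (at_right (0::real))" by real_asymp
        thus ?thesis by (simp only: c_def)
      qed
    qed
    show "(((\<lambda>s. s powr z * exp_rem (Suc r) s) \<circ> real_of_ereal) \<longlongrightarrow> 0) (at_left \<infinity>)"
      unfolding ereal_tendsto_simps
    proof (rule Lim_null_comparison)
      show "eventually (\<lambda>s. norm (s powr z * exp_rem (Suc r) s) \<le> 2 * s powr (z + r)) (at_top :: real filter)"
        using eventually_gt_at_top[of 0]
      proof eventually_elim
        case (elim s)
        have "s powr z * \<bar>exp_rem (Suc r) s\<bar> \<le> s powr z * (2 * s powr real r)"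
          by (rule mult_left_mono[OF abs_exp_rem_Suc_le_powr]) (use elim in auto)
        thus ?case by (simp add: powr_add abs_mult)
      qed
      define c where "c = z + r"
      have "c < 0" using Suc.prems by (simp add: c_def)
      hence "((\<lambda>s. 2 * s powr c) \<longlongrightarrow> 0) (at_top :: real filter)" by real_asymp
      thus "((\<lambda>s. 2 * s powr (z + r)) \<longlongrightarrow> 0) (at_top :: real filter)" by (simp only: c_def)
    qed
  qed auto
  hence "(LINT s:{0<..}|lborel. z * (s powr (z - 1) * exp_rem (Suc r) s) - s powr z * exp_rem r s) = 0"
    by (simp add: interval_lebesgue_integral_def ei)
  hence "z * (LINT s:{0<..}|lborel. s powr (z - 1) * exp_rem (Suc r) s) = Gamma (z + 1)"
    by (subst (asm) set_integral_diff(2)) (use i1 i2 IH in \<open>auto intro: set_integrable_mult_right\<close>)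
  also have "\<dots> = z * Gamma z"
  proof (rule Gamma_plus1)
    show "z \<notin> \<int>\<^sub>\<le>\<^sub>0"
    proof
      assume "z \<in> \<int>\<^sub>\<le>\<^sub>0"
      then obtain i :: int where i: "z = of_int i" by (auto elim!: nonpos_Ints_cases)
      have "of_int (- 1 - int r) < (of_int i :: real)" "(of_int i :: real) < of_int (- int r)"
        using Suc.prems by (simp_all add: i)
      thus False unfolding of_int_less_iff by simp
    qed
  qed
  finally show ?case using z by simp
qed

lemma abs_exp_rem_le_powr_pred:
  assumes "s > 0" shows "\<bar>exp_rem r s\<bar> \<le> 2 * s powr (real r - 1)"
proof (cases r)
  case 0
  have "exp (- s) \<le> 1 / s"
  proof -
    have "s \<le> exp s" using exp_ge_add_one_self[of s] by linarith
    thus ?thesis using assms by (simp add: exp_minus field_simps)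
  qed
  also have "\<dots> \<le> 2 * (1 / s)" using assms by (simp add: field_simps)
  finally show ?thesis using assms 0 by (simp add: powr_minus field_simps)
qed (use abs_exp_rem_Suc_le_powr[OF assms] in simp)

text \<open>
  The substitution \<open>s = u / (4 t)\<close>, which turns Mellin integrals into superpositions of heat kernels.
\<close>

lemma has_bochner_integral_inverse_scale:
  fixes W :: "real \<Rightarrow> real"
  assumes h: "has_bochner_integral lborel (\<lambda>s. indicator {0<..} s * (s powr (- \<beta> - 1) * W s)) I"
    and u: "u > 0" and [measurable]: "W \<in> borel_measurable borel"
  shows "has_bochner_integral lborel (\<lambda>t. indicator {0<..} t * (t powr (\<beta> - 1) * W (u / (4 * t)))) ((u / 4) powr \<beta> * I)"
proof -
  let ?S = "{0::real<..}" and ?f = "\<lambda>s. s powr (- \<beta> - 1) * W s"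
  let ?g = "\<lambda>t::real. u / (4 * t)" and ?g' = "\<lambda>t::real. - u / (4 * t\<^sup>2)"
  have si: "set_integrable lborel ?S ?f" and I: "(LINT s:?S|lborel. ?f s) = I"
    using h by (auto simp: has_bochner_integral_iff set_integrable_def set_lebesgue_integral_def)
  have g: "?g ` ?S = ?S"
  proof
    show "?S \<subseteq> ?g ` ?S"
    proof
      fix s :: real assume "s \<in> ?S"
      thus "s \<in> ?g ` ?S" using u by (intro image_eqI[of _ _ "u / (4 * s)"]) auto
    qed
  qed (use u in auto)
  have "?f absolutely_integrable_on ?S"
    using si unfolding set_integrable_def by (subst integrable_completion) auto
  moreover have "integral ?S ?f = I" using set_borel_integral_eq_integral(2)[OF si] I by simp
  ultimately have 1: "(\<lambda>t. \<bar>?g' t\<bar> * ?f (?g t)) absolutely_integrable_on ?S \<and> integral ?S (\<lambda>t. \<bar>?g' t\<bar> * ?f (?g t)) = I"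
    by (subst has_absolute_integral_change_of_variables_1'[of ?S ?g ?g' ?f I])
       (use u in \<open>auto simp: g inj_on_def power2_eq_square intro!: derivative_eq_intros\<close>)
  let ?h = "\<lambda>t. indicator ?S t *\<^sub>R (\<bar>?g' t\<bar> * ?f (?g t))"
  have i: "integrable lborel ?h"
    using 1 unfolding set_integrable_def by (subst (asm) integrable_completion) auto
  have v: "integral\<^sup>L lborel ?h = I"
    using set_borel_integral_eq_integral(2)[of ?S "\<lambda>t. \<bar>?g' t\<bar> * ?f (?g t)"] i 1
    by (simp add: set_integrable_def set_lebesgue_integral_def)
  have e: "(u / 4) powr \<beta> * ?h t = indicator ?S t * (t powr (\<beta> - 1) * W (u / (4 * t)))" for t
  proof (cases "t > 0")
    case True
    have "\<bar>?g' t\<bar> * (u / (4 * t)) powr (- \<beta> - 1) = (u / 4) powr (- \<beta>) * t powr (\<beta> - 1)"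
    proof -
      have "(u / (4 * t)) powr (- \<beta> - 1) = (u / 4) powr (- \<beta> - 1) * t powr (\<beta> + 1)"
        using u True powr_divide[of "u / 4" t "- \<beta> - 1"] by (simp add: powr_minus_divide field_simps powr_diff powr_minus powr_add)
      moreover have "(u / 4) powr (- \<beta>) = (u / 4) powr (- \<beta> - 1) * (u / 4)"
        using u by (simp add: powr_diff)
      moreover have "t powr (\<beta> + 1) = t powr (\<beta> - 1) * t\<^sup>2"
        using True by (simp add: powr_diff powr_add power2_eq_square)
      ultimately show ?thesis using u True by (simp add: field_simps)
    qed
    hence "\<bar>?g' t\<bar> * ?f (?g t) = (u / 4) powr (- \<beta>) * t powr (\<beta> - 1) * W (u / (4 * t))"
      by (simp add: mult.assoc[symmetric])
    thus ?thesis using True u by (simp add: powr_minus field_simps)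
  qed simp
  have "has_bochner_integral lborel (\<lambda>t. (u / 4) powr \<beta> * ?h t) ((u / 4) powr \<beta> * I)"
    using i v by (intro has_bochner_integral_mult_right) (simp add: has_bochner_integral_iff)
  thus ?thesis unfolding e .
qed

text \<open>
  The second statement, with a constant independent of \<open>u\<close>, is what Fubini's theorem asks for.
\<close>

lemma exp_rem_Mellin:
  assumes \<beta>: "\<beta> < real r" "r > 0 \<Longrightarrow> \<beta> > real r - 1"
  obtains K where
    "\<And>u. u > 0 \<Longrightarrow> has_bochner_integral lborel (\<lambda>t. indicator {0<..} t * (t powr (\<beta> - 1) * exp_rem r (u / (4 * t)))) ((u / 4) powr \<beta> * Gamma (- \<beta>))"
    "\<And>u. u > 0 \<Longrightarrow> (LINT t|lborel. norm (indicator {0<..} t * (t powr (\<beta> - 1) * exp_rem r (u / (4 * t))))) = (u / 4) powr \<beta> * K"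
proof -
  let ?f = "\<lambda>s. indicator {0<..} s * (s powr (- \<beta> - 1) * exp_rem r s)"
  have z: "r > 0 \<Longrightarrow> - \<beta> < 1 - real r" using \<beta>(2) by linarith
  have i: "integrable lborel ?f" and v: "integral\<^sup>L lborel ?f = Gamma (- \<beta>)"
    using set_integrable_exp_rem[of r "- \<beta>"] integral_exp_rem[of r "- \<beta>"] \<beta> z
    by (auto simp: set_integrable_def set_lebesgue_integral_def)
  show thesis
  proof (rule that)
    fix u :: real assume u: "u > 0"
    show "has_bochner_integral lborel (\<lambda>t. indicator {0<..} t * (t powr (\<beta> - 1) * exp_rem r (u / (4 * t)))) ((u / 4) powr \<beta> * Gamma (- \<beta>))"
      by (rule has_bochner_integral_inverse_scale) (use i v u in \<open>auto simp: has_bochner_integral_iff\<close>)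
    have "has_bochner_integral lborel (\<lambda>t. indicator {0<..} t * (t powr (\<beta> - 1) * \<bar>exp_rem r (u / (4 * t))\<bar>)) ((u / 4) powr \<beta> * (LINT s|lborel. norm (?f s)))"
      by (rule has_bochner_integral_inverse_scale) (use i u in \<open>auto simp: has_bochner_integral_iff abs_mult dest: integrable_norm\<close>)
    thus "(LINT t|lborel. norm (indicator {0<..} t * (t powr (\<beta> - 1) * exp_rem r (u / (4 * t))))) = (u / 4) powr \<beta> * (LINT s|lborel. norm (?f s))"
      by (simp add: has_bochner_integral_iff abs_mult)
  qed
qed

text \<open>
  At the exponent \<open>r\<close>, on the border of two strips, the Mellin integrals of \<open>exp_rem r\<close> and \<open>exp_rem (Suc r)\<close> diverge
  at the origin and at infinity, respectively. Subtracting the last Taylor term below a threshold \<open>c\<close> only cures both.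
\<close>

definition log_rem :: "nat \<Rightarrow> real \<Rightarrow> real \<Rightarrow> real" where
  "log_rem r c s = exp_rem r s - (if s < c then (- s) ^ r / fact r else 0)"

lemma borel_measurable_log_rem [measurable]: "log_rem r c \<in> borel_measurable borel"
  unfolding log_rem_def by measurable

lemma set_integrable_log_rem:
  "set_integrable lborel {0<..} (\<lambda>s. s powr (- real r - 1) * log_rem r 1 s)" (is "set_integrable _ _ ?f")
proof -
  have 1: "set_integrable lborel {0<..<1} ?f"
  proof (rule set_integrable_bound)
    show "set_integrable lborel {0<..<1} (\<lambda>s::real. s powr 0)"
      by (rule set_integrable_powr_0_1) simp
    show "AE s in lborel. s \<in> {0<..<1} \<longrightarrow> norm (?f s) \<le> norm (s powr 0)"
    proof (intro AE_I2 impI)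
      fix s :: real assume s: "s \<in> {0<..<1}"
      hence e: "log_rem r 1 s = exp_rem (Suc r) s" by (simp add: log_rem_def exp_rem_Suc)
      have "s powr (- real r - 1) * \<bar>exp_rem (Suc r) s\<bar> \<le> s powr (- real r - 1) * s powr real (Suc r)"
        by (rule mult_left_mono[OF abs_exp_rem_le_powr]) (use s in auto)
      also have "\<dots> = s powr 0" by (simp add: powr_add[symmetric])
      finally show "norm (?f s) \<le> norm (s powr 0)" using e by (simp add: abs_mult)
    qed
  qed (auto simp: set_borel_measurable_def)
  have 2: "set_integrable lborel {1<..} ?f"
  proof (rule set_integrable_bound)
    show "set_integrable lborel {1<..} (\<lambda>s::real. 2 * s powr (-2))"
      by (intro set_integrable_mult_right set_integrable_powr_1_inf) simp
    show "AE s in lborel. s \<in> {1<..} \<longrightarrow> norm (?f s) \<le> norm (2 * s powr (-2))"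
    proof (intro AE_I2 impI)
      fix s :: real assume s: "s \<in> {1<..}"
      hence e: "log_rem r 1 s = exp_rem r s" by (simp add: log_rem_def)
      have "s powr (- real r - 1) * \<bar>exp_rem r s\<bar> \<le> s powr (- real r - 1) * (2 * s powr (real r - 1))"
        by (rule mult_left_mono[OF abs_exp_rem_le_powr_pred]) (use s in auto)
      also have "\<dots> = 2 * s powr (-2)" by (simp add: powr_add[symmetric])
      finally show "norm (?f s) \<le> norm (2 * s powr (-2))" using e by (simp add: abs_mult)
    qed
  qed (auto simp: set_borel_measurable_def)
  have "set_integrable lborel {1::real} ?f"
    unfolding set_integrable_def by (rule integrable_cong_AE_imp[of _ "\<lambda>_. 0"]) (auto simp: AE_lborel_singleton intro: AE_mp[OF AE_lborel_singleton[of 1]])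
  hence "set_integrable lborel ({0<..<1} \<union> {1<..} \<union> {1}) ?f"
    by (intro set_integrable_Un 1 2) auto
  also have "{0<..<1} \<union> {1<..} \<union> {1} = {0::real<..}" by auto
  finally show ?thesis .
qed

text \<open>
  The integral of \<open>1 / s\<close> between two thresholds; it is the source of the logarithm in the kernel.
\<close>

lemma has_bochner_integral_inverse_gap:
  assumes c: "c > (0::real)"
  defines "h \<equiv> \<lambda>s::real. indicator {0<..} s * ((1 / s) * ((if s < 1 then 1 else 0) - (if s < c then 1 else 0)))"
  shows "has_bochner_integral lborel h (- ln c)" "(LINT s|lborel. \<bar>h s\<bar>) = \<bar>ln c\<bar>"
proof -
  have FTC: "has_bochner_integral lborel (\<lambda>s. (1 / s) * indicator {a..b} s) (ln b - ln a)" if "0 < a" "a \<le> b" for a b :: real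
    by (rule has_bochner_integral_FTC_Icc_real) (use that in \<open>auto intro!: derivative_eq_intros continuous_intros\<close>)
  have ae: "AE s in lborel. s \<noteq> (1::real) \<and> s \<noteq> c"
    using AE_lborel_singleton[of 1] AE_lborel_singleton[of c] by eventually_elim auto
  have hm: "h \<in> borel_measurable lborel" unfolding h_def by measurable
  have "has_bochner_integral lborel h (- ln c) \<and> (LINT s|lborel. \<bar>h s\<bar>) = \<bar>ln c\<bar>"
  proof (cases "c \<ge> 1")
    case True
    note F = FTC[of 1 c, simplified]
    have e: "AE s in lborel. - ((1 / s) * indicator {1..c} s) = h s"
      using ae by eventually_elim (use True in \<open>auto simp: h_def indicator_def\<close>)
    hence "has_bochner_integral lborel (\<lambda>s. - ((1 / s) * indicator {1..c} s)) (- ln c) \<longleftrightarrow> has_bochner_integral lborel h (- ln c)"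
      by (intro has_bochner_integral_cong_AE hm) auto
    moreover have "AE s in lborel. \<bar>h s\<bar> = (1 / s) * indicator {1..c} s"
      using e
    proof eventually_elim
      case (elim s)
      show ?case unfolding elim[symmetric] by (auto simp: indicator_def)
    qed
    hence "(LINT s|lborel. \<bar>h s\<bar>) = (LINT s|lborel. (1 / s) * indicator {1..c} s)"
      by (intro integral_cong_AE) (use hm in auto)
    ultimately show ?thesis using F True has_bochner_integral_minus[OF F] by (auto simp: has_bochner_integral_iff)
  next
    case False
    note F = FTC[of c 1, simplified]
    have e: "AE s in lborel. (1 / s) * indicator {c..1} s = h s"
      using ae by eventually_elim (use False c in \<open>auto simp: h_def indicator_def\<close>)
    hence "has_bochner_integral lborel (\<lambda>s. (1 / s) * indicator {c..1} s) (- ln c) \<longleftrightarrow> has_bochner_integral lborel h (- ln c)"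
      by (intro has_bochner_integral_cong_AE hm) auto
    moreover have "AE s in lborel. \<bar>h s\<bar> = (1 / s) * indicator {c..1} s"
      using e
    proof eventually_elim
      case (elim s)
      show ?case unfolding elim[symmetric] using c by (auto simp: indicator_def)
    qed
    hence "(LINT s|lborel. \<bar>h s\<bar>) = (LINT s|lborel. (1 / s) * indicator {c..1} s)"
      by (intro integral_cong_AE) (use hm in auto)
    ultimately show ?thesis using F False c by (auto simp: has_bochner_integral_iff)
  qed
  thus "has_bochner_integral lborel h (- ln c)" "(LINT s|lborel. \<bar>h s\<bar>) = \<bar>ln c\<bar>" by auto
qed

text \<open>
  With the threshold \<open>u / 4\<close> the condition \<open>s < c\<close> on \<open>s = u / (4 t)\<close> reads \<open>t > 1\<close>, the same for all \<open>u\<close>. Therefore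
  the subtracted term can be recognized as a moment when \<open>u = \<bar>z\<bar>\<^sup>2\<close> is integrated over \<open>z\<close> for fixed \<open>t\<close>.
\<close>

lemma log_rem_Mellin:
  obtains a K where
    "\<And>u. u > 0 \<Longrightarrow> has_bochner_integral lborel (\<lambda>t. indicator {0<..} t * (t powr (real r - 1) * log_rem r (u / 4) (u / (4 * t))))
       ((u / 4) powr real r * (a - (-1) ^ r / fact r * ln (u / 4)))"
    "\<And>u. u > 0 \<Longrightarrow> (LINT t|lborel. norm (indicator {0<..} t * (t powr (real r - 1) * log_rem r (u / 4) (u / (4 * t)))))
       \<le> (u / 4) powr real r * (K + \<bar>ln (u / 4)\<bar>)"
proof -
  let ?f = "\<lambda>c s. indicator {0<..} s * (s powr (- real r - 1) * log_rem r c s)"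
  let ?h = "\<lambda>c s::real. indicator {0<..} s * ((1 / s) * ((if s < 1 then 1 else 0) - (if s < c then 1 else 0)))"
  have i: "integrable lborel (?f 1)"
    using set_integrable_log_rem[of r] by (simp add: set_integrable_def)
  define a where "a = integral\<^sup>L lborel (?f 1)"
  define K where "K = (LINT s|lborel. \<bar>?f 1 s\<bar>)"
  have f: "?f c s = ?f 1 s + (-1) ^ r / fact r * ?h c s" for c s
  proof (cases "s > 0")
    case True
    have "(- s) ^ r = (-1) ^ r * s ^ r" by (rule power_minus)
    moreover have "s powr (- real r - 1) * s ^ r = 1 / s"
      using True by (simp add: powr_diff powr_minus powr_realpow field_simps)
    ultimately have e: "s powr (- real r - 1) * ((- s) ^ r / fact r) = (-1) ^ r / fact r * (1 / s)"
      by (metis (no_types, opaque_lifting) mult.left_commute times_divide_eq_right times_divide_eq_left mult.commute)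
    define D :: real where "D = (if s < 1 then 1 else 0) - (if s < c then 1 else 0)"
    have "log_rem r c s = log_rem r 1 s + D * ((- s) ^ r / fact r)"
      by (simp add: log_rem_def D_def)
    hence "s powr (- real r - 1) * log_rem r c s = s powr (- real r - 1) * log_rem r 1 s + D * (s powr (- real r - 1) * ((- s) ^ r / fact r))"
      by (simp only: distrib_left mult.left_commute)
    thus ?thesis unfolding e D_def[symmetric] using True by (simp add: mult_ac)
  qed simp
  have 1: "has_bochner_integral lborel (?f c) (a - (-1) ^ r / fact r * ln c)" if "c > 0" for c
  proof -
    have "has_bochner_integral lborel (\<lambda>s. ?f 1 s + (-1) ^ r / fact r * ?h c s) (a + (-1) ^ r / fact r * (- ln c))"
      by (intro has_bochner_integral_add has_bochner_integral_mult_right has_bochner_integral_inverse_gap that)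
         (use i in \<open>simp add: has_bochner_integral_iff a_def\<close>)
    thus ?thesis unfolding f[symmetric] by simp
  qed
  have 2: "(LINT s|lborel. \<bar>?f c s\<bar>) \<le> K + \<bar>ln c\<bar>" if c: "c > 0" for c
  proof -
    have ih: "integrable lborel (?h c)" using has_bochner_integral_inverse_gap(1)[OF c] by (simp add: has_bochner_integral_iff)
    have "(LINT s|lborel. \<bar>?f c s\<bar>) \<le> (LINT s|lborel. \<bar>?f 1 s\<bar> + \<bar>?h c s\<bar>)"
    proof (rule integral_mono)
      show "integrable lborel (\<lambda>s. \<bar>?f c s\<bar>)" using 1[OF c] by (intro integrable_abs) (simp add: has_bochner_integral_iff)
      show "integrable lborel (\<lambda>s. \<bar>?f 1 s\<bar> + \<bar>?h c s\<bar>)" by (intro Bochner_Integration.integrable_add integrable_abs i ih)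
      show "\<bar>?f c s\<bar> \<le> \<bar>?f 1 s\<bar> + \<bar>?h c s\<bar>" for s
      proof -
        have "\<bar>(-1) ^ r / fact r * ?h c s\<bar> = \<bar>?h c s\<bar> / fact r" by (simp add: abs_mult)
        also have "\<dots> \<le> \<bar>?h c s\<bar> / 1" by (rule divide_left_mono) auto
        finally have le: "\<bar>(-1) ^ r / fact r * ?h c s\<bar> \<le> \<bar>?h c s\<bar>" by (simp only: div_by_1)
        have "\<bar>?f c s\<bar> = \<bar>?f 1 s + (-1) ^ r / fact r * ?h c s\<bar>" by (rule arg_cong[where f = abs, OF f])
        also have "\<dots> \<le> \<bar>?f 1 s\<bar> + \<bar>(-1) ^ r / fact r * ?h c s\<bar>" by (rule abs_triangle_ineq)
        also have "\<dots> \<le> \<bar>?f 1 s\<bar> + \<bar>?h c s\<bar>" by (rule add_left_mono[OF le])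
        finally show ?thesis .
      qed
    qed
    also have "\<dots> = (LINT s|lborel. \<bar>?f 1 s\<bar>) + (LINT s|lborel. \<bar>?h c s\<bar>)"
      by (rule Bochner_Integration.integral_add[OF integrable_abs[OF i] integrable_abs[OF ih]])
    also have "\<dots> = K + \<bar>ln c\<bar>"
      unfolding has_bochner_integral_inverse_gap(2)[OF c] K_def ..
    finally show ?thesis .
  qed
  show thesis
  proof (rule that)
    fix u :: real assume u: "u > 0"
    hence c: "u / 4 > 0" by simp
    show "has_bochner_integral lborel (\<lambda>t. indicator {0<..} t * (t powr (real r - 1) * log_rem r (u / 4) (u / (4 * t))))
       ((u / 4) powr real r * (a - (-1) ^ r / fact r * ln (u / 4)))"
      by (rule has_bochner_integral_inverse_scale[OF 1[OF c] u]) measurable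
    have "has_bochner_integral lborel (\<lambda>t. indicator {0<..} t * (t powr (real r - 1) * \<bar>log_rem r (u / 4) (u / (4 * t))\<bar>))
       ((u / 4) powr real r * (LINT s|lborel. \<bar>?f (u / 4) s\<bar>))"
    proof (rule has_bochner_integral_inverse_scale[OF _ u])
      show "has_bochner_integral lborel (\<lambda>s. indicator {0<..} s * (s powr (- real r - 1) * \<bar>log_rem r (u / 4) s\<bar>)) (LINT s|lborel. \<bar>?f (u / 4) s\<bar>)"
        using integrable_abs[of lborel "?f (u / 4)"] 1[OF c] by (simp add: has_bochner_integral_iff abs_mult)
    qed measurable
    hence "(LINT t|lborel. norm (indicator {0<..} t * (t powr (real r - 1) * log_rem r (u / 4) (u / (4 * t)))))
       = (u / 4) powr real r * (LINT s|lborel. \<bar>?f (u / 4) s\<bar>)"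
      by (simp add: has_bochner_integral_iff abs_mult)
    also have "\<dots> \<le> (u / 4) powr real r * (K + \<bar>ln (u / 4)\<bar>)"
      by (intro mult_left_mono 2 c) auto
    finally show "(LINT t|lborel. norm (indicator {0<..} t * (t powr (real r - 1) * log_rem r (u / 4) (u / (4 * t)))))
       \<le> (u / 4) powr real r * (K + \<bar>ln (u / 4)\<bar>)" .
  qed
qed

section \<open>Superpositions of Gaussians\<close>

lemma AE_lborel_nonzero: "AE z in (lborel :: 'a::euclidean_space measure). z \<noteq> 0"
  by (rule AE_lborel_singleton)

text \<open>
  Fubini's theorem in the form in which Mellin representations \<open>P\<close> of a kernel are inserted into a convolution.
\<close>

lemma integral_superposition:
  fixes G :: "'a::euclidean_space \<Rightarrow> complex" and w :: "real \<Rightarrow> real \<Rightarrow> real"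
  assumes G[measurable]: "G \<in> borel_measurable borel" and w[measurable]: "(\<lambda>(t, u). w t u) \<in> borel_measurable (borel \<Otimes>\<^sub>M borel)"
    and Pm[measurable]: "P \<in> borel_measurable borel"
    and P: "\<And>u. u > 0 \<Longrightarrow> has_bochner_integral lborel (\<lambda>t. indicator {0<..} t * (t powr (\<beta> - 1) * w t u)) (P u)"
    and H: "\<And>u. u > 0 \<Longrightarrow> (LINT t|lborel. norm (indicator {0<..} t * (t powr (\<beta> - 1) * w t u))) \<le> H u"
    and GH: "integrable lborel (\<lambda>z. norm (G z) * H ((norm z)\<^sup>2))"
    and F: "\<And>t. t > 0 \<Longrightarrow> (LINT z|lborel. G z * of_real (w t ((norm z)\<^sup>2))) = F t"
  shows "(LINT t|lborel. of_real (indicator {0<..} t * t powr (\<beta> - 1)) * F t) = (LINT z|lborel. G z * of_real (P ((norm z)\<^sup>2)))"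
proof -
  let ?k = "\<lambda>t u. indicator {0<..} t * (t powr (\<beta> - 1) * w t u)"
  let ?f = "\<lambda>z t. G z * of_real (?k t ((norm z)\<^sup>2))"
  have [measurable]: "(\<lambda>x. w (f x) (g x)) \<in> borel_measurable M"
    if "f \<in> borel_measurable M" "g \<in> borel_measurable M" for f g and M :: "'z measure"
    using measurable_compose[OF measurable_Pair[OF that] w] by simp
  have m[measurable]: "case_prod ?f \<in> borel_measurable (lborel \<Otimes>\<^sub>M lborel)" by measurable
  have iw: "integrable lborel (\<lambda>t. ?k t ((norm z)\<^sup>2))" if "z \<noteq> 0" for z :: 'a
    using P[of "(norm z)\<^sup>2"] that by (simp add: has_bochner_integral_iff)
  have "integrable (lborel \<Otimes>\<^sub>M lborel) (case_prod ?f)"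
  proof (rule lborel_pair.Fubini_integrable[OF m])
    show "AE z in lborel. integrable lborel (\<lambda>t. case_prod ?f (z, t))"
      using AE_lborel_nonzero
    proof eventually_elim
      case (elim z)
      show ?case unfolding case_prod_conv by (intro integrable_mult_right integrable_of_real iw[OF elim])
    qed
    show "integrable lborel (\<lambda>z. LINT t|lborel. norm (case_prod ?f (z, t)))"
    proof (rule Bochner_Integration.integrable_bound[OF GH])
      show "AE z in lborel. norm (LINT t|lborel. norm (case_prod ?f (z, t))) \<le> norm (norm (G z) * H ((norm z)\<^sup>2))"
        using AE_lborel_nonzero
      proof eventually_elim
        case (elim z)
        have "(LINT t|lborel. norm (case_prod ?f (z, t))) = norm (G z) * (LINT t|lborel. norm (?k t ((norm z)\<^sup>2)))"
          unfolding case_prod_conv norm_mult[of "G z"] norm_of_real real_norm_def by (rule integral_mult_right_zero)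
        also have "\<dots> \<le> norm (G z) * H ((norm z)\<^sup>2)"
          using H[of "(norm z)\<^sup>2"] elim by (intro mult_left_mono) auto
        finally have "(LINT t|lborel. norm (case_prod ?f (z, t))) \<le> norm (G z) * H ((norm z)\<^sup>2)" .
        moreover have "(LINT t|lborel. norm (case_prod ?f (z, t))) \<ge> 0" by simp
        ultimately show ?case unfolding real_norm_def[of "LINT t|lborel. _ t"] real_norm_def[of "_ * _"] by linarith
      qed
    qed measurable
  qed
  from lborel_pair.Fubini_integral[OF this]
  have "(LINT t|lborel. LINT z|lborel. ?f z t) = (LINT z|lborel. LINT t|lborel. ?f z t)" .
  moreover have "(LINT t|lborel. LINT z|lborel. ?f z t) = (LINT t|lborel. of_real (indicator {0<..} t * t powr (\<beta> - 1)) * F t)"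
  proof (intro Bochner_Integration.integral_cong refl)
    fix t :: real
    have "(LINT z|lborel. ?f z t) = (LINT z|lborel. of_real (indicator {0<..} t * t powr (\<beta> - 1)) * (G z * of_real (w t ((norm z)\<^sup>2))))"
      by (intro Bochner_Integration.integral_cong refl) simp
    also have "\<dots> = of_real (indicator {0<..} t * t powr (\<beta> - 1)) * (LINT z|lborel. G z * of_real (w t ((norm z)\<^sup>2)))"
      by (rule integral_mult_right_zero)
    finally show "(LINT z|lborel. ?f z t) = of_real (indicator {0<..} t * t powr (\<beta> - 1)) * F t"
      using F[of t] by (cases "t > 0") auto
  qed
  moreover have "(LINT z|lborel. LINT t|lborel. ?f z t) = (LINT z|lborel. G z * of_real (P ((norm z)\<^sup>2)))"
  proof (rule integral_cong_AE)
    have "AE z in (lborel :: 'a measure). (LINT t|lborel. ?k t ((norm z)\<^sup>2)) = P ((norm z)\<^sup>2)"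
      using AE_lborel_nonzero
    proof eventually_elim
      case (elim z)
      thus ?case using P[of "(norm z)\<^sup>2"] by (simp add: has_bochner_integral_iff)
    qed
    thus "AE z in lborel. (LINT t|lborel. ?f z t) = G z * of_real (P ((norm z)\<^sup>2))"
    proof eventually_elim
      case (elim z)
      show ?case unfolding integral_mult_right_zero integral_complex_of_real elim ..
    qed
    show "(\<lambda>z. G z * of_real (P ((norm z)\<^sup>2))) \<in> borel_measurable lborel"
      by measurable
  qed measurable
  ultimately show ?thesis by simp
qed

lemma lborel_reflect: "distr (lborel :: 'a::euclidean_space measure) borel (\<lambda>z. x - z) = lborel"
  using lborel_affine[of "-1" x] by (simp add: density_1)

text \<open>
  The wave \<open>gauss_wave t 0 x\<close> is an admissible test function in the definition of the Fourier transform, and its own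
  transform is a Gaussian centered at \<open>x\<close>.
\<close>

lemma heat_identity:
  fixes g h :: "'a::euclidean_space \<Rightarrow> complex"
  assumes fou: "is_fourier g h" and t: "t > 0"
  shows "integrable lborel (\<lambda>\<xi>. h \<xi> * cis (x \<bullet> \<xi>) * of_real (exp (- t * (norm \<xi>)\<^sup>2)))" (is ?th1)
    and "integrable lborel (\<lambda>z. g (x - z) * of_real (exp (- (norm z)\<^sup>2 / (4 * t))))" (is ?th2)
    and "(LINT \<xi>|lborel. h \<xi> * cis (x \<bullet> \<xi>) * of_real (exp (- t * (norm \<xi>)\<^sup>2))) =
       of_real ((pi / t) powr (real DIM('a) / 2)) * (LINT z|lborel. g (x - z) * of_real (exp (- (norm z)\<^sup>2 / (4 * t))))" (is ?th3)
proof -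
  let ?c = "(pi / t) powr (real DIM('a) / 2)"
  have S: "schwartz (gauss_wave t 0 x)" by (rule schwartz_gauss_wave[OF t])
  have gm[measurable]: "g \<in> borel_measurable borel" using fou by (simp add: is_fourier_def)
  have fi: "fourier_integral (gauss_wave t 0 x) y = of_real (?c * exp (- (norm (x - y))\<^sup>2 / (4 * t)))" for y
  proof -
    have "gauss_wave t 0 x \<xi> * cis (- (\<xi> \<bullet> y)) = of_real (exp (-t * (norm \<xi>)\<^sup>2)) * cis (\<xi> \<bullet> (x - y))" for \<xi>
      by (simp add: gauss_wave_def cis_mult inner_diff_right inner_commute mult.assoc)
    thus ?thesis unfolding fourier_integral_def
      using has_bochner_integral_gauss_cis[OF t, of "x - y"] by (simp add: has_bochner_integral_iff)
  qed
  have gw: "h \<xi> * gauss_wave t 0 x \<xi> = h \<xi> * cis (x \<bullet> \<xi>) * of_real (exp (- t * (norm \<xi>)\<^sup>2))" for \<xi>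
    by (simp add: gauss_wave_def)
  have "integrable lborel (\<lambda>\<xi>. h \<xi> * gauss_wave t 0 x \<xi>)"
    and eq: "(LINT \<xi>|lborel. h \<xi> * gauss_wave t 0 x \<xi>) = (LINT y|lborel. g y * fourier_integral (gauss_wave t 0 x) y)"
    using fou S unfolding is_fourier_def by blast+
  thus ?th1 unfolding gw by simp
  have refl: "(LINT y|lborel. f y) = (LINT z|lborel. f (x - z))" if [measurable]: "f \<in> borel_measurable borel" for f :: "'a \<Rightarrow> complex"
    by (subst lborel_reflect[of x, symmetric], subst integral_distr) auto
  have "(LINT y|lborel. g y * fourier_integral (gauss_wave t 0 x) y) = of_real ?c * (LINT y|lborel. g y * of_real (exp (- (norm (x - y))\<^sup>2 / (4 * t))))"
    unfolding fi by (subst integral_mult_right_zero[symmetric]) (simp add: mult_ac)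
  also have "(LINT y|lborel. g y * of_real (exp (- (norm (x - y))\<^sup>2 / (4 * t)))) = (LINT z|lborel. g (x - z) * of_real (exp (- (norm z)\<^sup>2 / (4 * t))))"
    by (subst refl) auto
  finally show ?th3 using eq unfolding gw by simp
  have gw2: "gauss_wave (1 / (4 * t)) x 0 y = of_real (exp (- (norm (x - y))\<^sup>2 / (4 * t)))" for y
    by (simp add: gauss_wave_def norm_minus_commute)
  have "schwartz (gauss_wave (1 / (4 * t)) x 0)" by (rule schwartz_gauss_wave) (use t in simp)
  hence "integrable lborel (\<lambda>y. g y * gauss_wave (1 / (4 * t)) x 0 y)"
    using fou unfolding is_fourier_def by blast
  hence "integrable (distr lborel borel (\<lambda>z. x - z)) (\<lambda>y. g y * of_real (exp (- (norm (x - y))\<^sup>2 / (4 * t))))"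
    unfolding gw2 lborel_reflect .
  thus ?th2 by (subst (asm) integrable_distr_eq) auto
qed

lemma has_bochner_integral_Gamma_scaled:
  assumes c: "c > 0" and u: "u > (0::real)"
  shows "has_bochner_integral lborel (\<lambda>t. indicator {0<..} t * (t powr (c - 1) * exp (- t * u))) (Gamma c * u powr (- c))"
proof -
  have "has_bochner_integral lborel (\<lambda>s. indicator {0<..} s * (s powr (c - 1) * exp (- s))) (Gamma c)"
    using set_integrable_exp_rem[of 0 c] integral_exp_rem[of 0 c] c
    by (simp add: has_bochner_integral_iff set_integrable_def set_lebesgue_integral_def)
  hence "has_bochner_integral lborel (\<lambda>t. indicator {0<..} (0 + u * t) * ((0 + u * t) powr (c - 1) * exp (- (0 + u * t)))) (Gamma c /\<^sub>R \<bar>u\<bar>)"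
    using u by (subst lborel_has_bochner_integral_real_affine_iff[symmetric]) auto
  hence "has_bochner_integral lborel (\<lambda>t. u powr (1 - c) * (indicator {0<..} (0 + u * t) * ((0 + u * t) powr (c - 1) * exp (- (0 + u * t))))) (u powr (1 - c) * (Gamma c /\<^sub>R \<bar>u\<bar>))"
    by (rule has_bochner_integral_mult_right[rotated])
  moreover have "u powr (1 - c) * (indicator {0<..} (0 + u * t) * ((0 + u * t) powr (c - 1) * exp (- (0 + u * t)))) = indicator {0<..} t * (t powr (c - 1) * exp (- t * u))" for t
  proof (cases "t > 0")
    case True
    have "u powr (1 - c) * (u * t) powr (c - 1) = t powr (c - 1)"
      using u True by (simp add: powr_mult mult.assoc[symmetric] powr_add[symmetric])
    thus ?thesis using u True by (simp add: mult.assoc[symmetric] mult.commute[of u t])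
  qed (use u in \<open>auto simp: indicator_def zero_less_mult_iff\<close>)
  moreover have "u powr (1 - c) * (Gamma c /\<^sub>R \<bar>u\<bar>) = Gamma c * u powr (- c)"
    using u by (simp add: powr_diff powr_minus field_simps)
  ultimately show ?thesis by (simp only:)
qed

text \<open>
  Euler's integral represents \<open>\<bar>\<xi>\<bar>\<close> to the power \<open>- \<alpha>\<close> as a superposition of \<open>exp (- t \<bar>\<xi>\<bar>\<^sup>2)\<close>.
\<close>

lemma riesz_potential_heat:
  fixes h :: "'a::euclidean_space \<Rightarrow> complex"
  assumes \<alpha>: "\<alpha> > 0" and m[measurable]: "h \<in> borel_measurable borel"
    and i: "integrable lborel (\<lambda>\<xi>. norm (h \<xi>) * norm \<xi> powr (- \<alpha>))"
  shows "(LINT t|lborel. of_real (indicator {0<..} t * t powr (\<alpha> / 2 - 1)) * (LINT \<xi>|lborel. h \<xi> * cis (x \<bullet> \<xi>) * of_real (exp (- t * (norm \<xi>)\<^sup>2)))) =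
    of_real (Gamma (\<alpha> / 2)) * (LINT \<xi>|lborel. h \<xi> * cis (x \<bullet> \<xi>) * of_real (norm \<xi> powr (- \<alpha>)))"
proof -
  let ?P = "\<lambda>u::real. Gamma (\<alpha> / 2) * u powr (- (\<alpha> / 2))"
  have cism[measurable]: "(\<lambda>\<xi>. cis (x \<bullet> \<xi>)) \<in> borel_measurable borel"
    by (auto intro!: borel_measurable_continuous_onI continuous_intros simp: cis_conv_exp)
  have sq: "((norm \<xi>)\<^sup>2) powr (- (\<alpha> / 2)) = norm \<xi> powr (- \<alpha>)" for \<xi> :: 'a
    by (cases "\<xi> = 0") (use powr_powr[of "norm \<xi>" 2 "- (\<alpha> / 2)"] in auto)
  have P: "has_bochner_integral lborel (\<lambda>t. indicator {0<..} t * (t powr (\<alpha> / 2 - 1) * exp (- t * u))) (?P u)" if "u > 0" for u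
    by (rule has_bochner_integral_Gamma_scaled) (use \<alpha> that in auto)
  have "(LINT t|lborel. of_real (indicator {0<..} t * t powr (\<alpha> / 2 - 1)) * (LINT \<xi>|lborel. h \<xi> * cis (x \<bullet> \<xi>) * of_real (exp (- t * (norm \<xi>)\<^sup>2)))) =
    (LINT \<xi>|lborel. h \<xi> * cis (x \<bullet> \<xi>) * of_real (?P ((norm \<xi>)\<^sup>2)))"
  proof (rule integral_superposition[where w = "\<lambda>t u. exp (- t * u)" and H = ?P])
    show "(LINT t|lborel. norm (indicator {0<..} t * (t powr (\<alpha> / 2 - 1) * exp (- t * u)))) \<le> ?P u" if "u > 0" for u
      using P[OF that] by (simp add: has_bochner_integral_iff)
    have "integrable lborel (\<lambda>\<xi>. Gamma (\<alpha> / 2) * (norm (h \<xi>) * norm \<xi> powr (- \<alpha>)))" using i by simp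
    thus "integrable lborel (\<lambda>\<xi>. norm (h \<xi> * cis (x \<bullet> \<xi>)) * ?P ((norm \<xi>)\<^sup>2))"
      unfolding sq by (simp add: norm_mult mult_ac)
  qed (use P in \<open>simp_all\<close>)
  also have "\<dots> = of_real (Gamma (\<alpha> / 2)) * (LINT \<xi>|lborel. h \<xi> * cis (x \<bullet> \<xi>) * of_real (norm \<xi> powr (- \<alpha>)))"
    unfolding sq by (subst integral_mult_right_zero[symmetric]) (simp add: mult_ac)
  finally show ?thesis .
qed

text \<open>
  The subtracted Taylor terms integrate to multiples of vanishing moments.
\<close>

lemma integral_exp_rem_eq_heat:
  fixes G :: "'a::euclidean_space \<Rightarrow> complex"
  assumes i0: "integrable lborel (\<lambda>z. G z * of_real (exp (- (norm z)\<^sup>2 / (4 * t))))"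
    and M: "\<And>i. i < r \<Longrightarrow> integrable lborel (\<lambda>z. G z * of_real (norm z ^ (2 * i))) \<and> (LINT z|lborel. G z * of_real (norm z ^ (2 * i))) = 0"
  shows "has_bochner_integral lborel (\<lambda>z. G z * of_real (exp_rem r ((norm z)\<^sup>2 / (4 * t))))
     (LINT z|lborel. G z * of_real (exp (- (norm z)\<^sup>2 / (4 * t))))"
proof -
  have "has_bochner_integral lborel (\<lambda>z. G z * of_real (exp (- (norm z)\<^sup>2 / (4 * t))) -
      (\<Sum>i<r. of_real ((-1) ^ i / ((4 * t) ^ i * fact i)) * (G z * of_real (norm z ^ (2 * i)))))
     ((LINT z|lborel. G z * of_real (exp (- (norm z)\<^sup>2 / (4 * t)))) - (\<Sum>i<r. of_real ((-1) ^ i / ((4 * t) ^ i * fact i)) * 0))"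
    by (intro has_bochner_integral_diff has_bochner_integral_sum has_bochner_integral_mult_right)
       (use i0 M in \<open>auto simp: has_bochner_integral_iff\<close>)
  moreover have "G z * of_real (exp (- (norm z)\<^sup>2 / (4 * t))) -
      (\<Sum>i<r. of_real ((-1) ^ i / ((4 * t) ^ i * fact i)) * (G z * of_real (norm z ^ (2 * i))))
     = G z * of_real (exp_rem r ((norm z)\<^sup>2 / (4 * t)))" for z
  proof -
    have "(- ((norm z)\<^sup>2 / (4 * t))) ^ i / fact i = (-1) ^ i / ((4 * t) ^ i * fact i) * norm z ^ (2 * i)" for i
      by (subst power_minus) (simp add: power_divide power_mult)
    thus ?thesis
      by (simp add: exp_rem_def of_real_diff right_diff_distrib sum_distrib_left mult_ac)
  qed
  ultimately show ?thesis by simp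
qed

lemma power2_powr_norm: "((norm z)\<^sup>2) powr b = norm (z :: 'a::real_normed_vector) powr (2 * b)"
  by (cases "z = 0") (use powr_powr[of "norm z" 2 b] in auto)

text \<open>
  If \<open>N - d/2\<close> is not a natural number, \<open>exp_rem_Mellin\<close> applies with the Taylor polynomial of the matching order and
  the Gamma function in \<open>riesz_coeffs\<close> comes out. Otherwise \<open>log_rem_Mellin\<close> gives the logarithm with the right
  coefficient, and a multiple of \<open>\<bar>z\<bar>\<close> to the power \<open>2 N - d\<close> that is again a vanishing moment.
\<close>

lemma powlog_integral_heat:
  fixes G :: "'a::euclidean_space \<Rightarrow> complex"
  assumes R: "riesz_coeffs d N A B"
    and Gm[measurable]: "G \<in> borel_measurable borel"
    and I1: "integrable lborel (\<lambda>z. norm (G z) * (norm z powr (2 * N - d) * (1 + \<bar>ln (norm z)\<bar>)))"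
    and I0: "\<And>t. t > 0 \<Longrightarrow> integrable lborel (\<lambda>z. G z * of_real (exp (- (norm z)\<^sup>2 / (4 * t))))"
    and M: "\<And>i. real i \<le> real N - d / 2 \<Longrightarrow> integrable lborel (\<lambda>z. G z * of_real (norm z ^ (2 * i))) \<and> (LINT z|lborel. G z * of_real (norm z ^ (2 * i))) = 0"
  shows "(LINT z|lborel. G z * of_real (powlog (real N - d / 2) A B ((norm z)\<^sup>2))) =
     of_real ((-1) ^ N / ((4 * pi) powr (d / 2) * fact (N - 1))) *
     (LINT t|lborel. of_real (indicator {0<..} t * t powr (real N - d / 2 - 1)) * (LINT z|lborel. G z * of_real (exp (- (norm z)\<^sup>2 / (4 * t)))))"
proof -
  define b where "b = real N - d / 2"
  have b2: "2 * b = 2 * real N - d" by (simp add: b_def)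
  define F where "F = (\<lambda>t. LINT z|lborel. G z * of_real (exp (- (norm z)\<^sup>2 / (4 * t))))"
  let ?c = "(-1) ^ N / ((4 * pi) powr (d / 2) * fact (N - 1)) :: real"
  have cst: "4 powr (- b) / (4 * pi) powr (d / 2) = 1 / (4 ^ N * pi powr (d / 2))"
  proof -
    have "4 powr (- b) = 4 powr (d / 2) / 4 powr real N"
      using powr_diff[of 4 "d / 2" "real N"] by (simp add: b_def)
    moreover have "4 powr real N = 4 ^ N" by (rule powr_realpow) simp
    moreover have "(4 * pi) powr (d / 2) = 4 powr (d / 2) * pi powr (d / 2)" by (simp add: powr_mult)
    moreover have "4 powr (d / 2) \<noteq> 0" by simp
    ultimately show ?thesis by (simp add: field_simps)
  qed
  have u4: "((norm z)\<^sup>2 / 4) powr b = 4 powr (- b) * norm z powr (2 * b)" for z :: 'a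
    by (simp add: powr_divide power2_powr_norm powr_minus field_simps)
  note I1 = I1[folded b2]
  have I1': "integrable lborel (\<lambda>z. norm (G z) * norm z powr (2 * b))"
    by (rule Bochner_Integration.integrable_bound[OF I1]) (auto simp: algebra_simps)
  have I2: "integrable lborel (\<lambda>z. norm (G z) * (norm z powr (2 * b) * \<bar>ln (norm z)\<bar>))"
    by (rule Bochner_Integration.integrable_bound[OF I1]) (auto simp: abs_mult algebra_simps)
  show ?thesis
  proof (cases "even d \<and> d \<le> 2 * N")
    case False
    hence AB: "B = 0" "A = (-1) ^ N * Gamma (d / 2 - N) / (4 ^ N * pi powr (d / 2) * fact (N - 1))"
      using R unfolding riesz_coeffs_def by auto
    \<comment> \<open>The number of Taylor terms for which \<open>b\<close> lies in the open strip of convergence; for negative \<open>b\<close> it is zero.\<close>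
    define r where "r = nat \<lceil>b\<rceil>"
    have r: "b < real r" "r > 0 \<Longrightarrow> b > real r - 1"
    proof -
      have "b \<noteq> real r"
      proof
        assume "b = real r"
        hence "real d = 2 * (real N - real r)" by (simp add: b_def)
        hence "real (d + 2 * r) = real (2 * N)" by simp
        hence "d + 2 * r = 2 * N" by (simp only: of_nat_eq_iff)
        hence "even d \<and> d \<le> 2 * N" by presburger
        thus False using False by blast
      qed
      moreover have "b \<le> real r" unfolding r_def by linarith
      ultimately show "b < real r" by simp
      show "b > real r - 1" if "r > 0" using that unfolding r_def by linarith
    qed
    obtain K where K: "\<And>u. u > 0 \<Longrightarrow> has_bochner_integral lborel (\<lambda>t. indicator {0<..} t * (t powr (b - 1) * exp_rem r (u / (4 * t)))) ((u / 4) powr b * Gamma (- b))"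
      "\<And>u. u > 0 \<Longrightarrow> (LINT t|lborel. norm (indicator {0<..} t * (t powr (b - 1) * exp_rem r (u / (4 * t))))) = (u / 4) powr b * K"
      using exp_rem_Mellin[OF r] by blast
    have "(LINT t|lborel. of_real (indicator {0<..} t * t powr (b - 1)) * F t) =
      (LINT z|lborel. G z * of_real (((norm z)\<^sup>2 / 4) powr b * Gamma (- b)))"
    proof (rule integral_superposition[where w = "\<lambda>t u. exp_rem r (u / (4 * t))" and H = "\<lambda>u. (u / 4) powr b * K"])
      have "integrable lborel (\<lambda>z. (4 powr (- b) * K) * (norm (G z) * norm z powr (2 * b)))" using I1' by simp
      thus "integrable lborel (\<lambda>z. norm (G z) * (((norm z)\<^sup>2 / 4) powr b * K))"
        unfolding u4 by (simp add: mult_ac)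
      show "(LINT z|lborel. G z * of_real (exp_rem r ((norm z)\<^sup>2 / (4 * t)))) = F t" if "t > 0" for t
        using integral_exp_rem_eq_heat[OF I0[OF that], of r] M r unfolding F_def b_def[symmetric]
        by (force simp: has_bochner_integral_iff)
    qed (use K in \<open>simp_all\<close>)
    hence "of_real ?c * (LINT t|lborel. of_real (indicator {0<..} t * t powr (b - 1)) * F t) =
      (LINT z|lborel. of_real ?c * (G z * of_real (((norm z)\<^sup>2 / 4) powr b * Gamma (- b))))"
      by (simp only: integral_mult_right_zero)
    moreover have "of_real ?c * (G z * of_real (((norm z)\<^sup>2 / 4) powr b * Gamma (- b))) = G z * of_real (powlog b A B ((norm z)\<^sup>2))" for z
    proof -
      have "?c * (((norm z)\<^sup>2 / 4) powr b * Gamma (- b)) = (-1) ^ N / fact (N - 1) * (4 powr (- b) / (4 * pi) powr (d / 2)) * Gamma (- b) * norm z powr (2 * b)"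
        unfolding u4 by (simp add: mult_ac)
      also have "\<dots> = powlog b A B ((norm z)\<^sup>2)"
        unfolding cst AB powlog_def power2_powr_norm by (simp add: b_def mult_ac)
      finally have "of_real ?c * (complex_of_real (((norm z)\<^sup>2 / 4) powr b * Gamma (- b))) = of_real (powlog b A B ((norm z)\<^sup>2))"
        by (simp only: of_real_mult[symmetric])
      thus ?thesis by (metis mult.left_commute)
    qed
    ultimately show ?thesis unfolding F_def b_def by (simp only:)
  next
    case True
    define r where "r = N - d div 2"
    have br: "b = real r" using True by (auto simp: b_def r_def elim!: evenE)
    have B: "B = - ((-1) ^ N * (-1) ^ r) / (fact r * 4 ^ N * pi powr (d / 2) * fact (N - 1))"
      using R True unfolding riesz_coeffs_def r_def by simp
    obtain a K where K: "\<And>u. u > 0 \<Longrightarrow> has_bochner_integral lborel (\<lambda>t. indicator {0<..} t * (t powr (real r - 1) * log_rem r (u / 4) (u / (4 * t))))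
       ((u / 4) powr real r * (a - (-1) ^ r / fact r * ln (u / 4)))"
      "\<And>u. u > 0 \<Longrightarrow> (LINT t|lborel. norm (indicator {0<..} t * (t powr (real r - 1) * log_rem r (u / 4) (u / (4 * t)))))
       \<le> (u / 4) powr real r * (K + \<bar>ln (u / 4)\<bar>)"
      using log_rem_Mellin[of r] by blast
    have Mr: "integrable lborel (\<lambda>z. G z * of_real (norm z ^ (2 * r)))" "(LINT z|lborel. G z * of_real (norm z ^ (2 * r))) = 0"
      using M[of r] br unfolding b_def by auto
    have pr: "norm z powr (2 * b) = norm z ^ (2 * r)" if "z \<noteq> 0" for z :: 'a
      unfolding br using that by (simp add: powr_realpow[symmetric])
    have lnu: "ln ((norm z)\<^sup>2 / 4) = 2 * ln (norm z) - ln 4" if "z \<noteq> 0" for z :: 'a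
      using that by (simp add: ln_div ln_realpow)
    have "(LINT t|lborel. of_real (indicator {0<..} t * t powr (b - 1)) * F t) =
      (LINT z|lborel. G z * of_real (((norm z)\<^sup>2 / 4) powr b * (a - (-1) ^ r / fact r * ln ((norm z)\<^sup>2 / 4))))"
      unfolding br
    proof (rule integral_superposition[where w = "\<lambda>t u. log_rem r (u / 4) (u / (4 * t))" and H = "\<lambda>u. (u / 4) powr real r * (K + \<bar>ln (u / 4)\<bar>)"])
      show "(\<lambda>(t, u). log_rem r (u / 4) (u / (4 * t))) \<in> borel_measurable (borel \<Otimes>\<^sub>M borel)"
        unfolding log_rem_def by measurable
      have "integrable lborel (\<lambda>z. (4 powr (- b) * (\<bar>K\<bar> + ln 4)) * (norm (G z) * norm z powr (2 * b)) + (4 powr (- b) * 2) * (norm (G z) * (norm z powr (2 * b) * \<bar>ln (norm z)\<bar>)))"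
        by (intro Bochner_Integration.integrable_add integrable_mult_right I1' I2)
      thus "integrable lborel (\<lambda>z. norm (G z) * (((norm z)\<^sup>2 / 4) powr real r * (K + \<bar>ln ((norm z)\<^sup>2 / 4)\<bar>)))"
      proof (rule Bochner_Integration.integrable_bound)
        show "AE z in lborel. norm (norm (G z) * (((norm z)\<^sup>2 / 4) powr real r * (K + \<bar>ln ((norm z)\<^sup>2 / 4)\<bar>))) \<le>
          norm ((4 powr (- b) * (\<bar>K\<bar> + ln 4)) * (norm (G z) * norm z powr (2 * b)) + (4 powr (- b) * 2) * (norm (G z) * (norm z powr (2 * b) * \<bar>ln (norm z)\<bar>)))"
          using AE_lborel_nonzero
        proof eventually_elim
          case (elim z)
          have "\<bar>K + \<bar>ln ((norm z)\<^sup>2 / 4)\<bar>\<bar> \<le> (\<bar>K\<bar> + ln 4) + 2 * \<bar>ln (norm z)\<bar>"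
            unfolding lnu[OF elim] using ln_ge_zero[of 4] by linarith
          hence "norm (norm (G z) * (((norm z)\<^sup>2 / 4) powr real r * (K + \<bar>ln ((norm z)\<^sup>2 / 4)\<bar>))) \<le> norm (G z) * (((norm z)\<^sup>2 / 4) powr b * ((\<bar>K\<bar> + ln 4) + 2 * \<bar>ln (norm z)\<bar>))"
            unfolding br by (simp add: abs_mult mult_left_mono)
          also have "\<dots> = (4 powr (- b) * (\<bar>K\<bar> + ln 4)) * (norm (G z) * norm z powr (2 * b)) + (4 powr (- b) * 2) * (norm (G z) * (norm z powr (2 * b) * \<bar>ln (norm z)\<bar>))"
            unfolding u4 by (simp add: algebra_simps)
          finally show ?case by simp
        qed
      qed measurable
      show "(LINT z|lborel. G z * of_real (log_rem r ((norm z)\<^sup>2 / 4) ((norm z)\<^sup>2 / (4 * t)))) = F t" if t: "t > 0" for t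
      proof -
        have 1: "has_bochner_integral lborel (\<lambda>z. G z * of_real (exp_rem r ((norm z)\<^sup>2 / (4 * t)))) (F t)"
          unfolding F_def using M br by (intro integral_exp_rem_eq_heat I0 t) (auto simp: b_def)
        \<comment> \<open>The cutoff term is a multiple of a moment for each fixed \<open>t\<close>.\<close>
        let ?q = "complex_of_real (if t > 1 then (-1) ^ r / ((4 * t) ^ r * fact r) else 0)"
        have "has_bochner_integral lborel (\<lambda>z. G z * of_real (exp_rem r ((norm z)\<^sup>2 / (4 * t))) - ?q * (G z * of_real (norm z ^ (2 * r)))) (F t - ?q * 0)"
          by (intro has_bochner_integral_diff 1 has_bochner_integral_mult_right) (use Mr in \<open>simp add: has_bochner_integral_iff\<close>)
        hence "(LINT z|lborel. G z * of_real (exp_rem r ((norm z)\<^sup>2 / (4 * t))) - ?q * (G z * of_real (norm z ^ (2 * r)))) = F t"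
          by (simp add: has_bochner_integral_iff)
        moreover have "(LINT z|lborel. G z * of_real (exp_rem r ((norm z)\<^sup>2 / (4 * t))) - ?q * (G z * of_real (norm z ^ (2 * r)))) =
          (LINT z|lborel. G z * of_real (log_rem r ((norm z)\<^sup>2 / 4) ((norm z)\<^sup>2 / (4 * t))))"
        proof (rule integral_cong_AE)
          show "AE z in lborel. G z * of_real (exp_rem r ((norm z)\<^sup>2 / (4 * t))) - ?q * (G z * of_real (norm z ^ (2 * r))) =
            G z * of_real (log_rem r ((norm z)\<^sup>2 / 4) ((norm z)\<^sup>2 / (4 * t)))"
            using AE_lborel_nonzero
          proof eventually_elim
            case (elim z)
            have "(- ((norm z)\<^sup>2 / (4 * t))) ^ r / fact r = (-1) ^ r / ((4 * t) ^ r * fact r) * norm z ^ (2 * r)"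
              by (subst power_minus) (simp add: power_divide power_mult)
            moreover have "(norm z)\<^sup>2 / (4 * t) < (norm z)\<^sup>2 / 4 \<longleftrightarrow> t > 1"
              using elim t by (simp add: field_simps)
            ultimately show ?case
              by (simp add: log_rem_def right_diff_distrib mult_ac)
          qed
        qed (auto simp: log_rem_def)
        ultimately show ?thesis by simp
      qed
    qed (use K in \<open>simp_all\<close>)
    hence eq: "of_real ?c * (LINT t|lborel. of_real (indicator {0<..} t * t powr (b - 1)) * F t) =
      (LINT z|lborel. of_real ?c * (G z * of_real (((norm z)\<^sup>2 / 4) powr b * (a - (-1) ^ r / fact r * ln ((norm z)\<^sup>2 / 4)))))"
      by (simp only: integral_mult_right_zero)
    \<comment> \<open>\<open>Q\<close> collects the free coefficient and the constants of the Mellin integral; its contribution is a vanishing moment.\<close>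
    define Q where "Q = A - ?c * 4 powr (- b) * (a + (-1) ^ r / fact r * ln 4)"
    have pw: "powlog b A B ((norm z)\<^sup>2) = ?c * (((norm z)\<^sup>2 / 4) powr b * (a - (-1) ^ r / fact r * ln ((norm z)\<^sup>2 / 4))) + Q * norm z ^ (2 * r)"
      if z: "z \<noteq> 0" for z :: 'a
    proof -
      have cB: "?c * 4 powr (- b) * ((-1) ^ r / fact r) = - B"
      proof -
        have "?c * 4 powr (- b) * ((-1) ^ r / fact r) = (-1) ^ N / fact (N - 1) * (4 powr (- b) / (4 * pi) powr (d / 2)) * ((-1) ^ r / fact r)" by (simp add: mult_ac)
        thus ?thesis unfolding cst B by (simp add: mult_ac)
      qed
      have "?c * (((norm z)\<^sup>2 / 4) powr b * (a - (-1) ^ r / fact r * ln ((norm z)\<^sup>2 / 4))) =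
         norm z powr (2 * b) * (?c * 4 powr (- b) * (a + (-1) ^ r / fact r * ln 4) - (?c * 4 powr (- b) * ((-1) ^ r / fact r)) * (2 * ln (norm z)))"
        unfolding u4 lnu[OF z] by (simp add: algebra_simps add_divide_distrib)
      also have "\<dots> = norm z powr (2 * b) * (A - Q + B * (2 * ln (norm z)))" unfolding cB Q_def by simp
      finally have "?c * (((norm z)\<^sup>2 / 4) powr b * (a - (-1) ^ r / fact r * ln ((norm z)\<^sup>2 / 4))) + Q * norm z ^ (2 * r) = norm z powr (2 * b) * (A + B * (2 * ln (norm z)))"
        unfolding pr[OF z, symmetric] by (simp add: algebra_simps)
      thus ?thesis unfolding powlog_def power2_powr_norm using z by (simp add: ln_realpow)
    qed
    have iP: "integrable lborel (\<lambda>z. of_real ?c * (G z * of_real (((norm z)\<^sup>2 / 4) powr b * (a - (-1) ^ r / fact r * ln ((norm z)\<^sup>2 / 4)))))"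
      (is "integrable _ ?Pz")
    proof -
      have "integrable lborel (\<lambda>z. \<bar>?c\<bar> * 4 powr (- b) * ((\<bar>a\<bar> + \<bar>ln 4\<bar>) * (norm (G z) * norm z powr (2 * b)) + 2 * (norm (G z) * (norm z powr (2 * b) * \<bar>ln (norm z)\<bar>))))"
        by (intro Bochner_Integration.integrable_add integrable_mult_right I1' I2)
      thus ?thesis
      proof (rule Bochner_Integration.integrable_bound)
        show "AE z in lborel. norm (?Pz z) \<le> norm (\<bar>?c\<bar> * 4 powr (- b) * ((\<bar>a\<bar> + \<bar>ln 4\<bar>) * (norm (G z) * norm z powr (2 * b)) + 2 * (norm (G z) * (norm z powr (2 * b) * \<bar>ln (norm z)\<bar>))))"
          using AE_lborel_nonzero
        proof eventually_elim
          case (elim z)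
          let ?L = "ln ((norm z)\<^sup>2 / 4)"
          have "\<bar>(-1) ^ r / fact r * ?L\<bar> = \<bar>?L\<bar> / fact r" by (simp add: abs_mult)
          also have "\<dots> \<le> \<bar>?L\<bar> / 1" by (rule divide_left_mono) auto
          finally have "\<bar>a - (-1) ^ r / fact r * ?L\<bar> \<le> \<bar>a\<bar> + \<bar>?L\<bar>"
            using abs_triangle_ineq4[of a "(-1) ^ r / fact r * ?L"] by linarith
          also have "\<dots> \<le> \<bar>a\<bar> + \<bar>ln 4\<bar> + 2 * \<bar>ln (norm z)\<bar>" unfolding lnu[OF elim] by linarith
          finally have le: "\<bar>a - (-1) ^ r / fact r * ?L\<bar> \<le> \<bar>a\<bar> + \<bar>ln 4\<bar> + 2 * \<bar>ln (norm z)\<bar>" .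
          have "norm (?Pz z) = \<bar>?c\<bar> * (norm (G z) * (((norm z)\<^sup>2 / 4) powr b * \<bar>a - (-1) ^ r / fact r * ?L\<bar>))"
            by (simp only: norm_mult norm_of_real abs_mult abs_of_nonneg[OF powr_ge_zero])
          also have "\<dots> \<le> \<bar>?c\<bar> * (norm (G z) * (((norm z)\<^sup>2 / 4) powr b * (\<bar>a\<bar> + \<bar>ln 4\<bar> + 2 * \<bar>ln (norm z)\<bar>)))"
            by (intro mult_left_mono le) auto
          also have "\<dots> = \<bar>?c\<bar> * 4 powr (- b) * ((\<bar>a\<bar> + \<bar>ln 4\<bar>) * (norm (G z) * norm z powr (2 * b)) + 2 * (norm (G z) * (norm z powr (2 * b) * \<bar>ln (norm z)\<bar>)))"
            unfolding u4 by (simp only: algebra_simps)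
          finally show ?case by (rule order_trans) (simp only: real_norm_def abs_ge_self)
        qed
      qed measurable
    qed
    have "(LINT z|lborel. G z * of_real (powlog b A B ((norm z)\<^sup>2))) = (LINT z|lborel. ?Pz z + of_real Q * (G z * of_real (norm z ^ (2 * r))))"
    proof (rule integral_cong_AE)
      show "AE z in lborel. G z * of_real (powlog b A B ((norm z)\<^sup>2)) = ?Pz z + of_real Q * (G z * of_real (norm z ^ (2 * r)))"
        using AE_lborel_nonzero
      proof eventually_elim
        case (elim z)
        show ?case unfolding pw[OF elim] by (simp only: of_real_add of_real_mult distrib_left mult_ac)
      qed
    qed (auto simp: powlog_def)
    also have "\<dots> = (LINT z|lborel. ?Pz z) + of_real Q * (LINT z|lborel. G z * of_real (norm z ^ (2 * r)))"
      by (subst Bochner_Integration.integral_add[OF iP]) (use Mr(1) in \<open>simp_all only: integrable_mult_right integral_mult_right_zero\<close>)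
    also have "\<dots> = of_real ?c * (LINT t|lborel. of_real (indicator {0<..} t * t powr (b - 1)) * F t)"
      unfolding Mr(2) eq by simp
    finally show ?thesis unfolding F_def b_def .
  qed
qed

section \<open>Vanishing moments\<close>

lemma powr_exp_bounded:
  assumes c: "c \<ge> (0::real)"
  obtains K where "\<And>y. y \<ge> 0 \<Longrightarrow> y powr c * exp (- y) \<le> K"
proof -
  define k where "k = nat \<lceil>c\<rceil>"
  have ck: "c \<le> real k" unfolding k_def by linarith
  show thesis
  proof (rule that)
    fix y :: real assume y: "y \<ge> 0"
    show "y powr c * exp (- y) \<le> fact k"
    proof (cases "y \<ge> 1")
      case True
      have "y powr c \<le> y powr real k" using True ck by (intro powr_mono) auto
      also have "\<dots> = y ^ k" using True by (simp add: powr_realpow)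
      also have "\<dots> \<le> fact k * exp y"
      proof -
        have "(\<Sum>n\<in>{k}. y ^ n /\<^sub>R fact n) \<le> exp y"
          unfolding exp_def by (rule sum_le_suminf[OF summable_exp_generic]) (use y in auto)
        thus ?thesis by (simp add: field_simps)
      qed
      finally show ?thesis by (simp add: exp_minus field_simps)
    next
      case False
      have "y powr c * exp (- y) \<le> 1 * 1"
        using False y c powr_mono2[of c y 1] by (intro mult_mono) auto
      also have "\<dots> \<le> (fact k :: real)" by simp
      finally show ?thesis .
    qed
  qed
qed

text \<open>
  On the Fourier side the function is, up to a constant, \<open>t\<close> to the power \<open>(p + n) / 2\<close> times an integral of \<open>exp (- t \<bar>\<xi>\<bar>\<^sup>2)\<close>, with
  \<open>n\<close> the dimension; by \<open>H\<close> dominated convergence applies.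
\<close>

lemma heat_decay:
  fixes g h :: "'a::euclidean_space \<Rightarrow> complex"
  assumes fou: "is_fourier g h"
    and H: "integrable lborel (\<lambda>\<xi>. norm (h \<xi>) * norm \<xi> powr (- (real p + DIM('a))))"
  shows "((\<lambda>t. of_real (t powr (real p / 2)) * (LINT z|lborel. g (x - z) * of_real (exp (- (norm z)\<^sup>2 / (4 * t))))) \<longlongrightarrow> 0) at_top"
proof -
  define c where "c = (real p + DIM('a)) / 2"
  have c: "c > 0" by (simp add: c_def add_nonneg_pos)
  obtain K where K: "\<And>y. y \<ge> 0 \<Longrightarrow> y powr c * exp (- y) \<le> K"
    using powr_exp_bounded[of c] c by auto
  have [measurable]: "h \<in> borel_measurable borel" using fou by (simp add: is_fourier_def)
  have cism[measurable]: "(\<lambda>\<xi>. cis (x \<bullet> \<xi>)) \<in> borel_measurable borel"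
    by (auto intro!: borel_measurable_continuous_onI continuous_intros simp: cis_conv_exp)
  let ?s = "\<lambda>t \<xi>. h \<xi> * cis (x \<bullet> \<xi>) * of_real (t powr c * exp (- t * (norm \<xi>)\<^sup>2))"
  have lim: "((\<lambda>t. LINT \<xi>|lborel. ?s t \<xi>) \<longlongrightarrow> (LINT \<xi>|(lborel :: 'a measure). 0)) at_top"
  proof (rule integral_dominated_convergence_at_top)
    show "integrable lborel (\<lambda>\<xi>. K * (norm (h \<xi>) * norm \<xi> powr (- (real p + DIM('a)))))" using H by simp
    show "AE \<xi> in lborel. ((\<lambda>t. ?s t \<xi>) \<longlongrightarrow> 0) at_top"
      using AE_lborel_nonzero
    proof eventually_elim
      case (elim \<xi>)
      define l where "l = (norm \<xi>)\<^sup>2"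
      have "l > 0" using elim by (simp add: l_def)
      hence "((\<lambda>t. t powr c * exp (- t * l)) \<longlongrightarrow> 0) at_top" using c by real_asymp
      hence "((\<lambda>t. h \<xi> * cis (x \<bullet> \<xi>) * complex_of_real (t powr c * exp (- t * l))) \<longlongrightarrow> h \<xi> * cis (x \<bullet> \<xi>) * of_real 0) at_top"
        by (intro tendsto_mult tendsto_const tendsto_of_real)
      thus ?case by (simp only: l_def of_real_0 mult_zero_right)
    qed
    show "\<forall>\<^sub>F t in at_top. AE \<xi> in lborel. norm (?s t \<xi>) \<le> K * (norm (h \<xi>) * norm \<xi> powr (- (real p + DIM('a))))"
      using eventually_gt_at_top[of 0]
    proof eventually_elim
      case (elim t)
      show ?case using AE_lborel_nonzero
      proof eventually_elim
        case (elim \<xi>)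
        have n: "norm \<xi> > 0" using elim by simp
        have "norm \<xi> powr (real p + DIM('a)) = ((norm \<xi>)\<^sup>2) powr c"
        proof -
          have "2 * c = real p + DIM('a)" by (simp add: c_def)
          thus ?thesis unfolding power2_powr_norm by simp
        qed
        moreover have "norm \<xi> powr (real p + DIM('a)) * norm \<xi> powr (- (real p + DIM('a))) = 1"
          using n by (simp only: powr_add[symmetric]) simp
        moreover have "(t * (norm \<xi>)\<^sup>2) powr c = t powr c * ((norm \<xi>)\<^sup>2) powr c"
          using n \<open>0 < t\<close> by (simp add: powr_mult)
        ultimately have e: "t powr c = (t * (norm \<xi>)\<^sup>2) powr c * norm \<xi> powr (- (real p + DIM('a)))"
          by (metis mult.assoc mult.right_neutral)
        have "t powr c * exp (- t * (norm \<xi>)\<^sup>2) = ((t * (norm \<xi>)\<^sup>2) powr c * exp (- (t * (norm \<xi>)\<^sup>2))) * norm \<xi> powr (- (real p + DIM('a)))"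
          unfolding e by simp
        also have "\<dots> \<le> K * norm \<xi> powr (- (real p + DIM('a)))"
          by (intro mult_right_mono K) (use \<open>0 < t\<close> in auto)
        finally have "t powr c * exp (- t * (norm \<xi>)\<^sup>2) \<le> K * norm \<xi> powr (- (real p + DIM('a)))" .
        hence "norm (h \<xi>) * (t powr c * exp (- t * (norm \<xi>)\<^sup>2)) \<le> norm (h \<xi>) * (K * norm \<xi> powr (- (real p + DIM('a))))"
          by (rule mult_left_mono) simp
        thus ?case by (simp add: norm_mult mult_ac)
      qed
    qed
  qed measurable
  have eq: "of_real (t powr (real p / 2)) * (LINT z|lborel. g (x - z) * of_real (exp (- (norm z)\<^sup>2 / (4 * t)))) =
     of_real (pi powr (- (real DIM('a) / 2))) * (LINT \<xi>|lborel. ?s t \<xi>)" if t: "t > 0" for t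
  proof -
    have "(LINT \<xi>|lborel. ?s t \<xi>) = (LINT \<xi>|lborel. of_real (t powr c) * (h \<xi> * cis (x \<bullet> \<xi>) * of_real (exp (- t * (norm \<xi>)\<^sup>2))))"
      by (intro Bochner_Integration.integral_cong refl) (simp add: mult_ac)
    also have "\<dots> = of_real (t powr c * (pi / t) powr (real DIM('a) / 2)) * (LINT z|lborel. g (x - z) * of_real (exp (- (norm z)\<^sup>2 / (4 * t))))"
      unfolding integral_mult_right_zero heat_identity(3)[OF fou t] by simp
    also have "t powr c * (pi / t) powr (real DIM('a) / 2) = pi powr (real DIM('a) / 2) * t powr (real p / 2)"
      using t by (simp add: c_def powr_divide add_divide_distrib powr_add)
    finally show ?thesis by (simp add: powr_minus field_simps)
  qed
  have "((\<lambda>t. of_real (pi powr (- (real DIM('a) / 2))) * (LINT \<xi>|lborel. ?s t \<xi>)) \<longlongrightarrow> of_real (pi powr (- (real DIM('a) / 2))) * 0) at_top"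
    using lim by (intro tendsto_mult tendsto_const) simp
  moreover have "eventually (\<lambda>t. of_real (pi powr (- (real DIM('a) / 2))) * (LINT \<xi>|lborel. ?s t \<xi>) =
      of_real (t powr (real p / 2)) * (LINT z|lborel. g (x - z) * of_real (exp (- (norm z)\<^sup>2 / (4 * t))))) at_top"
    using eventually_gt_at_top[of 0] by eventually_elim (use eq in simp)
  ultimately show ?thesis by (simp add: Lim_transform_eventually)
qed

text \<open>
  Once the lower moments are zero, \<open>(4 t)\<^sup>i\<close> times the heat integral converges to a nonzero multiple of the moment of order
  \<open>2 i\<close>, whereas \<open>heat_decay\<close> forces the limit zero for \<open>2 i \<le> p\<close>.
\<close>

lemma moments_vanish:
  fixes g h :: "'a::euclidean_space \<Rightarrow> complex"
  assumes fou: "is_fourier g h"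
    and H: "integrable lborel (\<lambda>\<xi>. norm (h \<xi>) * norm \<xi> powr (- (real p + DIM('a))))"
    and G: "\<And>i. 2 * i \<le> p \<Longrightarrow> integrable lborel (\<lambda>z. g (x - z) * of_real (norm z ^ (2 * i)))"
  shows "2 * i \<le> p \<Longrightarrow> (LINT z|lborel. g (x - z) * of_real (norm z ^ (2 * i))) = 0"
proof (induction i rule: less_induct)
  case (less i)
  have [measurable]: "g \<in> borel_measurable borel" using fou by (simp add: is_fourier_def)
  define F where "F = (\<lambda>t. LINT z|lborel. g (x - z) * of_real (exp (- (norm z)\<^sup>2 / (4 * t))))"
  have M: "integrable lborel (\<lambda>z. g (x - z) * of_real (norm z ^ (2 * l))) \<and> (LINT z|lborel. g (x - z) * of_real (norm z ^ (2 * l))) = 0" if "l < i" for l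
    using less that G[of l] by auto
  have Fi: "(LINT z|lborel. g (x - z) * of_real (exp_rem i ((norm z)\<^sup>2 / (4 * t)))) = F t" if "t > 0" for t
    using integral_exp_rem_eq_heat[OF heat_identity(2)[OF fou that, of x] M] unfolding F_def
    by (simp add: has_bochner_integral_iff)
  let ?s = "\<lambda>t z. g (x - z) * of_real ((4 * t) ^ i * exp_rem i ((norm z)\<^sup>2 / (4 * t)))"
  have lim: "((\<lambda>t. LINT z|lborel. ?s t z) \<longlongrightarrow> (LINT z|lborel. of_real ((-1) ^ i / fact i) * (g (x - z) * of_real (norm z ^ (2 * i))))) at_top"
  proof (rule integral_dominated_convergence_at_top)
    show "integrable lborel (\<lambda>z. norm (g (x - z) * of_real (norm z ^ (2 * i))))"
      using G[OF less.prems] by (rule integrable_norm)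
    show "AE z in lborel. ((\<lambda>t. ?s t z) \<longlongrightarrow> of_real ((-1) ^ i / fact i) * (g (x - z) * of_real (norm z ^ (2 * i)))) at_top"
      using AE_lborel_nonzero
    proof eventually_elim
      case (elim z)
      define u where "u = (norm z)\<^sup>2"
      have u: "u > 0" using elim by (simp add: u_def)
      have "filterlim (\<lambda>t. u / (4 * t)) (at_right 0) at_top" using u by real_asymp
      from filterlim_compose[OF exp_rem_tendsto[of i] this]
      have "((\<lambda>t. u ^ i * (exp_rem i (u / (4 * t)) / (u / (4 * t)) ^ i)) \<longlongrightarrow> u ^ i * ((-1) ^ i / fact i)) at_top"
        by (intro tendsto_mult tendsto_const)
      moreover have "eventually (\<lambda>t. u ^ i * (exp_rem i (u / (4 * t)) / (u / (4 * t)) ^ i) = (4 * t) ^ i * exp_rem i (u / (4 * t))) at_top"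
        using eventually_gt_at_top[of 0] by eventually_elim (use u in \<open>simp add: power_divide\<close>)
      ultimately have "((\<lambda>t. (4 * t) ^ i * exp_rem i (u / (4 * t))) \<longlongrightarrow> u ^ i * ((-1) ^ i / fact i)) at_top"
        by (rule Lim_transform_eventually)
      hence "((\<lambda>t. g (x - z) * complex_of_real ((4 * t) ^ i * exp_rem i (u / (4 * t)))) \<longlongrightarrow> g (x - z) * of_real (u ^ i * ((-1) ^ i / fact i))) at_top"
        by (rule tendsto_mult[OF tendsto_const tendsto_of_real])
      moreover have "u ^ i = norm z ^ (2 * i)" by (simp add: u_def power_mult)
      ultimately show ?case by (simp only: of_real_mult mult_ac u_def)
    qed
    show "\<forall>\<^sub>F t in at_top. AE z in lborel. norm (?s t z) \<le> norm (g (x - z) * of_real (norm z ^ (2 * i)))"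
      using eventually_gt_at_top[of 0]
    proof eventually_elim
      case (elim t)
      have "(4 * t) ^ i * \<bar>exp_rem i (u / (4 * t))\<bar> \<le> u ^ i" if "u \<ge> 0" for u
      proof -
        have "\<bar>exp_rem i (u / (4 * t))\<bar> \<le> (u / (4 * t)) ^ i / fact i" by (rule abs_exp_rem_le) (use that elim in simp)
        also have "\<dots> \<le> (u / (4 * t)) ^ i / 1" by (rule divide_left_mono) (use that elim in \<open>auto simp: fact_ge_1\<close>)
        finally have "(4 * t) ^ i * \<bar>exp_rem i (u / (4 * t))\<bar> \<le> (4 * t) ^ i * (u / (4 * t)) ^ i"
          by (intro mult_left_mono) (use elim in auto)
        thus ?thesis using elim by (simp add: power_divide)
      qed
      from this[of "(norm _)\<^sup>2"] show ?case using elim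
        by (intro AE_I2) (auto simp: norm_mult abs_mult power_mult norm_power intro!: mult_left_mono)
    qed
  qed measurable
  have "((\<lambda>t. of_real ((4 * t) ^ i) * F t) \<longlongrightarrow> of_real ((-1) ^ i / fact i) * (LINT z|lborel. g (x - z) * of_real (norm z ^ (2 * i)))) at_top"
  proof (rule Lim_transform_eventually)
    show "((\<lambda>t. LINT z|lborel. ?s t z) \<longlongrightarrow> of_real ((-1) ^ i / fact i) * (LINT z|lborel. g (x - z) * of_real (norm z ^ (2 * i)))) at_top"
      using lim unfolding integral_mult_right_zero .
    show "\<forall>\<^sub>F t in at_top. (LINT z|lborel. ?s t z) = of_real ((4 * t) ^ i) * F t"
      using eventually_gt_at_top[of 0]
    proof eventually_elim
      case (elim t)
      have "(LINT z|lborel. ?s t z) = (LINT z|lborel. of_real ((4 * t) ^ i) * (g (x - z) * of_real (exp_rem i ((norm z)\<^sup>2 / (4 * t)))))"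
        by (intro Bochner_Integration.integral_cong refl) (simp add: mult_ac)
      thus ?case unfolding integral_mult_right_zero Fi[OF elim] .
    qed
  qed
  moreover have "((\<lambda>t. of_real ((4 * t) ^ i) * F t) \<longlongrightarrow> 0) at_top"
  proof (rule Lim_null_comparison)
    have "((\<lambda>t. norm (of_real (t powr (real p / 2)) * F t)) \<longlongrightarrow> 0) at_top"
      using tendsto_norm[OF heat_decay[OF fou H, of x]] unfolding F_def by simp
    from tendsto_mult[OF tendsto_const[of "4 ^ i"] this]
    show "((\<lambda>t. 4 ^ i * norm (of_real (t powr (real p / 2)) * F t)) \<longlongrightarrow> 0) at_top" by simp
    show "\<forall>\<^sub>F t in at_top. norm (of_real ((4 * t) ^ i) * F t) \<le> 4 ^ i * norm (of_real (t powr (real p / 2)) * F t)"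
      using eventually_ge_at_top[of 1]
    proof eventually_elim
      case (elim t)
      have "t ^ i = t powr real i" using elim by (simp add: powr_realpow)
      also have "\<dots> \<le> t powr (real p / 2)" using elim less.prems by (intro powr_mono) auto
      finally have "t ^ i * norm (F t) \<le> t powr (real p / 2) * norm (F t)" by (rule mult_right_mono) simp
      thus ?case using elim by (simp add: norm_mult power_mult_distrib norm_power mult.assoc)
    qed
  qed
  ultimately have "of_real ((-1) ^ i / fact i) * (LINT z|lborel. g (x - z) * of_real (norm z ^ (2 * i))) = (0 :: complex)"
    using tendsto_unique[OF trivial_limit_at_top_linorder] by blast
  thus ?case by simp
qed

section \<open>Bounds for the transform by duality\<close>

lemma borel_measurable_cis [measurable (raw)]:
  "f \<in> borel_measurable M \<Longrightarrow> (\<lambda>x. cis (f x)) \<in> borel_measurable M"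
proof -
  have "cis \<in> borel_measurable borel"
    by (auto intro!: borel_measurable_continuous_onI continuous_intros simp: cis_conv_exp[abs_def])
  thus "f \<in> borel_measurable M \<Longrightarrow> (\<lambda>x. cis (f x)) \<in> borel_measurable M"
    by (rule measurable_compose[rotated])
qed

lemma borel_measurable_cnj [measurable (raw)]:
  "f \<in> borel_measurable M \<Longrightarrow> (\<lambda>x. cnj (f x)) \<in> borel_measurable M"
proof -
  have "cnj \<in> borel_measurable borel"
    by (auto intro!: borel_measurable_continuous_onI continuous_intros)
  thus "f \<in> borel_measurable M \<Longrightarrow> (\<lambda>x. cnj (f x)) \<in> borel_measurable M"
    by (rule measurable_compose[rotated])
qed

lemma integrable_gauss:
  assumes "t > 0" shows "integrable lborel (\<lambda>y::'a::euclidean_space. exp (- t * (norm y)\<^sup>2))"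
proof -
  have "integrable lborel (\<lambda>y::'a. norm (of_real (exp (-t * (norm y)\<^sup>2)) * cis (y \<bullet> 0)))"
    using has_bochner_integral_gauss_cis[OF assms, of "0::'a"] by (intro integrable_norm) (simp add: has_bochner_integral_iff)
  thus ?thesis by (simp add: norm_mult)
qed

lemma integral_gauss:
  assumes "t > 0" shows "(LINT y|lborel. exp (- t * (norm (y::'a::euclidean_space))\<^sup>2)) = (pi / t) powr (real DIM('a) / 2)"
proof -
  have "complex_of_real (LINT y|lborel. exp (- t * (norm (y::'a))\<^sup>2)) = of_real ((pi / t) powr (real DIM('a) / 2))"
    using has_bochner_integral_gauss_cis[OF assms, of "0::'a"]
    by (simp add: has_bochner_integral_iff flip: integral_complex_of_real)
  thus ?thesis by (simp only: of_real_eq_iff)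
qed

lemma integral_gauss_shift:
  assumes "t > 0" shows "integrable lborel (\<lambda>y::'a::euclidean_space. exp (- t * (norm (y - x))\<^sup>2))"
    "(LINT y|lborel. exp (- t * (norm (y - x :: 'a))\<^sup>2)) = (pi / t) powr (real DIM('a) / 2)"
proof -
  have "integrable (distr lborel borel (\<lambda>z. x - z)) (\<lambda>y::'a. exp (- t * (norm (y - x))\<^sup>2))"
    by (subst integrable_distr_eq) (use integrable_gauss[OF assms] in auto)
  thus "integrable lborel (\<lambda>y::'a. exp (- t * (norm (y - x))\<^sup>2))" unfolding lborel_reflect .
  have "(LINT y|lborel. exp (- t * (norm (y - x :: 'a))\<^sup>2)) = integral\<^sup>L (distr lborel borel (\<lambda>z. x - z)) (\<lambda>y::'a. exp (- t * (norm (y - x))\<^sup>2))"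
    unfolding lborel_reflect ..
  also have "\<dots> = (LINT z|lborel. exp (- t * (norm (z::'a))\<^sup>2))" by (subst integral_distr) auto
  finally show "(LINT y|lborel. exp (- t * (norm (y - x :: 'a))\<^sup>2)) = (pi / t) powr (real DIM('a) / 2)"
    using integral_gauss[OF assms, where 'a = 'a] by simp
qed

lemma integrable_prod_mult:
  fixes f :: "'a::euclidean_space \<Rightarrow> complex" and g :: "'b::euclidean_space \<Rightarrow> complex" and k :: "'a \<times> 'b \<Rightarrow> complex"
  assumes f: "integrable lborel f" and g: "integrable lborel g"
    and k: "k \<in> borel_measurable (lborel \<Otimes>\<^sub>M lborel)" "\<And>p. norm (k p) \<le> 1"
  shows "integrable (lborel \<Otimes>\<^sub>M lborel) (\<lambda>(x, y). f x * g y * k (x, y))"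
proof -
  have [measurable]: "f \<in> borel_measurable borel" "g \<in> borel_measurable borel"
    using f g borel_measurable_integrable by (auto dest!: borel_measurable_integrable)
  note k(1)[measurable]
  have "integrable (lborel \<Otimes>\<^sub>M lborel) (\<lambda>(x, y). f x * g y)"
  proof (rule lborel_pair.Fubini_integrable)
    show "integrable lborel (\<lambda>x. LINT y|lborel. norm (case (x, y) of (x, y) \<Rightarrow> f x * g y))"
      using f by (simp add: norm_mult)
    show "AE x in lborel. integrable lborel (\<lambda>y. case (x, y) of (x, y) \<Rightarrow> f x * g y)"
      using g by simp
  qed measurable
  thus ?thesis
  proof (rule Bochner_Integration.integrable_bound)
    show "AE p in lborel \<Otimes>\<^sub>M lborel. norm (case p of (x, y) \<Rightarrow> f x * g y * k (x, y)) \<le> norm (case p of (x, y) \<Rightarrow> f x * g y)"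
      using k(2) by (intro AE_I2) (auto simp: norm_mult intro!: mult_left_le)
  qed measurable
qed

text \<open>
  Weights \<open>w\<close> bounded by the indicator of a ball test the size of the transform; on the side of \<open>g\<close> they appear through
  this integral.
\<close>

definition osc_integral :: "('a::euclidean_space \<Rightarrow> complex) \<Rightarrow> 'a \<Rightarrow> complex" where
  "osc_integral w y = (LINT \<eta>|lborel. w \<eta> * cis (- (\<eta> \<bullet> y)))"

lemma osc_integral_measurable [measurable]:
  fixes w :: "'a::euclidean_space \<Rightarrow> complex"
  assumes [measurable]: "w \<in> borel_measurable borel"
  shows "osc_integral w \<in> borel_measurable borel"
proof -
  have "(\<lambda>y. LINT \<eta>|lborel. w \<eta> * cis (- (\<eta> \<bullet> y))) \<in> borel_measurable borel"
    by (rule lborel.borel_measurable_lebesgue_integral) measurable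
  thus ?thesis by (simp only: osc_integral_def[abs_def])
qed

context
  fixes w :: "'a::euclidean_space \<Rightarrow> complex" and B :: "'a set"
  assumes wm[measurable]: "w \<in> borel_measurable borel"
    and w: "\<And>\<eta>. norm (w \<eta>) \<le> indicator B \<eta>"
    and B[measurable]: "B \<in> sets borel" and Bf: "emeasure lborel B < \<infinity>"
begin

lemma integrable_of_indicator_bound: "integrable lborel w"
proof -
  have "integrable lborel (indicator B :: 'a \<Rightarrow> real)" using Bf by (simp add: integrable_real_indicator)
  thus ?thesis by (rule Bochner_Integration.integrable_bound) (use w in auto)
qed

lemma integral_norm_le_measure: "(LINT \<eta>|lborel. norm (w \<eta>)) \<le> measure lborel B"
proof -
  have "(LINT \<eta>|lborel. norm (w \<eta>)) \<le> (LINT \<eta>|lborel. indicator B \<eta>)"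
    by (rule integral_mono) (use integrable_of_indicator_bound w Bf in \<open>auto intro: integrable_norm integrable_real_indicator\<close>)
  thus ?thesis by simp
qed

lemma norm_osc_integral_le: "norm (osc_integral w y) \<le> measure lborel B"
proof -
  have "norm (osc_integral w y) \<le> (LINT \<eta>|lborel. norm (w \<eta> * cis (- (\<eta> \<bullet> y))))"
    unfolding osc_integral_def by (rule integral_norm_bound)
  thus ?thesis using integral_norm_le_measure by (simp add: norm_mult)
qed

text \<open>
  One half of Plancherel's theorem with a convergence factor: the integral is the pairing of \<open>w\<close> with a Gaussian average of
  the conjugate of \<open>w\<close>, and \<open>w\<close> is bounded by \<open>1\<close>.
\<close>

lemma osc_integral_gauss_L2:
  assumes \<epsilon>: "\<epsilon> > 0"
  shows "(LINT y|lborel. (norm (osc_integral w y))\<^sup>2 * exp (- \<epsilon> * (norm y)\<^sup>2)) \<le> (2 * pi) ^ DIM('a) * measure lborel B"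
proof -
  let ?E = "\<lambda>y::'a. exp (- \<epsilon> * (norm y)\<^sup>2)"
  let ?g = "(pi / \<epsilon>) powr (real DIM('a) / 2)"
  define U where "U = (\<lambda>\<eta>. LINT y|lborel. of_real (?E y) * cnj (osc_integral w y) * cis (- (\<eta> \<bullet> y)))"
  have iE: "integrable lborel (\<lambda>y::'a. complex_of_real (?E y))" using integrable_gauss[OF \<epsilon>, where 'a = 'a] by (rule integrable_of_real)
  have iEw: "integrable lborel (\<lambda>y. of_real (?E y) * cnj (osc_integral w y))"
  proof (rule Bochner_Integration.integrable_bound[where f = "\<lambda>y. ?E y * measure lborel B"])
    show "integrable lborel (\<lambda>y::'a. ?E y * measure lborel B)" using integrable_gauss[OF \<epsilon>, where 'a = 'a] by simp
    show "AE y in lborel. norm (of_real (?E y) * cnj (osc_integral w y)) \<le> norm (?E y * measure lborel B)"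
      using norm_osc_integral_le by (intro AE_I2) (auto simp: norm_mult)
  qed measurable
  have U: "norm (U \<eta>) \<le> (2 * pi) ^ DIM('a)" for \<eta>
  proof -
    have icw: "integrable lborel (\<lambda>\<zeta>. cnj (w \<zeta>))" using integrable_of_indicator_bound by simp
    have F: "integrable (lborel \<Otimes>\<^sub>M lborel) (\<lambda>(\<zeta>, y). cnj (w \<zeta>) * complex_of_real (?E y) * (case (\<zeta>, y) of (\<zeta>, y) \<Rightarrow> cis ((\<zeta> - \<eta>) \<bullet> y)))"
      by (rule integrable_prod_mult[OF icw iE]) (measurable, auto)
    have "U \<eta> = (LINT y|lborel. LINT \<zeta>|lborel. cnj (w \<zeta>) * complex_of_real (?E y) * cis ((\<zeta> - \<eta>) \<bullet> y))"
      unfolding U_def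
    proof (intro Bochner_Integration.integral_cong refl)
      fix y :: 'a
      have "of_real (?E y) * cnj (osc_integral w y) * cis (- (\<eta> \<bullet> y)) = (of_real (?E y) * cis (- (\<eta> \<bullet> y))) * (LINT \<zeta>|lborel. cnj (w \<zeta> * cis (- (\<zeta> \<bullet> y))))"
        unfolding osc_integral_def by (simp only: Bochner_Integration.integral_cnj mult_ac)
      also have "\<dots> = (LINT \<zeta>|lborel. (of_real (?E y) * cis (- (\<eta> \<bullet> y))) * cnj (w \<zeta> * cis (- (\<zeta> \<bullet> y))))"
        by (rule integral_mult_right_zero[symmetric])
      also have "\<dots> = (LINT \<zeta>|lborel. cnj (w \<zeta>) * complex_of_real (?E y) * cis ((\<zeta> - \<eta>) \<bullet> y))"
      proof (intro Bochner_Integration.integral_cong refl)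
        fix \<zeta>
        have "cis ((\<zeta> - \<eta>) \<bullet> y) = cis (\<zeta> \<bullet> y) * cis (- (\<eta> \<bullet> y))" by (simp add: cis_mult inner_diff_left)
        thus "(of_real (?E y) * cis (- (\<eta> \<bullet> y))) * cnj (w \<zeta> * cis (- (\<zeta> \<bullet> y))) = cnj (w \<zeta>) * complex_of_real (?E y) * cis ((\<zeta> - \<eta>) \<bullet> y)"
          by (simp add: cis_cnj mult_ac)
      qed
      finally show "of_real (?E y) * cnj (osc_integral w y) * cis (- (\<eta> \<bullet> y)) = (LINT \<zeta>|lborel. cnj (w \<zeta>) * complex_of_real (?E y) * cis ((\<zeta> - \<eta>) \<bullet> y))" .
    qed
    also have "\<dots> = (LINT \<zeta>|lborel. LINT y|lborel. cnj (w \<zeta>) * complex_of_real (?E y) * cis ((\<zeta> - \<eta>) \<bullet> y))"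
      by (rule lborel_pair.Fubini_integral) (use F in simp)
    also have "\<dots> = (LINT \<zeta>|lborel. cnj (w \<zeta>) * of_real (?g * exp (- (norm (\<zeta> - \<eta>))\<^sup>2 / (4 * \<epsilon>))))"
    proof (intro Bochner_Integration.integral_cong refl)
      fix \<zeta>
      have "(LINT y|lborel. cnj (w \<zeta>) * complex_of_real (?E y) * cis ((\<zeta> - \<eta>) \<bullet> y)) = (LINT y|lborel. cnj (w \<zeta>) * (complex_of_real (?E y) * cis (y \<bullet> (\<zeta> - \<eta>))))"
        by (simp add: mult.assoc inner_commute)
      also have "\<dots> = cnj (w \<zeta>) * of_real (?g * exp (- (norm (\<zeta> - \<eta>))\<^sup>2 / (4 * \<epsilon>)))"
        unfolding integral_mult_right_zero using has_bochner_integral_gauss_cis[OF \<epsilon>, of "\<zeta> - \<eta>"]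
        by (simp add: has_bochner_integral_iff)
      finally show "(LINT y|lborel. cnj (w \<zeta>) * complex_of_real (?E y) * cis ((\<zeta> - \<eta>) \<bullet> y)) = cnj (w \<zeta>) * of_real (?g * exp (- (norm (\<zeta> - \<eta>))\<^sup>2 / (4 * \<epsilon>)))" .
    qed
    finally have "norm (U \<eta>) \<le> (LINT \<zeta>|lborel. norm (cnj (w \<zeta>) * of_real (?g * exp (- (norm (\<zeta> - \<eta>))\<^sup>2 / (4 * \<epsilon>)))))"
      by simp
    also have "\<dots> \<le> (LINT \<zeta>|lborel. ?g * exp (- (1 / (4 * \<epsilon>)) * (norm (\<zeta> - \<eta>))\<^sup>2))"
    proof (rule integral_mono')
      show "integrable lborel (\<lambda>\<zeta>. ?g * exp (- (1 / (4 * \<epsilon>)) * (norm (\<zeta> - \<eta>))\<^sup>2))"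
        using integral_gauss_shift(1)[of "1 / (4 * \<epsilon>)" \<eta>] \<epsilon> by simp
      fix \<zeta> :: 'a
      have "norm (w \<zeta>) \<le> 1" using w[of \<zeta>] by (rule order_trans) (auto simp: indicator_def)
      thus "norm (cnj (w \<zeta>) * of_real (?g * exp (- (norm (\<zeta> - \<eta>))\<^sup>2 / (4 * \<epsilon>)))) \<le> ?g * exp (- (1 / (4 * \<epsilon>)) * (norm (\<zeta> - \<eta>))\<^sup>2)"
        by (simp add: norm_mult abs_mult mult_left_le_one_le)
    qed auto
    also have "\<dots> = ?g * (pi / (1 / (4 * \<epsilon>))) powr (real DIM('a) / 2)"
      using integral_gauss_shift(2)[of "1 / (4 * \<epsilon>)" \<eta>] \<epsilon> by simp
    also have "\<dots> = ((pi / \<epsilon>) * (4 * pi * \<epsilon>)) powr (real DIM('a) / 2)"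
      using \<epsilon> by (subst powr_mult) (auto simp: mult_ac)
    also have "(pi / \<epsilon>) * (4 * pi * \<epsilon>) = (2 * pi)\<^sup>2" using \<epsilon> by (simp add: power2_eq_square)
    also have "((2 * pi)\<^sup>2) powr (real DIM('a) / 2) = (2 * pi) powr real DIM('a)"
      using powr_powr[of "2 * pi" 2 "real DIM('a) / 2"] by simp
    also have "\<dots> = (2 * pi) ^ DIM('a)" by (simp add: powr_realpow)
    finally show ?thesis .
  qed
  have Um[measurable]: "U \<in> borel_measurable borel"
  proof -
    have "(\<lambda>\<eta>. LINT y|lborel. of_real (?E y) * cnj (osc_integral w y) * cis (- (\<eta> \<bullet> y))) \<in> borel_measurable borel"
      by (rule lborel.borel_measurable_lebesgue_integral) measurable
    thus ?thesis unfolding U_def .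
  qed
  have F: "integrable (lborel \<Otimes>\<^sub>M lborel) (\<lambda>(\<eta>, y). w \<eta> * (of_real (?E y) * cnj (osc_integral w y)) * (case (\<eta>, y) of (\<eta>, y) \<Rightarrow> cis (- (\<eta> \<bullet> y))))"
    by (rule integrable_prod_mult[OF integrable_of_indicator_bound iEw]) (measurable, auto)
  have "complex_of_real (LINT y|lborel. (norm (osc_integral w y))\<^sup>2 * ?E y) = (LINT y|lborel. of_real ((norm (osc_integral w y))\<^sup>2 * ?E y))"
    by (rule integral_complex_of_real[symmetric])
  also have "\<dots> = (LINT y|lborel. LINT \<eta>|lborel. w \<eta> * (of_real (?E y) * cnj (osc_integral w y)) * cis (- (\<eta> \<bullet> y)))"
  proof (intro Bochner_Integration.integral_cong refl)
    fix y :: 'a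
    have "complex_of_real ((norm (osc_integral w y))\<^sup>2 * ?E y) = (of_real (?E y) * cnj (osc_integral w y)) * osc_integral w y"
      by (simp only: of_real_mult complex_norm_square mult_ac)
    also have "\<dots> = (LINT \<eta>|lborel. (of_real (?E y) * cnj (osc_integral w y)) * (w \<eta> * cis (- (\<eta> \<bullet> y))))"
      unfolding osc_integral_def[of w y] by (rule integral_mult_right_zero[symmetric])
    finally show "complex_of_real ((norm (osc_integral w y))\<^sup>2 * ?E y) = (LINT \<eta>|lborel. w \<eta> * (of_real (?E y) * cnj (osc_integral w y)) * cis (- (\<eta> \<bullet> y)))"
      by (simp add: mult_ac)
  qed
  also have "\<dots> = (LINT \<eta>|lborel. LINT y|lborel. w \<eta> * (of_real (?E y) * cnj (osc_integral w y)) * cis (- (\<eta> \<bullet> y)))"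
    by (rule lborel_pair.Fubini_integral) (use F in simp)
  also have "\<dots> = (LINT \<eta>|lborel. w \<eta> * U \<eta>)"
    unfolding U_def by (intro Bochner_Integration.integral_cong refl) (simp add: mult.assoc)
  finally have eq: "complex_of_real (LINT y|lborel. (norm (osc_integral w y))\<^sup>2 * ?E y) = (LINT \<eta>|lborel. w \<eta> * U \<eta>)" .
  have "(LINT y|lborel. (norm (osc_integral w y))\<^sup>2 * ?E y) \<le> norm (complex_of_real (LINT y|lborel. (norm (osc_integral w y))\<^sup>2 * ?E y))"
    unfolding norm_of_real by (rule abs_ge_self)
  also have "\<dots> = norm (LINT \<eta>|lborel. w \<eta> * U \<eta>)" unfolding eq ..
  also have "\<dots> \<le> (LINT \<eta>|lborel. norm (w \<eta> * U \<eta>))" by (rule integral_norm_bound)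
  also have "\<dots> \<le> (LINT \<eta>|lborel. norm (w \<eta>) * (2 * pi) ^ DIM('a))"
    by (rule integral_mono') (use integrable_of_indicator_bound U in \<open>auto simp: norm_mult intro!: mult_left_mono\<close>)
  also have "\<dots> = (2 * pi) ^ DIM('a) * (LINT \<eta>|lborel. norm (w \<eta>))" by simp
  also have "\<dots> \<le> (2 * pi) ^ DIM('a) * measure lborel B" by (intro mult_left_mono integral_norm_le_measure) auto
  finally show ?thesis .
qed

text \<open>
  The convergence factor is removed by Fatou's lemma.
\<close>

lemma osc_integral_L2:
  "(\<integral>\<^sup>+y. ennreal ((norm (osc_integral w y))\<^sup>2) \<partial>lborel) \<le> ennreal ((2 * pi) ^ DIM('a) * measure lborel B)"
proof -
  let ?f = "\<lambda>k::nat. \<lambda>y. (norm (osc_integral w y))\<^sup>2 * exp (- (1 / real (Suc k)) * (norm y)\<^sup>2)"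
  have lim: "(\<lambda>k. ?f k y) \<longlonglongrightarrow> (norm (osc_integral w y))\<^sup>2" for y
  proof -
    have "(\<lambda>k. - (1 / real (Suc k)) * l) \<longlonglongrightarrow> - 0 * l" for l :: real by real_asymp
    from this[of "(norm y)\<^sup>2"]
    have "(\<lambda>k. (norm (osc_integral w y))\<^sup>2 * exp (- (1 / real (Suc k)) * (norm y)\<^sup>2)) \<longlonglongrightarrow> (norm (osc_integral w y))\<^sup>2 * exp (- 0 * (norm y)\<^sup>2)"
      by (rule tendsto_mult[OF tendsto_const tendsto_exp])
    thus ?thesis by simp
  qed
  have "(\<integral>\<^sup>+y. ennreal ((norm (osc_integral w y))\<^sup>2) \<partial>lborel) = (\<integral>\<^sup>+y. liminf (\<lambda>k. ennreal (?f k y)) \<partial>lborel)"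
  proof (intro nn_integral_cong)
    fix y
    have "(\<lambda>k. ennreal (?f k y)) \<longlonglongrightarrow> ennreal ((norm (osc_integral w y))\<^sup>2)" by (intro tendsto_ennrealI lim)
    thus "ennreal ((norm (osc_integral w y))\<^sup>2) = liminf (\<lambda>k. ennreal (?f k y))"
      by (rule lim_imp_Liminf[OF sequentially_bot, symmetric])
  qed
  also have "\<dots> \<le> liminf (\<lambda>k. \<integral>\<^sup>+y. ennreal (?f k y) \<partial>lborel)"
    by (rule nn_integral_liminf) measurable
  also have "\<dots> \<le> ennreal ((2 * pi) ^ DIM('a) * measure lborel B)"
  proof (rule Liminf_le)
    show "\<forall>\<^sub>F k in sequentially. (\<integral>\<^sup>+y. ennreal (?f k y) \<partial>lborel) \<le> ennreal ((2 * pi) ^ DIM('a) * measure lborel B)"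
    proof (intro always_eventually allI)
      fix k
      have "integrable lborel (\<lambda>y::'a. (measure lborel B)\<^sup>2 * exp (- (1 / real (Suc k)) * (norm y)\<^sup>2))"
        by (intro integrable_mult_right integrable_gauss) simp
      hence "integrable lborel (?f k)"
        by (rule Bochner_Integration.integrable_bound) (use norm_osc_integral_le in \<open>auto intro!: power_mono\<close>)
      hence "(\<integral>\<^sup>+y. ennreal (?f k y) \<partial>lborel) = ennreal (LINT y|lborel. ?f k y)"
        by (intro nn_integral_eq_integral) auto
      also have "\<dots> \<le> ennreal ((2 * pi) ^ DIM('a) * measure lborel B)"
        by (intro ennreal_leI osc_integral_gauss_L2) simp
      finally show "(\<integral>\<^sup>+y. ennreal (?f k y) \<partial>lborel) \<le> ennreal ((2 * pi) ^ DIM('a) * measure lborel B)" .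
    qed
  qed simp
  finally show ?thesis .
qed

end

lemma one_plus_norm_le: "1 + norm (x :: 'a::real_normed_vector) \<le> (1 + norm y) * (1 + norm (x - y))"
proof -
  have "norm x \<le> norm y + norm (x - y)" by (rule norm_triangle_sub)
  moreover have "0 \<le> norm y * norm (x - y)" by simp
  ultimately show ?thesis unfolding distrib_left distrib_right mult_1_left mult_1_right by linarith
qed

lemma integral_norm_bound_nn:
  fixes f :: "'z \<Rightarrow> complex"
  assumes "(\<integral>\<^sup>+y. ennreal (norm (f y)) \<partial>N) \<le> ennreal B" "B \<ge> 0"
  shows "norm (integral\<^sup>L N f) \<le> B"
proof (cases "integrable N f")
  case True
  have "ennreal (norm (integral\<^sup>L N f)) \<le> (\<integral>\<^sup>+y. ennreal (norm (f y)) \<partial>N)"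
    by (rule integral_norm_bound_ennreal[OF True])
  also note assms(1)
  finally show ?thesis using assms(2) by (simp add: ennreal_le_iff)
qed (use assms in \<open>simp add: not_integrable_integral_eq\<close>)

context
  fixes g h :: "'a::euclidean_space \<Rightarrow> complex" and M :: nat
  assumes fou: "is_fourier g h"
    and hM: "integrable lborel (\<lambda>\<xi>. norm (h \<xi>) / (1 + norm \<xi>) ^ M)"
begin

lemma transform_borel_measurable: "h \<in> borel_measurable borel" and function_borel_measurable: "g \<in> borel_measurable borel"
  using fou by (auto simp: is_fourier_def)

context
  fixes w :: "'a \<Rightarrow> complex" and R :: real
  assumes wm[measurable]: "w \<in> borel_measurable borel" and R: "R \<ge> 0"
    and w: "\<And>\<eta>. norm (w \<eta>) \<le> indicator (cball 0 R) \<eta>"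
begin

lemma integrable_weight: "integrable lborel w"
  by (rule integrable_of_indicator_bound[OF wm w _ emeasure_lborel_cball_finite]) simp

text \<open>
  The weight \<open>w\<close> need not be smooth, but its convolution with a Gaussian is a superposition of the Schwartz functions
  \<open>gauss_wave t \<eta> 0\<close>, for which the definition of the transform can be used.
\<close>

lemma mollified_pairing:
  assumes t: "t > 0"
  shows "(LINT \<xi>|lborel. h \<xi> * (LINT \<eta>|lborel. w \<eta> * of_real (exp (- t * (norm (\<xi> - \<eta>))\<^sup>2)))) =
     of_real ((pi / t) powr (real DIM('a) / 2)) * (LINT y|lborel. g y * of_real (exp (- (norm y)\<^sup>2 / (4 * t))) * osc_integral w y)"
proof -
  note transform_borel_measurable[measurable] function_borel_measurable[measurable]
  let ?c = "(pi / t) powr (real DIM('a) / 2)"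
  let ?E = "\<lambda>y::'a. complex_of_real (exp (- (norm y)\<^sup>2 / (4 * t)))"
  obtain K where K: "\<And>r. r \<ge> 0 \<Longrightarrow> (1 + r) ^ M * exp (- t * r\<^sup>2) \<le> K"
    using power_gauss_bounded[OF t] by blast
  \<comment> \<open>The weight \<open>(1 + \<bar>\<xi>\<bar>)\<^sup>M\<close> is moved from \<open>h\<close> to the Gaussian, where it is bounded for \<open>\<bar>\<eta>\<bar> \<le> R\<close>.\<close>
  define q where "q = K * (1 + R) ^ M"
  have "K > 0" using K[of 0] by simp
  hence q: "q > 0" using R by (simp add: q_def)
  define k :: "'a \<times> 'a \<Rightarrow> complex" where "k = (\<lambda>(\<eta>, \<xi>). if norm \<eta> \<le> R then complex_of_real ((1 + norm \<xi>) ^ M * exp (- t * (norm (\<xi> - \<eta>))\<^sup>2) / q) else 0)"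
  have km: "k \<in> borel_measurable (lborel \<Otimes>\<^sub>M (lborel :: 'a measure))" unfolding k_def by measurable
  have k: "norm (k p) \<le> 1" for p :: "'a \<times> 'a"
  proof (cases p)
    case (Pair \<eta> \<xi>)
    show ?thesis
    proof (cases "norm \<eta> \<le> R")
      case True
      have "(1 + norm \<xi>) ^ M \<le> ((1 + norm \<eta>) * (1 + norm (\<xi> - \<eta>))) ^ M"
        by (intro power_mono one_plus_norm_le) simp
      also have "\<dots> \<le> ((1 + R) * (1 + norm (\<xi> - \<eta>))) ^ M"
        using True by (intro power_mono mult_right_mono) auto
      finally have "(1 + norm \<xi>) ^ M * exp (- t * (norm (\<xi> - \<eta>))\<^sup>2) \<le> ((1 + R) * (1 + norm (\<xi> - \<eta>))) ^ M * exp (- t * (norm (\<xi> - \<eta>))\<^sup>2)"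
        by (rule mult_right_mono) simp
      also have "\<dots> = (1 + R) ^ M * ((1 + norm (\<xi> - \<eta>)) ^ M * exp (- t * (norm (\<xi> - \<eta>))\<^sup>2))"
        by (simp add: power_mult_distrib)
      also have "\<dots> \<le> (1 + R) ^ M * K" by (intro mult_left_mono K) (use R in auto)
      also have "\<dots> = q" by (simp add: q_def)
      finally have "(1 + norm \<xi>) ^ M * exp (- t * (norm (\<xi> - \<eta>))\<^sup>2) \<le> q" .
      hence "\<bar>(1 + norm \<xi>) ^ M * exp (- t * (norm (\<xi> - \<eta>))\<^sup>2) / q\<bar> \<le> 1"
        using q by (simp add: abs_mult)
      moreover have "k p = complex_of_real ((1 + norm \<xi>) ^ M * exp (- t * (norm (\<xi> - \<eta>))\<^sup>2) / q)"
        using Pair True by (simp add: k_def)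
      ultimately show ?thesis by (simp only: norm_of_real)
    qed (use Pair in \<open>simp add: k_def\<close>)
  qed
  have hq: "integrable lborel (\<lambda>\<xi>. of_real q * (h \<xi> / of_real ((1 + norm \<xi>) ^ M)))"
  proof (rule integrable_mult_right)
    show "integrable lborel (\<lambda>\<xi>. h \<xi> / of_real ((1 + norm \<xi>) ^ M))"
      by (rule Bochner_Integration.integrable_bound[OF hM])
         (measurable, intro AE_I2, simp add: norm_divide del: of_real_power of_real_add)
  qed
  have F0: "integrable (lborel \<Otimes>\<^sub>M lborel) (\<lambda>(\<eta>, \<xi>). w \<eta> * (of_real q * (h \<xi> / of_real ((1 + norm \<xi>) ^ M))) * k (\<eta>, \<xi>))"
    by (rule integrable_prod_mult[OF integrable_weight hq]) (rule km, rule k)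
  have e0: "w \<eta> * (of_real q * (h \<xi> / of_real ((1 + norm \<xi>) ^ M))) * k (\<eta>, \<xi>) = h \<xi> * (w \<eta> * of_real (exp (- t * (norm (\<xi> - \<eta>))\<^sup>2)))" for \<eta> \<xi>
  proof (cases "norm \<eta> \<le> R")
    case True
    define P where "P = complex_of_real ((1 + norm \<xi>) ^ M)"
    have "0 < (1 + norm \<xi>) ^ M" by (intro zero_less_power) (simp add: add_pos_nonneg)
    hence P: "P \<noteq> 0" unfolding P_def of_real_eq_0_iff by linarith
    have kP: "k (\<eta>, \<xi>) = P * of_real (exp (- t * (norm (\<xi> - \<eta>))\<^sup>2)) / of_real q"
      using True by (simp add: k_def P_def)
    show ?thesis unfolding kP P_def[symmetric] using q P by simp
  next
    case False
    have "norm (w \<eta>) \<le> 0" using w[of \<eta>] False by (simp add: indicator_def)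
    thus ?thesis by simp
  qed
  have F1: "integrable (lborel \<Otimes>\<^sub>M lborel) (\<lambda>(\<eta>, \<xi>). h \<xi> * (w \<eta> * of_real (exp (- t * (norm (\<xi> - \<eta>))\<^sup>2))))"
    using F0 by (simp only: e0)
  have gE: "integrable lborel (\<lambda>y. g y * ?E y)"
  proof -
    have "integrable lborel (\<lambda>y. g y * gauss_wave (1 / (4 * t)) 0 0 y)"
    proof -
      have "schwartz (gauss_wave (1 / (4 * t)) 0 (0 :: 'a))" by (rule schwartz_gauss_wave) (use t in simp)
      thus ?thesis using fou unfolding is_fourier_def by blast
    qed
    thus ?thesis by (simp add: gauss_wave_def)
  qed
  have inner: "(LINT \<xi>|lborel. h \<xi> * of_real (exp (- t * (norm (\<xi> - \<eta>))\<^sup>2))) = of_real ?c * (LINT y|lborel. g y * ?E y * cis (- (\<eta> \<bullet> y)))" for \<eta>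
  proof -
    have gw: "gauss_wave t \<eta> 0 \<xi> = of_real (exp (- t * (norm (\<xi> - \<eta>))\<^sup>2))" for \<xi> by (simp add: gauss_wave_def)
    have fi: "fourier_integral (gauss_wave t \<eta> 0) y = of_real ?c * (?E y * cis (- (\<eta> \<bullet> y)))" for y
    proof -
      have "fourier_integral (gauss_wave t \<eta> 0) y = integral\<^sup>L (distr lborel borel (\<lambda>z. \<eta> - z)) (\<lambda>\<xi>. of_real (exp (- t * (norm (\<xi> - \<eta>))\<^sup>2)) * cis (- (\<xi> \<bullet> y)))"
        unfolding fourier_integral_def gw lborel_reflect ..
      also have "\<dots> = (LINT z|lborel. of_real (exp (- t * (norm z)\<^sup>2)) * cis (- ((\<eta> - z) \<bullet> y)))"
        by (subst integral_distr) auto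
      also have "\<dots> = (LINT z|lborel. cis (- (\<eta> \<bullet> y)) * (of_real (exp (- t * (norm z)\<^sup>2)) * cis (z \<bullet> y)))"
      proof (intro Bochner_Integration.integral_cong refl)
        fix z
        have "cis (- ((\<eta> - z) \<bullet> y)) = cis (- (\<eta> \<bullet> y)) * cis (z \<bullet> y)" by (simp add: cis_mult inner_diff_left)
        thus "of_real (exp (- t * (norm z)\<^sup>2)) * cis (- ((\<eta> - z) \<bullet> y)) = cis (- (\<eta> \<bullet> y)) * (of_real (exp (- t * (norm z)\<^sup>2)) * cis (z \<bullet> y))"
          by (simp add: mult_ac)
      qed
      also have "\<dots> = cis (- (\<eta> \<bullet> y)) * of_real (?c * exp (- (norm y)\<^sup>2 / (4 * t)))"
        unfolding integral_mult_right_zero using has_bochner_integral_gauss_cis[OF t, of y] by (simp add: has_bochner_integral_iff)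
      finally show ?thesis by (simp add: mult_ac)
    qed
    have "(LINT \<xi>|lborel. h \<xi> * gauss_wave t \<eta> 0 \<xi>) = (LINT y|lborel. g y * fourier_integral (gauss_wave t \<eta> 0) y)"
      using fou schwartz_gauss_wave[OF t, of \<eta> 0] unfolding is_fourier_def by blast
    also have "\<dots> = (LINT y|lborel. of_real ?c * (g y * ?E y * cis (- (\<eta> \<bullet> y))))"
      unfolding fi by (intro Bochner_Integration.integral_cong refl) (simp add: mult_ac)
    finally show ?thesis unfolding gw integral_mult_right_zero .
  qed
  have F2: "integrable (lborel \<Otimes>\<^sub>M lborel) (\<lambda>(\<eta>, y). w \<eta> * (g y * ?E y) * (case (\<eta>, y) of (\<eta>, y) \<Rightarrow> cis (- (\<eta> \<bullet> y))))"
    by (rule integrable_prod_mult[OF integrable_weight gE]) (measurable, auto)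
  have "(LINT \<xi>|lborel. h \<xi> * (LINT \<eta>|lborel. w \<eta> * of_real (exp (- t * (norm (\<xi> - \<eta>))\<^sup>2)))) =
     (LINT \<xi>|lborel. LINT \<eta>|lborel. h \<xi> * (w \<eta> * of_real (exp (- t * (norm (\<xi> - \<eta>))\<^sup>2))))"
    by (simp only: integral_mult_right_zero)
  also have "\<dots> = (LINT \<eta>|lborel. LINT \<xi>|lborel. h \<xi> * (w \<eta> * of_real (exp (- t * (norm (\<xi> - \<eta>))\<^sup>2))))"
    by (rule lborel_pair.Fubini_integral) (use F1 in simp)
  also have "\<dots> = (LINT \<eta>|lborel. of_real ?c * (LINT y|lborel. w \<eta> * (g y * ?E y) * cis (- (\<eta> \<bullet> y))))"
  proof (intro Bochner_Integration.integral_cong refl)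
    fix \<eta>
    have "(LINT \<xi>|lborel. h \<xi> * (w \<eta> * of_real (exp (- t * (norm (\<xi> - \<eta>))\<^sup>2)))) = (LINT \<xi>|lborel. w \<eta> * (h \<xi> * of_real (exp (- t * (norm (\<xi> - \<eta>))\<^sup>2))))"
      by (intro Bochner_Integration.integral_cong refl) (simp add: mult_ac)
    also have "\<dots> = w \<eta> * (of_real ?c * (LINT y|lborel. g y * ?E y * cis (- (\<eta> \<bullet> y))))"
      by (simp only: integral_mult_right_zero inner)
    also have "\<dots> = of_real ?c * (LINT y|lborel. w \<eta> * (g y * ?E y * cis (- (\<eta> \<bullet> y))))"
      by (simp only: integral_mult_right_zero mult.left_commute)
    finally show "(LINT \<xi>|lborel. h \<xi> * (w \<eta> * of_real (exp (- t * (norm (\<xi> - \<eta>))\<^sup>2)))) = of_real ?c * (LINT y|lborel. w \<eta> * (g y * ?E y) * cis (- (\<eta> \<bullet> y)))"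
      by (simp only: mult.assoc)
  qed
  also have "\<dots> = of_real ?c * (LINT \<eta>|lborel. LINT y|lborel. w \<eta> * (g y * ?E y) * cis (- (\<eta> \<bullet> y)))"
    by (rule integral_mult_right_zero)
  also have "(LINT \<eta>|lborel. LINT y|lborel. w \<eta> * (g y * ?E y) * cis (- (\<eta> \<bullet> y))) = (LINT y|lborel. LINT \<eta>|lborel. w \<eta> * (g y * ?E y) * cis (- (\<eta> \<bullet> y)))"
    by (rule lborel_pair.Fubini_integral[symmetric]) (use F2 in simp)
  also have "\<dots> = (LINT y|lborel. g y * ?E y * osc_integral w y)"
  proof (intro Bochner_Integration.integral_cong refl)
    fix y
    have "(LINT \<eta>|lborel. w \<eta> * (g y * ?E y) * cis (- (\<eta> \<bullet> y))) = (LINT \<eta>|lborel. (g y * ?E y) * (w \<eta> * cis (- (\<eta> \<bullet> y))))"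
      by (intro Bochner_Integration.integral_cong refl) (simp add: mult_ac)
    thus "(LINT \<eta>|lborel. w \<eta> * (g y * ?E y) * cis (- (\<eta> \<bullet> y))) = g y * ?E y * osc_integral w y"
      by (simp only: integral_mult_right_zero osc_integral_def)
  qed
  finally show ?thesis .
qed

text \<open>
  The mollified weights are bounded by a multiple of \<open>1 / (1 + \<bar>\<xi>\<bar>)\<close> to the power \<open>M\<close>, uniformly in \<open>t \<ge> 1\<close>, and
  converge pointwise to \<open>w\<close> as \<open>t\<close> grows, so the bound survives the limit.
\<close>

lemma pairing_bound_continuous:
  assumes cont: "continuous_on UNIV w"
    and Bd: "(\<integral>\<^sup>+y. ennreal (norm (g y) * norm (osc_integral w y)) \<partial>lborel) \<le> ennreal Bd" "Bd \<ge> 0"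
  shows "norm (LINT \<xi>|lborel. h \<xi> * w \<xi>) \<le> Bd"
proof -
  note transform_borel_measurable[measurable] function_borel_measurable[measurable]
  let ?n = "real DIM('a)"
  define W where "W = (\<lambda>t \<xi>. (LINT z|lborel. w (\<xi> + (1 / sqrt t) *\<^sub>R z) * of_real (exp (- 1 * (norm z)\<^sup>2))) / of_real (pi powr (?n / 2)))"
  have w1: "norm (w \<eta>) \<le> 1" for \<eta> using w[of \<eta>] by (rule order_trans) (auto simp: indicator_def)
  have subst: "(LINT \<eta>|lborel. w \<eta> * of_real (exp (- t * (norm (\<xi> - \<eta>))\<^sup>2))) = of_real ((pi / t) powr (?n / 2)) * W t \<xi>" if t: "t > 0" for t \<xi>
  proof -
    let ?c = "1 / sqrt t"
    have c: "?c \<noteq> 0" "\<bar>?c\<bar> ^ DIM('a) = t powr (- (?n / 2))"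
    proof -
      show "?c \<noteq> 0" using t by simp
      have "?c = t powr (- (1 / 2))"
        unfolding powr_minus_divide powr_half_sqrt[OF less_imp_le[OF t]] ..
      moreover have "(t powr (- (1 / 2))) ^ DIM('a) = t powr (real DIM('a) * (- (1 / 2)))"
        by (rule powr_power) (use t in simp)
      ultimately show "\<bar>?c\<bar> ^ DIM('a) = t powr (- (?n / 2))" using t by simp
    qed
    have e: "- t * (norm (\<xi> - (\<xi> + ?c *\<^sub>R z)))\<^sup>2 = - 1 * (norm z)\<^sup>2" for z :: 'a
      using t by (simp add: power_divide)
    have "(LINT \<eta>|lborel. w \<eta> * of_real (exp (- t * (norm (\<xi> - \<eta>))\<^sup>2))) =
       integral\<^sup>L (density (distr lborel borel (\<lambda>z. \<xi> + ?c *\<^sub>R z)) (\<lambda>_. ennreal (\<bar>?c\<bar> ^ DIM('a)))) (\<lambda>\<eta>. w \<eta> * of_real (exp (- t * (norm (\<xi> - \<eta>))\<^sup>2)))"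
      using lborel_affine[OF c(1), of \<xi>] by simp
    also have "\<dots> = \<bar>?c\<bar> ^ DIM('a) *\<^sub>R (LINT z|lborel. w (\<xi> + ?c *\<^sub>R z) * of_real (exp (- t * (norm (\<xi> - (\<xi> + ?c *\<^sub>R z)))\<^sup>2)))"
      by (subst integral_density) (auto simp: integral_distr)
    also have "\<dots> = \<bar>?c\<bar> ^ DIM('a) *\<^sub>R (LINT z|lborel. w (\<xi> + ?c *\<^sub>R z) * of_real (exp (- 1 * (norm z)\<^sup>2)))"
      unfolding e ..
    also have "\<dots> = of_real ((pi / t) powr (?n / 2)) * W t \<xi>"
      unfolding c W_def using t by (simp add: scaleR_conv_of_real powr_divide powr_minus field_simps)
    finally show ?thesis .
  qed
  have lim1: "((\<lambda>t. W t \<xi>) \<longlongrightarrow> w \<xi>) at_top" for \<xi>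
  proof -
    have "((\<lambda>t. LINT z|lborel. w (\<xi> + (1 / sqrt t) *\<^sub>R z) * of_real (exp (- 1 * (norm z)\<^sup>2))) \<longlongrightarrow> (LINT z|lborel. w \<xi> * of_real (exp (- 1 * (norm (z::'a))\<^sup>2)))) at_top"
    proof (rule integral_dominated_convergence_at_top)
      show "integrable lborel (\<lambda>z::'a. exp (- 1 * (norm z)\<^sup>2))" by (rule integrable_gauss) simp
      show "\<forall>\<^sub>F t in at_top. AE z in lborel. norm (w (\<xi> + (1 / sqrt t) *\<^sub>R z) * of_real (exp (- 1 * (norm z)\<^sup>2))) \<le> exp (- 1 * (norm z)\<^sup>2)"
        using w1 by (intro always_eventually allI AE_I2) (auto simp: norm_mult mult_left_le_one_le)
      show "AE z in lborel. ((\<lambda>t. w (\<xi> + (1 / sqrt t) *\<^sub>R z) * of_real (exp (- 1 * (norm z)\<^sup>2))) \<longlongrightarrow> w \<xi> * of_real (exp (- 1 * (norm z)\<^sup>2))) at_top"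
      proof (intro AE_I2 tendsto_mult tendsto_const)
        fix z :: 'a
        have "((\<lambda>t. 1 / sqrt t) \<longlongrightarrow> 0) at_top" by real_asymp
        hence "((\<lambda>t. \<xi> + (1 / sqrt t) *\<^sub>R z) \<longlongrightarrow> \<xi> + 0 *\<^sub>R z) at_top" by (intro tendsto_intros)
        hence "((\<lambda>t. \<xi> + (1 / sqrt t) *\<^sub>R z) \<longlongrightarrow> \<xi>) at_top" by simp
        thus "((\<lambda>t. w (\<xi> + (1 / sqrt t) *\<^sub>R z)) \<longlongrightarrow> w \<xi>) at_top"
          using cont by (intro isCont_tendsto_compose[of \<xi> w]) (auto simp: continuous_on_eq_continuous_at)
      qed
    qed measurable
    moreover have "(LINT z|lborel. w \<xi> * of_real (exp (- 1 * (norm (z::'a))\<^sup>2))) = w \<xi> * of_real (pi powr (?n / 2))"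
      unfolding integral_mult_right_zero integral_complex_of_real
      using integral_gauss[of 1, where 'a = 'a] by simp
    ultimately have "((\<lambda>t. W t \<xi>) \<longlongrightarrow> w \<xi> * of_real (pi powr (?n / 2)) / of_real (pi powr (?n / 2))) at_top"
      unfolding W_def by (intro tendsto_divide tendsto_const) auto
    thus ?thesis by simp
  qed
  obtain K where K: "\<And>r::real. r \<ge> 0 \<Longrightarrow> (1 + r) ^ M * exp (- (1/2) * r\<^sup>2) \<le> K"
    using power_gauss_bounded[of "1/2 :: real" M] by (metis half_gt_zero_iff zero_less_one)
  have K0: "K \<ge> 0" using K[of 0] by simp
  define Q where "Q = (1 + R) ^ M * K * (LINT z|lborel. exp (- (1/2) * (norm (z::'a))\<^sup>2)) / pi powr (?n / 2)"
  have WQ: "norm (W t \<xi>) \<le> Q / (1 + norm \<xi>) ^ M" if t: "t \<ge> 1" for t \<xi>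
  proof -
    have p1: "(1 + norm \<xi>) ^ M > 0" by (intro zero_less_power) (simp add: add_pos_nonneg)
    have "norm (LINT z|lborel. w (\<xi> + (1 / sqrt t) *\<^sub>R z) * of_real (exp (- 1 * (norm z)\<^sup>2))) \<le>
       (LINT z|lborel. norm (w (\<xi> + (1 / sqrt t) *\<^sub>R z) * of_real (exp (- 1 * (norm z)\<^sup>2))))"
      by (rule integral_norm_bound)
    also have "\<dots> \<le> (LINT z|lborel. (1 + R) ^ M * K / (1 + norm \<xi>) ^ M * exp (- (1/2) * (norm (z::'a))\<^sup>2))"
    proof (rule integral_mono')
      show "integrable lborel (\<lambda>z::'a. (1 + R) ^ M * K / (1 + norm \<xi>) ^ M * exp (- (1/2) * (norm z)\<^sup>2))"
        by (intro integrable_mult_right integrable_gauss) simp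
      fix z :: 'a
      show "norm (w (\<xi> + (1 / sqrt t) *\<^sub>R z) * of_real (exp (- 1 * (norm z)\<^sup>2))) \<le> (1 + R) ^ M * K / (1 + norm \<xi>) ^ M * exp (- (1/2) * (norm z)\<^sup>2)"
      proof (cases "norm (\<xi> + (1 / sqrt t) *\<^sub>R z) \<le> R")
        case True
        have "norm ((1 / sqrt t) *\<^sub>R z) \<le> 1 * norm z"
          unfolding norm_scaleR using t by (intro mult_right_mono) auto
        hence "norm \<xi> \<le> R + norm z"
          using True norm_triangle_ineq4[of "\<xi> + (1 / sqrt t) *\<^sub>R z" "(1 / sqrt t) *\<^sub>R z"] by simp
        also have "1 + (R + norm z) \<le> (1 + R) * (1 + norm z)" using R by (simp add: algebra_simps)
        finally have "1 + norm \<xi> \<le> (1 + R) * (1 + norm z)" by simp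
        hence le: "(1 + norm \<xi>) ^ M \<le> (1 + R) ^ M * (1 + norm z) ^ M"
          unfolding power_mult_distrib[symmetric] by (intro power_mono) auto
        have "norm (w (\<xi> + (1 / sqrt t) *\<^sub>R z) * of_real (exp (- 1 * (norm z)\<^sup>2))) \<le> 1 * exp (- 1 * (norm z)\<^sup>2)"
          unfolding norm_mult using w1 by (intro mult_mono) auto
        moreover have "exp (- 1 * (norm z)\<^sup>2) = exp (- (1/2) * (norm z)\<^sup>2) * exp (- (1/2) * (norm z)\<^sup>2)"
          by (simp add: exp_add[symmetric])
        ultimately have "norm (w (\<xi> + (1 / sqrt t) *\<^sub>R z) * of_real (exp (- 1 * (norm z)\<^sup>2))) \<le> exp (- (1/2) * (norm z)\<^sup>2) * exp (- (1/2) * (norm z)\<^sup>2)"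
          by linarith
        hence "(1 + norm \<xi>) ^ M * norm (w (\<xi> + (1 / sqrt t) *\<^sub>R z) * of_real (exp (- 1 * (norm z)\<^sup>2))) \<le>
            ((1 + R) ^ M * (1 + norm z) ^ M) * (exp (- (1/2) * (norm z)\<^sup>2) * exp (- (1/2) * (norm z)\<^sup>2))"
          using le R by (intro mult_mono) auto
        also have "\<dots> = (1 + R) ^ M * ((1 + norm z) ^ M * exp (- (1/2) * (norm z)\<^sup>2)) * exp (- (1/2) * (norm z)\<^sup>2)"
          by (simp only: mult_ac)
        also have "\<dots> \<le> (1 + R) ^ M * K * exp (- (1/2) * (norm z)\<^sup>2)"
          by (intro mult_right_mono mult_left_mono K) (use R in auto)
        finally show ?thesis using p1 by (simp add: field_simps)
      next
        case False
        have "w (\<xi> + (1 / sqrt t) *\<^sub>R z) = 0" using w[of "\<xi> + (1 / sqrt t) *\<^sub>R z"] False by (simp add: indicator_def)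
        thus ?thesis using R K0 p1 by simp
      qed
    qed (use R K0 in auto)
    also have "\<dots> = (1 + R) ^ M * K / (1 + norm \<xi>) ^ M * (LINT z|lborel. exp (- (1/2) * (norm (z::'a))\<^sup>2))"
      by (rule integral_mult_right_zero)
    finally have "norm (LINT z|lborel. w (\<xi> + (1 / sqrt t) *\<^sub>R z) * of_real (exp (- 1 * (norm z)\<^sup>2))) / pi powr (?n / 2) \<le> ((1 + R) ^ M * K / (1 + norm \<xi>) ^ M * (LINT z|lborel. exp (- (1/2) * (norm (z::'a))\<^sup>2))) / pi powr (?n / 2)"
      by (rule divide_right_mono) simp
    thus ?thesis
      unfolding W_def Q_def norm_divide norm_of_real abs_of_nonneg[OF powr_ge_zero] by (simp add: mult_ac)
  qed
  have Wm[measurable]: "W t \<in> borel_measurable borel" for t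
  proof -
    have "(\<lambda>\<xi>. LINT z|lborel. w (\<xi> + (1 / sqrt t) *\<^sub>R z) * of_real (exp (- 1 * (norm z)\<^sup>2))) \<in> borel_measurable borel"
      by (rule lborel.borel_measurable_lebesgue_integral) measurable
    thus ?thesis unfolding W_def by measurable
  qed
  have "((\<lambda>t. LINT \<xi>|lborel. h \<xi> * W t \<xi>) \<longlongrightarrow> (LINT \<xi>|lborel. h \<xi> * w \<xi>)) at_top"
  proof (rule integral_dominated_convergence_at_top)
    show "integrable lborel (\<lambda>\<xi>. Q * (norm (h \<xi>) / (1 + norm \<xi>) ^ M))" using hM by (rule integrable_mult_right)
    show "AE \<xi> in lborel. ((\<lambda>t. h \<xi> * W t \<xi>) \<longlongrightarrow> h \<xi> * w \<xi>) at_top"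
      by (intro AE_I2 tendsto_mult tendsto_const lim1)
    show "\<forall>\<^sub>F t in at_top. AE \<xi> in lborel. norm (h \<xi> * W t \<xi>) \<le> Q * (norm (h \<xi>) / (1 + norm \<xi>) ^ M)"
      using eventually_ge_at_top[of 1]
    proof eventually_elim
      case (elim t)
      show ?case
      proof (intro AE_I2)
        fix \<xi>
        have "norm (h \<xi> * W t \<xi>) \<le> norm (h \<xi>) * (Q / (1 + norm \<xi>) ^ M)"
          unfolding norm_mult by (intro mult_left_mono WQ elim) auto
        thus "norm (h \<xi> * W t \<xi>) \<le> Q * (norm (h \<xi>) / (1 + norm \<xi>) ^ M)" by (simp add: mult_ac)
      qed
    qed
  qed measurable
  hence "((\<lambda>t. norm (LINT \<xi>|lborel. h \<xi> * W t \<xi>)) \<longlongrightarrow> norm (LINT \<xi>|lborel. h \<xi> * w \<xi>)) at_top"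
    by (rule tendsto_norm)
  thus ?thesis
  proof (rule tendsto_upperbound)
    show "\<forall>\<^sub>F t in at_top. norm (LINT \<xi>|lborel. h \<xi> * W t \<xi>) \<le> Bd"
      using eventually_gt_at_top[of 0]
    proof eventually_elim
      case (elim t)
      let ?c = "(pi / t) powr (?n / 2)"
      have c: "?c > 0" using elim by simp
      have "of_real ?c * (LINT \<xi>|lborel. h \<xi> * W t \<xi>) = (LINT \<xi>|lborel. h \<xi> * (LINT \<eta>|lborel. w \<eta> * of_real (exp (- t * (norm (\<xi> - \<eta>))\<^sup>2))))"
        unfolding subst[OF elim] by (subst integral_mult_right_zero[symmetric]) (simp only: mult.left_commute)
      also have "\<dots> = of_real ?c * (LINT y|lborel. g y * of_real (exp (- (norm y)\<^sup>2 / (4 * t))) * osc_integral w y)"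
        by (rule mollified_pairing[OF elim])
      finally have "(LINT \<xi>|lborel. h \<xi> * W t \<xi>) = (LINT y|lborel. g y * of_real (exp (- (norm y)\<^sup>2 / (4 * t))) * osc_integral w y)"
        using c by simp
      moreover have "norm (LINT y|lborel. g y * of_real (exp (- (norm y)\<^sup>2 / (4 * t))) * osc_integral w y) \<le> Bd"
      proof (rule integral_norm_bound_nn)
        show "(\<integral>\<^sup>+y. ennreal (norm (g y * of_real (exp (- (norm y)\<^sup>2 / (4 * t))) * osc_integral w y)) \<partial>lborel) \<le> ennreal Bd"
        proof (rule order_trans[OF nn_integral_mono Bd(1)])
          fix y :: 'a
          have "exp (- (norm y)\<^sup>2 / (4 * t)) \<le> 1" using elim by simp
          hence "norm (g y) * exp (- (norm y)\<^sup>2 / (4 * t)) * norm (osc_integral w y) \<le> norm (g y) * 1 * norm (osc_integral w y)"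
            by (intro mult_right_mono mult_left_mono) auto
          thus "ennreal (norm (g y * of_real (exp (- (norm y)\<^sup>2 / (4 * t))) * osc_integral w y)) \<le> ennreal (norm (g y) * norm (osc_integral w y))"
            by (intro ennreal_leI) (simp add: norm_mult)
        qed
      qed (rule Bd(2))
      ultimately show ?case by simp
    qed
  qed simp
qed

end
end

lemma cball_in_borel [measurable]: "cball c r \<in> sets borel"
  by (simp add: borel_closed)

text \<open>
  Duality: the integral is the pairing of \<open>h\<close> with the conjugate of its sign on the ball, and this bounded function is a
  limit almost everywhere of continuous functions that are bounded by \<open>1\<close> and supported in the doubled ball.
\<close>

lemma integral_norm_ball_le:
  fixes g h :: "'a::euclidean_space \<Rightarrow> complex" and M :: nat
  assumes fou: "is_fourier g h"
    and hM: "integrable lborel (\<lambda>\<xi>. norm (h \<xi>) / (1 + norm \<xi>) ^ M)"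
    and \<rho>: "\<rho> > 0" and Bd0: "Bd \<ge> 0"
    and Bd: "\<And>w. w \<in> borel_measurable borel \<Longrightarrow> (\<And>\<eta>. norm (w \<eta>) \<le> indicator (cball 0 (2 * \<rho>)) \<eta>) \<Longrightarrow>
       (\<integral>\<^sup>+y. ennreal (norm (g y) * norm (osc_integral w y)) \<partial>lborel) \<le> ennreal Bd"
  shows "(\<integral>\<^sup>+\<xi>. ennreal (norm (h \<xi>)) * indicator (cball 0 \<rho>) \<xi> \<partial>lborel) \<le> ennreal Bd"
proof -
  have hm[measurable]: "h \<in> borel_measurable borel" using transform_borel_measurable[OF fou hM] .
  define s where "s = (\<lambda>\<xi>. (if norm \<xi> \<le> \<rho> then cnj (sgn (h \<xi>)) else 0))"
  have sm[measurable]: "s \<in> borel_measurable borel" unfolding s_def by measurable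
  have s1: "norm (s \<xi>) \<le> 1" for \<xi> by (simp add: s_def norm_sgn)
  have "s \<in> borel_measurable lebesgue" by (rule measurable_completion) (simp add: sm)
  hence "s measurable_on UNIV" by (intro lebesgue_measurable_imp_measurable_on) auto
  then obtain N u where N: "negligible N" and u: "\<And>k. continuous_on UNIV (u k)"
    and lim: "\<And>x. x \<notin> N \<Longrightarrow> (\<lambda>k. u k x) \<longlonglongrightarrow> s x"
    unfolding measurable_on_def by auto
  \<comment> \<open>A continuous cutoff, equal to one on the ball of radius \<open>\<rho>\<close> and zero outside the doubled one.\<close>
  let ?\<chi> = "\<lambda>x::'a. max 0 (min 1 (2 - norm x / \<rho>))"
  define w where "w = (\<lambda>k::nat. \<lambda>x. ?\<chi> x *\<^sub>R (u k x /\<^sub>R max 1 (norm (u k x))))"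
  have wc: "continuous_on UNIV (w k)" for k
    unfolding w_def using \<rho> by (intro continuous_intros u) auto
  have wm[measurable]: "w k \<in> borel_measurable borel" for k by (intro borel_measurable_continuous_onI wc)
  have c1: "norm (c /\<^sub>R max 1 (norm c)) \<le> 1" for c :: complex
    by (simp add: divide_inverse[symmetric] mult.commute[of "inverse _"])
  have wb: "norm (w k x) \<le> indicator (cball 0 (2 * \<rho>)) x" for k x
  proof (cases "norm x \<le> 2 * \<rho>")
    case True
    have "norm (w k x) \<le> 1 * 1"
      unfolding w_def norm_scaleR[of "?\<chi> x"] by (intro mult_mono c1) auto
    thus ?thesis using True by simp
  next
    case False
    hence "norm x / \<rho> \<ge> 2" using \<rho> by (simp add: field_simps)
    thus ?thesis by (simp add: w_def)
  qed
  have wlim: "(\<lambda>k. w k x) \<longlonglongrightarrow> s x" if "x \<notin> N" for x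
  proof -
    have "(\<lambda>k. w k x) \<longlonglongrightarrow> ?\<chi> x *\<^sub>R (s x /\<^sub>R max 1 (norm (s x)))"
      unfolding w_def by (intro tendsto_intros lim that) auto
    moreover have "?\<chi> x *\<^sub>R (s x /\<^sub>R max 1 (norm (s x))) = s x"
    proof (cases "norm x \<le> \<rho>")
      case True
      hence "norm x / \<rho> \<le> 1" using \<rho> by simp
      thus ?thesis using s1[of x] by (simp add: max_def)
    qed (simp add: s_def)
    ultimately show ?thesis by simp
  qed
  have bound: "norm (LINT \<xi>|lborel. h \<xi> * w k \<xi>) \<le> Bd" for k
    by (rule pairing_bound_continuous[OF fou hM wm _ wb wc Bd Bd0]) (use \<rho> wb in auto)
  have hR: "integrable lborel (\<lambda>\<xi>. (1 + 2 * \<rho>) ^ M * (norm (h \<xi>) / (1 + norm \<xi>) ^ M))" using hM by (rule integrable_mult_right)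
  have dom: "norm (h \<xi>) * indicator (cball 0 (2 * \<rho>)) \<xi> \<le> (1 + 2 * \<rho>) ^ M * (norm (h \<xi>) / (1 + norm \<xi>) ^ M)" for \<xi>
  proof (cases "norm \<xi> \<le> 2 * \<rho>")
    case True
    have "(1 + norm \<xi>) ^ M \<le> (1 + 2 * \<rho>) ^ M" using True by (intro power_mono) auto
    moreover have "(1 + norm \<xi>) ^ M > 0" by (intro zero_less_power) (simp add: add_pos_nonneg)
    ultimately have "1 \<le> (1 + 2 * \<rho>) ^ M / (1 + norm \<xi>) ^ M" by simp
    hence "norm (h \<xi>) * 1 \<le> norm (h \<xi>) * ((1 + 2 * \<rho>) ^ M / (1 + norm \<xi>) ^ M)" by (rule mult_left_mono) simp
    thus ?thesis using True by (simp add: mult_ac)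
  qed (use \<rho> in simp)
  have NA: "AE x in lborel. x \<notin> N"
  proof -
    have "N \<in> null_sets lebesgue" using N by (simp add: negligible_iff_null_sets)
    hence "AE x in lebesgue. x \<notin> N" by (rule AE_not_in)
    thus ?thesis by (simp add: AE_completion_iff)
  qed
  have "(\<lambda>k. LINT \<xi>|lborel. h \<xi> * w k \<xi>) \<longlonglongrightarrow> (LINT \<xi>|lborel. h \<xi> * s \<xi>)"
  proof (rule integral_dominated_convergence)
    show "integrable lborel (\<lambda>\<xi>. (1 + 2 * \<rho>) ^ M * (norm (h \<xi>) / (1 + norm \<xi>) ^ M))" by (rule hR)
    show "AE \<xi> in lborel. (\<lambda>k. h \<xi> * w k \<xi>) \<longlonglongrightarrow> h \<xi> * s \<xi>"
      using NA
    proof eventually_elim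
      case (elim \<xi>)
      show ?case by (rule tendsto_mult[OF tendsto_const wlim[OF elim]])
    qed
    show "AE \<xi> in lborel. norm (h \<xi> * w k \<xi>) \<le> (1 + 2 * \<rho>) ^ M * (norm (h \<xi>) / (1 + norm \<xi>) ^ M)" for k
      by (intro AE_I2 order_trans[OF _ dom]) (auto simp: norm_mult intro!: mult_left_mono wb)
  qed measurable
  from tendsto_norm[OF this] have "norm (LINT \<xi>|lborel. h \<xi> * s \<xi>) \<le> Bd"
    by (rule tendsto_upperbound) (simp_all add: bound)
  moreover have hs: "h \<xi> * s \<xi> = of_real (norm (h \<xi>) * indicator (cball 0 \<rho>) \<xi>)" for \<xi>
  proof (cases "norm \<xi> \<le> \<rho>")
    case True
    have "h \<xi> * cnj (sgn (h \<xi>)) = of_real (norm (h \<xi>))"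
    proof (cases "h \<xi> = 0")
      case False
      have "h \<xi> * cnj (sgn (h \<xi>)) = (h \<xi> * cnj (h \<xi>)) / of_real (norm (h \<xi>))"
        by (simp add: sgn_eq)
      also have "\<dots> = of_real ((norm (h \<xi>))\<^sup>2 / norm (h \<xi>))"
        by (simp only: complex_norm_square[symmetric] of_real_divide)
      finally show ?thesis using False by (simp add: power2_eq_square)
    qed simp
    thus ?thesis using True by (simp add: s_def)
  qed (simp add: s_def)
  ultimately have le: "(LINT \<xi>|lborel. norm (h \<xi>) * indicator (cball 0 \<rho>) \<xi>) \<le> Bd"
    by (simp only: hs integral_complex_of_real norm_of_real)
  have "integrable lborel (\<lambda>\<xi>. norm (h \<xi>) * indicator (cball 0 \<rho>) \<xi>)"
  proof (rule Bochner_Integration.integrable_bound[OF hR])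
    show "AE \<xi> in lborel. norm (norm (h \<xi>) * indicator (cball 0 \<rho>) \<xi>) \<le> norm ((1 + 2 * \<rho>) ^ M * (norm (h \<xi>) / (1 + norm \<xi>) ^ M))"
    proof (intro AE_I2)
      fix \<xi>
      have "norm (h \<xi>) * indicator (cball 0 \<rho>) \<xi> \<le> norm (h \<xi>) * indicator (cball 0 (2 * \<rho>)) \<xi>"
        using \<rho> by (intro mult_left_mono) (auto simp: indicator_def)
      also note dom
      finally have "norm (h \<xi>) * indicator (cball 0 \<rho>) \<xi> \<le> (1 + 2 * \<rho>) ^ M * (norm (h \<xi>) / (1 + norm \<xi>) ^ M)" .
      moreover have "0 \<le> norm (h \<xi>) * indicator (cball 0 \<rho>) \<xi>" by simp
      ultimately show "norm (norm (h \<xi>) * indicator (cball 0 \<rho>) \<xi>) \<le> norm ((1 + 2 * \<rho>) ^ M * (norm (h \<xi>) / (1 + norm \<xi>) ^ M))"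
        unfolding real_norm_def[of "_ * _"] by linarith
    qed
  qed measurable
  hence "(\<integral>\<^sup>+\<xi>. ennreal (norm (h \<xi>) * indicator (cball 0 \<rho>) \<xi>) \<partial>lborel) = ennreal (LINT \<xi>|lborel. norm (h \<xi>) * indicator (cball 0 \<rho>) \<xi>)"
    by (intro nn_integral_eq_integral) auto
  also have "\<dots> \<le> ennreal Bd" by (intro ennreal_leI le)
  finally show ?thesis by (simp add: ennreal_mult' ennreal_indicator)
qed

section \<open>Decay with logarithmic weights\<close>

lemma integrable_radial:
  fixes f :: "real \<Rightarrow> real"
  assumes [measurable]: "f \<in> borel_measurable borel"
    and i: "set_integrable lborel {0<..} (\<lambda>r. r ^ (DIM('a) - 1) * f r)"
  shows "integrable lborel (\<lambda>x::'a::euclidean_space. f (norm x))"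
proof -
  let ?d = "\<lambda>r. if 0 \<le> r then unit_ball_vol (DIM('a)) * real DIM('a) * r ^ (DIM('a) - 1) else 0"
  have "integrable lborel (\<lambda>r. (unit_ball_vol (DIM('a)) * real DIM('a)) * (indicator {0<..} r *\<^sub>R (r ^ (DIM('a) - 1) * f r)))"
    using i unfolding set_integrable_def by (rule integrable_mult_right)
  hence "integrable lborel (\<lambda>r. ?d r *\<^sub>R f r)"
  proof (rule integrable_cong_AE_imp)
    show "AE r in lborel. (unit_ball_vol (DIM('a)) * real DIM('a)) * (indicator {0<..} r *\<^sub>R (r ^ (DIM('a) - 1) * f r)) = ?d r *\<^sub>R f r"
      using AE_lborel_singleton[of "0::real"] by eventually_elim (auto simp: indicator_def)
  qed measurable
  hence "integrable (density lborel (\<lambda>r. ennreal (?d r))) f"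
    by (subst integrable_density) auto
  hence "integrable (distr (lborel :: 'a measure) borel norm) f" unfolding distr_norm_lborel .
  thus ?thesis by (subst (asm) integrable_distr_eq) auto
qed

lemma set_integrable_log_weight:
  assumes \<delta>: "\<delta> > (1::real)"
  shows "set_integrable lborel {0<..} (\<lambda>r. ln (exp 1 + r) powr (- \<delta>) / (exp 1 + r))"
proof -
  have "set_integrable lborel (einterval 0 \<infinity>) (\<lambda>r. ln (exp 1 + r) powr (- \<delta>) / (exp 1 + r))"
  proof (rule interval_integral_FTC_nonneg(1)[where F = "\<lambda>r. ln (exp 1 + r) powr (1 - \<delta>) / (1 - \<delta>)"])
    show "((\<lambda>r. ln (exp 1 + r) powr (1 - \<delta>) / (1 - \<delta>)) has_real_derivative ln (exp 1 + r) powr (- \<delta>) / (exp 1 + r)) (at r)" if "0 < ereal r" for r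
    proof -
      have r: "r > 0" using that by simp
      have "exp 1 + r > 1" using r exp_ge_add_one_self[of 1] by linarith
      hence l: "ln (exp 1 + r) > 0" "exp 1 + r > 0" by auto
      have "((\<lambda>r. ln (exp 1 + r)) has_real_derivative 1 / (exp 1 + r)) (at r)"
        using l by (auto intro!: derivative_eq_intros)
      from DERIV_cdivide[OF DERIV_chain2[OF has_real_derivative_powr[OF l(1), of "1 - \<delta>"] this], of "1 - \<delta>"]
      show ?thesis using \<delta> by simp
    qed
    show "isCont (\<lambda>r. ln (exp 1 + r) powr (- \<delta>) / (exp 1 + r)) r" if "0 < ereal r" for r
    proof -
      have r: "r > 0" using that by simp
      have "exp 1 + r > 1" using r exp_ge_add_one_self[of 1] by linarith
      hence "ln (exp 1 + r) > 0" "exp 1 + r > 0" by auto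
      thus ?thesis by (auto intro!: continuous_intros)
    qed
    show "(((\<lambda>r. ln (exp 1 + r) powr (1 - \<delta>) / (1 - \<delta>)) \<circ> real_of_ereal) \<longlongrightarrow> ln (exp 1 + 0) powr (1 - \<delta>) / (1 - \<delta>)) (at_right 0)"
      unfolding zero_ereal_def ereal_tendsto_simps using \<delta> by (intro tendsto_intros) auto
    show "(((\<lambda>r. ln (exp 1 + r) powr (1 - \<delta>) / (1 - \<delta>)) \<circ> real_of_ereal) \<longlongrightarrow> 0) (at_left \<infinity>)"
      unfolding ereal_tendsto_simps using \<delta> by real_asymp
  qed (auto intro!: AE_I2 divide_nonneg_pos simp: add_pos_pos)
  moreover have "einterval 0 \<infinity> = {0::real<..}" by (auto simp: einterval_def)
  ultimately show ?thesis by simp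
qed

lemma set_integrable_near_zero:
  assumes \<tau>: "\<tau> > (1::real)" and \<rho>: "0 < (\<rho>::real)" "\<rho> < 1"
  shows "set_integrable lborel {0<..<\<rho>} (\<lambda>r. \<bar>ln r\<bar> powr (- \<tau>) / r)"
proof -
  have "set_integrable lborel (einterval 0 (ereal \<rho>)) (\<lambda>r. \<bar>ln r\<bar> powr (- \<tau>) / r)"
  proof (rule interval_integral_FTC_nonneg(1)[where F = "\<lambda>r. (- ln r) powr (1 - \<tau>) / (\<tau> - 1)"])
    show "((\<lambda>r. (- ln r) powr (1 - \<tau>) / (\<tau> - 1)) has_real_derivative \<bar>ln r\<bar> powr (- \<tau>) / r) (at r)" if "0 < ereal r" "ereal r < ereal \<rho>" for r
    proof -
      have r: "0 < r" "r < 1" using that \<rho> by auto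
      hence l: "- ln r > 0" by simp
      hence a: "\<bar>ln r\<bar> = - ln r" by simp
      have "((\<lambda>r. - ln r) has_real_derivative - (1 / r)) (at r)"
        using r by (auto intro!: derivative_eq_intros)
      from DERIV_cdivide[OF DERIV_chain2[OF has_real_derivative_powr[OF l, of "1 - \<tau>"] this], of "\<tau> - 1"]
      have "((\<lambda>r. (- ln r) powr (1 - \<tau>) / (\<tau> - 1)) has_real_derivative (1 - \<tau>) * (- ln r) powr (- \<tau>) * - (1 / r) / (\<tau> - 1)) (at r)"
        by simp
      moreover have "(1 - \<tau>) * (- ln r) powr (- \<tau>) * - (1 / r) / (\<tau> - 1) = \<bar>ln r\<bar> powr (- \<tau>) / r"
        unfolding a using \<tau> r by (simp add: field_simps)
      ultimately show ?thesis by simp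
    qed
    show "isCont (\<lambda>r. \<bar>ln r\<bar> powr (- \<tau>) / r) r" if "0 < ereal r" "ereal r < ereal \<rho>" for r
      using that \<rho> by (auto intro!: continuous_intros)
    show "(((\<lambda>r. (- ln r) powr (1 - \<tau>) / (\<tau> - 1)) \<circ> real_of_ereal) \<longlongrightarrow> 0) (at_right 0)"
      unfolding zero_ereal_def ereal_tendsto_simps using \<tau> by real_asymp
    show "(((\<lambda>r. (- ln r) powr (1 - \<tau>) / (\<tau> - 1)) \<circ> real_of_ereal) \<longlongrightarrow> (- ln \<rho>) powr (1 - \<tau>) / (\<tau> - 1)) (at_left (ereal \<rho>))"
      unfolding ereal_tendsto_simps using \<rho> \<tau> by (intro tendsto_intros) auto
  qed (use \<rho> in \<open>auto intro!: AE_I2\<close>)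
  moreover have "einterval 0 (ereal \<rho>) = {0<..<\<rho>}" by (auto simp: einterval_def)
  ultimately show ?thesis by simp
qed

lemma set_integrable_ln_0_1: "set_integrable lborel {0<..<1} (\<lambda>r::real. 1 - ln r)"
proof -
  have "set_integrable lborel (einterval 0 1) (\<lambda>r::real. 1 - ln r)"
  proof (rule interval_integral_FTC_nonneg(1)[where F = "\<lambda>r. 2 * r - r * ln r"])
    show "(((\<lambda>r::real. 2 * r - r * ln r) \<circ> real_of_ereal) \<longlongrightarrow> 0) (at_right 0)"
      unfolding zero_ereal_def ereal_tendsto_simps by real_asymp
    show "(((\<lambda>r::real. 2 * r - r * ln r) \<circ> real_of_ereal) \<longlongrightarrow> 2 * 1 - 1 * ln 1) (at_left 1)"
      unfolding one_ereal_def ereal_tendsto_simps by (intro tendsto_intros) auto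
    show "AE x in lborel. 0 < ereal x \<longrightarrow> ereal x < 1 \<longrightarrow> 0 \<le> 1 - ln x"
    proof (intro AE_I2 impI)
      fix x assume "0 < ereal x" "ereal x < 1"
      hence "0 < x" "x < 1" by (simp_all add: one_ereal_def)
      hence "ln x < 0" by simp
      thus "0 \<le> 1 - ln x" by simp
    qed
  qed (auto intro!: derivative_eq_intros continuous_intros)
  moreover have "einterval 0 1 = {0<..<1::real}" by (auto simp: einterval_def)
  ultimately show ?thesis by simp
qed

lemma one_le_ln_e: "r \<ge> 0 \<Longrightarrow> 1 \<le> ln (exp 1 + (r::real))"
  using ln_le_cancel_iff[of "exp 1" "exp 1 + r"] by (simp add: add_pos_nonneg)

lemma powr_split_factor:
  "p > 0 \<Longrightarrow> q > 0 \<Longrightarrow> q powr (- a) = p powr a * (p * q) powr (- (a::real))"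
  by (simp add: powr_mult mult.assoc[symmetric] powr_add[symmetric])

lemma integrable_log_weight:
  assumes \<delta>: "\<delta> > (1::real)"
  shows "integrable lborel (\<lambda>x::'a::euclidean_space. (1 + norm x) powr (- real DIM('a)) * ln (exp 1 + norm x) powr (- \<delta>))"
proof (rule integrable_radial[where f = "\<lambda>r. (1 + r) powr (- real DIM('a)) * ln (exp 1 + r) powr (- \<delta>)"])
  let ?n = "DIM('a)"
  show "set_integrable lborel {0<..} (\<lambda>r. r ^ (?n - 1) * ((1 + r) powr (- real ?n) * ln (exp 1 + r) powr (- \<delta>)))"
  proof (rule set_integrable_bound)
    show "set_integrable lborel {0<..} (\<lambda>r. exp 1 * (ln (exp 1 + r) powr (- \<delta>) / (exp 1 + r)))"
      by (intro set_integrable_mult_right set_integrable_log_weight \<delta>)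
    show "AE r in lborel. r \<in> {0<..} \<longrightarrow> norm (r ^ (?n - 1) * ((1 + r) powr (- real ?n) * ln (exp 1 + r) powr (- \<delta>))) \<le> norm (exp 1 * (ln (exp 1 + r) powr (- \<delta>) / (exp 1 + r)))"
    proof (intro AE_I2 impI)
      fix r :: real assume "r \<in> {0<..}"
      hence r: "r > 0" by simp
      have "r ^ (?n - 1) \<le> (1 + r) ^ (?n - 1)" using r by (intro power_mono) auto
      also have "(1 + r) ^ (?n - 1) * (1 + r) = (1 + r) ^ ?n"
        using power_minus_mult[of ?n "1 + r"] by simp
      hence "(1 + r) ^ (?n - 1) = (1 + r) ^ ?n / (1 + r)" using r by (simp add: field_simps)
      finally have "r ^ (?n - 1) * (1 + r) powr (- real ?n) \<le> (1 + r) ^ ?n / (1 + r) * (1 + r) powr (- real ?n)"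
        by (rule mult_right_mono) simp
      also have "\<dots> = 1 / (1 + r)" using r by (simp add: powr_minus powr_realpow)
      also have "\<dots> \<le> exp 1 / (exp 1 + r)"
        using r exp_ge_add_one_self[of "1::real"] by (simp add: field_simps)
      finally have "r ^ (?n - 1) * (1 + r) powr (- real ?n) * ln (exp 1 + r) powr (- \<delta>) \<le> exp 1 / (exp 1 + r) * ln (exp 1 + r) powr (- \<delta>)"
        by (rule mult_right_mono) simp
      thus "norm (r ^ (?n - 1) * ((1 + r) powr (- real ?n) * ln (exp 1 + r) powr (- \<delta>))) \<le> norm (exp 1 * (ln (exp 1 + r) powr (- \<delta>) / (exp 1 + r)))"
        using r by (simp add: abs_mult mult_ac add_pos_pos)
    qed
  qed (auto simp: set_borel_measurable_def)
qed measurable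

definition log_decay :: "real \<Rightarrow> real \<Rightarrow> real \<Rightarrow> ('a::euclidean_space \<Rightarrow> complex) \<Rightarrow> bool" where
  "log_decay C a \<delta> g \<longleftrightarrow> (\<forall>y. norm (g y) \<le> C * ((1 + norm y) powr (- a) * ln (exp 1 + norm y) powr (- \<delta>)))"

text \<open>
  Translation changes \<open>1 + \<bar>y\<bar>\<close> and the logarithm by bounded factors only.
\<close>

lemma log_decay_reflect:
  fixes g :: "'a::euclidean_space \<Rightarrow> complex"
  assumes g: "log_decay C a \<delta> g" and C: "C \<ge> 0" and a: "a \<ge> 0" and \<delta>: "\<delta> \<ge> 0"
  obtains C' where "C' \<ge> 0" "log_decay C' a \<delta> (\<lambda>z. g (x - z))"
proof (rule that)
  let ?L = "\<lambda>y::'a. ln (exp 1 + norm y)"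
  let ?C = "C * ((1 + norm x) powr a * (1 + ?L x) powr \<delta>)"
  show "?C \<ge> 0" using C by simp
  show "log_decay ?C a \<delta> (\<lambda>z. g (x - z))"
    unfolding log_decay_def
  proof
    fix z :: 'a
    have p: "1 + norm z > 0" "1 + norm x > 0" "1 + norm (x - z) > 0" by (simp_all add: add_pos_nonneg)
    have L1: "?L y \<ge> 1" for y :: 'a by (rule one_le_ln_e) simp
    have "1 + norm z \<le> (1 + norm x) * (1 + norm (z - x))" by (rule one_plus_norm_le)
    hence 1: "1 + norm z \<le> (1 + norm x) * (1 + norm (x - z))" by (simp add: norm_minus_commute)
    have "(1 + norm (x - z)) powr (- a) = (1 + norm x) powr a * ((1 + norm x) * (1 + norm (x - z))) powr (- a)"
      using p(2,3) by (rule powr_split_factor)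
    also have "\<dots> \<le> (1 + norm x) powr a * (1 + norm z) powr (- a)"
      using 1 p a by (intro mult_left_mono powr_mono2') auto
    finally have A: "(1 + norm (x - z)) powr (- a) \<le> (1 + norm x) powr a * (1 + norm z) powr (- a)" .
    have e: "exp (1::real) \<ge> 1" "exp 1 + norm y > 0" for y :: 'a by (simp_all add: add_pos_nonneg)
    have "norm z \<le> norm x + norm (x - z)" using norm_triangle_ineq4[of x "x - z"] by simp
    hence "exp 1 + norm z \<le> exp 1 * exp 1 + exp 1 * norm x + exp 1 * norm (x - z) + norm x * norm (x - z)"
      using mult_right_mono[of 1 "exp 1" "norm x"] mult_right_mono[of 1 "exp 1" "norm (x - z)"] mult_right_mono[of 1 "exp 1" "exp (1::real)"] e(1)
        mult_nonneg_nonneg[of "norm x" "norm (x - z)"] norm_ge_zero[of x] norm_ge_zero[of "x - z"]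
      unfolding mult_1_left by linarith
    also have "\<dots> = (exp 1 + norm x) * (exp 1 + norm (x - z))" by (simp add: algebra_simps)
    finally have "?L z \<le> ln ((exp 1 + norm x) * (exp 1 + norm (x - z)))"
      using e(2)[of z] by (intro ln_mono) auto
    also have "\<dots> = ?L x + ?L (x - z)" by (rule ln_mult_pos[OF e(2) e(2)])
    also have "\<dots> \<le> ?L x * ?L (x - z) + ?L (x - z)"
      using L1[of x] L1[of "x - z"] mult_left_mono[of 1 "?L (x - z)" "?L x"] by simp
    finally have 2: "?L z \<le> (1 + ?L x) * ?L (x - z)" by (simp add: algebra_simps)
    have q: "?L z > 0" "1 + ?L x > 0" "?L (x - z) > 0" using L1[of z] L1[of x] L1[of "x - z"] by linarith+
    have "?L (x - z) powr (- \<delta>) = (1 + ?L x) powr \<delta> * ((1 + ?L x) * ?L (x - z)) powr (- \<delta>)"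
      using q(2,3) by (rule powr_split_factor)
    also have "\<dots> \<le> (1 + ?L x) powr \<delta> * ?L z powr (- \<delta>)"
      using 2 q \<delta> by (intro mult_left_mono powr_mono2') auto
    finally have B: "?L (x - z) powr (- \<delta>) \<le> (1 + ?L x) powr \<delta> * ?L z powr (- \<delta>)" .
    have "norm (g (x - z)) \<le> C * ((1 + norm (x - z)) powr (- a) * ?L (x - z) powr (- \<delta>))"
      using g unfolding log_decay_def by blast
    also have "\<dots> \<le> C * (((1 + norm x) powr a * (1 + norm z) powr (- a)) * ((1 + ?L x) powr \<delta> * ?L z powr (- \<delta>)))"
      by (intro mult_left_mono mult_mono A B C) auto
    also have "\<dots> = ?C * ((1 + norm z) powr (- a) * ?L z powr (- \<delta>))" by (simp add: mult_ac)
    finally show "norm (g (x - z)) \<le> ?C * ((1 + norm z) powr (- a) * ?L z powr (- \<delta>))" .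
  qed
qed

text \<open>
  At infinity one logarithm is spent on the factor \<open>1 + \<bar>ln \<bar>z\<bar>\<bar>\<close>, which leaves the exponent \<open>\<delta> - 1 > 1\<close>; at the origin
  the power is no worse than \<open>1 - n\<close> in dimension \<open>n\<close>.
\<close>

lemma log_decay_integrable:
  fixes G :: "'a::euclidean_space \<Rightarrow> complex"
  assumes Gm[measurable]: "G \<in> borel_measurable borel" and G: "log_decay C a \<delta> G" and C: "C \<ge> 0" and a: "a \<ge> 0" and \<delta>: "\<delta> > 2"
    and s: "s \<ge> 1 - real DIM('a)" "s \<le> a - real DIM('a)"
  shows "integrable lborel (\<lambda>z. norm (G z) * (norm z powr s * (1 + \<bar>ln (norm z)\<bar>)))"
proof -
  let ?n = "real DIM('a)"
  let ?f = "\<lambda>r::real. indicator {0<..<1} r * (r powr (1 - ?n) * (1 - ln r))"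
  let ?g = "\<lambda>r. (1 + r) powr (- ?n) * ln (exp 1 + r) powr (- (\<delta> - 1))"
  have i1: "integrable lborel (\<lambda>x::'a. ?f (norm x))"
  proof (rule integrable_radial)
    have e: "indicator {0<..} r *\<^sub>R (r ^ (DIM('a) - 1) * ?f r) = indicator {0<..<1} r *\<^sub>R (1 - ln r)" for r :: real
    proof (cases "0 < r \<and> r < 1")
      case True
      have "r ^ (DIM('a) - 1) = r powr (?n - 1)"
        using True DIM_positive[where 'a = 'a] by (simp add: powr_realpow[symmetric] of_nat_diff Suc_le_eq del: DIM_positive)
      hence "r ^ (DIM('a) - 1) * r powr (1 - ?n) = 1" using True by (simp add: powr_add[symmetric])
      thus ?thesis using True by (simp add: mult.assoc[symmetric])
    qed (auto simp: indicator_def)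
    show "set_integrable lborel {0<..} (\<lambda>r. r ^ (DIM('a) - 1) * ?f r)"
      using set_integrable_ln_0_1 unfolding set_integrable_def e .
  qed measurable
  have i2: "integrable lborel (\<lambda>x::'a. ?g (norm x))"
    by (rule integrable_log_weight) (use \<delta> in simp)
  have "integrable lborel (\<lambda>x::'a. C * ?f (norm x) + (C * 2 powr \<bar>s\<bar> * 2) * ?g (norm x))"
    by (intro Bochner_Integration.integrable_add integrable_mult_right i1 i2)
  thus ?thesis
  proof (rule Bochner_Integration.integrable_bound)
    show "AE z in lborel. norm (norm (G z) * (norm z powr s * (1 + \<bar>ln (norm z)\<bar>))) \<le> norm (C * ?f (norm z) + (C * 2 powr \<bar>s\<bar> * 2) * ?g (norm z))"
      using AE_lborel_nonzero
    proof eventually_elim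
      case (elim z)
      define r where "r = norm z"
      have r: "r > 0" using elim by (simp add: r_def)
      have L1: "ln (exp 1 + r) \<ge> 1" by (rule one_le_ln_e) (use r in simp)
      have Gz: "norm (G z) \<le> C * ((1 + r) powr (- a) * ln (exp 1 + r) powr (- \<delta>))"
        using G unfolding log_decay_def r_def by blast
      have f0: "?f r \<ge> 0"
      proof (cases "r < 1")
        case True
        hence "ln r \<le> 0" using r by simp
        thus ?thesis by simp
      qed simp
      have "norm (G z) * (r powr s * (1 + \<bar>ln r\<bar>)) \<le> C * ?f r + (C * 2 powr \<bar>s\<bar> * 2) * ?g r"
      proof (cases "r < 1")
        case True
        have l: "\<bar>ln r\<bar> = - ln r" using True r by simp
        have "(1 + r) powr (- a) \<le> 1 powr (- a)" using r a by (intro powr_mono2') auto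
        moreover have "ln (exp 1 + r) powr (- \<delta>) \<le> 1 powr (- \<delta>)" using L1 \<delta> by (intro powr_mono2') auto
        ultimately have "(1 + r) powr (- a) * ln (exp 1 + r) powr (- \<delta>) \<le> 1 * 1" by (intro mult_mono) auto
        hence "C * ((1 + r) powr (- a) * ln (exp 1 + r) powr (- \<delta>)) \<le> C * (1 * 1)" using C by (intro mult_left_mono)
        hence G1: "norm (G z) \<le> C" using Gz by simp
        have "r powr s \<le> r powr (1 - ?n)" using True r s by (intro powr_mono') auto
        hence "norm (G z) * (r powr s * (1 + \<bar>ln r\<bar>)) \<le> C * (r powr (1 - ?n) * (1 + \<bar>ln r\<bar>))"
          using G1 C by (intro mult_mono) auto
        also have "\<dots> = C * ?f r" using True r unfolding l by simp
        also have "\<dots> \<le> C * ?f r + (C * 2 powr \<bar>s\<bar> * 2) * ?g r" using C by simp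
        finally show ?thesis .
      next
        case False
        have l: "\<bar>ln r\<bar> = ln r" using False r by simp
        have "ln r \<le> ln (exp 1 + r)" using r by (intro ln_mono) auto
        hence 1: "1 + \<bar>ln r\<bar> \<le> 2 * ln (exp 1 + r)" using L1 unfolding l by linarith
        have 2: "r powr s \<le> 2 powr \<bar>s\<bar> * (1 + r) powr s"
        proof (cases "s \<ge> 0")
          case True
          have "r powr s \<le> (1 + r) powr s" using True r by (intro powr_mono2) auto
          also have "\<dots> \<le> 2 powr \<bar>s\<bar> * (1 + r) powr s"
            using mult_right_mono[of 1 "2 powr \<bar>s\<bar>" "(1 + r) powr s"] ge_one_powr_ge_zero[of 2 "\<bar>s\<bar>"] by simp
          finally show ?thesis .
        next
          case neg: False
          have "r powr s \<le> ((1 + r) / 2) powr s" using neg False by (intro powr_mono2') auto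
          also have "\<dots> = 2 powr \<bar>s\<bar> * (1 + r) powr s" using neg r by (simp add: powr_divide powr_minus_divide)
          finally show ?thesis .
        qed
        have "norm (G z) * (r powr s * (1 + \<bar>ln r\<bar>)) \<le> (C * ((1 + r) powr (- a) * ln (exp 1 + r) powr (- \<delta>))) * ((2 powr \<bar>s\<bar> * (1 + r) powr s) * (2 * ln (exp 1 + r)))"
          using Gz 1 2 L1 C by (intro mult_mono) auto
        also have "\<dots> = (C * 2 powr \<bar>s\<bar> * 2) * (((1 + r) powr (- a) * (1 + r) powr s) * (ln (exp 1 + r) powr (- \<delta>) * ln (exp 1 + r)))"
          by (simp only: mult_ac)
        also have "(1 + r) powr (- a) * (1 + r) powr s = (1 + r) powr (s - a)" by (simp add: powr_add[symmetric])
        also have "ln (exp 1 + r) powr (- \<delta>) * ln (exp 1 + r) = ln (exp 1 + r) powr (- (\<delta> - 1))"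
          using L1 powr_add[of "ln (exp 1 + r)" "- \<delta>" 1] by simp
        also have "(C * 2 powr \<bar>s\<bar> * 2) * ((1 + r) powr (s - a) * ln (exp 1 + r) powr (- (\<delta> - 1))) \<le> (C * 2 powr \<bar>s\<bar> * 2) * ?g r"
          using r s C by (intro mult_left_mono mult_right_mono powr_mono) auto
        also have "\<dots> \<le> C * ?f r + (C * 2 powr \<bar>s\<bar> * 2) * ?g r" using C f0 by simp
        finally show ?thesis .
      qed
      moreover have "norm (G z) * (r powr s * (1 + \<bar>ln r\<bar>)) \<ge> 0" by simp
      ultimately show ?case unfolding r_def[symmetric] real_norm_def[of "_ * _"] real_norm_def[of "_ + _"] by linarith
    qed
  qed measurable
qed

text \<open>
  Near the origin the power with exponent \<open>- a\<close> dominates, elsewhere \<open>\<bar>\<xi>\<bar>\<close> is comparable to \<open>1 + \<bar>\<xi>\<bar>\<close>.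
\<close>

lemma multiplier_integrable:
  fixes h :: "'a::euclidean_space \<Rightarrow> complex"
  assumes hm[measurable]: "h \<in> borel_measurable borel"
    and hM: "integrable lborel (\<lambda>\<xi>. norm (h \<xi>) / (1 + norm \<xi>) ^ M)"
    and near: "\<rho> > 0" "\<rho> \<le> 1" "(\<integral>\<^sup>+\<xi>. ennreal (norm (h \<xi>) * norm \<xi> powr (- a)) * indicator (cball 0 \<rho>) \<xi> \<partial>lborel) < \<infinity>"
    and \<alpha>: "real M \<le> \<alpha>" "\<alpha> \<le> a"
  shows "integrable lborel (\<lambda>\<xi>. norm (h \<xi>) * norm \<xi> powr (- \<alpha>))"
proof -
  let ?N = "\<lambda>\<xi>. norm (h \<xi>) * norm \<xi> powr (- a) * indicator (cball 0 \<rho>) \<xi>"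
  have iN: "integrable lborel ?N"
  proof (rule integrableI_bounded)
    have "ennreal (norm (?N \<xi>)) = ennreal (norm (h \<xi>) * norm \<xi> powr (- a)) * indicator (cball 0 \<rho>) \<xi>" for \<xi>
      by (simp add: indicator_def)
    thus "(\<integral>\<^sup>+\<xi>. ennreal (norm (?N \<xi>)) \<partial>lborel) < \<infinity>" using near(3) by simp
  qed measurable
  define c where "c = ((1 + \<rho>) / \<rho>) powr \<alpha>"
  have "integrable lborel (\<lambda>\<xi>. ?N \<xi> + c * (norm (h \<xi>) / (1 + norm \<xi>) ^ M))"
    by (intro Bochner_Integration.integrable_add integrable_mult_right iN hM)
  thus ?thesis
  proof (rule Bochner_Integration.integrable_bound)
    show "AE \<xi> in lborel. norm (norm (h \<xi>) * norm \<xi> powr (- \<alpha>)) \<le> norm (?N \<xi> + c * (norm (h \<xi>) / (1 + norm \<xi>) ^ M))"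
      using AE_lborel_nonzero
    proof eventually_elim
      case (elim \<xi>)
      have n: "norm \<xi> > 0" "1 + norm \<xi> > 0" using elim by (auto simp: add_pos_nonneg)
      have c0: "c * (norm (h \<xi>) / (1 + norm \<xi>) ^ M) \<ge> 0" by (simp add: c_def)
      have "norm (h \<xi>) * norm \<xi> powr (- \<alpha>) \<le> ?N \<xi> + c * (norm (h \<xi>) / (1 + norm \<xi>) ^ M)"
      proof (cases "norm \<xi> \<le> \<rho>")
        case True
        have "norm \<xi> powr (- \<alpha>) \<le> norm \<xi> powr (- a)" using True n near \<alpha> by (intro powr_mono') auto
        hence "norm (h \<xi>) * norm \<xi> powr (- \<alpha>) \<le> norm (h \<xi>) * norm \<xi> powr (- a)" by (rule mult_left_mono) simp
        thus ?thesis using True c0 by simp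
      next
        case False
        have "norm \<xi> \<ge> (\<rho> / (1 + \<rho>)) * (1 + norm \<xi>)" using False near by (simp add: field_simps)
        hence "norm \<xi> powr (- \<alpha>) \<le> ((\<rho> / (1 + \<rho>)) * (1 + norm \<xi>)) powr (- \<alpha>)"
          using n near \<alpha> by (intro powr_mono2') auto
        also have "\<dots> = c * (1 + norm \<xi>) powr (- \<alpha>)"
        proof -
          have "(\<rho> / (1 + \<rho>)) powr (- \<alpha>) = c"
            using near unfolding c_def powr_minus by (simp add: powr_divide)
          thus ?thesis using n near by (simp only: powr_mult)
        qed
        also have "\<dots> \<le> c * (1 + norm \<xi>) powr (- real M)"
          using n \<alpha> by (intro mult_left_mono powr_mono) (auto simp: c_def)
        also have "\<dots> = c / (1 + norm \<xi>) ^ M" using n by (simp add: powr_minus powr_realpow field_simps)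
        finally have "norm (h \<xi>) * norm \<xi> powr (- \<alpha>) \<le> norm (h \<xi>) * (c / (1 + norm \<xi>) ^ M)" by (rule mult_left_mono) simp
        thus ?thesis using False by (simp add: mult_ac)
      qed
      moreover have "0 \<le> norm (h \<xi>) * norm \<xi> powr (- \<alpha>)" by simp
      ultimately show ?case unfolding real_norm_def[of "_ * _"] real_norm_def[of "_ + _"] by linarith
    qed
  qed measurable
qed

text \<open>
  In polar coordinates the bound becomes \<open>\<bar>ln r\<bar>\<close> to the power \<open>- \<tau>\<close> divided by \<open>r\<close>.
\<close>

lemma near_zero_of_vanishing:
  fixes h :: "'a::euclidean_space \<Rightarrow> complex"
  assumes hm[measurable]: "h \<in> borel_measurable borel" and \<tau>: "\<tau> > (1::real)" and r: "r > 0" and C: "C \<ge> 0"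
    and h: "AE \<xi> in lborel. norm \<xi> < r \<longrightarrow> norm (h \<xi>) \<le> C * norm \<xi> ^ p * \<bar>ln (norm \<xi>)\<bar> powr (- \<tau>)"
  obtains \<rho> where "0 < \<rho>" "\<rho> \<le> 1" "(\<integral>\<^sup>+\<xi>. ennreal (norm (h \<xi>) * norm \<xi> powr (- (real p + DIM('a)))) * indicator (cball 0 \<rho>) \<xi> \<partial>lborel) < \<infinity>"
proof -
  let ?n = "real DIM('a)"
  define \<rho> where "\<rho> = min (r / 2) (1 / 2)"
  have \<rho>: "0 < \<rho>" "\<rho> < 1" "\<rho> < r" using r by (auto simp: \<rho>_def)
  let ?f = "\<lambda>t::real. indicator {0<..<\<rho>} t * (t powr (- ?n) * \<bar>ln t\<bar> powr (- \<tau>))"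
  have i: "integrable lborel (\<lambda>x::'a. ?f (norm x))"
  proof (rule integrable_radial)
    have e: "indicator {0<..} t *\<^sub>R (t ^ (DIM('a) - 1) * ?f t) = indicator {0<..<\<rho>} t *\<^sub>R (\<bar>ln t\<bar> powr (- \<tau>) / t)" for t :: real
    proof (cases "0 < t \<and> t < \<rho>")
      case True
      have "t ^ (DIM('a) - 1) = t powr (?n - 1)"
        using True DIM_positive[where 'a = 'a] by (simp add: powr_realpow[symmetric] of_nat_diff Suc_le_eq del: DIM_positive)
      hence "t ^ (DIM('a) - 1) * t powr (- ?n) = t powr ((?n - 1) + (- ?n))" by (simp only: powr_add)
      also have "\<dots> = 1 / t" using True by (simp add: powr_minus_divide)
      finally have "t ^ (DIM('a) - 1) * t powr (- ?n) = 1 / t" .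
      thus ?thesis using True by (simp add: mult.assoc[symmetric])
    qed (auto simp: indicator_def)
    show "set_integrable lborel {0<..} (\<lambda>t. t ^ (DIM('a) - 1) * ?f t)"
      using set_integrable_near_zero[OF \<tau> \<rho>(1,2)] unfolding set_integrable_def e .
  qed measurable
  hence "integrable lborel (\<lambda>x::'a. C * ?f (norm x))" by (rule integrable_mult_right)
  hence fin: "(\<integral>\<^sup>+x. ennreal (norm (C * ?f (norm (x::'a)))) \<partial>lborel) < \<infinity>" unfolding integrable_iff_bounded by blast
  have "(\<integral>\<^sup>+\<xi>. ennreal (norm (h \<xi>) * norm \<xi> powr (- (real p + ?n))) * indicator (cball 0 (\<rho> / 2)) \<xi> \<partial>lborel) \<le> (\<integral>\<^sup>+x. ennreal (norm (C * ?f (norm (x::'a)))) \<partial>lborel)"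
  proof (rule nn_integral_mono_AE)
    show "AE \<xi> in lborel. ennreal (norm (h \<xi>) * norm \<xi> powr (- (real p + ?n))) * indicator (cball 0 (\<rho> / 2)) \<xi> \<le> ennreal (norm (C * ?f (norm (\<xi>::'a))))"
      using h AE_lborel_nonzero
    proof eventually_elim
      case (elim \<xi>)
      show ?case
      proof (cases "norm \<xi> \<le> \<rho> / 2")
        case True
        have n: "norm \<xi> > 0" "norm \<xi> < \<rho>" "norm \<xi> < r" using elim True \<rho> by auto
        have "norm \<xi> ^ p * norm \<xi> powr (- (real p + ?n)) = norm \<xi> powr (- ?n)"
          using n by (simp add: powr_realpow[symmetric] powr_add[symmetric])
        moreover have "norm (h \<xi>) * norm \<xi> powr (- (real p + ?n)) \<le> (C * norm \<xi> ^ p * \<bar>ln (norm \<xi>)\<bar> powr (- \<tau>)) * norm \<xi> powr (- (real p + ?n))"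
          using elim n by (intro mult_right_mono) auto
        ultimately have "norm (h \<xi>) * norm \<xi> powr (- (real p + ?n)) \<le> C * (norm \<xi> powr (- ?n) * \<bar>ln (norm \<xi>)\<bar> powr (- \<tau>))"
          by (metis (no_types, opaque_lifting) mult.assoc mult.commute)
        also have "\<dots> = norm (C * ?f (norm \<xi>))" using n C by (simp add: abs_mult)
        finally show ?thesis using True by (simp add: ennreal_leI)
      qed simp
    qed
  qed
  also note fin
  finally show thesis using \<rho> by (intro that[of "\<rho> / 2"]) auto
qed

section \<open>Integrability of the transform near the origin\<close>

lemma integral_norm_ball_le_ennreal:
  fixes g h :: "'a::euclidean_space \<Rightarrow> complex" and M :: nat
  assumes fou: "is_fourier g h"
    and hM: "integrable lborel (\<lambda>\<xi>. norm (h \<xi>) / (1 + norm \<xi>) ^ M)"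
    and \<rho>: "\<rho> > 0"
    and Bd: "\<And>w. w \<in> borel_measurable borel \<Longrightarrow> (\<And>\<eta>. norm (w \<eta>) \<le> indicator (cball 0 (2 * \<rho>)) \<eta>) \<Longrightarrow>
       (\<integral>\<^sup>+y. ennreal (norm (g y) * norm (osc_integral w y)) \<partial>lborel) \<le> Bd"
  shows "(\<integral>\<^sup>+\<xi>. ennreal (norm (h \<xi>)) * indicator (cball 0 \<rho>) \<xi> \<partial>lborel) \<le> Bd"
proof (cases "Bd = \<infinity>")
  case False
  hence e: "Bd = ennreal (enn2real Bd)" by (simp add: less_top)
  show ?thesis
    using integral_norm_ball_le[OF fou hM \<rho> enn2real_nonneg, of Bd] Bd unfolding e[symmetric] by blast
qed simp

lemma nn_integral_powr_tail:
  assumes a: "2 * a > real DIM('a::euclidean_space)" and R: "R > 0"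
  shows "(\<integral>\<^sup>+y. ennreal (norm y powr (- 2 * a)) * indicator (- cball 0 R) y \<partial>(lborel :: 'a measure)) \<le>
     ennreal (unit_ball_vol (DIM('a)) * real DIM('a) * (R powr (real DIM('a) - 2 * a) / (2 * a - real DIM('a))))"
proof -
  let ?n = "real DIM('a)"
  let ?c = "unit_ball_vol ?n * ?n"
  have "(\<integral>\<^sup>+y. ennreal (norm y powr (- 2 * a)) * indicator (- cball 0 R) y \<partial>(lborel :: 'a measure)) =
    (\<integral>\<^sup>+y. (\<lambda>r. ennreal (r powr (- 2 * a)) * indicator {R<..} r) (norm y) \<partial>(lborel :: 'a measure))"
    by (intro nn_integral_cong) (auto simp: indicator_def)
  also have "\<dots> = (\<integral>\<^sup>+r. ennreal (if 0 \<le> r then ?c * r ^ (DIM('a) - 1) else 0) * (ennreal (r powr (- 2 * a)) * indicator {R<..} r) \<partial>lborel)"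
    by (rule nn_integral_radial) measurable
  also have "\<dots> \<le> (\<integral>\<^sup>+r. ennreal (?c * r powr (?n - 1 - 2 * a)) * indicator {R..} r \<partial>lborel)"
  proof (intro nn_integral_mono)
    fix r :: real
    show "ennreal (if 0 \<le> r then ?c * r ^ (DIM('a) - 1) else 0) * (ennreal (r powr (- 2 * a)) * indicator {R<..} r) \<le> ennreal (?c * r powr (?n - 1 - 2 * a)) * indicator {R..} r"
    proof (cases "r > R")
      case True
      hence r: "r > 0" using R by simp
      have "r ^ (DIM('a) - 1) = r powr (?n - 1)"
        using r DIM_positive[where 'a = 'a] by (simp add: powr_realpow[symmetric] of_nat_diff Suc_le_eq del: DIM_positive)
      hence "r ^ (DIM('a) - 1) * r powr (- 2 * a) = r powr (?n - 1 - 2 * a)" by (simp add: powr_add[symmetric])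
      thus ?thesis using True r by (simp add: ennreal_mult'[symmetric] mult.assoc)
    qed simp
  qed
  also have "\<dots> = ennreal (0 - ?c * (R powr (?n - 2 * a) / (?n - 2 * a)))"
  proof (rule nn_integral_FTC_atLeast)
    show "((\<lambda>r. ?c * (r powr (?n - 2 * a) / (?n - 2 * a))) has_real_derivative ?c * r powr (?n - 1 - 2 * a)) (at r)" if "R \<le> r" for r
    proof -
      have r: "r > 0" using that R by simp
      define s where "s = ?n - 2 * a"
      have s: "s \<noteq> 0" using a by (simp add: s_def)
      have "((\<lambda>r. ?c * (r powr s / s)) has_real_derivative ?c * (s * r powr (s - 1) / s)) (at r)"
        by (intro DERIV_cmult DERIV_cdivide has_real_derivative_powr r)
      moreover have "s * r powr (s - 1) / s = r powr (s - 1)" using s by simp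
      moreover have "s - 1 = ?n - 1 - 2 * a" by (simp add: s_def)
      ultimately show ?thesis by (simp only: s_def)
    qed
    define s where "s = ?n - 2 * a"
    have "s < 0" using a by (simp add: s_def)
    hence "((\<lambda>r. ?c * (r powr s / s)) \<longlongrightarrow> ?c * (0 / s)) at_top"
      by (intro tendsto_mult tendsto_const tendsto_divide) (real_asymp, auto)
    thus "((\<lambda>r. ?c * (r powr (?n - 2 * a) / (?n - 2 * a))) \<longlongrightarrow> 0) at_top" by (simp add: s_def)
  qed auto
  also have "0 - ?c * (R powr (?n - 2 * a) / (?n - 2 * a)) = ?c * (R powr (?n - 2 * a) / (2 * a - ?n))"
    using a by (simp add: field_simps)
  finally show ?thesis .
qed

text \<open>
  A geometric series that starts at the first \<open>l\<close> with \<open>\<bar>y\<bar> \<le> 2\<^sup>l\<close>.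
\<close>

lemma suminf_dyadic_indicator:
  assumes q: "q > 0"
  shows "(\<Sum>l. ennreal (2 powr (- (real l * q))) * indicator (cball 0 (2 powr real l)) y) \<le>
     ennreal (2 powr q / (1 - 2 powr (- q)) * (1 + norm (y :: 'a::euclidean_space)) powr (- q))"
proof -
  define x where "x = 2 powr (- q)"
  have x: "0 < x" "x < 1" using q powr_less_mono[of "- q" 0 2] by (auto simp: x_def)
  have xl: "2 powr (- (real l * q)) = x ^ l" for l
    by (simp add: x_def powr_realpow[symmetric] powr_powr mult_ac)
  obtain k where "norm y \<le> 2 ^ k" using real_arch_pow[of 2 "norm y"] by (auto dest: less_imp_le)
  hence ex: "norm y \<le> 2 powr real k" by (simp add: powr_realpow)
  define l0 where "l0 = (LEAST l. norm y \<le> 2 powr real l)"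
  have l0: "norm y \<le> 2 powr real l0" unfolding l0_def by (rule LeastI[of _ k]) (rule ex)
  have lt: "\<not> norm y \<le> 2 powr real l" if "l < l0" for l using that not_less_Least unfolding l0_def by blast
  let ?f = "\<lambda>l. ennreal (2 powr (- (real l * q))) * indicator (cball 0 (2 powr real l)) y"
  have "(\<Sum>l. ?f l) = (\<Sum>l. ?f (l + l0)) + (\<Sum>l<l0. ?f l)"
    by (rule suminf_offset) (rule summableI)
  also have "(\<Sum>l<l0. ?f l) = 0" using lt by (intro sum.neutral) auto
  also have "(\<Sum>l. ?f (l + l0)) + 0 = (\<Sum>l. ennreal (x ^ l0 * x ^ l))"
  proof -
    have "?f (l + l0) = ennreal (x ^ l0 * x ^ l)" for l
    proof -
      have "2 powr real l0 \<le> 2 powr real (l + l0)" by (intro powr_mono) auto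
      hence "norm y \<le> 2 powr real (l + l0)" by (rule order_trans[OF l0])
      thus ?thesis unfolding xl by (simp add: power_add mult.commute)
    qed
    thus ?thesis by simp
  qed
  also have "\<dots> = ennreal (x ^ l0 * (1 / (1 - x)))"
    by (rule suminf_ennreal_eq) (use x geometric_sums[of x] in \<open>auto intro!: sums_mult simp del: times_divide_eq_right\<close>)
  also have "\<dots> \<le> ennreal (2 powr q / (1 - 2 powr (- q)) * (1 + norm y) powr (- q))"
  proof (rule ennreal_leI)
    have "1 \<le> 2 powr real l0" by (simp add: ge_one_powr_ge_zero)
    hence "1 + norm y \<le> 2 * 2 powr real l0" using l0 by simp
    hence "(2 * 2 powr real l0) powr (- q) \<le> (1 + norm y) powr (- q)"
      using q by (intro powr_mono2') (auto simp: add_pos_nonneg)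
    hence "2 powr (- q) * x ^ l0 \<le> (1 + norm y) powr (- q)"
      unfolding xl[symmetric] by (simp add: powr_mult powr_powr mult_ac)
    hence "2 powr q * (2 powr (- q) * x ^ l0) \<le> 2 powr q * (1 + norm y) powr (- q)" by (rule mult_left_mono) simp
    hence "x ^ l0 \<le> 2 powr q * (1 + norm y) powr (- q)" by (simp add: mult.assoc[symmetric] powr_add[symmetric])
    hence "x ^ l0 * (1 / (1 - x)) \<le> 2 powr q * (1 + norm y) powr (- q) * (1 / (1 - x))"
      using x by (intro mult_right_mono) auto
    thus "x ^ l0 * (1 / (1 - x)) \<le> 2 powr q / (1 - 2 powr (- q)) * (1 + norm y) powr (- q)"
      by (simp add: x_def mult_ac)
  qed
  finally show ?thesis .
qed

text \<open>
  On the ball of radius \<open>1 / 2\<^sup>l\<close> the integral of \<open>\<bar>h\<bar>\<close> is estimated by duality. The part of \<open>g\<close> inside the ball of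
  radius \<open>2\<^sup>l\<close> is paired with the supremum of the oscillatory integral, the part outside with its square integral, and the
  two factors of the latter are balanced by a weight. Multiplied by \<open>2\<close> to the power \<open>l a\<close> the outer parts are summable because
  \<open>\<delta> > 1\<close>; for the inner parts, summing over \<open>l\<close> first gives back a function with the borderline power and
  \<open>\<delta>\<close> logarithms.
\<close>

lemma near_zero_of_L2:
  fixes g h :: "'a::euclidean_space \<Rightarrow> complex" and M :: nat
  assumes fou: "is_fourier g h"
    and hM: "integrable lborel (\<lambda>\<xi>. norm (h \<xi>) / (1 + norm \<xi>) ^ M)"
    and g: "log_decay C a \<delta> g" and C: "C \<ge> 0" and \<delta>: "\<delta> > 1"
    and a: "a < real DIM('a)" "2 * a > real DIM('a)"
  shows "(\<integral>\<^sup>+\<xi>. ennreal (norm (h \<xi>) * norm \<xi> powr (- a)) * indicator (cball 0 1) \<xi> \<partial>lborel) < \<infinity>"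
proof -
  let ?n = "real DIM('a)"
  define V where "V = unit_ball_vol ?n"
  have V: "V \<ge> 0" by (simp add: V_def)
  define T where "T = (\<lambda>y::'a. C * ((1 + norm y) powr (- a) * ln (exp 1 + norm y) powr (- \<delta>)))"
  have T0: "T y \<ge> 0" for y using C by (simp add: T_def)
  have gT: "norm (g y) \<le> T y" for y using g unfolding log_decay_def T_def by blast
  have Tm[measurable]: "T \<in> borel_measurable borel" unfolding T_def by measurable
  have hm[measurable]: "h \<in> borel_measurable borel" and gm[measurable]: "g \<in> borel_measurable borel"
    using fou unfolding is_fourier_def by simp_all
  have a0: "a > 0" using a(2) DIM_positive[where 'a = 'a] by simp
  define I where "I = (\<lambda>l::nat. \<integral>\<^sup>+y. ennreal (T y) * indicator (cball 0 (2 powr real l)) y \<partial>lborel)"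
  define S where "S = (\<lambda>l::nat. \<integral>\<^sup>+y. ennreal ((T y)\<^sup>2) * indicator (- cball 0 (2 powr real l)) y \<partial>lborel)"
  define b where "b = (\<lambda>l::nat. V * 2 powr ?n * 2 powr (- (real l * ?n)))"
  \<comment> \<open>This weight makes the outer part of \<open>g\<close> and the square integral both contribute \<open>(l + 1)\<close> to the power \<open>- \<delta>\<close>.\<close>
  define lam where "lam = (\<lambda>l::nat. 2 powr (real l * (a - ?n)) * real (Suc l) powr \<delta>)"
  have lam: "lam l > 0" for l by (simp add: lam_def)
  have b0: "b l \<ge> 0" for l using V by (simp add: b_def)
  have ball: "(\<integral>\<^sup>+\<xi>. ennreal (norm (h \<xi>)) * indicator (cball 0 (2 powr (- real l))) \<xi> \<partial>lborel) \<le>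
     ennreal (b l) * I l + (ennreal (lam l) * S l + ennreal ((2 * pi) ^ DIM('a) * b l / lam l))" for l
  proof (rule integral_norm_ball_le_ennreal[OF fou hM])
    let ?B = "cball (0::'a) (2 * 2 powr (- real l))"
    have mB: "measure lborel ?B = b l"
    proof -
      have "measure lborel ?B = V * (2 * 2 powr (- real l)) ^ DIM('a)"
        unfolding V_def by (rule content_cball) simp
      also have "(2 * 2 powr (- real l)) ^ DIM('a) = 2 powr ?n * 2 powr (- (real l * ?n))"
        by (simp add: power_mult_distrib powr_realpow[symmetric] powr_powr)
      finally show ?thesis by (simp add: b_def)
    qed
    fix w :: "'a \<Rightarrow> complex"
    assume wm[measurable]: "w \<in> borel_measurable borel" and w: "\<And>\<eta>. norm (w \<eta>) \<le> indicator ?B \<eta>"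
    have om[measurable]: "osc_integral w \<in> borel_measurable borel" by (rule osc_integral_measurable[OF wm])
    have osup: "norm (osc_integral w y) \<le> b l" for y
      using norm_osc_integral_le[OF wm w _ emeasure_lborel_cball_finite] mB by simp
    have o2: "(\<integral>\<^sup>+y. ennreal ((norm (osc_integral w y))\<^sup>2) \<partial>lborel) \<le> ennreal ((2 * pi) ^ DIM('a) * b l)"
      using osc_integral_L2[OF wm w _ emeasure_lborel_cball_finite] mB by simp
    let ?R = "cball (0::'a) (2 powr real l)"
    have "(\<integral>\<^sup>+y. ennreal (norm (g y) * norm (osc_integral w y)) \<partial>lborel) \<le>
      (\<integral>\<^sup>+y. ennreal (b l) * (ennreal (T y) * indicator ?R y) + (ennreal (lam l) * (ennreal ((T y)\<^sup>2) * indicator (- ?R) y) + ennreal (1 / lam l) * ennreal ((norm (osc_integral w y))\<^sup>2)) \<partial>lborel)"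
    proof (intro nn_integral_mono)
      fix y :: 'a
      let ?o = "norm (osc_integral w y)"
      show "ennreal (norm (g y) * ?o) \<le> ennreal (b l) * (ennreal (T y) * indicator ?R y) + (ennreal (lam l) * (ennreal ((T y)\<^sup>2) * indicator (- ?R) y) + ennreal (1 / lam l) * ennreal (?o\<^sup>2))"
      proof (cases "y \<in> ?R")
        case True
        have "norm (g y) * ?o \<le> T y * b l" by (intro mult_mono gT osup T0) auto
        hence "ennreal (norm (g y) * ?o) \<le> ennreal (b l) * (ennreal (T y) * indicator ?R y)"
          using True b0[of l] T0[of y] by (simp add: ennreal_mult[symmetric] ennreal_leI mult.commute)
        thus ?thesis by (rule order_trans) (simp add: add_increasing2)
      next
        case False
        have "norm (g y) * ?o \<le> T y * ?o" by (intro mult_right_mono gT) auto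
        also have "\<dots> \<le> lam l * (T y)\<^sup>2 + 1 / lam l * ?o\<^sup>2"
        proof -
          have "0 \<le> (lam l * T y - ?o)\<^sup>2 + (lam l * T y) * ?o" using lam[of l] T0[of y] by (intro add_nonneg_nonneg) auto
          hence "lam l * (T y * ?o) \<le> lam l * (lam l * (T y)\<^sup>2 + 1 / lam l * ?o\<^sup>2)"
            using lam[of l] by (simp add: power2_eq_square algebra_simps)
          thus ?thesis using lam[of l] by (simp only: mult_le_cancel_left_pos)
        qed
        finally have "ennreal (norm (g y) * ?o) \<le> ennreal (lam l * (T y)\<^sup>2 + 1 / lam l * ?o\<^sup>2)" by (rule ennreal_leI)
        also have "\<dots> = ennreal (lam l) * (ennreal ((T y)\<^sup>2) * indicator (- ?R) y) + ennreal (1 / lam l) * ennreal (?o\<^sup>2)"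
          using False lam[of l] by (subst ennreal_plus) (simp_all add: ennreal_mult'[symmetric] less_imp_le)
        finally show ?thesis using False by simp
      qed
    qed
    also have "\<dots> = ennreal (b l) * I l + (ennreal (lam l) * S l + ennreal (1 / lam l) * (\<integral>\<^sup>+y. ennreal ((norm (osc_integral w y))\<^sup>2) \<partial>lborel))"
      unfolding I_def S_def by (simp add: nn_integral_add nn_integral_cmult)
    also have "\<dots> \<le> ennreal (b l) * I l + (ennreal (lam l) * S l + ennreal (1 / lam l) * ennreal ((2 * pi) ^ DIM('a) * b l))"
      by (intro add_left_mono mult_left_mono o2) auto
    also have "ennreal (1 / lam l) * ennreal ((2 * pi) ^ DIM('a) * b l) = ennreal ((2 * pi) ^ DIM('a) * b l / lam l)"
      using lam[of l] by (subst ennreal_mult'[symmetric]) (simp_all add: less_imp_le)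
    finally show "(\<integral>\<^sup>+y. ennreal (norm (g y) * norm (osc_integral w y)) \<partial>lborel) \<le> ennreal (b l) * I l + (ennreal (lam l) * S l + ennreal ((2 * pi) ^ DIM('a) * b l / lam l))" .
  qed simp
  define KS where "KS = C\<^sup>2 * 3 powr (2 * \<delta>) * (V * ?n / (2 * a - ?n))"
  have KS: "KS \<ge> 0" using V a by (simp add: KS_def)
  have Sl: "S l \<le> ennreal (KS * (real (Suc l) powr (- 2 * \<delta>) * 2 powr (real l * (?n - 2 * a))))" for l
  proof -
    let ?k = "C\<^sup>2 * (3 powr (2 * \<delta>) * real (Suc l) powr (- 2 * \<delta>))"
    have "S l \<le> (\<integral>\<^sup>+y. ennreal ?k * (ennreal (norm y powr (- 2 * a)) * indicator (- cball 0 (2 powr real l)) y) \<partial>(lborel :: 'a measure))"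
      unfolding S_def
    proof (intro nn_integral_mono)
      fix y :: 'a
      show "ennreal ((T y)\<^sup>2) * indicator (- cball 0 (2 powr real l)) y \<le> ennreal ?k * (ennreal (norm y powr (- 2 * a)) * indicator (- cball 0 (2 powr real l)) y)"
      proof (cases "norm y \<le> 2 powr real l")
        case False
        hence y: "norm y > 2 powr real l" by simp
        hence y0: "norm y > 0" using powr_gt_zero[of 2 "real l"] by linarith
        have L1: "ln (exp 1 + norm y) \<ge> 1" by (rule one_le_ln_e) simp
        have "ln (2 powr real l) \<le> ln (exp 1 + norm y)" using y by (intro ln_mono) (auto simp: add_pos_nonneg intro: add_increasing)
        hence "real l * ln 2 \<le> ln (exp 1 + norm y)" by (simp add: ln_powr)
        moreover have "ln 2 \<ge> (2/3 :: real)" by (rule ln2_ge_two_thirds)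
        hence "real l * (2/3) \<le> real l * ln 2" by (intro mult_left_mono) auto
        ultimately have L: "real (Suc l) / 3 \<le> ln (exp 1 + norm y)" using L1 by simp
        have "(T y)\<^sup>2 = C\<^sup>2 * (((1 + norm y) powr (- a))\<^sup>2 * (ln (exp 1 + norm y) powr (- \<delta>))\<^sup>2)"
          by (simp add: T_def power_mult_distrib)
        also have "\<dots> \<le> C\<^sup>2 * ((norm y powr (- a))\<^sup>2 * ((real (Suc l) / 3) powr (- \<delta>))\<^sup>2)"
          using y0 a0 L \<delta> by (intro mult_left_mono mult_mono power_mono powr_mono2') auto
        also have "(norm y powr (- a))\<^sup>2 = norm y powr (- 2 * a)" using y0 by (simp add: power2_eq_square powr_add[symmetric])
        also have "((real (Suc l) / 3) powr (- \<delta>))\<^sup>2 = 3 powr (2 * \<delta>) * real (Suc l) powr (- 2 * \<delta>)"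
          by (simp add: power2_eq_square powr_add[symmetric] powr_divide powr_minus field_simps)
        finally have "(T y)\<^sup>2 \<le> ?k * norm y powr (- 2 * a)" by (simp add: mult_ac)
        hence "ennreal ((T y)\<^sup>2) \<le> ennreal ?k * ennreal (norm y powr (- 2 * a))"
          by (subst ennreal_mult'[symmetric]) (auto intro!: ennreal_leI)
        thus ?thesis using False by simp
      qed simp
    qed
    also have "\<dots> = ennreal ?k * (\<integral>\<^sup>+y. ennreal (norm y powr (- 2 * a)) * indicator (- cball 0 (2 powr real l)) y \<partial>(lborel :: 'a measure))"
      by (rule nn_integral_cmult) measurable
    also have "\<dots> \<le> ennreal ?k * ennreal (V * ?n * ((2 powr real l) powr (?n - 2 * a) / (2 * a - ?n)))"
      unfolding V_def by (intro mult_left_mono nn_integral_powr_tail a) auto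
    also have "\<dots> = ennreal (?k * (V * ?n * ((2 powr real l) powr (?n - 2 * a) / (2 * a - ?n))))"
      by (rule ennreal_mult'[symmetric]) simp
    also have "?k * (V * ?n * ((2 powr real l) powr (?n - 2 * a) / (2 * a - ?n))) = KS * (real (Suc l) powr (- 2 * \<delta>) * 2 powr (real l * (?n - 2 * a)))"
      by (simp add: KS_def powr_powr mult_ac)
    finally show ?thesis .
  qed
  define c1 where "c1 = 2 powr a * (V * 2 powr ?n)"
  define c2 where "c2 = 2 powr a * (KS + (2 * pi) ^ DIM('a) * (V * 2 powr ?n))"
  have c1: "c1 \<ge> 0" using V by (simp add: c1_def)
  have c2: "c2 \<ge> 0" using V KS by (simp add: c2_def)
  have weighted: "ennreal (2 powr (real (Suc l) * a)) * (\<integral>\<^sup>+\<xi>. ennreal (norm (h \<xi>)) * indicator (cball 0 (2 powr (- real l))) \<xi> \<partial>lborel) \<le>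
     ennreal c1 * (ennreal (2 powr (- (real l * (?n - a)))) * I l) + ennreal (c2 * real (Suc l) powr (- \<delta>))" for l
  proof -
    let ?A = "2 powr (real (Suc l) * a)"
    let ?p = "real (Suc l)"
    have A: "?A = 2 powr a * 2 powr (real l * a)" by (simp add: powr_add[symmetric] distrib_right add.commute)
    have e1: "?A * b l = c1 * 2 powr (- (real l * (?n - a)))"
    proof -
      have "2 powr (real l * a) * 2 powr (- (real l * ?n)) = 2 powr (- (real l * (?n - a)))"
        by (simp add: powr_add[symmetric] algebra_simps)
      thus ?thesis unfolding A b_def c1_def by (simp add: mult_ac)
    qed
    have e2: "?A * (lam l * (KS * (?p powr (- 2 * \<delta>) * 2 powr (real l * (?n - 2 * a))))) = 2 powr a * KS * ?p powr (- \<delta>)"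
    proof -
      have "2 powr (real l * a) * (2 powr (real l * (a - ?n)) * 2 powr (real l * (?n - 2 * a))) = (1::real)"
        by (simp add: powr_add[symmetric] algebra_simps)
      moreover have "?p powr \<delta> * ?p powr (- 2 * \<delta>) = ?p powr (- \<delta>)" by (simp add: powr_add[symmetric])
      moreover have "?A * (lam l * (KS * (?p powr (- 2 * \<delta>) * 2 powr (real l * (?n - 2 * a))))) =
        2 powr a * KS * (?p powr \<delta> * ?p powr (- 2 * \<delta>)) * (2 powr (real l * a) * (2 powr (real l * (a - ?n)) * 2 powr (real l * (?n - 2 * a))))"
        unfolding A lam_def by (simp only: mult_ac)
      ultimately show ?thesis by simp
    qed
    have e3: "?A * ((2 * pi) ^ DIM('a) * b l / lam l) = 2 powr a * ((2 * pi) ^ DIM('a) * (V * 2 powr ?n)) * ?p powr (- \<delta>)"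
    proof -
      have "2 powr (real l * a) * 2 powr (- (real l * ?n)) = 2 powr (real l * (a - ?n))"
        by (simp add: powr_add[symmetric] algebra_simps)
      hence "?A * b l = 2 powr a * (V * 2 powr ?n) * 2 powr (real l * (a - ?n))" unfolding A b_def by (simp add: mult_ac)
      hence "?A * b l / lam l = 2 powr a * (V * 2 powr ?n) * ?p powr (- \<delta>)" by (simp add: lam_def powr_minus field_simps)
      moreover have "?A * ((2 * pi) ^ DIM('a) * b l / lam l) = (2 * pi) ^ DIM('a) * (?A * b l / lam l)" by simp
      ultimately show ?thesis by (simp only: mult_ac)
    qed
    have "ennreal ?A * (\<integral>\<^sup>+\<xi>. ennreal (norm (h \<xi>)) * indicator (cball 0 (2 powr (- real l))) \<xi> \<partial>lborel) \<le>
      ennreal ?A * (ennreal (b l) * I l + (ennreal (lam l) * S l + ennreal ((2 * pi) ^ DIM('a) * b l / lam l)))"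
      by (intro mult_left_mono ball) auto
    also have "\<dots> \<le> ennreal ?A * (ennreal (b l) * I l + (ennreal (lam l) * ennreal (KS * (?p powr (- 2 * \<delta>) * 2 powr (real l * (?n - 2 * a)))) + ennreal ((2 * pi) ^ DIM('a) * b l / lam l)))"
      by (intro mult_left_mono add_left_mono add_right_mono Sl) auto
    also have "\<dots> = ennreal (?A * b l) * I l + (ennreal (?A * (lam l * (KS * (?p powr (- 2 * \<delta>) * 2 powr (real l * (?n - 2 * a)))))) + ennreal (?A * ((2 * pi) ^ DIM('a) * b l / lam l)))"
    proof -
      have "ennreal A * (ennreal x * J + (ennreal y * ennreal z + ennreal q)) = ennreal (A * x) * J + (ennreal (A * (y * z)) + ennreal (A * q))"
        if "A \<ge> 0" "y \<ge> 0" for A x y z q J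
        using that by (simp only: ennreal_mult' distrib_left mult.assoc)
      from this[OF powr_ge_zero less_imp_le[OF lam]] show ?thesis .
    qed
    also have "\<dots> = ennreal (c1 * 2 powr (- (real l * (?n - a)))) * I l + ennreal (2 powr a * KS * ?p powr (- \<delta>) + 2 powr a * ((2 * pi) ^ DIM('a) * (V * 2 powr ?n)) * ?p powr (- \<delta>))"
      unfolding e1 e2 e3 using KS V by (subst ennreal_plus) auto
    also have "2 powr a * KS * ?p powr (- \<delta>) + 2 powr a * ((2 * pi) ^ DIM('a) * (V * 2 powr ?n)) * ?p powr (- \<delta>) = c2 * ?p powr (- \<delta>)"
      by (simp only: c2_def distrib_left distrib_right)
    finally show ?thesis using c1 by (simp add: ennreal_mult' mult.assoc)
  qed
  have "(\<integral>\<^sup>+\<xi>. ennreal (norm (h \<xi>) * norm \<xi> powr (- a)) * indicator (cball 0 1) \<xi> \<partial>lborel) \<le>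
    (\<integral>\<^sup>+\<xi>. (\<Sum>l. ennreal (2 powr (real (Suc l) * a)) * (ennreal (norm (h \<xi>)) * indicator (cball 0 (2 powr (- real l))) \<xi>)) \<partial>lborel)"
  proof (rule nn_integral_mono_AE)
    show "AE \<xi> in lborel. ennreal (norm (h \<xi>) * norm \<xi> powr (- a)) * indicator (cball 0 1) \<xi> \<le> (\<Sum>l. ennreal (2 powr (real (Suc l) * a)) * (ennreal (norm (h \<xi>)) * indicator (cball 0 (2 powr (- real l))) \<xi>))"
      using AE_lborel_nonzero
    proof eventually_elim
      case (elim \<xi>)
      show ?case
      proof (cases "norm \<xi> \<le> 1")
        case True
        have n: "norm \<xi> > 0" using elim by simp
        define l where "l = nat \<lfloor>- log 2 (norm \<xi>)\<rfloor>"
        have lg: "- log 2 (norm \<xi>) \<ge> 0" using True n by simp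
        have l: "real l \<le> - log 2 (norm \<xi>)" "- log 2 (norm \<xi>) \<le> real (Suc l)" using lg unfolding l_def by linarith+
        have nl: "norm \<xi> = 2 powr (log 2 (norm \<xi>))" using n by simp
        have "norm \<xi> \<le> 2 powr (- real l)" by (subst nl) (use l in \<open>intro powr_mono; simp\<close>)
        hence ind: "indicator (cball 0 (2 powr (- real l))) \<xi> = (1 :: ennreal)" by simp
        have "norm \<xi> powr (- a) = 2 powr (- log 2 (norm \<xi>) * a)" by (subst nl) (simp add: powr_powr)
        also have "\<dots> \<le> 2 powr (real (Suc l) * a)" using l a0 by (intro powr_mono mult_right_mono) auto
        finally have "norm (h \<xi>) * norm \<xi> powr (- a) \<le> 2 powr (real (Suc l) * a) * norm (h \<xi>)"
          by (subst mult.commute) (rule mult_right_mono, auto)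
        hence "ennreal (norm (h \<xi>) * norm \<xi> powr (- a)) \<le> ennreal (2 powr (real (Suc l) * a)) * (ennreal (norm (h \<xi>)) * indicator (cball 0 (2 powr (- real l))) \<xi>)"
          unfolding ind by (simp add: ennreal_mult'[symmetric] ennreal_leI del: of_nat_Suc)
        also have "\<dots> \<le> (\<Sum>l. ennreal (2 powr (real (Suc l) * a)) * (ennreal (norm (h \<xi>)) * indicator (cball 0 (2 powr (- real l))) \<xi>))"
          using sum_le_suminf[OF summableI, of "{l}" "\<lambda>l. ennreal (2 powr (real (Suc l) * a)) * (ennreal (norm (h \<xi>)) * indicator (cball 0 (2 powr (- real l))) \<xi>)"] by simp
        finally show ?thesis using True by simp
      qed simp
    qed
  qed
  also have "\<dots> = (\<Sum>l. \<integral>\<^sup>+\<xi>. ennreal (2 powr (real (Suc l) * a)) * (ennreal (norm (h \<xi>)) * indicator (cball 0 (2 powr (- real l))) \<xi>) \<partial>lborel)"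
    by (rule nn_integral_suminf) measurable
  also have "\<dots> = (\<Sum>l. ennreal (2 powr (real (Suc l) * a)) * (\<integral>\<^sup>+\<xi>. ennreal (norm (h \<xi>)) * indicator (cball 0 (2 powr (- real l))) \<xi> \<partial>lborel))"
    by (subst nn_integral_cmult) measurable
  also have "\<dots> \<le> (\<Sum>l. ennreal c1 * (ennreal (2 powr (- (real l * (?n - a)))) * I l) + ennreal (c2 * real (Suc l) powr (- \<delta>)))"
    by (intro suminf_le weighted summableI)
  also have "\<dots> = ennreal c1 * (\<Sum>l. ennreal (2 powr (- (real l * (?n - a)))) * I l) + (\<Sum>l. ennreal (c2 * real (Suc l) powr (- \<delta>)))"
    by (subst suminf_add[OF summableI summableI, symmetric]) (simp add: ennreal_suminf_cmult)
  also have "\<dots> < \<infinity>"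
  proof -
    have "summable (\<lambda>l. c2 * real (Suc l) powr (- \<delta>))"
      using \<delta> summable_real_powr_iff[of "- \<delta>"] by (intro summable_mult) (simp add: summable_Suc_iff[of "\<lambda>l. real l powr (- \<delta>)"] del: of_nat_Suc)
    hence f2: "(\<Sum>l. ennreal (c2 * real (Suc l) powr (- \<delta>))) < \<infinity>"
      using c2 by (subst suminf_ennreal2) (auto simp del: of_nat_Suc)
    have "(\<Sum>l. ennreal (2 powr (- (real l * (?n - a)))) * I l) = (\<Sum>l. \<integral>\<^sup>+y. ennreal (T y) * (ennreal (2 powr (- (real l * (?n - a)))) * indicator (cball 0 (2 powr real l)) y) \<partial>lborel)"
      unfolding I_def by (subst nn_integral_cmult[symmetric]) (measurable, simp only: mult.left_commute)
    also have "\<dots> = (\<integral>\<^sup>+y. (\<Sum>l. ennreal (T y) * (ennreal (2 powr (- (real l * (?n - a)))) * indicator (cball 0 (2 powr real l)) y)) \<partial>lborel)"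
      by (rule nn_integral_suminf[symmetric]) measurable
    also have "\<dots> \<le> (\<integral>\<^sup>+y. ennreal (T y * (2 powr (?n - a) / (1 - 2 powr (- (?n - a))) * (1 + norm y) powr (- (?n - a)))) \<partial>lborel)"
    proof (intro nn_integral_mono)
      fix y :: 'a
      have "(\<Sum>l. ennreal (T y) * (ennreal (2 powr (- (real l * (?n - a)))) * indicator (cball 0 (2 powr real l)) y)) = ennreal (T y) * (\<Sum>l. ennreal (2 powr (- (real l * (?n - a)))) * indicator (cball 0 (2 powr real l)) y)"
        by (rule ennreal_suminf_cmult)
      also have "\<dots> \<le> ennreal (T y) * ennreal (2 powr (?n - a) / (1 - 2 powr (- (?n - a))) * (1 + norm y) powr (- (?n - a)))"
        by (intro mult_left_mono suminf_dyadic_indicator) (use a in auto)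
      also have "\<dots> = ennreal (T y * (2 powr (?n - a) / (1 - 2 powr (- (?n - a))) * (1 + norm y) powr (- (?n - a))))"
        by (rule ennreal_mult'[symmetric]) (rule T0)
      finally show "(\<Sum>l. ennreal (T y) * (ennreal (2 powr (- (real l * (?n - a)))) * indicator (cball 0 (2 powr real l)) y)) \<le> ennreal (T y * (2 powr (?n - a) / (1 - 2 powr (- (?n - a))) * (1 + norm y) powr (- (?n - a))))" .
    qed
    also have "\<dots> < \<infinity>"
    proof -
      have e: "T y * (2 powr (?n - a) / (1 - 2 powr (- (?n - a))) * (1 + norm y) powr (- (?n - a))) =
          (C * (2 powr (?n - a) / (1 - 2 powr (- (?n - a))))) * ((1 + norm y) powr (- ?n) * ln (exp 1 + norm y) powr (- \<delta>))" for y :: 'a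
      proof -
        have "(1 + norm y) powr (- a) * (1 + norm y) powr (- (?n - a)) = (1 + norm y) powr (- ?n)" by (simp add: powr_add[symmetric])
        moreover have "T y * (k * (1 + norm y) powr (- (?n - a))) = (C * k) * (((1 + norm y) powr (- a) * (1 + norm y) powr (- (?n - a))) * ln (exp 1 + norm y) powr (- \<delta>))" for k
          by (simp only: T_def mult_ac)
        ultimately show ?thesis by (simp only:)
      qed
      have "integrable lborel (\<lambda>y::'a. (C * (2 powr (?n - a) / (1 - 2 powr (- (?n - a))))) * ((1 + norm y) powr (- ?n) * ln (exp 1 + norm y) powr (- \<delta>)))"
        by (intro integrable_mult_right integrable_log_weight \<delta>)
      hence "integrable lborel (\<lambda>y::'a. T y * (2 powr (?n - a) / (1 - 2 powr (- (?n - a))) * (1 + norm y) powr (- (?n - a))))"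
        unfolding e .
      hence "(\<integral>\<^sup>+y. ennreal (norm (T y * (2 powr (?n - a) / (1 - 2 powr (- (?n - a))) * (1 + norm y) powr (- (?n - a))))) \<partial>lborel) < \<infinity>"
        unfolding integrable_iff_bounded by blast
      thus ?thesis
        by (rule order_le_less_trans[rotated]) (intro nn_integral_mono ennreal_leI, simp only: real_norm_def abs_ge_self)
    qed
    finally have "ennreal c1 * (\<Sum>l. ennreal (2 powr (- (real l * (?n - a)))) * I l) < \<infinity>"
      by (simp add: ennreal_mult_less_top)
    with f2 show ?thesis by simp
  qed
  finally show ?thesis .
qed

section \<open>The multiplier\<close>

lemma Gamma_nat_plus_half: "Gamma (real r + 1 / 2) = sqrt pi * fact (2 * r) / (4 ^ r * fact r)"
proof (induction r)
  case 0
  show ?case by (simp add: Gamma_one_half_real)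
next
  case (Suc r)
  have "real r + 1 / 2 \<notin> \<int>\<^sub>\<le>\<^sub>0" by (auto elim!: nonpos_Ints_cases')
  from Gamma_plus1[OF this] have "Gamma (real (Suc r) + 1 / 2) = (real r + 1 / 2) * Gamma (real r + 1 / 2)"
    by (simp add: add_ac)
  also have "\<dots> = (real r + 1 / 2) * (sqrt pi * fact (2 * r) / (4 ^ r * fact r))" by (simp only: Suc.IH)
  also have "\<dots> = sqrt pi * (2 * (real r + 1) * (2 * real r + 1) * fact (2 * r)) / (4 * 4 ^ r * ((real r + 1) * fact r))"
  proof -
    have "(t + 1 / 2) * (s * F / (q * f)) = s * (2 * (t + 1) * (2 * t + 1) * F) / (4 * q * ((t + 1) * f))"
      if "t \<ge> 0" "q \<noteq> 0" "f \<noteq> 0" for t s F q f :: real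
    proof -
      have "(t + 1 / 2) * (s * F / (q * f)) = ((t + 1 / 2) * s * F) / (q * f)" by simp
      also have "\<dots> = s * (2 * (t + 1) * (2 * t + 1) * F) / (4 * q * ((t + 1) * f))"
      proof (subst frac_eq_eq)
        show "q * f \<noteq> 0" "4 * q * ((t + 1) * f) \<noteq> 0" using that by auto
      qed (simp only: ring_distribs mult_1_left mult_1_right, simp add: algebra_simps)
      finally show ?thesis .
    qed
    thus ?thesis by simp
  qed
  also have "\<dots> = sqrt pi * fact (2 * Suc r) / (4 ^ Suc r * fact (Suc r))"
    by (simp add: algebra_simps)
  finally show ?case .
qed

lemma c_coeff_eq: "c_coeff n = b_coeff n / real (Suc n)"
proof -
  have "Suc n * ((2 * n) choose Suc n) = n * ((2 * n) choose n)"
  proof -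
    have "Suc n * ((2 * n) choose Suc n) = 2 * n * (2 * n - 1 choose n)" by (rule binomial_absorption)
    also have "\<dots> = (2 * n - n) * (2 * n choose n)" by (rule binomial_absorb_comp[symmetric])
    finally show ?thesis by simp
  qed
  hence "real (Suc n) * real ((2 * n) choose Suc n) = real n * real ((2 * n) choose n)"
    by (simp only: of_nat_mult[symmetric])
  thus ?thesis by (simp add: c_coeff_def b_coeff_def field_simps)
qed

text \<open>
  The value of \<open>\<Gamma>\<close> at half-integers, with the powers of \<open>\<pi>\<close> collected into \<open>2 \<pi>\<close> to the dimension \<open>d - 1\<close>.
\<close>

lemma riesz_constant:
  assumes N: "N \<ge> 1" and d: "d \<ge> 1"
  shows "Gamma (real N - 1 / 2) / ((4 * pi) powr (real d / 2) * pi powr (real (d - 1) / 2) * fact (N - 1)) =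
    2 powi (1 - 2 * int N) * b_coeff (N - 1) / (2 * pi) ^ (d - 1)"
proof -
  obtain r where r: "N = Suc r" using N by (cases N) auto
  obtain n where n: "d = Suc n" using d by (cases d) auto
  have "pi powr (real d / 2) * pi powr (real (d - 1) / 2) = pi powr (real n + 1 / 2)"
    unfolding powr_add[symmetric] by (simp add: n add_divide_distrib)
  also have "\<dots> = pi ^ n * sqrt pi" by (simp add: powr_add powr_realpow powr_half_sqrt)
  finally have p: "pi powr (real d / 2) * pi powr (real (d - 1) / 2) = pi ^ n * sqrt pi" .
  have "(4::real) powr (real d / 2) = (2 powr 2) powr (real d / 2)" by simp
  also have "\<dots> = 2 ^ d" unfolding powr_powr by (simp add: powr_realpow)
  finally have q: "(4 * pi) powr (real d / 2) * pi powr (real (d - 1) / 2) = 2 ^ d * (pi ^ n * sqrt pi)"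
    using p by (simp add: powr_mult)
  have b: "b_coeff r = fact (2 * r) / (fact r * fact r)"
    unfolding b_coeff_def by (simp add: binomial_fact)
  have e: "2 powi (1 - 2 * int N) = 1 / (2 * 4 ^ r :: real)"
  proof -
    have "1 - 2 * int N = - int (2 * r + 1)" by (simp add: r)
    hence "(2::real) powi (1 - 2 * int N) = 1 / 2 ^ (2 * r + 1)" by (simp only: power_int_minus power_int_of_nat inverse_eq_divide)
    thus ?thesis by (simp add: power_mult)
  qed
  have G: "Gamma (real N - 1 / 2) = sqrt pi * fact (2 * r) / (4 ^ r * fact r)"
  proof -
    have "real N - 1 / 2 = real r + 1 / 2" by (simp add: r)
    thus ?thesis by (simp only: Gamma_nat_plus_half)
  qed
  have "Gamma (real N - 1 / 2) / ((4 * pi) powr (real d / 2) * pi powr (real (d - 1) / 2) * fact (N - 1)) =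
    sqrt pi * fact (2 * r) / (4 ^ r * fact r) / (2 ^ d * (pi ^ n * sqrt pi) * fact r)"
    unfolding G q by (simp add: r)
  also have "\<dots> = 1 / (2 * 4 ^ r) * (fact (2 * r) / (fact r * fact r)) / (2 * pi) ^ n"
    by (simp add: n power_mult_distrib)
  finally show ?thesis unfolding e by (simp add: b r n)
qed

text \<open>
  Both sides are the same integral over \<open>t\<close> of heat integrals: \<open>powlog_integral_heat\<close> treats the kernel,
  \<open>riesz_potential_heat\<close> the symbol, and \<open>heat_identity\<close> contributes the factor \<open>(\<pi> / t)\<close> to the power \<open>(d - 1) / 2\<close> that
  reconciles the exponents of \<open>t\<close>.
\<close>

lemma riesz_convolution_multiplier:
  fixes g h :: "'a::euclidean_space \<Rightarrow> complex"
  assumes fou: "is_fourier g h" and dim: "DIM('a) = d - 1" and d: "d \<ge> 1" and R: "riesz_coeffs d N A B" and N: "N \<ge> 1"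
    and H: "integrable lborel (\<lambda>\<xi>. norm (h \<xi>) * norm \<xi> powr (- (2 * real N - 1)))"
    and I1: "integrable lborel (\<lambda>z. norm (g (x - z)) * (norm z powr (2 * real N - real d) * (1 + \<bar>ln (norm z)\<bar>)))"
    and M: "\<And>i. real i \<le> real N - d / 2 \<Longrightarrow> integrable lborel (\<lambda>z. g (x - z) * of_real (norm z ^ (2 * i))) \<and> (LINT z|lborel. g (x - z) * of_real (norm z ^ (2 * i))) = 0"
  shows "(LINT z|lborel. g (x - z) * of_real (powlog (real N - d / 2) A B ((norm z)\<^sup>2))) =
    of_real ((-1) ^ N * 2 powi (1 - 2 * int N) * b_coeff (N - 1) / (2 * pi) ^ DIM('a)) *
    (LINT \<xi>|lborel. h \<xi> * cis (x \<bullet> \<xi>) * of_real (norm \<xi> powr (- (2 * real N - 1))))"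
proof -
  have hm: "h \<in> borel_measurable borel" and gm[measurable]: "g \<in> borel_measurable borel"
    using fou unfolding is_fourier_def by simp_all
  have gx: "(\<lambda>z. g (x - z)) \<in> borel_measurable borel" by measurable
  define n where "n = real (d - 1)"
  have nd: "n = real d - 1" using d by (simp add: n_def of_nat_diff)
  define F where "F = (\<lambda>t. LINT z|lborel. g (x - z) * of_real (exp (- (norm z)\<^sup>2 / (4 * t))))"
  define J where "J = (LINT t|lborel. of_real (indicator {0<..} t * t powr (real N - d / 2 - 1)) * F t)"
  define I where "I = (LINT \<xi>|lborel. h \<xi> * cis (x \<bullet> \<xi>) * of_real (norm \<xi> powr (- (2 * real N - 1))))"
  \<comment> \<open>\<open>N - 3/2\<close> minus \<open>(d - 1)/2\<close> is \<open>N - d/2 - 1\<close>.\<close>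
  have e: "of_real (indicator {0<..} t * t powr ((2 * real N - 1) / 2 - 1)) * (LINT \<xi>|lborel. h \<xi> * cis (x \<bullet> \<xi>) * of_real (exp (- t * (norm \<xi>)\<^sup>2))) =
    of_real (pi powr (n / 2)) * (of_real (indicator {0<..} t * t powr (real N - d / 2 - 1)) * F t)" for t
  proof (cases "t > 0")
    case True
    have "t powr ((2 * real N - 1) / 2 - 1) * (pi / t) powr (n / 2) = pi powr (n / 2) * (t powr ((2 * real N - 1) / 2 - 1) * t powr (- (n / 2)))"
      using True by (simp add: powr_divide powr_minus field_simps)
    also have "t powr ((2 * real N - 1) / 2 - 1) * t powr (- (n / 2)) = t powr (real N - d / 2 - 1)"
      unfolding powr_add[symmetric] by (rule arg_cong[of _ _ "(powr) t"]) (simp add: nd field_simps)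
    finally have "complex_of_real (t powr ((2 * real N - 1) / 2 - 1)) * of_real ((pi / t) powr (n / 2)) = of_real (pi powr (n / 2)) * of_real (t powr (real N - d / 2 - 1))"
      by (simp only: of_real_mult[symmetric])
    moreover have "(LINT \<xi>|lborel. h \<xi> * cis (x \<bullet> \<xi>) * of_real (exp (- t * (norm \<xi>)\<^sup>2))) = of_real ((pi / t) powr (n / 2)) * F t"
      unfolding heat_identity(3)[OF fou True] F_def n_def dim ..
    ultimately show ?thesis using True by (simp add: mult.assoc[symmetric])
  qed simp
  have "of_real (Gamma ((2 * real N - 1) / 2)) * I = of_real (pi powr (n / 2)) * J"
    unfolding I_def J_def using riesz_potential_heat[OF _ hm H, of x] N unfolding e by simp
  hence J: "J = of_real (Gamma (real N - 1 / 2) / pi powr (n / 2)) * I" by (simp add: field_simps)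
  have "(LINT z|lborel. g (x - z) * of_real (powlog (real N - d / 2) A B ((norm z)\<^sup>2))) =
    of_real ((-1) ^ N / ((4 * pi) powr (d / 2) * fact (N - 1))) * J"
    unfolding J_def F_def by (rule powlog_integral_heat[OF R gx I1 _ M]) (rule heat_identity(2)[OF fou])
  also have "\<dots> = of_real ((-1) ^ N * (Gamma (real N - 1 / 2) / ((4 * pi) powr (real d / 2) * pi powr (real (d - 1) / 2) * fact (N - 1)))) * I"
    unfolding J n_def by (simp only: of_real_mult[symmetric] mult.assoc[symmetric]) (simp add: mult_ac)
  also have "(-1) ^ N * (Gamma (real N - 1 / 2) / ((4 * pi) powr (real d / 2) * pi powr (real (d - 1) / 2) * fact (N - 1))) =
    (-1) ^ N * 2 powi (1 - 2 * int N) * b_coeff (N - 1) / (2 * pi) ^ DIM('a)"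
    unfolding riesz_constant[OF N d] dim by simp
  finally show ?thesis unfolding I_def .
qed

text \<open>
  In both cases the exponent at the origin is the decay exponent \<open>2 m - 1 - j\<close>. If \<open>j > 2 m - d\<close>, it is smaller than
  the dimension \<open>d - 1\<close>, and more than half of it because \<open>j < m\<close> and \<open>2 m > d\<close>.
\<close>

lemma admissible_regularity:
  fixes g :: "'a::euclidean_space \<Rightarrow> complex"
  assumes adm: "admissible m d j g" and dim: "DIM('a) = d - 1" and d: "d \<ge> 2" and md: "2 * m > d" and j: "j < m"
  obtains C \<delta> \<rho> where "C \<ge> 0" "\<delta> > 2" "log_decay C (real (2 * m - 1 - j)) \<delta> g"
    "integrable lborel (\<lambda>\<xi>. norm (fourier g \<xi>) / (1 + norm \<xi>) ^ (m - j))"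
    "\<rho> > 0" "\<rho> \<le> 1" "(\<integral>\<^sup>+\<xi>. ennreal (norm (fourier g \<xi>) * norm \<xi> powr (- real (2 * m - 1 - j))) * indicator (cball 0 \<rho>) \<xi> \<partial>lborel) < \<infinity>"
proof -
  let ?a = "real (2 * m - 1 - j)"
  have fou: "is_fourier g (fourier g)" using adm by (simp add: admissible_def)
  have hm: "fourier g \<in> borel_measurable borel" using fou unfolding is_fourier_def by simp_all
  obtain C \<delta> where C: "C > 0" "\<delta> > 2"
    and dec: "\<And>y. norm (g y) \<le> C * (1 + norm y) powi (1 + int j - 2 * int m) * ln (exp 1 + norm y) powr (- \<delta>)"
    using adm unfolding admissible_def by blast
  have g: "log_decay C ?a \<delta> g"
    unfolding log_decay_def
  proof
    fix y :: 'a
    have p: "1 + norm y > 0" by (simp add: add_pos_nonneg)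
    have e: "real_of_int (1 + int j - 2 * int m) = - ?a" using j by (simp add: of_nat_diff)
    have "(1 + norm y) powr (real_of_int (1 + int j - 2 * int m)) = (1 + norm y) powi (1 + int j - 2 * int m)"
      using p by (intro powr_real_of_int') auto
    hence "(1 + norm y) powi (1 + int j - 2 * int m) = (1 + norm y) powr (- ?a)" unfolding e by (rule sym)
    thus "norm (g y) \<le> C * ((1 + norm y) powr (- ?a) * ln (exp 1 + norm y) powr (- \<delta>))"
      using dec[of y] by (simp add: mult.assoc)
  qed
  have hM: "integrable lborel (\<lambda>\<xi>. norm (fourier g \<xi>) / (1 + norm \<xi>) ^ (m - j))"
  proof -
    have "(1 + norm \<xi>) powi (int j - int m) = 1 / (1 + norm \<xi>) ^ (m - j)" for \<xi> :: 'a
    proof -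
      have "int j - int m = - int (m - j)" using j by simp
      thus ?thesis by (simp only: power_int_minus power_int_of_nat inverse_eq_divide)
    qed
    thus ?thesis using adm by (simp add: admissible_def)
  qed
  have C0: "C \<ge> 0" using C by simp
  show thesis
  proof (cases "int j \<le> 2 * int m - int d")
    case True
    define p where "p = 2 * m - j - d"
    have pe: "real p + DIM('a) = ?a" using True d by (simp add: p_def dim of_nat_diff)
    have pi: "2 * int m - int j - int d = int p" using True by (simp add: p_def)
    have "int j \<le> min (int m - 1) (2 * int m - int d)" using True j by simp
    then obtain C' \<tau> r where v: "C' > 0" "\<tau> > 1" "r > 0" "AE \<xi> in lborel. norm \<xi> < r \<longrightarrow>
        norm (fourier g \<xi>) \<le> C' * norm \<xi> powi (2 * int m - int j - int d) * \<bar>ln (norm \<xi>)\<bar> powr (- \<tau>)"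
      using adm unfolding admissible_def by blast
    obtain \<rho> where "0 < \<rho>" "\<rho> \<le> 1" "(\<integral>\<^sup>+\<xi>. ennreal (norm (fourier g \<xi>) * norm \<xi> powr (- (real p + DIM('a)))) * indicator (cball 0 \<rho>) \<xi> \<partial>lborel) < \<infinity>"
      by (rule near_zero_of_vanishing[OF hm v(2,3) less_imp_le[OF v(1)] v(4)[unfolded pi power_int_of_nat]])
    thus thesis unfolding pe by (rule that[OF C0 C(2) g hM])
  next
    case False
    have n: "real DIM('a) = real d - 1" using d by (simp add: dim of_nat_diff)
    have a: "?a < real DIM('a)" "2 * ?a > real DIM('a)" using False d j md unfolding n by linarith+
    have \<delta>1: "\<delta> > 1" using C by simp
    show thesis
      by (rule that[OF C0 C(2) g hM _ _ near_zero_of_L2[OF fou hM g C0 \<delta>1 a]]) simp_all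
  qed
qed

lemma integrable_reflect:
  fixes f :: "'a::euclidean_space \<Rightarrow> complex"
  assumes [measurable]: "f \<in> borel_measurable borel"
  shows "integrable lborel (\<lambda>z. f (x - z)) \<longleftrightarrow> integrable lborel f"
    and "(LINT z|lborel. f (x - z)) = (LINT y|lborel. f y)"
proof -
  have "integrable (distr lborel borel (\<lambda>z. x - z)) f \<longleftrightarrow> integrable lborel (\<lambda>z. f (x - z))"
    by (rule integrable_distr_eq) measurable
  thus "integrable lborel (\<lambda>z. f (x - z)) \<longleftrightarrow> integrable lborel f" unfolding lborel_reflect ..
  have "(LINT y|distr lborel borel (\<lambda>z. x - z). f y) = (LINT z|lborel. f (x - z))"
    by (rule integral_distr) measurable
  thus "(LINT z|lborel. f (x - z)) = (LINT y|lborel. f y)" unfolding lborel_reflect ..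
qed

lemma AE_lborel_neq: "AE y in lborel. y \<noteq> (x :: 'a::euclidean_space)"
  by (rule AE_I[of _ _ "{x}"]) auto

text \<open>
  The value of the kernel at \<open>y = x\<close> is arbitrary; a single point affects neither measurability nor the integral.
\<close>

lemma integral_kernel_powlog:
  fixes g :: "'a::euclidean_space \<Rightarrow> complex"
  assumes gm[measurable]: "g \<in> borel_measurable borel"
    and K: "\<And>y. x \<noteq> y \<Longrightarrow> K y = \<kappa> * powlog b A B ((norm (x - y))\<^sup>2)"
    and I: "integrable lborel (\<lambda>z. norm (g (x - z)) * (norm z powr (2 * b) * (1 + \<bar>ln (norm z)\<bar>)))"
  shows "integrable lborel (\<lambda>y. g y * of_real (K y))"
    and "(LINT y|lborel. g y * of_real (K y)) = of_real \<kappa> * (LINT z|lborel. g (x - z) * of_real (powlog b A B ((norm z)\<^sup>2)))"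
proof -
  define f where "f = (\<lambda>y. g y * of_real (\<kappa> * powlog b A B ((norm (x - y))\<^sup>2)))"
  have fm[measurable]: "f \<in> borel_measurable borel" unfolding f_def powlog_def by measurable
  have fz: "f (x - z) = of_real \<kappa> * (g (x - z) * of_real (powlog b A B ((norm z)\<^sup>2)))" for z
    by (simp add: f_def mult_ac)
  have "integrable lborel (\<lambda>z. g (x - z) * of_real (powlog b A B ((norm z)\<^sup>2)))"
  proof (rule Bochner_Integration.integrable_bound)
    show "integrable lborel (\<lambda>z. (\<bar>A\<bar> + 2 * \<bar>B\<bar>) * (norm (g (x - z)) * (norm z powr (2 * b) * (1 + \<bar>ln (norm z)\<bar>))))"
      by (intro integrable_mult_right I)
    show "AE z in lborel. norm (g (x - z) * of_real (powlog b A B ((norm z)\<^sup>2))) \<le> norm ((\<bar>A\<bar> + 2 * \<bar>B\<bar>) * (norm (g (x - z)) * (norm z powr (2 * b) * (1 + \<bar>ln (norm z)\<bar>))))"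
      using AE_lborel_nonzero
    proof eventually_elim
      case (elim z)
      have z: "norm z > 0" using elim by simp
      have "\<bar>A + B * (2 * ln (norm z))\<bar> \<le> \<bar>A\<bar> + 2 * \<bar>B\<bar> * \<bar>ln (norm z)\<bar>"
        by (rule order_trans[OF abs_triangle_ineq]) (simp add: abs_mult)
      also have "\<dots> \<le> (\<bar>A\<bar> + 2 * \<bar>B\<bar>) * (1 + \<bar>ln (norm z)\<bar>)" by (simp add: algebra_simps)
      finally have "norm z powr (2 * b) * \<bar>A + B * (2 * ln (norm z))\<bar> \<le> norm z powr (2 * b) * ((\<bar>A\<bar> + 2 * \<bar>B\<bar>) * (1 + \<bar>ln (norm z)\<bar>))"
        by (rule mult_left_mono) simp
      moreover have "\<bar>powlog b A B ((norm z)\<^sup>2)\<bar> = norm z powr (2 * b) * \<bar>A + B * (2 * ln (norm z))\<bar>"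
        using z by (simp add: powlog_def abs_mult ln_realpow power2_powr_norm)
      ultimately have "norm (g (x - z)) * \<bar>powlog b A B ((norm z)\<^sup>2)\<bar> \<le> norm (g (x - z)) * (norm z powr (2 * b) * ((\<bar>A\<bar> + 2 * \<bar>B\<bar>) * (1 + \<bar>ln (norm z)\<bar>)))"
        by (intro mult_left_mono) auto
      thus ?case by (simp add: norm_mult mult_ac abs_mult)
    qed
  qed (unfold powlog_def, measurable)
  hence "integrable lborel (\<lambda>z. f (x - z))" unfolding fz by (rule integrable_mult_right)
  hence fi: "integrable lborel f" using integrable_reflect(1)[OF fm] by blast
  have Km: "K \<in> borel_measurable borel"
  proof -
    have "K = (\<lambda>y. if y = x then K x else \<kappa> * powlog b A B ((norm (x - y))\<^sup>2))" using K by (intro ext) auto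
    moreover have "(\<lambda>y. if y = x then K x else \<kappa> * powlog b A B ((norm (x - y))\<^sup>2)) \<in> borel_measurable borel"
      unfolding powlog_def by measurable
    ultimately show ?thesis by simp
  qed
  have ae: "AE y in lborel. f y = g y * of_real (K y)"
    using AE_lborel_neq[of x]
  proof eventually_elim
    case (elim y)
    thus ?case using K[of y] by (simp add: f_def)
  qed
  have gK: "(\<lambda>y. g y * of_real (K y)) \<in> borel_measurable lborel" using Km by measurable
  have fl: "f \<in> borel_measurable lborel" by simp
  show "integrable lborel (\<lambda>y. g y * of_real (K y))"
    using fi integrable_cong_AE[OF fl gK ae] by blast
  have "(LINT y|lborel. g y * of_real (K y)) = (LINT y|lborel. f y)"
    using integral_cong_AE[OF fl gK ae] by simp
  also have "\<dots> = (LINT z|lborel. f (x - z))" by (rule integrable_reflect(2)[OF fm, symmetric])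
  also have "\<dots> = of_real \<kappa> * (LINT z|lborel. g (x - z) * of_real (powlog b A B ((norm z)\<^sup>2)))"
    unfolding fz by (rule integral_mult_right_zero)
  finally show "(LINT y|lborel. g y * of_real (K y)) = of_real \<kappa> * (LINT z|lborel. g (x - z) * of_real (powlog b A B ((norm z)\<^sup>2)))" .
qed

text \<open>
  The odd case rests on \<open>c\<^sub>n = b\<^sub>n / (n + 1)\<close>, which absorbs the factor \<open>- 1 / (2 N)\<close> of the kernel.
\<close>

lemma symbol_constant:
  assumes jk: "even (j + k)" "j < m" "k < m" and N: "N = m - (j + k) div 2"
  shows "(-1) powi ((int j + int k - 2 * int m) div 2) * M_coeff m k j =
    (if even j then 1 else - (1 / (2 * real N))) * ((-1) ^ N * 2 powi (1 - 2 * int N) * b_coeff (N - 1))"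
proof -
  have jN: "int j + int k - 2 * int m = - (2 * int N)"
  proof -
    obtain q where q: "j + k = 2 * q" using jk(1) by (elim evenE)
    hence "q < m" "N = m - q" using jk N by auto
    thus ?thesis using q by simp
  qed
  have N1: "N \<ge> 1" using jN jk by linarith
  have "(int j + int k - 2 * int m) div 2 = - int N" unfolding jN by simp
  hence s: "(-1) powi ((int j + int k - 2 * int m) div 2) = (-1 :: real) ^ N"
    by (cases "even N") (simp_all add: power_int_minus)
  have t: "1 + int j + int k - 2 * int m = 1 - 2 * int N" using jN by simp
  have r: "m - (j + k) div 2 - 1 = N - 1" by (simp add: N)
  show ?thesis
  proof (cases "even j")
    case True
    hence "even k" using jk(1) by simp
    thus ?thesis using True unfolding s M_coeff_def t r by simp
  next
    case False
    hence k: "odd k" using jk(1) by simp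
    have h: "(2::real) powi (1 - 2 * int N) = 2 * 2 powi (- (2 * int N))"
      using power_int_add[of "2::real" 1 "- (2 * int N)"] by simp
    show ?thesis using False k N1 unfolding s h unfolding M_coeff_def jN r by (simp add: c_coeff_eq of_nat_diff)
  qed
qed

theorem proposition4p1:
  fixes m d j k :: nat and C :: real
    and \<phi> :: "'a::euclidean_space \<times> real \<Rightarrow> real"
  assumes "d \<ge> 2" and "DIM('a) = d - 1"
    and "real m > real d / 2" and "j < m" and "k < m"
    and "\<phi> = phi C m d" and "fundamental_solution m \<phi>"
  shows "(\<forall>g. admissible m d j g \<longrightarrow>
            (\<forall>x. integrable lborel (\<lambda>y. g y * of_real (bdry_kernel k j \<phi> x y)))) \<and>
         is_multiplier_on {g. admissible m d j g} (v_op k j \<phi>) (v_symbol m k j)"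
proof -
  note d = assms(1) and dim = assms(2) and j = assms(4) and k = assms(5) and \<phi> = assms(6)
  have md: "2 * m > d" using assms(3) by linarith
  have dimp: "DIM('a \<times> real) = d" using d dim by simp
  define A where "A = (if even d then 0 else C)"
  define B where "B = (if even d then C / 2 else 0)"
  \<comment> \<open>For even \<open>d\<close> the logarithm of the squared norm accounts for the factor one half.\<close>
  have R: "riesz_coeffs d m A B"
    unfolding A_def B_def using fundamental_solution_riesz_coeffs[OF _ dimp d md] assms(7) unfolding \<phi> by blast
  have pw: "\<phi> z = powlog (real m - d / 2) A B ((norm z)\<^sup>2)" if "z \<noteq> 0" for z
    unfolding \<phi> A_def B_def by (rule phi_eq_powlog[OF that])
  have kernel_odd: "bdry_kernel k j \<phi> x y = 0" if "odd (j + k)" "x \<noteq> y" for x y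
    using that by (intro bdry_kernel_powlog(2)[OF dim d pw R j k])
  have kernel_even: "\<exists>A' B'. riesz_coeffs d (m - (j + k) div 2) A' B' \<and>
    (\<forall>x y. x \<noteq> y \<longrightarrow> bdry_kernel k j \<phi> x y =
      (if even j then 1 else - (1 / (2 * real (m - (j + k) div 2)))) * powlog (real (m - (j + k) div 2) - d / 2) A' B' ((norm (x - y))\<^sup>2))"
    if "even (j + k)"
    using that by (intro bdry_kernel_powlog(1)[OF dim d pw R j k])
  have main: "integrable lborel (\<lambda>y. g y * of_real (bdry_kernel k j \<phi> x y)) \<and>
      integrable lborel (\<lambda>\<xi>. v_symbol m k j \<xi> * fourier g \<xi> * cis (x \<bullet> \<xi>)) \<and>
      v_op k j \<phi> g x = (LINT \<xi>|lborel. v_symbol m k j \<xi> * fourier g \<xi> * cis (x \<bullet> \<xi>)) / (2 * pi) ^ DIM('a)"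
    if adm: "admissible m d j g" for g :: "'a \<Rightarrow> complex" and x
  proof (cases "even (j + k)")
    case False
    have k0: "AE y in lborel. g y * of_real (bdry_kernel k j \<phi> x y) = 0"
      using AE_lborel_neq[of x] by eventually_elim (simp add: kernel_odd[OF False])
    have gm: "g \<in> borel_measurable borel" using adm unfolding admissible_def is_fourier_def by simp
    have m: "(\<lambda>y. g y * of_real (bdry_kernel k j \<phi> x y)) \<in> borel_measurable lborel"
    proof -
      have "(\<lambda>y. g y * of_real (bdry_kernel k j \<phi> x y)) = (\<lambda>y. if y = x then g x * of_real (bdry_kernel k j \<phi> x x) else 0)"
        using kernel_odd[OF False] by (intro ext) auto
      thus ?thesis by simp
    qed
    have z: "v_symbol m k j \<xi> = 0" for \<xi> :: 'a using False by (auto simp: v_symbol_def M_coeff_def)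
    have "integrable lborel (\<lambda>y. g y * of_real (bdry_kernel k j \<phi> x y))"
      by (subst integrable_cong_AE[OF m _ k0]) simp_all
    moreover have "(LINT y|lborel. g y * of_real (bdry_kernel k j \<phi> x y)) = 0"
      by (subst integral_cong_AE[OF m _ k0]) simp_all
    ultimately show ?thesis unfolding v_op_def z by simp
  next
    case True
    define N where "N = m - (j + k) div 2"
    define \<kappa> where "\<kappa> = (if even j then 1 else - (1 / (2 * real N)))"
    obtain q where q: "j + k = 2 * q" using True by (elim evenE)
    have N: "N \<ge> 1" "2 * real N = 2 * real m - real j - real k"
      using q j k by (auto simp: N_def of_nat_diff)
    obtain A' B' where R': "riesz_coeffs d N A' B'"
      and K: "\<And>x y. x \<noteq> y \<Longrightarrow> bdry_kernel k j \<phi> x y = \<kappa> * powlog (real N - d / 2) A' B' ((norm (x - y))\<^sup>2)"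
      using kernel_even[OF True] unfolding \<kappa>_def N_def by blast
    let ?a = "real (2 * m - 1 - j)"
    let ?h = "fourier g"
    have a: "?a = 2 * real m - 1 - real j" using j by (simp add: of_nat_diff)
    have n: "real DIM('a) = real d - 1" using d by (simp add: dim of_nat_diff)
    have fou: "is_fourier g ?h" using adm by (simp add: admissible_def)
    have gm[measurable]: "g \<in> borel_measurable borel" and hm[measurable]: "?h \<in> borel_measurable borel"
      using fou unfolding is_fourier_def by simp_all
    obtain C0 \<delta> \<rho> where C0: "C0 \<ge> 0" and \<delta>: "\<delta> > 2" and dec: "log_decay C0 ?a \<delta> g"
      and hM: "integrable lborel (\<lambda>\<xi>. norm (?h \<xi>) / (1 + norm \<xi>) ^ (m - j))"
      and near: "\<rho> > 0" "\<rho> \<le> 1" "(\<integral>\<^sup>+\<xi>. ennreal (norm (?h \<xi>) * norm \<xi> powr (- ?a)) * indicator (cball 0 \<rho>) \<xi> \<partial>lborel) < \<infinity>"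
      by (rule admissible_regularity[OF adm dim d md j])
    obtain C1 where C1: "C1 \<ge> 0" "log_decay C1 ?a \<delta> (\<lambda>z. g (x - z))"
      by (rule log_decay_reflect[OF dec C0, of x]) (use \<delta> in auto)
    have gx: "(\<lambda>z. g (x - z)) \<in> borel_measurable borel" by measurable
    have Is: "integrable lborel (\<lambda>z. norm (g (x - z)) * (norm z powr s * (1 + \<bar>ln (norm z)\<bar>)))"
      if "s \<ge> 1 - real DIM('a)" "s \<le> ?a - real DIM('a)" for s
      by (rule log_decay_integrable[OF gx C1(2,1) _ \<delta> that]) simp
    have I1: "integrable lborel (\<lambda>z. norm (g (x - z)) * (norm z powr (2 * real N - real d) * (1 + \<bar>ln (norm z)\<bar>)))"
      by (rule Is) (use N a n in linarith)+
    have Ha: "integrable lborel (\<lambda>\<xi>. norm (?h \<xi>) * norm \<xi> powr (- \<alpha>))" if "real (m - j) \<le> \<alpha>" "\<alpha> \<le> ?a" for \<alpha>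
      by (rule multiplier_integrable[OF hm hM near that])
    have H: "integrable lborel (\<lambda>\<xi>. norm (?h \<xi>) * norm \<xi> powr (- (2 * real N - 1)))"
      by (rule Ha) (use N a j k in linarith)+
    have M: "integrable lborel (\<lambda>z. g (x - z) * of_real (norm z ^ (2 * i))) \<and> (LINT z|lborel. g (x - z) * of_real (norm z ^ (2 * i))) = 0"
      if i: "real i \<le> real N - d / 2" for i
    proof -
      \<comment> \<open>The hypothesis on \<open>i\<close> makes \<open>2 m - j - d\<close> nonnegative, so that the truncated difference is the true one.\<close>
      define p where "p = 2 * m - j - d"
      have p: "real p = 2 * real m - real j - real d" using i N by (simp add: p_def of_nat_diff)
      have pa: "real p + DIM('a) = ?a" unfolding p n a by simp
      have G: "integrable lborel (\<lambda>z. g (x - z) * of_real (norm z ^ (2 * l)))" if l: "2 * l \<le> p" for l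
      proof (rule Bochner_Integration.integrable_bound)
        show "integrable lborel (\<lambda>z. norm (g (x - z)) * (norm z powr real (2 * l) * (1 + \<bar>ln (norm z)\<bar>)))"
          by (rule Is) (use l pa n d in linarith)+
        show "AE z in lborel. norm (g (x - z) * of_real (norm z ^ (2 * l))) \<le> norm (norm (g (x - z)) * (norm z powr real (2 * l) * (1 + \<bar>ln (norm z)\<bar>)))"
          using AE_lborel_nonzero
        proof eventually_elim
          case (elim z)
          have "norm z powr real (2 * l) = norm z ^ (2 * l)" by (rule powr_realpow) (use elim in simp)
          moreover have "norm (g (x - z)) * (norm z ^ (2 * l) * 1) \<le> norm (g (x - z)) * (norm z ^ (2 * l) * (1 + \<bar>ln (norm z)\<bar>))"
            by (intro mult_left_mono) auto
          ultimately show ?case by (simp add: norm_mult norm_power)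
        qed
      qed measurable
      have Hp: "integrable lborel (\<lambda>\<xi>. norm (?h \<xi>) * norm \<xi> powr (- (real p + DIM('a))))"
        unfolding pa by (rule Ha) (use j in auto)
      have ip: "2 * i \<le> p" using i N p by linarith
      show ?thesis using G[OF ip] moments_vanish[OF fou Hp G ip] by blast
    qed
    let ?c = "(-1) ^ N * 2 powi (1 - 2 * int N) * b_coeff (N - 1)"
    let ?I = "LINT \<xi>|lborel. ?h \<xi> * cis (x \<bullet> \<xi>) * of_real (norm \<xi> powr (- (2 * real N - 1)))"
    have I1': "integrable lborel (\<lambda>z. norm (g (x - z)) * (norm z powr (2 * (real N - d / 2)) * (1 + \<bar>ln (norm z)\<bar>)))"
      using I1 by (simp add: right_diff_distrib)
    have gK: "integrable lborel (\<lambda>y. g y * of_real (bdry_kernel k j \<phi> x y))"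
      by (rule integral_kernel_powlog(1)[OF gm _ I1']) (rule K)
    have vK: "(LINT y|lborel. g y * of_real (bdry_kernel k j \<phi> x y)) = of_real \<kappa> * (LINT z|lborel. g (x - z) * of_real (powlog (real N - d / 2) A' B' ((norm z)\<^sup>2)))"
      by (rule integral_kernel_powlog(2)[OF gm _ I1']) (rule K)
    have d1: "d \<ge> 1" using d by simp
    have v: "v_op k j \<phi> g x = of_real \<kappa> * (of_real (?c / (2 * pi) ^ DIM('a)) * ?I)"
      unfolding v_op_def vK by (subst riesz_convolution_multiplier[OF fou dim d1 R' N(1) H I1 M]) simp_all
    have cism[measurable]: "(\<lambda>\<xi>::'a. cis (x \<bullet> \<xi>)) \<in> borel_measurable borel"
      by (auto intro!: borel_measurable_continuous_onI continuous_intros simp: cis_conv_exp)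
    have iI: "integrable lborel (\<lambda>\<xi>. ?h \<xi> * cis (x \<bullet> \<xi>) * of_real (norm \<xi> powr (- (2 * real N - 1))))"
      by (rule Bochner_Integration.integrable_bound[OF H]) (auto simp: norm_mult)
    have sym: "v_symbol m k j \<xi> = of_real (\<kappa> * ?c) * of_real (norm \<xi> powr (- (2 * real N - 1)))" if "\<xi> \<noteq> 0" for \<xi> :: 'a
    proof -
      have e: "real_of_int (int j + int k + 1 - 2 * int m) = - (2 * real N - 1)" using N(2) by simp
      have "norm \<xi> powr (real_of_int (int j + int k + 1 - 2 * int m)) = norm \<xi> powi (int j + int k + 1 - 2 * int m)"
        using that by (intro powr_real_of_int') auto
      hence "norm \<xi> powi (int j + int k + 1 - 2 * int m) = norm \<xi> powr (- (2 * real N - 1))" unfolding e by (rule sym)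
      thus ?thesis unfolding v_symbol_def symbol_constant[OF True j k N_def] \<kappa>_def by (simp only: of_real_mult)
    qed
    have ae: "AE \<xi> in lborel. of_real (\<kappa> * ?c) * (?h \<xi> * cis (x \<bullet> \<xi>) * of_real (norm \<xi> powr (- (2 * real N - 1)))) = v_symbol m k j \<xi> * ?h \<xi> * cis (x \<bullet> \<xi>)"
      using AE_lborel_nonzero by eventually_elim (simp add: sym mult_ac)
    have m1: "(\<lambda>\<xi>. of_real (\<kappa> * ?c) * (?h \<xi> * cis (x \<bullet> \<xi>) * of_real (norm \<xi> powr (- (2 * real N - 1))))) \<in> borel_measurable lborel"
      by measurable
    have "(\<lambda>\<xi>::'a. norm \<xi> powi (int j + int k + 1 - 2 * int m)) \<in> borel_measurable borel"
      unfolding power_int_def by measurable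
    hence m2: "(\<lambda>\<xi>. v_symbol m k j \<xi> * ?h \<xi> * cis (x \<bullet> \<xi>)) \<in> borel_measurable lborel"
      unfolding v_symbol_def by measurable
    have "integrable lborel (\<lambda>\<xi>. v_symbol m k j \<xi> * ?h \<xi> * cis (x \<bullet> \<xi>))"
      using integrable_cong_AE[OF m1 m2 ae] integrable_mult_right[OF iI] by blast
    moreover have "(LINT \<xi>|lborel. v_symbol m k j \<xi> * ?h \<xi> * cis (x \<bullet> \<xi>)) = of_real (\<kappa> * ?c) * ?I"
      unfolding integral_cong_AE[OF m1 m2 ae, symmetric] by (rule integral_mult_right_zero)
    ultimately show ?thesis using gK unfolding v by simp
  qed
  have "is_fourier g (fourier g)" if "admissible m d j g" for g :: "'a \<Rightarrow> complex"
    using that by (simp add: admissible_def)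
  with main show ?thesis unfolding is_multiplier_on_def by blast
qed

end
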